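(* Let $k$ be a $\sigma$-field. The assignment $R\rightsquigarrow\pi_0^\sigma(R)$, acting on morphisms by restriction, gives rise to a monoidal functor on the category of $k$-$\sigma$-algebras (with monoidal structure given by $\otimes_k$).
   Context: All rings are commutative. A $\sigma$-ring is a ring $R$ with a ring endomorphism $\sigma\colon R\to R$ (not assumed injective); a $\sigma$-field is a $\sigma$-ring whose underlying ring is a field. For a $\sigma$-field $k$, a $k$-$\sigma$-algebra is a $\sigma$-ring $R$ with a $\sigma$-equivariant ring morphism $k\to R$; morphisms of $k$-$\sigma$-algebras are $\sigma$-equivariant morphisms of $k$-algebras; a $k$-$\sigma$-subalgebra is a $k$-subalgebra stable under $\sigma$. Tensor products of $k$-$\sigma$-algebras carry $\sigma(r\otimes s)=\sigma(r)\otimes\sigma(s)$. $R$ is $\sigma$-separable over $k$ if $\sigma$ is injective on $R\otimes_k K$ for every $\sigma$-field extension $K|k$. $R$ is strongly $\sigma$-étale over $k$ if it is $\sigma$-separable over $k$ and étale as a $k$-algebra (i.e. $R\otimes_k\overline{k}$ is isomorphic to a finite product of copies of $\overline{k}$). The strong core $\pi_0^\sigma(R)=\pi_0^\sigma(R|k)$ is the union of all strongly $\sigma$-étale $k$-$\sigma$-subalgebras of $R$ (it is a $k$-$\sigma$-subalgebra of $R$). *)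

theory Defs
  imports "HOL-Algebra.Algebra" "HOL-Library.Infinite_Typeclass"
begin

section \<open>Monoidal categories and monoidal functors\<close>

text \<open>
  A category is given by a family of hom-sets \<open>Arr A B\<close>. Composition \<open>cmp C g f\<close> is \<open>g\<close> after \<open>f\<close>.
\<close>

record ('o, 'm) cat =
  Ob  :: "'o set"
  Arr :: "'o \<Rightarrow> 'o \<Rightarrow> 'm set"
  idt :: "'o \<Rightarrow> 'm"
  cmp :: "'m \<Rightarrow> 'm \<Rightarrow> 'm"

locale category =
  fixes C :: "('o, 'm, 'x) cat_scheme"
  assumes idt_in: "A \<in> Ob C \<Longrightarrow> idt C A \<in> Arr C A A"
    and cmp_in: "\<lbrakk> A \<in> Ob C; B \<in> Ob C; D \<in> Ob C; f \<in> Arr C A B; g \<in> Arr C B D \<rbrakk>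
      \<Longrightarrow> cmp C g f \<in> Arr C A D"
    and idt_left: "\<lbrakk> A \<in> Ob C; B \<in> Ob C; f \<in> Arr C A B \<rbrakk> \<Longrightarrow> cmp C (idt C B) f = f"
    and idt_right: "\<lbrakk> A \<in> Ob C; B \<in> Ob C; f \<in> Arr C A B \<rbrakk> \<Longrightarrow> cmp C f (idt C A) = f"
    and cmp_assoc: "\<lbrakk> A \<in> Ob C; B \<in> Ob C; D \<in> Ob C; E \<in> Ob C;
        f \<in> Arr C A B; g \<in> Arr C B D; h \<in> Arr C D E \<rbrakk>
      \<Longrightarrow> cmp C (cmp C h g) f = cmp C h (cmp C g f)"

definition iso_arr :: "('o, 'm, 'x) cat_scheme \<Rightarrow> 'o \<Rightarrow> 'o \<Rightarrow> 'm \<Rightarrow> bool"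
  where "iso_arr C A B f \<longleftrightarrow> f \<in> Arr C A B \<and>
    (\<exists>g \<in> Arr C B A. cmp C g f = idt C A \<and> cmp C f g = idt C B)"

record ('o, 'm) moncat = "('o, 'm) cat" +
  tob :: "'o \<Rightarrow> 'o \<Rightarrow> 'o"
  tar :: "'m \<Rightarrow> 'm \<Rightarrow> 'm"
  unt :: "'o"
  assoc :: "'o \<Rightarrow> 'o \<Rightarrow> 'o \<Rightarrow> 'm"
  lunit :: "'o \<Rightarrow> 'm"
  runit :: "'o \<Rightarrow> 'm"

locale monoidal_category = category C for C :: "('o, 'm, 'x) moncat_scheme" +
  assumes unt_ob: "unt C \<in> Ob C"
    and tob_ob: "\<lbrakk> A \<in> Ob C; B \<in> Ob C \<rbrakk> \<Longrightarrow> tob C A B \<in> Ob C"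
    and tar_in: "\<lbrakk> A \<in> Ob C; A' \<in> Ob C; B \<in> Ob C; B' \<in> Ob C; f \<in> Arr C A A'; g \<in> Arr C B B' \<rbrakk>
      \<Longrightarrow> tar C f g \<in> Arr C (tob C A B) (tob C A' B')"
    and tar_idt: "\<lbrakk> A \<in> Ob C; B \<in> Ob C \<rbrakk> \<Longrightarrow> tar C (idt C A) (idt C B) = idt C (tob C A B)"
    and tar_cmp: "\<lbrakk> A \<in> Ob C; A' \<in> Ob C; A'' \<in> Ob C; B \<in> Ob C; B' \<in> Ob C; B'' \<in> Ob C;
        f \<in> Arr C A A'; f' \<in> Arr C A' A''; g \<in> Arr C B B'; g' \<in> Arr C B' B'' \<rbrakk>
      \<Longrightarrow> tar C (cmp C f' f) (cmp C g' g) = cmp C (tar C f' g') (tar C f g)"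
    and assoc_iso: "\<lbrakk> A \<in> Ob C; B \<in> Ob C; D \<in> Ob C \<rbrakk>
      \<Longrightarrow> iso_arr C (tob C (tob C A B) D) (tob C A (tob C B D)) (assoc C A B D)"
    and assoc_nat: "\<lbrakk> A \<in> Ob C; A' \<in> Ob C; B \<in> Ob C; B' \<in> Ob C; D \<in> Ob C; D' \<in> Ob C;
        f \<in> Arr C A A'; g \<in> Arr C B B'; h \<in> Arr C D D' \<rbrakk>
      \<Longrightarrow> cmp C (assoc C A' B' D') (tar C (tar C f g) h)
        = cmp C (tar C f (tar C g h)) (assoc C A B D)"
    and lunit_iso: "A \<in> Ob C \<Longrightarrow> iso_arr C (tob C (unt C) A) A (lunit C A)"
    and lunit_nat: "\<lbrakk> A \<in> Ob C; A' \<in> Ob C; f \<in> Arr C A A' \<rbrakk>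
      \<Longrightarrow> cmp C (lunit C A') (tar C (idt C (unt C)) f) = cmp C f (lunit C A)"
    and runit_iso: "A \<in> Ob C \<Longrightarrow> iso_arr C (tob C A (unt C)) A (runit C A)"
    and runit_nat: "\<lbrakk> A \<in> Ob C; A' \<in> Ob C; f \<in> Arr C A A' \<rbrakk>
      \<Longrightarrow> cmp C (runit C A') (tar C f (idt C (unt C))) = cmp C f (runit C A)"
    and triangle: "\<lbrakk> A \<in> Ob C; B \<in> Ob C \<rbrakk>
      \<Longrightarrow> cmp C (tar C (idt C A) (lunit C B)) (assoc C A (unt C) B) = tar C (runit C A) (idt C B)"
    and pentagon: "\<lbrakk> A \<in> Ob C; B \<in> Ob C; D \<in> Ob C; E \<in> Ob C \<rbrakk>
      \<Longrightarrow> cmp C (assoc C A B (tob C D E)) (assoc C (tob C A B) D E)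
        = cmp C (tar C (idt C A) (assoc C B D E))
            (cmp C (assoc C A (tob C B D) E) (tar C (assoc C A B D) (idt C E)))"

locale cat_functor = C: category C + D: category D
  for C :: "('o, 'm, 'x) cat_scheme" and D :: "('p, 'n, 'y) cat_scheme" +
  fixes Fo :: "'o \<Rightarrow> 'p" and Fa :: "'m \<Rightarrow> 'n"
  assumes Fo_ob: "A \<in> Ob C \<Longrightarrow> Fo A \<in> Ob D"
    and Fa_in: "\<lbrakk> A \<in> Ob C; B \<in> Ob C; f \<in> Arr C A B \<rbrakk> \<Longrightarrow> Fa f \<in> Arr D (Fo A) (Fo B)"
    and Fa_idt: "A \<in> Ob C \<Longrightarrow> Fa (idt C A) = idt D (Fo A)"
    and Fa_cmp: "\<lbrakk> A \<in> Ob C; B \<in> Ob C; E \<in> Ob C; f \<in> Arr C A B; g \<in> Arr C B E \<rbrakk>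
      \<Longrightarrow> Fa (cmp C g f) = cmp D (Fa g) (Fa f)"

text \<open>
  Monoidal functors are taken in the strong sense: the comparison morphisms \<open>\<mu>\<close> and \<open>\<epsilon>\<close> are
  isomorphisms.
\<close>

locale monoidal_functor =
  C: monoidal_category C + D: monoidal_category D + cat_functor C D Fo Fa
  for C :: "('o, 'm, 'x) moncat_scheme" and D :: "('p, 'n, 'y) moncat_scheme" and Fo Fa +
  fixes \<mu> :: "'o \<Rightarrow> 'o \<Rightarrow> 'n" and \<epsilon> :: "'n"
  assumes mu_iso: "\<lbrakk> A \<in> Ob C; B \<in> Ob C \<rbrakk>
      \<Longrightarrow> iso_arr D (tob D (Fo A) (Fo B)) (Fo (tob C A B)) (\<mu> A B)"
    and mu_nat: "\<lbrakk> A \<in> Ob C; A' \<in> Ob C; B \<in> Ob C; B' \<in> Ob C; f \<in> Arr C A A'; g \<in> Arr C B B' \<rbrakk>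
      \<Longrightarrow> cmp D (\<mu> A' B') (tar D (Fa f) (Fa g)) = cmp D (Fa (tar C f g)) (\<mu> A B)"
    and eps_iso: "iso_arr D (unt D) (Fo (unt C)) \<epsilon>"
    and mu_assoc: "\<lbrakk> A \<in> Ob C; B \<in> Ob C; E \<in> Ob C \<rbrakk>
      \<Longrightarrow> cmp D (Fa (assoc C A B E)) (cmp D (\<mu> (tob C A B) E) (tar D (\<mu> A B) (idt D (Fo E))))
        = cmp D (\<mu> A (tob C B E))
            (cmp D (tar D (idt D (Fo A)) (\<mu> B E)) (assoc D (Fo A) (Fo B) (Fo E)))"
    and mu_lunit: "A \<in> Ob C
      \<Longrightarrow> cmp D (Fa (lunit C A)) (cmp D (\<mu> (unt C) A) (tar D \<epsilon> (idt D (Fo A)))) = lunit D (Fo A)"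
    and mu_runit: "A \<in> Ob C
      \<Longrightarrow> cmp D (Fa (runit C A)) (cmp D (\<mu> A (unt C)) (tar D (idt D (Fo A)) \<epsilon>)) = runit D (Fo A)"


section \<open>Difference rings and algebras\<close>

record 'a sring = "'a ring" +
  sig :: "'a \<Rightarrow> 'a"

text \<open>In an algebra, \<open>str\<close> is the structure morphism from the base.\<close>

record ('k, 'a) salg = "'a sring" +
  str :: "'k \<Rightarrow> 'a"

definition sigma_ring :: "('a, 'm) sring_scheme \<Rightarrow> bool"
  where "sigma_ring R \<longleftrightarrow> cring R \<and> sig R \<in> ring_hom R R"

definition sigma_field :: "('a, 'm) sring_scheme \<Rightarrow> bool"
  where "sigma_field k \<longleftrightarrow> sigma_ring k \<and> field k"

definition sigma_alg :: "('k, 'm) sring_scheme \<Rightarrow> ('k, 'a, 'n) salg_scheme \<Rightarrow> bool"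
  where "sigma_alg k R \<longleftrightarrow> sigma_ring R \<and> str R \<in> ring_hom k R \<and>
    (\<forall>c \<in> carrier k. str R (sig k c) = sig R (str R c))"

definition sigma_alg_hom ::
    "('k, 'm) sring_scheme \<Rightarrow> ('k, 'a, 'n) salg_scheme \<Rightarrow> ('k, 'b, 'p) salg_scheme \<Rightarrow> ('a \<Rightarrow> 'b) set"
  where "sigma_alg_hom k R S = {f \<in> ring_hom R S.
    (\<forall>x \<in> carrier R. f (sig R x) = sig S (f x)) \<and> (\<forall>c \<in> carrier k. f (str R c) = str S c)}"

definition sigma_subalg :: "('k, 'm) sring_scheme \<Rightarrow> ('k, 'a, 'n) salg_scheme \<Rightarrow> 'a set \<Rightarrow> bool"
  where "sigma_subalg k R A \<longleftrightarrow> subcring A R \<and> str R ` carrier k \<subseteq> A \<and> sig R ` A \<subseteq> A"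


section \<open>Tensor products\<close>

text \<open>
  Let \<open>i : k \<rightarrow> R\<close> and \<open>j : k \<rightarrow> S\<close> be ring morphisms. The list
  \<open>[(r\<^sub>1, s\<^sub>1), \<dots>, (r\<^sub>n, s\<^sub>n)]\<close> stands for \<open>r\<^sub>1 \<otimes> s\<^sub>1 + \<dots> + r\<^sub>n \<otimes> s\<^sub>n\<close>, and \<open>tensor_eq\<close> is
  the congruence generated by the relations defining the tensor product over \<open>k\<close>. No rule for
  negatives is needed: \<open>(\<ominus>r) \<otimes> s\<close> is a negative of \<open>r \<otimes> s\<close>.
\<close>

inductive tensor_eq ::
    "('k, 'm) ring_scheme \<Rightarrow> ('a, 'n) ring_scheme \<Rightarrow> ('k \<Rightarrow> 'a) \<Rightarrow> ('b, 'p) ring_scheme \<Rightarrow>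
     ('k \<Rightarrow> 'b) \<Rightarrow> ('a \<times> 'b) list \<Rightarrow> ('a \<times> 'b) list \<Rightarrow> bool"
  for k R i S j
  where
    refl: "xs \<in> lists (carrier R \<times> carrier S) \<Longrightarrow> tensor_eq k R i S j xs xs"
  | sym: "tensor_eq k R i S j xs ys \<Longrightarrow> tensor_eq k R i S j ys xs"
  | trans: "\<lbrakk> tensor_eq k R i S j xs ys; tensor_eq k R i S j ys zs \<rbrakk> \<Longrightarrow> tensor_eq k R i S j xs zs"
  | append: "\<lbrakk> tensor_eq k R i S j xs xs'; tensor_eq k R i S j ys ys' \<rbrakk>
      \<Longrightarrow> tensor_eq k R i S j (xs @ ys) (xs' @ ys')"
  | commute: "\<lbrakk> xs \<in> lists (carrier R \<times> carrier S); ys \<in> lists (carrier R \<times> carrier S) \<rbrakk>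
      \<Longrightarrow> tensor_eq k R i S j (xs @ ys) (ys @ xs)"
  | zero: "s \<in> carrier S \<Longrightarrow> tensor_eq k R i S j [(\<zero>\<^bsub>R\<^esub>, s)] []"
  | add_left: "\<lbrakk> r \<in> carrier R; r' \<in> carrier R; s \<in> carrier S \<rbrakk>
      \<Longrightarrow> tensor_eq k R i S j [(r \<oplus>\<^bsub>R\<^esub> r', s)] [(r, s), (r', s)]"
  | add_right: "\<lbrakk> r \<in> carrier R; s \<in> carrier S; s' \<in> carrier S \<rbrakk>
      \<Longrightarrow> tensor_eq k R i S j [(r, s \<oplus>\<^bsub>S\<^esub> s')] [(r, s), (r, s')]"
  | balanced: "\<lbrakk> c \<in> carrier k; r \<in> carrier R; s \<in> carrier S \<rbrakk>
      \<Longrightarrow> tensor_eq k R i S j [(i c \<otimes>\<^bsub>R\<^esub> r, s)] [(r, j c \<otimes>\<^bsub>S\<^esub> s)]"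

definition tensor_class ::
    "('k, 'm) ring_scheme \<Rightarrow> ('a, 'n) ring_scheme \<Rightarrow> ('k \<Rightarrow> 'a) \<Rightarrow> ('b, 'p) ring_scheme \<Rightarrow>
     ('k \<Rightarrow> 'b) \<Rightarrow> ('a \<times> 'b) list \<Rightarrow> ('a \<times> 'b) list set"
  where "tensor_class k R i S j xs = {ys. tensor_eq k R i S j xs ys}"

definition tensor_ring ::
    "('k, 'm) ring_scheme \<Rightarrow> ('a, 'n) ring_scheme \<Rightarrow> ('k \<Rightarrow> 'a) \<Rightarrow> ('b, 'p) ring_scheme \<Rightarrow>
     ('k \<Rightarrow> 'b) \<Rightarrow> ('a \<times> 'b) list set ring"
  where "tensor_ring k R i S j = (let cl = tensor_class k R i S j in
    \<lparr> carrier = cl ` lists (carrier R \<times> carrier S),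
      monoid.mult = (\<lambda>U V. \<Union>xs \<in> U. \<Union>ys \<in> V.
        cl [(r \<otimes>\<^bsub>R\<^esub> r', s \<otimes>\<^bsub>S\<^esub> s'). (r, s) \<leftarrow> xs, (r', s') \<leftarrow> ys]),
      monoid.one = cl [(\<one>\<^bsub>R\<^esub>, \<one>\<^bsub>S\<^esub>)],
      ring.zero = cl [],
      ring.add = (\<lambda>U V. \<Union>xs \<in> U. \<Union>ys \<in> V. cl (xs @ ys)) \<rparr>)"

definition tensor ::
    "('k, 'm) ring_scheme \<Rightarrow> ('k, 'a, 'n) salg_scheme \<Rightarrow> ('k, 'b, 'p) salg_scheme \<Rightarrow>
     ('k, ('a \<times> 'b) list set) salg"
  where "tensor k R S =
    (let T = tensor_ring k R (str R) S (str S); cl = tensor_class k R (str R) S (str S) in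
    \<lparr> carrier = carrier T, monoid.mult = monoid.mult T, monoid.one = monoid.one T,
      ring.zero = ring.zero T, ring.add = ring.add T,
      sig = (\<lambda>U. \<Union>xs \<in> U. cl (map (map_prod (sig R) (sig S)) xs)),
      str = (\<lambda>c. cl [(str R c, \<one>\<^bsub>S\<^esub>)]) \<rparr>)"


section \<open>Separable and etale difference algebras, the strong core\<close>

text \<open>
  The field extensions \<open>K\<close> range over the (infinite) type \<open>'k\<close> that carries the base field. This is
  no restriction: see \<open>sigma_separable_all\<close> below.
\<close>

definition sigma_separable :: "('k, 'm) sring_scheme \<Rightarrow> ('k, 'a, 'n) salg_scheme \<Rightarrow> bool"
  where "sigma_separable k R \<longleftrightarrow> (\<forall>K :: ('k, 'k) salg. sigma_alg k K \<and> field K \<longrightarrow>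
    inj_on (sig (tensor k R K)) (carrier (tensor k R K)))"

text \<open>
  \<open>field.alg_closure k\<close> is an algebraic closure of \<open>k\<close>, with embedding \<open>ring.indexed_const k\<close>.
  The isomorphism \<open>h\<close> is one of algebras over this closure.
\<close>

definition etale :: "('k, 'm) ring_scheme \<Rightarrow> ('k, 'a, 'n) salg_scheme \<Rightarrow> bool"
  where "etale k R \<longleftrightarrow>
    (let L = field.alg_closure k; j = ring.indexed_const k in
     \<exists>n. \<exists>h \<in> ring_iso (tensor_ring k R (str R) L j) (RDirProd_list (replicate n L)).
       \<forall>c \<in> carrier L. h (tensor_class k R (str R) L j [(\<one>\<^bsub>R\<^esub>, c)]) = replicate n c)"

definition strongly_etale :: "('k, 'm) sring_scheme \<Rightarrow> ('k, 'a, 'n) salg_scheme \<Rightarrow> bool"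
  where "strongly_etale k R \<longleftrightarrow> sigma_separable k R \<and> etale k R"

definition strong_core :: "('k, 'm) sring_scheme \<Rightarrow> ('k, 'a) salg \<Rightarrow> ('k, 'a) salg"
  where "strong_core k R =
    R\<lparr>carrier := \<Union>{A. sigma_subalg k R A \<and> strongly_etale k (R\<lparr>carrier := A\<rparr>)}\<rparr>"


section \<open>The monoidal category of difference algebras\<close>

text \<open>
  Objects are the algebras whose elements are taken from a fixed infinite type \<open>'u\<close>, which plays the
  role of a universe and also contains the base field. The tensor product of two such algebras can
  be embedded in \<open>'u\<close> again (see \<open>tensor_emb_inj\<close>), and the monoidal product is its copy in \<open>'u\<close>
  along a chosen injection.
\<close>

type_synonym 'u ualg = "('u, 'u) salg"

definition tensor_emb :: "'u sring \<Rightarrow> 'u ualg \<Rightarrow> 'u ualg \<Rightarrow> ('u \<times> 'u) list set \<Rightarrow> 'u"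
  where "tensor_emb k R S = (SOME e. inj_on e (carrier (tensor k R S)))"

definition copy_alg :: "('a \<Rightarrow> 'b) \<Rightarrow> ('k, 'a) salg \<Rightarrow> ('k, 'b) salg"
  where "copy_alg e T = (let d = inv_into (carrier T) e in
    \<lparr> carrier = e ` carrier T,
      monoid.mult = (\<lambda>x y. e (d x \<otimes>\<^bsub>T\<^esub> d y)),
      monoid.one = e \<one>\<^bsub>T\<^esub>,
      ring.zero = e \<zero>\<^bsub>T\<^esub>,
      ring.add = (\<lambda>x y. e (d x \<oplus>\<^bsub>T\<^esub> d y)),
      sig = (\<lambda>x. e (sig T (d x))),
      str = (\<lambda>c. e (str T c)) \<rparr>)"

definition tensor_ob :: "'u sring \<Rightarrow> 'u ualg \<Rightarrow> 'u ualg \<Rightarrow> 'u ualg"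
  where "tensor_ob k R S = copy_alg (tensor_emb k R S) (tensor k R S)"

definition pure_tensor :: "'u sring \<Rightarrow> 'u ualg \<Rightarrow> 'u ualg \<Rightarrow> 'u \<Rightarrow> 'u \<Rightarrow> 'u"
  where "pure_tensor k R S r s =
    tensor_emb k R S (tensor_class k R (str R) S (str S) [(r, s)])"

datatype 'u arrow = Arrow (src: "'u ualg") (act: "'u \<Rightarrow> 'u") (tgt: "'u ualg")

text \<open>
  The underlying maps of arrows are extensional, so that arrows are equal iff they agree on the
  carrier of their common source.
\<close>

definition alg_arr :: "'u sring \<Rightarrow> 'u ualg \<Rightarrow> 'u ualg \<Rightarrow> 'u arrow set"
  where "alg_arr k R S = {Arrow R f S | f. f \<in> sigma_alg_hom k R S \<and> f \<in> extensional (carrier R)}"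

text \<open>
  The remaining structure is given by the unique morphisms with the prescribed effect on pure
  tensors.
\<close>

definition tensor_arr :: "'u sring \<Rightarrow> 'u arrow \<Rightarrow> 'u arrow \<Rightarrow> 'u arrow"
  where "tensor_arr k f g =
    (THE h. h \<in> alg_arr k (tensor_ob k (src f) (src g)) (tensor_ob k (tgt f) (tgt g)) \<and>
      (\<forall>r \<in> carrier (src f). \<forall>s \<in> carrier (src g).
        act h (pure_tensor k (src f) (src g) r s) = pure_tensor k (tgt f) (tgt g) (act f r) (act g s)))"

definition base_alg :: "'u sring \<Rightarrow> 'u ualg"
  where "base_alg k = sring.extend k \<lparr> str = (\<lambda>c. c) \<rparr>"

definition assoc_arr :: "'u sring \<Rightarrow> 'u ualg \<Rightarrow> 'u ualg \<Rightarrow> 'u ualg \<Rightarrow> 'u arrow"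
  where "assoc_arr k R S T =
    (THE h. h \<in> alg_arr k (tensor_ob k (tensor_ob k R S) T) (tensor_ob k R (tensor_ob k S T)) \<and>
      (\<forall>r \<in> carrier R. \<forall>s \<in> carrier S. \<forall>t \<in> carrier T.
        act h (pure_tensor k (tensor_ob k R S) T (pure_tensor k R S r s) t) =
          pure_tensor k R (tensor_ob k S T) r (pure_tensor k S T s t)))"

definition lunit_arr :: "'u sring \<Rightarrow> 'u ualg \<Rightarrow> 'u arrow"
  where "lunit_arr k R =
    (THE h. h \<in> alg_arr k (tensor_ob k (base_alg k) R) R \<and>
      (\<forall>c \<in> carrier k. \<forall>r \<in> carrier R.
        act h (pure_tensor k (base_alg k) R c r) = str R c \<otimes>\<^bsub>R\<^esub> r))"

definition runit_arr :: "'u sring \<Rightarrow> 'u ualg \<Rightarrow> 'u arrow"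
  where "runit_arr k R =
    (THE h. h \<in> alg_arr k (tensor_ob k R (base_alg k)) R \<and>
      (\<forall>r \<in> carrier R. \<forall>c \<in> carrier k.
        act h (pure_tensor k R (base_alg k) r c) = r \<otimes>\<^bsub>R\<^esub> str R c))"

definition sigma_alg_cat :: "'u sring \<Rightarrow> ('u ualg, 'u arrow) moncat"
  where "sigma_alg_cat k =
    \<lparr> Ob = {R. sigma_alg k R},
      Arr = alg_arr k,
      idt = (\<lambda>R. Arrow R (\<lambda>x \<in> carrier R. x) R),
      cmp = (\<lambda>g f. Arrow (src f) (compose (carrier (src f)) (act g) (act f)) (tgt g)),
      tob = tensor_ob k,
      tar = tensor_arr k,
      unt = base_alg k,
      assoc = assoc_arr k,
      lunit = lunit_arr k,
      runit = runit_arr k \<rparr>"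

section \<open>The strong core on morphisms, and its comparison morphisms\<close>

definition core_arr :: "'u sring \<Rightarrow> 'u arrow \<Rightarrow> 'u arrow"
  where "core_arr k f =
    Arrow (strong_core k (src f)) (restrict (act f) (carrier (strong_core k (src f))))
      (strong_core k (tgt f))"

text \<open>
  The map \<open>\<pi>\<^sub>0(R) \<otimes> \<pi>\<^sub>0(S) \<rightarrow> \<pi>\<^sub>0(R \<otimes> S)\<close> induced by the inclusions into \<open>R\<close> and \<open>S\<close>.
\<close>

definition core_mu :: "'u sring \<Rightarrow> 'u ualg \<Rightarrow> 'u ualg \<Rightarrow> 'u arrow"
  where "core_mu k R S =
    (THE h. h \<in> alg_arr k (tensor_ob k (strong_core k R) (strong_core k S))
                 (strong_core k (tensor_ob k R S)) \<and>
      (\<forall>r \<in> carrier (strong_core k R). \<forall>s \<in> carrier (strong_core k S).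
        act h (pure_tensor k (strong_core k R) (strong_core k S) r s) = pure_tensor k R S r s))"

definition core_eps :: "'u sring \<Rightarrow> 'u arrow"
  where "core_eps k = Arrow (base_alg k) (\<lambda>c \<in> carrier k. c) (strong_core k (base_alg k))"


section \<open>Independence of the choice of universe\<close>

text \<open>
  The following facts justify the size restrictions above: tensor products fit into the universe
  again, and separability with respect to extensions in the type of the base field implies it for
  extensions in every type. For the latter, an equality in \<open>R \<otimes> K\<close> only involves finitely many
  elements of \<open>K\<close>, so it holds over a subfield of \<open>K\<close> that has a copy in \<open>'k\<close>.
\<close>

lemma card_of_list_UNIV:
  assumes "infinite (UNIV :: 'a set)"
  shows "|UNIV :: 'a list set| \<le>o |UNIV :: 'a set|"
proof -
  have len: "|{xs :: 'a list. length xs = n}| \<le>o |UNIV :: 'a set|" for n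
  proof (induction n)
    case 0
    have "finite {xs :: 'a list. length xs = 0}" by simp
    then show ?case
      using assms by (simp add: card_of_ordLeq_infinite ordLeq3_finite_infinite)
  next
    case (Suc n)
    have "{xs :: 'a list. length xs = Suc n} = (\<lambda>(x, xs). x # xs) ` (UNIV \<times> {xs. length xs = n})"
      by (auto simp: length_Suc_conv image_iff)
    moreover have "|(UNIV :: 'a set) \<times> {xs :: 'a list. length xs = n}| \<le>o |UNIV :: 'a set|"
      using assms Suc by (intro card_of_Times_ordLeq_infinite) (auto intro: ordIso_imp_ordLeq card_of_refl)
    ultimately show ?case
      using card_of_image ordLeq_transitive by metis
  qed
  have "(UNIV :: 'a list set) = (\<Union>n. {xs. length xs = n})" by auto
  moreover have "|\<Union>n. {xs :: 'a list. length xs = n}| \<le>o |UNIV :: 'a set|"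
  proof (rule card_of_UNION_ordLeq_infinite[OF assms])
    show "|UNIV :: nat set| \<le>o |UNIV :: 'a set|"
      using assms infinite_iff_card_of_nat by blast
  qed (use len in blast)
  ultimately show ?thesis by metis
qed

lemma tensor_emb_inj:
  fixes k :: "('u :: infinite) sring"
  shows "inj_on (tensor_emb k R S) (carrier (tensor k R S))"
proof -
  have inf: "infinite (UNIV :: 'u set)" by (rule infinite_UNIV)
  have "|UNIV :: 'u set| =o |UNIV \<times> UNIV :: ('u \<times> 'u) set|"
    using card_of_Times_same_infinite[OF inf] ordIso_symmetric by blast
  then have prod: "|UNIV :: ('u \<times> 'u) set| \<le>o |UNIV :: 'u set|"
    using ordIso_symmetric ordIso_imp_ordLeq by (metis UNIV_Times_UNIV)
  have "|UNIV :: ('u \<times> 'u) list set| \<le>o |UNIV :: ('u \<times> 'u) set|"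
    by (rule card_of_list_UNIV) (simp add: inf finite_prod)
  moreover have "|carrier (tensor k R S)| \<le>o |UNIV :: ('u \<times> 'u) list set|"
  proof -
    have "carrier (tensor k R S) \<subseteq> range (tensor_class k R (str R) S (str S))"
      by (auto simp: tensor_def tensor_ring_def Let_def)
    then show ?thesis
      using card_of_mono1 card_of_image ordLeq_transitive by metis
  qed
  ultimately have "|carrier (tensor k R S)| \<le>o |UNIV :: 'u set|"
    using prod by (meson ordLeq_transitive)
  then have "\<exists>e :: _ \<Rightarrow> 'u. inj_on e (carrier (tensor k R S))"
    using card_of_ordLeq[symmetric, of "carrier (tensor k R S)" "UNIV :: 'u set"] by blast
  then show ?thesis
    unfolding tensor_emb_def by (rule someI_ex)
qed

lemma tensor_eq_lists:
  assumes "tensor_eq k R i S j xs ys"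
    and "cring R" "cring S" "i \<in> carrier k \<rightarrow> carrier R" "j \<in> carrier k \<rightarrow> carrier S"
  shows "xs \<in> lists (carrier R \<times> carrier S) \<and> ys \<in> lists (carrier R \<times> carrier S)"
proof -
  interpret R: cring R by fact
  interpret S: cring S by fact
  show ?thesis
    using assms(1) by induction (use assms(4,5) in auto)
qed

lemma tensor_eq_map:
  assumes "tensor_eq k R i S j xs ys"
    and f: "f \<in> ring_hom R R'" and g: "g \<in> ring_hom S S'"
    and "cring R" "cring S" "cring R'" "cring S'"
    and i: "i \<in> carrier k \<rightarrow> carrier R" and j: "j \<in> carrier k \<rightarrow> carrier S"
    and p: "\<And>c. c \<in> carrier k \<Longrightarrow> p c \<in> carrier k' \<and> f (i c) = i' (p c) \<and> g (j c) = j' (p c)"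
  shows "tensor_eq k' R' i' S' j' (map (map_prod f g) xs) (map (map_prod f g) ys)"
proof -
  interpret f: ring_hom_cring R R' f
    using assms by (simp add: ring_hom_cring_def ring_hom_cring_axioms_def)
  interpret g: ring_hom_cring S S' g
    using assms by (simp add: ring_hom_cring_def ring_hom_cring_axioms_def)
  have L: "map (map_prod f g) xs \<in> lists (carrier R' \<times> carrier S')"
    if "xs \<in> lists (carrier R \<times> carrier S)" for xs
    using that by (fastforce simp: lists_eq_set)
  show ?thesis
    using assms(1)
  proof induction
    case (refl xs)
    then show ?case using L by (blast intro: tensor_eq.refl)
  next
    case (sym xs ys)
    then show ?case by (blast intro: tensor_eq.sym)
  next
    case (trans xs ys zs)
    then show ?case by (blast intro: tensor_eq.trans)
  next
    case (append xs xs' ys ys')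
    then show ?case by (simp add: tensor_eq.append)
  next
    case (commute xs ys)
    then show ?case using L by (simp add: tensor_eq.commute)
  next
    case (zero s)
    then show ?case by (simp add: tensor_eq.zero)
  next
    case (add_left r r' s)
    then show ?case by (simp add: tensor_eq.add_left)
  next
    case (add_right r s s')
    then show ?case by (simp add: tensor_eq.add_right)
  next
    case (balanced c r s)
    then show ?case
      using p[OF balanced(1)] i j tensor_eq.balanced[of "p c" k' "f r" R' "g s" S' i' j']
      by (simp add: Pi_iff)
  qed
qed

lemma lists_times_iff: "xs \<in> lists (A \<times> B) \<longleftrightarrow> fst ` set xs \<subseteq> A \<and> snd ` set xs \<subseteq> B"
  by (induction xs) auto

lemma tensor_eq_support:
  assumes "tensor_eq k R i S j xs ys"
    and "cring R" "cring S" "i \<in> carrier k \<rightarrow> carrier R" "j \<in> carrier k \<rightarrow> carrier S"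
  shows "\<exists>F. finite F \<and> F \<subseteq> carrier S \<and>
    (\<forall>M. F \<subseteq> M \<and> subring M S \<and> j ` carrier k \<subseteq> M \<longrightarrow> tensor_eq k R i (S\<lparr>carrier := M\<rparr>) j xs ys)"
  using assms(1)
proof induction
  case (refl xs)
  then show ?case
    by (intro exI[of _ "snd ` set xs"]) (simp add: lists_times_iff tensor_eq.refl)
next
  case (sym xs ys)
  then show ?case by (meson tensor_eq.sym)
next
  case (trans xs ys zs)
  from trans.IH obtain F G where F: "finite F" "F \<subseteq> carrier S"
      "\<forall>M. F \<subseteq> M \<and> subring M S \<and> j ` carrier k \<subseteq> M \<longrightarrow> tensor_eq k R i (S\<lparr>carrier := M\<rparr>) j xs ys"
    and G: "finite G" "G \<subseteq> carrier S"
      "\<forall>M. G \<subseteq> M \<and> subring M S \<and> j ` carrier k \<subseteq> M \<longrightarrow> tensor_eq k R i (S\<lparr>carrier := M\<rparr>) j ys zs"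
    by (elim exE conjE)
  have "tensor_eq k R i (S\<lparr>carrier := M\<rparr>) j xs zs"
    if "F \<union> G \<subseteq> M" "subring M S" "j ` carrier k \<subseteq> M" for M
    by (rule tensor_eq.trans[OF F(3)[rule_format] G(3)[rule_format]]) (use that in auto)
  then show ?case using F(1,2) G(1,2) by (intro exI[of _ "F \<union> G"]) simp
next
  case (append xs xs' ys ys')
  from append.IH obtain F G where F: "finite F" "F \<subseteq> carrier S"
      "\<forall>M. F \<subseteq> M \<and> subring M S \<and> j ` carrier k \<subseteq> M \<longrightarrow> tensor_eq k R i (S\<lparr>carrier := M\<rparr>) j xs xs'"
    and G: "finite G" "G \<subseteq> carrier S"
      "\<forall>M. G \<subseteq> M \<and> subring M S \<and> j ` carrier k \<subseteq> M \<longrightarrow> tensor_eq k R i (S\<lparr>carrier := M\<rparr>) j ys ys'"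
    by (elim exE conjE)
  have "tensor_eq k R i (S\<lparr>carrier := M\<rparr>) j (xs @ ys) (xs' @ ys')"
    if "F \<union> G \<subseteq> M" "subring M S" "j ` carrier k \<subseteq> M" for M
    by (rule tensor_eq.append[OF F(3)[rule_format] G(3)[rule_format]]) (use that in auto)
  then show ?case using F(1,2) G(1,2) by (intro exI[of _ "F \<union> G"]) simp
next
  case (commute xs ys)
  then show ?case
    by (intro exI[of _ "snd ` set (xs @ ys)"])
      (simp add: lists_times_iff tensor_eq.commute image_Un)
next
  case (zero s)
  then show ?case
    by (intro exI[of _ "{s}"]) (auto intro!: tensor_eq.zero)
next
  case (add_left r r' s)
  then show ?case
    by (intro exI[of _ "{s}"]) (auto intro!: tensor_eq.add_left)
next
  case (add_right r s s')
  then show ?case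
    using tensor_eq.add_right[of r R s "S\<lparr>carrier := _\<rparr>" s' k i j]
    by (intro exI[of _ "{s, s'}"]) auto
next
  case (balanced c r s)
  then show ?case
    using tensor_eq.balanced[of c k r R s "S\<lparr>carrier := _\<rparr>" i j]
    by (intro exI[of _ "{s}"]) auto
qed


lemma small_subfield:
  fixes K :: "('k :: infinite, 'c, 'p) salg_scheme"
  assumes "field K" and sg: "sig K \<in> ring_hom K K" and st: "str K \<in> carrier k \<rightarrow> carrier K"
    and F: "finite F" "F \<subseteq> carrier K"
  obtains M where "F \<subseteq> M" "str K ` carrier k \<subseteq> M" "subfield M K" "sig K ` M \<subseteq> M"
    "|M| \<le>o |UNIV :: 'k set|"
proof -
  interpret K: field K by fact
  have inf: "infinite (UNIV :: 'k set)" by (rule infinite_UNIV)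
  define step where "step V = V \<union> (\<lambda>(a, b). a \<oplus>\<^bsub>K\<^esub> b) ` (V \<times> V) \<union> (\<lambda>(a, b). a \<otimes>\<^bsub>K\<^esub> b) ` (V \<times> V)
    \<union> (\<lambda>a. \<ominus>\<^bsub>K\<^esub> a) ` V \<union> (\<lambda>a. inv\<^bsub>K\<^esub> a) ` (V - {\<zero>\<^bsub>K\<^esub>}) \<union> sig K ` V" for V
  define G where "G n = (step ^^ n) (str K ` carrier k \<union> insert \<one>\<^bsub>K\<^esub> F)" for n
  have G0: "G 0 = str K ` carrier k \<union> insert \<one>\<^bsub>K\<^esub> F" and GS: "G (Suc n) = step (G n)" for n
    by (simp_all add: G_def)
  define M where "M = (\<Union>n. G n)"
  have step_sub: "step V \<subseteq> carrier K" if "V \<subseteq> carrier K" for V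
    using that sg K.field_Units unfolding step_def by (auto simp: ring_hom_def)
  have Gsub: "G n \<subseteq> carrier K" for n
  proof (induction n)
    case 0
    then show ?case using F st by (auto simp: G0)
  next
    case (Suc n)
    then show ?case using step_sub by (simp add: GS)
  qed
  have "G n \<subseteq> G (Suc n)" for n by (auto simp: GS step_def)
  then have mono: "G m \<subseteq> G n" if "m \<le> n" for m n using that lift_Suc_mono_le[of G] by blast
  have two: "\<exists>n. a \<in> G n \<and> b \<in> G n" if ab: "a \<in> M" "b \<in> M" for a b
  proof -
    obtain m n where "a \<in> G m" "b \<in> G n" using ab unfolding M_def by blast
    then have "a \<in> G (max m n)" "b \<in> G (max m n)" using mono by (meson max.cobounded1 max.cobounded2 subsetD)+
    then show ?thesis by blast
  qed
  have up: "x \<in> step (G n) \<Longrightarrow> x \<in> M" for x n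
    unfolding M_def using GS by blast
  have base: "G 0 \<subseteq> M" by (auto simp: M_def)
  have Msub: "M \<subseteq> carrier K" using Gsub by (auto simp: M_def)
  have sr: "subring M K"
  proof (rule K.subringI[OF Msub])
    show "\<one>\<^bsub>K\<^esub> \<in> M" using base by (auto simp: G0)
    fix a b assume ab: "a \<in> M" "b \<in> M"
    obtain n where "a \<in> G n" "b \<in> G n" using two[OF ab] by blast
    then show "\<ominus>\<^bsub>K\<^esub> a \<in> M" "a \<otimes>\<^bsub>K\<^esub> b \<in> M" "a \<oplus>\<^bsub>K\<^esub> b \<in> M"
      by (auto intro!: up[of _ n] simp: step_def)
  qed
  have sf: "subfield M K"
  proof (rule K.subfieldI'[OF sr])
    fix a assume "a \<in> M - {\<zero>\<^bsub>K\<^esub>}"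
    moreover obtain n where "a \<in> G n" using calculation by (auto simp: M_def)
    ultimately show "inv\<^bsub>K\<^esub> a \<in> M" by (auto intro!: up[of _ n] simp: step_def)
  qed
  have sgM: "sig K ` M \<subseteq> M"
  proof
    fix x assume "x \<in> sig K ` M"
    then obtain a n where "a \<in> G n" "x = sig K a" by (auto simp: M_def)
    then show "x \<in> M" by (auto intro!: up[of _ n] simp: step_def)
  qed
  have img: "|f ` V| \<le>o |UNIV :: 'k set|" if "|V| \<le>o |UNIV :: 'k set|" for f :: "'x \<Rightarrow> 'c" and V
    using that card_of_image ordLeq_transitive by metis
  have stepc: "|step V| \<le>o |UNIV :: 'k set|" if V: "|V| \<le>o |UNIV :: 'k set|" for V
  proof -
    have VV: "|V \<times> V| \<le>o |UNIV :: 'k set|" using inf V by (intro card_of_Times_ordLeq_infinite) auto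
    have V0: "|V - {\<zero>\<^bsub>K\<^esub>}| \<le>o |UNIV :: 'k set|" using V card_of_mono1 ordLeq_transitive by (metis Diff_subset)
    show ?thesis unfolding step_def
      using inf V VV V0 by (intro card_of_Un_ordLeq_infinite img) auto
  qed
  have Gc: "|G n| \<le>o |UNIV :: 'k set|" for n
  proof (induction n)
    case 0
    have "|str K ` carrier k| \<le>o |UNIV :: 'k set|"
      using img card_of_UNIV by blast
    moreover have "|insert \<one>\<^bsub>K\<^esub> F| \<le>o |UNIV :: 'k set|"
      using F inf by (simp add: ordLess_imp_ordLeq finite_ordLess_infinite2)
    ultimately show ?case unfolding G0 using inf by (intro card_of_Un_ordLeq_infinite)
  next
    case (Suc n)
    then show ?case using stepc by (simp add: GS)
  qed
  have "|M| \<le>o |UNIV :: 'k set|" unfolding M_def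
    using inf Gc infinite_iff_card_of_nat by (intro card_of_UNION_ordLeq_infinite) auto
  then show ?thesis using that sf sgM base by (auto simp: G0)
qed

lemma copy_alg_sel:
  "carrier (copy_alg e T) = e ` carrier T"
  "one (copy_alg e T) = e (one T)" "ring.zero (copy_alg e T) = e (ring.zero T)"
  "str (copy_alg e T) c = e (str T c)"
  and copy_alg_ops: "inj_on e (carrier T) \<Longrightarrow> x \<in> carrier T \<Longrightarrow> sig (copy_alg e T) (e x) = e (sig T x)"
  "inj_on e (carrier T) \<Longrightarrow> x \<in> carrier T \<Longrightarrow> y \<in> carrier T
    \<Longrightarrow> monoid.mult (copy_alg e T) (e x) (e y) = e (monoid.mult T x y)"
  "inj_on e (carrier T) \<Longrightarrow> x \<in> carrier T \<Longrightarrow> y \<in> carrier T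
    \<Longrightarrow> ring.add (copy_alg e T) (e x) (e y) = e (ring.add T x y)"
  by (simp_all add: copy_alg_def Let_def)

lemma copy_alg_iso:
  assumes "ring T" "inj_on e (carrier T)"
  shows "e \<in> ring_iso T (copy_alg e T)"
  using assms by (auto simp: ring_iso_def ring_hom_def bij_betw_def copy_alg_sel copy_alg_ops)

lemma sigma_alg_copy:
  assumes T: "sigma_alg k T" and k: "sigma_ring k" and e: "inj_on e (carrier T)"
  shows "sigma_alg k (copy_alg e T)"
proof -
  interpret T: cring T using T by (simp add: sigma_alg_def sigma_ring_def)
  interpret k: cring k using k by (simp add: sigma_ring_def)
  have iso: "e \<in> ring_iso T (copy_alg e T)" by (rule copy_alg_iso[OF T.ring_axioms e])
  have cr: "cring (copy_alg e T)"
    using T.ring_iso_imp_img_cring[OF iso] by (simp add: copy_alg_sel(3)[symmetric])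
  have sT: "sig T \<in> ring_hom T T" "str T \<in> ring_hom k T" using T by (auto simp: sigma_alg_def sigma_ring_def)
  have "sig (copy_alg e T) \<in> ring_hom (copy_alg e T) (copy_alg e T)"
    using sT(1) e by (auto simp: ring_hom_def copy_alg_sel copy_alg_ops Pi_iff)
  moreover have "str (copy_alg e T) \<in> ring_hom k (copy_alg e T)"
    using sT(2) e by (auto simp: ring_hom_def copy_alg_sel copy_alg_ops Pi_iff)
  moreover have "sig k \<in> ring_hom k k" using k by (simp add: sigma_ring_def)
  ultimately show ?thesis
    using cr T sT(2) e by (auto simp: sigma_alg_def sigma_ring_def copy_alg_sel copy_alg_ops ring_hom_def Pi_iff)
qed

lemma tensor_eq_equiv:
  assumes "cring R" "cring S" "i \<in> carrier k \<rightarrow> carrier R" "j \<in> carrier k \<rightarrow> carrier S"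
    and "xs \<in> lists (carrier R \<times> carrier S)"
  shows "tensor_class k R i S j xs = tensor_class k R i S j ys \<longleftrightarrow> tensor_eq k R i S j xs ys"
proof
  assume "tensor_class k R i S j xs = tensor_class k R i S j ys"
  moreover have "tensor_eq k R i S j xs xs" using assms by (simp add: tensor_eq.refl)
  ultimately show "tensor_eq k R i S j xs ys" by (auto simp: tensor_class_def intro: tensor_eq.sym)
qed (auto simp: tensor_class_def intro: tensor_eq.sym tensor_eq.trans)

lemma sig_tensor_class:
  assumes k: "sigma_ring k" and R: "sigma_alg k R" and S: "sigma_alg k S"
    and xs: "xs \<in> lists (carrier R \<times> carrier S)"
  shows "sig (tensor k R S) (tensor_class k R (str R) S (str S) xs) =
    tensor_class k R (str R) S (str S) (map (map_prod (sig R) (sig S)) xs)"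
proof -
  have m: "tensor_eq k R (str R) S (str S) (map (map_prod (sig R) (sig S)) xs) (map (map_prod (sig R) (sig S)) ys)"
    if "tensor_eq k R (str R) S (str S) xs ys" for xs ys
    by (rule tensor_eq_map[OF that, where p = "sig k"])
      (use k R S in \<open>auto simp: sigma_alg_def sigma_ring_def ring_hom_def\<close>)
  have "xs \<in> tensor_class k R (str R) S (str S) xs" using xs by (simp add: tensor_class_def tensor_eq.refl)
  moreover have "tensor_class k R (str R) S (str S) (map (map_prod (sig R) (sig S)) ys) =
      tensor_class k R (str R) S (str S) (map (map_prod (sig R) (sig S)) xs)"
    if "ys \<in> tensor_class k R (str R) S (str S) xs" for ys
    using m[of xs ys] that by (auto simp: tensor_class_def intro: tensor_eq.sym tensor_eq.trans)
  ultimately have "(\<Union>ys \<in> tensor_class k R (str R) S (str S) xs.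
      tensor_class k R (str R) S (str S) (map (map_prod (sig R) (sig S)) ys)) =
      tensor_class k R (str R) S (str S) (map (map_prod (sig R) (sig S)) xs)"
    by blast
  then show ?thesis
    by (simp only: tensor_def Let_def sring.simps)
qed

lemma sigma_separable_all:
  fixes k :: "('k :: infinite, 'm) sring_scheme"
    and R :: "('k, 'a, 'n) salg_scheme" and K :: "('k, 'c, 'p) salg_scheme"
  assumes k: "sigma_field k" and R: "sigma_alg k R" and sep: "sigma_separable k R"
    and K: "sigma_alg k K" "field K"
  shows "inj_on (sig (tensor k R K)) (carrier (tensor k R K))"
proof (rule inj_onI)
  fix U V assume UV: "U \<in> carrier (tensor k R K)" "V \<in> carrier (tensor k R K)"
    "sig (tensor k R K) U = sig (tensor k R K) V"
  interpret K: field K by fact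
  have k': "sigma_ring k" "cring k" "sig k \<in> carrier k \<rightarrow> carrier k"
    using k by (auto simp: sigma_field_def sigma_ring_def ring_hom_def)
  have R': "cring R" "str R \<in> carrier k \<rightarrow> carrier R" "sig R \<in> ring_hom R R"
    using R by (auto simp: sigma_alg_def sigma_ring_def ring_hom_def)
  have K': "cring K" "str K \<in> carrier k \<rightarrow> carrier K" "sig K \<in> ring_hom K K"
    using K by (auto simp: sigma_alg_def sigma_ring_def ring_hom_def)
  let ?cl = "tensor_class k R (str R) K (str K)" and ?s = "map (map_prod (sig R) (sig K))"
  obtain xs ys where xs: "xs \<in> lists (carrier R \<times> carrier K)" "U = ?cl xs"
    and ys: "ys \<in> lists (carrier R \<times> carrier K)" "V = ?cl ys"
    using UV by (auto simp: tensor_def tensor_ring_def Let_def)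
  have sxs: "?s zs \<in> lists (carrier R \<times> carrier K)" if "zs \<in> lists (carrier R \<times> carrier K)" for zs
    using that R'(3) K'(3) by (force simp: lists_times_iff ring_hom_def)
  have "?cl (?s xs) = ?cl (?s ys)"
    using UV(3) sig_tensor_class[OF k'(1) R K(1)] xs ys by simp
  then have "tensor_eq k R (str R) K (str K) (?s xs) (?s ys)"
    using tensor_eq_equiv[OF R'(1) K'(1) R'(2) K'(2) sxs[OF xs(1)]] by simp
  from tensor_eq_support[OF this R'(1) K'(1) R'(2) K'(2)]
  obtain F where F: "finite F" "F \<subseteq> carrier K"
    "\<forall>M. F \<subseteq> M \<and> subring M K \<and> str K ` carrier k \<subseteq> M
      \<longrightarrow> tensor_eq k R (str R) (K\<lparr>carrier := M\<rparr>) (str K) (?s xs) (?s ys)"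
    by (elim exE conjE)
  let ?F = "F \<union> snd ` set (xs @ ys)"
  have "finite ?F" "?F \<subseteq> carrier K" using F(1,2) xs(1) ys(1) by (auto simp: lists_times_iff)
  from small_subfield[OF K(2) K'(3,2) this]
  obtain M where M: "?F \<subseteq> M" "str K ` carrier k \<subseteq> M" "subfield M K" "sig K ` M \<subseteq> M"
    "|M| \<le>o |UNIV :: 'k set|" .
  have subM: "subring M K" "M \<subseteq> carrier K"
    using subfieldE(1)[OF M(3)] subfieldE(3)[OF M(3)] by blast+
  obtain e :: "'c \<Rightarrow> 'k" where e: "inj_on e M"
    using M(5) card_of_ordLeq[of M "UNIV :: 'k set"] by blast
  define L :: "('k, 'c) salg" where "L = \<lparr> carrier = M, monoid.mult = monoid.mult K, monoid.one = monoid.one K,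
    ring.zero = ring.zero K, ring.add = ring.add K, sig = sig K, str = str K \<rparr>"
  have Lsel: "carrier L = M" "sig L = sig K" "str L = str K"
    "monoid.mult L = monoid.mult K" "monoid.one L = monoid.one K"
    "ring.zero L = ring.zero K" "ring.add L = ring.add K" by (simp_all add: L_def)
  let ?KM = "K\<lparr>carrier := M\<rparr>"
  have fKM: "field ?KM" using K.subfield_iff(2)[OF M(3)] by simp
  interpret KM: field ?KM by fact
  have idL: "(\<lambda>x. x) \<in> ring_iso ?KM L" by (auto simp: ring_iso_def ring_hom_def Lsel bij_betw_def inj_on_def)
  have fL: "field L" using KM.ring_iso_imp_img_field[OF idL] by (simp add: Lsel(6)[symmetric])
  interpret L: field L by fact
  have eL: "inj_on e (carrier L)" using e by (simp add: Lsel)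
  have aL: "sigma_alg k L"
    using K M L.is_cring unfolding sigma_alg_def sigma_ring_def ring_hom_def
    by (auto simp: Lsel subsetD[OF subM(2)])
  define N :: "('k, 'k) salg" where "N = copy_alg e L"
  have aN: "sigma_alg k N" unfolding N_def by (rule sigma_alg_copy[OF aL k'(1) eL])
  have isoN: "e \<in> ring_iso L N" unfolding N_def by (rule copy_alg_iso[OF L.ring_axioms eL])
  have fN: "field N" using L.ring_iso_imp_img_field[OF isoN] by (simp add: N_def copy_alg_sel(3)[symmetric])
  have crs: "cring ?KM" "cring L" "cring N" using KM.is_cring L.is_cring fN by (auto simp: field_def domain_def)
  have N': "str N \<in> carrier k \<rightarrow> carrier N" using aN by (auto simp: sigma_alg_def ring_hom_def)
  have eN: "e \<in> ring_hom ?KM N"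
    using isoN by (auto simp: ring_iso_def ring_hom_def Lsel)
  let ?d = "inv_into (carrier L) e"
  have dN: "?d \<in> ring_hom N K"
  proof -
    have "?d \<in> ring_hom N L"
      using ring_iso_set_sym[OF L.ring_axioms isoN] by (auto simp: ring_iso_def)
    then show ?thesis using subM by (auto simp: ring_hom_def Lsel)
  qed
  let ?e = "map (map_prod (\<lambda>x. x) e)"
  have idR: "(\<lambda>x. x) \<in> ring_hom R R" by (auto simp: ring_hom_def)
  have LM: "zs \<in> lists (carrier R \<times> M)" if "zs = xs \<or> zs = ys" for zs
    using that xs(1) ys(1) M(1) by (auto simp: lists_times_iff)
  have eLM: "?e zs \<in> lists (carrier R \<times> carrier N)" if "zs = xs \<or> zs = ys" for zs
    using LM[OF that] by (auto simp: lists_times_iff N_def copy_alg_sel Lsel)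
  have strKM: "str K \<in> carrier k \<rightarrow> carrier ?KM" using M(2) by auto
  have "tensor_eq k R (str R) ?KM (str K) (?s xs) (?s ys)"
    using F(3) M(1,2) subM(1) by simp
  then have "tensor_eq k R (str R) N (str N) (?e (?s xs)) (?e (?s ys))"
    by (rule tensor_eq_map[where p = "\<lambda>c. c"])
      (use idR eN R' crs strKM in \<open>auto simp: N_def copy_alg_sel Lsel\<close>)
  moreover have "?e (?s zs) = map (map_prod (sig R) (sig N)) (?e zs)" if "zs = xs \<or> zs = ys" for zs
    using LM[OF that] copy_alg_ops(1)[OF eL] by (auto simp: lists_times_iff N_def Lsel)
  ultimately have "tensor_eq k R (str R) N (str N) (map (map_prod (sig R) (sig N)) (?e xs))
      (map (map_prod (sig R) (sig N)) (?e ys))" by (simp only: simp_thms)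
  then have "tensor_class k R (str R) N (str N) (map (map_prod (sig R) (sig N)) (?e xs)) =
      tensor_class k R (str R) N (str N) (map (map_prod (sig R) (sig N)) (?e ys))"
    by (auto simp: tensor_class_def intro: tensor_eq.sym tensor_eq.trans)
  then have "sig (tensor k R N) (tensor_class k R (str R) N (str N) (?e xs)) =
      sig (tensor k R N) (tensor_class k R (str R) N (str N) (?e ys))"
    using sig_tensor_class[OF k'(1) R aN] eLM by simp
  moreover have "inj_on (sig (tensor k R N)) (carrier (tensor k R N))"
    using sep aN fN by (simp add: sigma_separable_def)
  ultimately have "tensor_class k R (str R) N (str N) (?e xs) = tensor_class k R (str R) N (str N) (?e ys)"
    using eLM by (auto simp: inj_on_def tensor_def tensor_ring_def Let_def)
  then have "tensor_eq k R (str R) N (str N) (?e xs) (?e ys)"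
    using tensor_eq_equiv[OF R'(1) crs(3) R'(2) N' eLM[of xs]] by simp
  then have "tensor_eq k R (str R) K (str K) (map (map_prod (\<lambda>x. x) ?d) (?e xs)) (map (map_prod (\<lambda>x. x) ?d) (?e ys))"
    by (rule tensor_eq_map[where p = "\<lambda>c. c"])
      (use idR dN R' K' crs N' M(2) eL in \<open>auto simp: N_def copy_alg_sel Lsel\<close>)
  moreover have "map (map_prod (\<lambda>x. x) ?d) (?e zs) = zs" if "zs = xs \<or> zs = ys" for zs
    using LM[OF that] eL by (auto simp: lists_times_iff Lsel intro!: map_idI)
  ultimately have "tensor_eq k R (str R) K (str K) xs ys" by (simp only: simp_thms)
  then show "U = V"
    using xs ys tensor_eq_equiv[OF R'(1) K'(1) R'(2) K'(2) xs(1)] by simp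
qed

end

theory Submission
  imports Defs
begin

text \<open>
  The point is that \<open>\<pi>\<^sub>0(R \<otimes> S) = \<pi>\<^sub>0(R) \<otimes> \<pi>\<^sub>0(S)\<close> inside \<open>R \<otimes> S\<close>; everything else follows from the
  universal property of the tensor product. Being etale amounts to having a separability idempotent,
  and an etale algebra is \<open>\<sigma>\<close>-separable iff it is spanned by the image of \<open>\<sigma>\<close>. Both conditions pass to
  images and tensor products, which gives one inclusion.

  Conversely, let \<open>C \<subseteq> R \<otimes> S\<close> be strongly etale. The two maps \<open>R \<otimes> S \<rightarrow> R \<otimes> S \<otimes> S\<close> send the separability
  idempotent of \<open>C\<close> to an idempotent \<open>e\<close>, and the coefficients of \<open>1 - e\<close> generate an ideal of \<open>S \<otimes> S\<close>
  that is generated by an idempotent \<open>1 - g\<close>. Then \<open>B = {s. (s \<otimes> 1) g = (1 \<otimes> s) g}\<close> contains all slices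
  of \<open>C\<close>, so \<open>C \<subseteq> R \<otimes> B\<close>. The cocycle identity \<open>g\<^sub>1\<^sub>2 g\<^sub>1\<^sub>3 = g\<^sub>1\<^sub>2 g\<^sub>2\<^sub>3\<close> in \<open>S \<otimes> S \<otimes> S\<close> shows
  \<open>g \<in> B \<otimes> B\<close>, so that \<open>g\<close> is a separability idempotent of \<open>B\<close>; comparing \<open>g\<close> with \<open>\<sigma>(g)\<close> shows that
  \<open>B\<close> is stable under \<open>\<sigma>\<close> and spanned by \<open>\<sigma>(B)\<close>. By symmetry \<open>C \<subseteq> A \<otimes> S\<close> with \<open>A\<close> strongly etale,
  and \<open>C \<subseteq> (A \<otimes> S) \<inter> (R \<otimes> B) = A \<otimes> B\<close>.
\<close>

section \<open>Algebras and linear functionals\<close>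

text \<open>Geometrically, call two points \<open>s\<close> and \<open>t\<close> of the spectrum of
  \<open>S\<close> equivalent if every \<open>c\<close> in \<open>C\<close> takes the same value at
  \<open>(r, s)\<close> and at \<open>(r, t)\<close> for all \<open>r\<close>. The idempotent
  \<open>g\<close> cuts this relation out of the spectrum of \<open>S \<otimes> S\<close>, and
  \<open>B\<close> consists of the functions that agree along it. The multiplication map sends
  \<open>g\<close> to \<open>1\<close> (reflexivity), the exchange of factors fixes \<open>g\<close>
  (symmetry), and the cocycle identity is transitivity. The delicate point is that the relation is
  open and closed: the coefficient ideal of \<open>1 - e\<close> is finitely generated and, as
  \<open>1 - e\<close> is idempotent, equal to its own square, so an idempotent generates it.
  Tensors are therefore handled through representations with independent components, whose
  coefficients are read off by linear functionals, and dimensions are compared only inside etale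
  algebras, where the separability idempotent itself supplies a finite basis. This finiteness also
  turns injectivity of \<open>\<sigma>\<close> after extension of scalars into the spanning
  condition.\<close>

primrec lsum :: "('a, 'm) ring_scheme \<Rightarrow> 'a list \<Rightarrow> 'a" where
  "lsum R [] = \<zero>\<^bsub>R\<^esub>"
| "lsum R (x # xs) = x \<oplus>\<^bsub>R\<^esub> lsum R xs"

context abelian_monoid
begin

lemma lsum_closed [intro]: "set xs \<subseteq> carrier G \<Longrightarrow> lsum G xs \<in> carrier G"
  by (induction xs) auto

lemma lsum_map_closed [simp]:
  "(\<And>x. x \<in> set xs \<Longrightarrow> f x \<in> carrier G) \<Longrightarrow> lsum G (map f xs) \<in> carrier G"
  by (induction xs) auto

lemma lsum_append:
  "set xs \<subseteq> carrier G \<Longrightarrow> set ys \<subseteq> carrier G \<Longrightarrow> lsum G (xs @ ys) = lsum G xs \<oplus> lsum G ys"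
  by (induction xs) (auto simp: a_assoc lsum_closed)

lemma lsum_map_add:
  assumes "\<And>x. x \<in> set xs \<Longrightarrow> f x \<in> carrier G" "\<And>x. x \<in> set xs \<Longrightarrow> g x \<in> carrier G"
  shows "lsum G (map (\<lambda>x. f x \<oplus> g x) xs) = lsum G (map f xs) \<oplus> lsum G (map g xs)"
  using assms
proof (induction xs)
  case (Cons x xs)
  have "lsum G (map f xs) \<in> carrier G" "lsum G (map g xs) \<in> carrier G"
    by (rule lsum_map_closed; use Cons.prems in simp)+
  then show ?case using Cons by (simp add: a_ac)
qed simp

lemma lsum_zero: "set xs \<subseteq> {\<zero>} \<Longrightarrow> lsum G xs = \<zero>"
  by (induction xs) auto

end

lemma (in ring) lsum_rdistr:
  "a \<in> carrier R \<Longrightarrow> (\<And>x. x \<in> set xs \<Longrightarrow> f x \<in> carrier R) \<Longrightarrow>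
    a \<otimes> lsum R (map f xs) = lsum R (map (\<lambda>x. a \<otimes> f x) xs)"
proof (induction xs)
  case (Cons x xs)
  have "lsum R (map f xs) \<in> carrier R" by (rule lsum_map_closed) (use Cons.prems in simp)
  then show ?case using Cons by (simp add: r_distr)
qed simp

lemma (in ring) lsum_ldistr:
  "a \<in> carrier R \<Longrightarrow> (\<And>x. x \<in> set xs \<Longrightarrow> f x \<in> carrier R) \<Longrightarrow>
    lsum R (map f xs) \<otimes> a = lsum R (map (\<lambda>x. f x \<otimes> a) xs)"
proof (induction xs)
  case (Cons x xs)
  have "lsum R (map f xs) \<in> carrier R" by (rule lsum_map_closed) (use Cons.prems in simp)
  then show ?case using Cons by (simp add: l_distr)
qed simp

lemma (in abelian_group) add_minus_cancel:
  assumes "x \<in> carrier G" "a \<in> carrier G" "c \<in> carrier G"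
  shows "(x \<oplus> a) \<ominus> (x \<oplus> c) = a \<ominus> c"
  using assms by (simp add: a_minus_def a_comm[of x a] minus_add a_assoc r_neg2)

text \<open>Contractions of tensors, and maps of a tensor with one argument frozen, are additive but
  not multiplicative. Agreement on pure tensors is therefore studied at this level and then
  specialised to ring homomorphisms.\<close>

definition additive :: "('a, 'm) ring_scheme \<Rightarrow> ('b, 'n) ring_scheme \<Rightarrow> ('a \<Rightarrow> 'b) \<Rightarrow> bool"
  where "additive R Q h \<longleftrightarrow> h \<in> carrier R \<rightarrow> carrier Q \<and>
    (\<forall>x \<in> carrier R. \<forall>y \<in> carrier R. h (x \<oplus>\<^bsub>R\<^esub> y) = h x \<oplus>\<^bsub>Q\<^esub> h y)"

lemma additiveD:
  assumes "additive R Q h"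
  shows "x \<in> carrier R \<Longrightarrow> h x \<in> carrier Q"
    and "x \<in> carrier R \<Longrightarrow> y \<in> carrier R \<Longrightarrow> h (x \<oplus>\<^bsub>R\<^esub> y) = h x \<oplus>\<^bsub>Q\<^esub> h y"
  using assms by (auto simp: additive_def)

lemma ring_hom_additive: "h \<in> ring_hom R Q \<Longrightarrow> additive R Q h"
  by (auto simp: additive_def ring_hom_def)

lemma additive_zero:
  assumes "abelian_group R" "abelian_group Q" "additive R Q h"
  shows "h \<zero>\<^bsub>R\<^esub> = \<zero>\<^bsub>Q\<^esub>"
proof -
  interpret R: abelian_group R by fact
  interpret Q: abelian_group Q by fact
  have "h \<zero>\<^bsub>R\<^esub> \<oplus>\<^bsub>Q\<^esub> h \<zero>\<^bsub>R\<^esub> = h \<zero>\<^bsub>R\<^esub>"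
    using additiveD(2)[OF assms(3), of "\<zero>\<^bsub>R\<^esub>" "\<zero>\<^bsub>R\<^esub>"] by simp
  then show ?thesis
    using additiveD(1)[OF assms(3), of "\<zero>\<^bsub>R\<^esub>"] by (simp add: Q.add.l_cancel_one)
qed

lemma additive_minus:
  assumes "abelian_group R" "abelian_group Q" "additive R Q h" "x \<in> carrier R"
  shows "h (\<ominus>\<^bsub>R\<^esub> x) = \<ominus>\<^bsub>Q\<^esub> h x"
proof -
  interpret R: abelian_group R by fact
  interpret Q: abelian_group Q by fact
  have "h (\<ominus>\<^bsub>R\<^esub> x) \<oplus>\<^bsub>Q\<^esub> h x = \<zero>\<^bsub>Q\<^esub>"
    using additiveD(2)[OF assms(3), of "\<ominus>\<^bsub>R\<^esub> x" x] additive_zero[OF assms(1-3)] assms(4)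
    by (simp add: R.l_neg)
  then show ?thesis
    using additiveD(1)[OF assms(3)] assms(4) by (metis Q.minus_equality R.a_inv_closed)
qed

lemma additive_lsum:
  assumes "abelian_group R" "abelian_group Q" "additive R Q h" "set xs \<subseteq> carrier R"
  shows "h (lsum R xs) = lsum Q (map h xs)"
proof -
  interpret R: abelian_group R by fact
  show ?thesis using assms(4)
  proof (induction xs)
    case Nil
    then show ?case using additive_zero[OF assms(1-3)] by simp
  next
    case (Cons x xs)
    then show ?case using additiveD(2)[OF assms(3), of x "lsum R xs"] R.lsum_closed by simp
  qed
qed

definition smul :: "('k, 'a, 'n) salg_scheme \<Rightarrow> 'k \<Rightarrow> 'a \<Rightarrow> 'a"
  where "smul R c r = str R c \<otimes>\<^bsub>R\<^esub> r"

text \<open>Negatives are covered by the scalar \<open>-1\<close>. With \<open>self_alg R\<close>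
  over \<open>R\<close> itself the same predicate describes the ideals of \<open>R\<close>, so spans
  and Zorn arguments serve subspaces and ideals at once.\<close>

definition ksub :: "('k, 'm) ring_scheme \<Rightarrow> ('k, 'a, 'n) salg_scheme \<Rightarrow> 'a set \<Rightarrow> bool"
  where "ksub k R W \<longleftrightarrow> W \<subseteq> carrier R \<and> \<zero>\<^bsub>R\<^esub> \<in> W \<and> (\<forall>x \<in> W. \<forall>y \<in> W. x \<oplus>\<^bsub>R\<^esub> y \<in> W) \<and>
    (\<forall>c \<in> carrier k. \<forall>x \<in> W. smul R c x \<in> W)"

lemma ksubD:
  assumes "ksub k R W"
  shows "x \<in> W \<Longrightarrow> x \<in> carrier R" "\<zero>\<^bsub>R\<^esub> \<in> W" "x \<in> W \<Longrightarrow> y \<in> W \<Longrightarrow> x \<oplus>\<^bsub>R\<^esub> y \<in> W"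
    "c \<in> carrier k \<Longrightarrow> x \<in> W \<Longrightarrow> smul R c x \<in> W"
  using assms by (auto simp: ksub_def)

lemma ksub_lsum: "ksub k R W \<Longrightarrow> set xs \<subseteq> W \<Longrightarrow> lsum R xs \<in> W"
  by (induction xs) (auto simp: ksub_def)

primrec lspan :: "('k, 'm) ring_scheme \<Rightarrow> ('k, 'a, 'n) salg_scheme \<Rightarrow> 'a list \<Rightarrow> 'a set" where
  "lspan k R [] = {\<zero>\<^bsub>R\<^esub>}"
| "lspan k R (v # vs) = {smul R c v \<oplus>\<^bsub>R\<^esub> w | c w. c \<in> carrier k \<and> w \<in> lspan k R vs}"

definition lin :: "('k, 'm) ring_scheme \<Rightarrow> ('k, 'a, 'n) salg_scheme \<Rightarrow> ('a \<Rightarrow> 'k) \<Rightarrow> bool"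
  where "lin k R f \<longleftrightarrow> additive R k f \<and>
    (\<forall>c \<in> carrier k. \<forall>r \<in> carrier R. f (smul R c r) = c \<otimes>\<^bsub>k\<^esub> f r)"

lemma linD:
  assumes "lin k R f"
  shows "x \<in> carrier R \<Longrightarrow> f x \<in> carrier k"
    "x \<in> carrier R \<Longrightarrow> y \<in> carrier R \<Longrightarrow> f (x \<oplus>\<^bsub>R\<^esub> y) = f x \<oplus>\<^bsub>k\<^esub> f y"
    "c \<in> carrier k \<Longrightarrow> x \<in> carrier R \<Longrightarrow> f (smul R c x) = c \<otimes>\<^bsub>k\<^esub> f x"
  using assms by (auto simp: lin_def additive_def)

locale algebra_over = k: cring k + R: cring R
  for k :: "('k, 'm) ring_scheme" and R :: "('k, 'a, 'n) salg_scheme" +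
  assumes str_hom: "str R \<in> ring_hom k R"

context algebra_over
begin

lemma str_closed [simp]: "c \<in> carrier k \<Longrightarrow> str R c \<in> carrier R"
  and str_add: "c \<in> carrier k \<Longrightarrow> d \<in> carrier k \<Longrightarrow> str R (c \<oplus>\<^bsub>k\<^esub> d) = str R c \<oplus>\<^bsub>R\<^esub> str R d"
  and str_mult: "c \<in> carrier k \<Longrightarrow> d \<in> carrier k \<Longrightarrow> str R (c \<otimes>\<^bsub>k\<^esub> d) = str R c \<otimes>\<^bsub>R\<^esub> str R d"
  and str_one [simp]: "str R \<one>\<^bsub>k\<^esub> = \<one>\<^bsub>R\<^esub>"
  using str_hom by (auto simp: ring_hom_def)

lemma str_zero [simp]: "str R \<zero>\<^bsub>k\<^esub> = \<zero>\<^bsub>R\<^esub>"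
  by (rule additive_zero[OF k.abelian_group_axioms R.abelian_group_axioms ring_hom_additive[OF str_hom]])

lemma str_minus: "c \<in> carrier k \<Longrightarrow> str R (\<ominus>\<^bsub>k\<^esub> c) = \<ominus>\<^bsub>R\<^esub> str R c"
  by (rule additive_minus[OF k.abelian_group_axioms R.abelian_group_axioms ring_hom_additive[OF str_hom]])

lemma smul_closed [simp]: "c \<in> carrier k \<Longrightarrow> x \<in> carrier R \<Longrightarrow> smul R c x \<in> carrier R"
  by (simp add: smul_def)

lemma smul_add: "c \<in> carrier k \<Longrightarrow> x \<in> carrier R \<Longrightarrow> y \<in> carrier R \<Longrightarrow>
    smul R c (x \<oplus>\<^bsub>R\<^esub> y) = smul R c x \<oplus>\<^bsub>R\<^esub> smul R c y"
  by (simp add: smul_def R.r_distr)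

lemma add_smul: "c \<in> carrier k \<Longrightarrow> d \<in> carrier k \<Longrightarrow> x \<in> carrier R \<Longrightarrow>
    smul R (c \<oplus>\<^bsub>k\<^esub> d) x = smul R c x \<oplus>\<^bsub>R\<^esub> smul R d x"
  by (simp add: smul_def R.l_distr str_add)

lemma smul_smul: "c \<in> carrier k \<Longrightarrow> d \<in> carrier k \<Longrightarrow> x \<in> carrier R \<Longrightarrow>
    smul R c (smul R d x) = smul R (c \<otimes>\<^bsub>k\<^esub> d) x"
  by (simp add: smul_def R.m_assoc str_mult)

lemma smul_one [simp]: "x \<in> carrier R \<Longrightarrow> smul R \<one>\<^bsub>k\<^esub> x = x"
  and smul_zero [simp]: "x \<in> carrier R \<Longrightarrow> smul R \<zero>\<^bsub>k\<^esub> x = \<zero>\<^bsub>R\<^esub>"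
  and smul_zero_right [simp]: "c \<in> carrier k \<Longrightarrow> smul R c \<zero>\<^bsub>R\<^esub> = \<zero>\<^bsub>R\<^esub>"
  and smul_uminus: "c \<in> carrier k \<Longrightarrow> x \<in> carrier R \<Longrightarrow> smul R (\<ominus>\<^bsub>k\<^esub> c) x = \<ominus>\<^bsub>R\<^esub> smul R c x"
  by (simp_all add: smul_def str_minus R.l_minus)

lemma ksub_uminus: "ksub k R W \<Longrightarrow> x \<in> W \<Longrightarrow> \<ominus>\<^bsub>R\<^esub> x \<in> W"
  using ksubD(4)[of k R W "\<ominus>\<^bsub>k\<^esub> \<one>\<^bsub>k\<^esub>" x] ksubD(1)[of k R W x] by (simp add: smul_uminus)

lemma ksub_minus: "ksub k R W \<Longrightarrow> x \<in> W \<Longrightarrow> y \<in> W \<Longrightarrow> x \<ominus>\<^bsub>R\<^esub> y \<in> W"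
  using ksub_uminus[of W y] ksubD(3)[of k R W x "\<ominus>\<^bsub>R\<^esub> y"] by (simp add: a_minus_def)

lemma ksub_carrier: "ksub k R (carrier R)"
  by (auto simp: ksub_def)

lemma lspan_closed: "set vs \<subseteq> carrier R \<Longrightarrow> lspan k R vs \<subseteq> carrier R"
  by (induction vs) auto

lemma lspan_ksub: "set vs \<subseteq> carrier R \<Longrightarrow> ksub k R (lspan k R vs)"
proof (induction vs)
  case Nil
  then show ?case by (simp add: ksub_def)
next
  case (Cons v vs)
  then have v: "v \<in> carrier R" and IH: "ksub k R (lspan k R vs)" by auto
  note D = ksubD[OF IH]
  show ?case unfolding ksub_def
  proof (intro conjI ballI)
    show "lspan k R (v # vs) \<subseteq> carrier R" using lspan_closed[OF Cons.prems] .
    show "\<zero>\<^bsub>R\<^esub> \<in> lspan k R (v # vs)"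
      using D(2) v by (auto intro!: exI[of _ "\<zero>\<^bsub>k\<^esub>"] exI[of _ "\<zero>\<^bsub>R\<^esub>"])
    fix x y assume "x \<in> lspan k R (v # vs)" "y \<in> lspan k R (v # vs)"
    then obtain c w d u where "c \<in> carrier k" "d \<in> carrier k" "w \<in> lspan k R vs" "u \<in> lspan k R vs"
      "x = smul R c v \<oplus>\<^bsub>R\<^esub> w" "y = smul R d v \<oplus>\<^bsub>R\<^esub> u" by auto
    moreover have "(smul R c v \<oplus>\<^bsub>R\<^esub> w) \<oplus>\<^bsub>R\<^esub> (smul R d v \<oplus>\<^bsub>R\<^esub> u) = smul R (c \<oplus>\<^bsub>k\<^esub> d) v \<oplus>\<^bsub>R\<^esub> (w \<oplus>\<^bsub>R\<^esub> u)"
      using calculation v D(1) by (simp add: add_smul R.a_ac)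
    ultimately show "x \<oplus>\<^bsub>R\<^esub> y \<in> lspan k R (v # vs)" using D(3) k.add.m_closed by auto
  next
    fix c x assume c: "c \<in> carrier k" and "x \<in> lspan k R (v # vs)"
    then obtain d w where "d \<in> carrier k" "w \<in> lspan k R vs" "x = smul R d v \<oplus>\<^bsub>R\<^esub> w" by auto
    moreover have "smul R c (smul R d v \<oplus>\<^bsub>R\<^esub> w) = smul R (c \<otimes>\<^bsub>k\<^esub> d) v \<oplus>\<^bsub>R\<^esub> smul R c w"
      using calculation v D(1) c by (simp add: smul_add smul_smul)
    ultimately show "smul R c x \<in> lspan k R (v # vs)" using D(4) c k.m_closed by auto
  qed
qed

lemma lspan_mem: "set vs \<subseteq> carrier R \<Longrightarrow> v \<in> set vs \<Longrightarrow> v \<in> lspan k R vs"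
proof (induction vs)
  case (Cons w vs)
  note D = ksubD[OF lspan_ksub, of vs]
  show ?case
  proof (cases "v = w")
    case True
    have "v = smul R \<one>\<^bsub>k\<^esub> w \<oplus>\<^bsub>R\<^esub> \<zero>\<^bsub>R\<^esub>" using True Cons.prems by simp
    then show ?thesis using D(2) Cons.prems k.one_closed by force
  next
    case False
    then have "v \<in> lspan k R vs" using Cons by simp
    moreover have "v = smul R \<zero>\<^bsub>k\<^esub> w \<oplus>\<^bsub>R\<^esub> v" using Cons.prems by auto
    ultimately show ?thesis using k.zero_closed by auto
  qed
qed simp

lemma lspan_least: "ksub k R W \<Longrightarrow> set vs \<subseteq> W \<Longrightarrow> lspan k R vs \<subseteq> W"
  by (induction vs) (auto simp: ksub_def)

lemma lspan_mono: "set us \<subseteq> lspan k R vs \<Longrightarrow> set vs \<subseteq> carrier R \<Longrightarrow> lspan k R us \<subseteq> lspan k R vs"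
  by (rule lspan_least[OF lspan_ksub])

lemma lspan_comb:
  "x \<in> lspan k R vs \<longleftrightarrow> (\<exists>cs \<in> lists (carrier k). length cs = length vs \<and> x = lsum R (map2 (smul R) cs vs))"
proof (induction vs arbitrary: x)
  case Nil
  then show ?case by auto
next
  case (Cons v vs)
  have "x \<in> lspan k R (v # vs) \<longleftrightarrow> (\<exists>c \<in> carrier k. \<exists>cs \<in> lists (carrier k). length cs = length vs \<and>
      x = smul R c v \<oplus>\<^bsub>R\<^esub> lsum R (map2 (smul R) cs vs))"
    using Cons.IH by auto
  also have "\<dots> \<longleftrightarrow> (\<exists>cs \<in> lists (carrier k). length cs = length (v # vs) \<and> x = lsum R (map2 (smul R) cs (v # vs)))"
  proof
    assume "\<exists>c \<in> carrier k. \<exists>cs \<in> lists (carrier k). length cs = length vs \<and>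
      x = smul R c v \<oplus>\<^bsub>R\<^esub> lsum R (map2 (smul R) cs vs)"
    then obtain c cs where "c \<in> carrier k" "cs \<in> lists (carrier k)" "length cs = length vs"
      "x = smul R c v \<oplus>\<^bsub>R\<^esub> lsum R (map2 (smul R) cs vs)" by blast
    then show "\<exists>cs \<in> lists (carrier k). length cs = length (v # vs) \<and> x = lsum R (map2 (smul R) cs (v # vs))"
      by (intro bexI[of _ "c # cs"]) auto
  next
    assume "\<exists>cs \<in> lists (carrier k). length cs = length (v # vs) \<and> x = lsum R (map2 (smul R) cs (v # vs))"
    then show "\<exists>c \<in> carrier k. \<exists>cs \<in> lists (carrier k). length cs = length vs \<and>
      x = smul R c v \<oplus>\<^bsub>R\<^esub> lsum R (map2 (smul R) cs vs)"
      by (auto simp: length_Suc_conv; metis in_listsI)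
  qed
  finally show ?case .
qed

lemma lin_zero: "lin k R f \<Longrightarrow> f \<zero>\<^bsub>R\<^esub> = \<zero>\<^bsub>k\<^esub>"
  using additive_zero[OF R.abelian_group_axioms k.abelian_group_axioms] by (auto simp: lin_def)

lemma lin_comb:
  assumes f: "lin k R f" and g: "lin k R g" and c: "c \<in> carrier k"
  shows "lin k R (\<lambda>x. f x \<oplus>\<^bsub>k\<^esub> c \<otimes>\<^bsub>k\<^esub> g x)"
  using linD[OF f] linD[OF g] c
  by (simp add: lin_def additive_def k.r_distr k.a_ac k.m_lcomm)

text \<open>Zorn's lemma: the union of a chain is closed under the operations because any two of its
  elements lie in one member. Over a field this yields hyperplanes and hence functionals; for a ring
  over itself it yields ideals maximal among those avoiding an element, which play the part of
  maximal ideals when idempotents are split.\<close>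

lemma ksub_maximal:
  assumes W: "ksub k R W" and x: "x \<notin> W"
  obtains M where "ksub k R M" "W \<subseteq> M" "x \<notin> M"
    "\<And>N. ksub k R N \<Longrightarrow> M \<subseteq> N \<Longrightarrow> x \<notin> N \<Longrightarrow> N = M"
proof -
  define F where "F = {M. ksub k R M \<and> W \<subseteq> M \<and> x \<notin> M}"
  have "\<exists>M\<in>F. \<forall>Y\<in>F. M \<subseteq> Y \<longrightarrow> Y = M"
  proof (rule subset_Zorn_nonempty)
    show "F \<noteq> {}" using W x by (auto simp: F_def)
    fix C assume C: "C \<noteq> {}" "subset.chain F C"
    have two: "\<exists>M\<in>C. a \<in> M \<and> b \<in> M" if ab: "a \<in> \<Union>C" "b \<in> \<Union>C" for a b
    proof -
      obtain M N where "M \<in> C" "N \<in> C" "a \<in> M" "b \<in> N" using ab by blast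
      moreover have "M \<subseteq> N \<or> N \<subseteq> M" using C(2) calculation by (auto simp: subset.chain_def)
      ultimately show ?thesis by blast
    qed
    have CF: "M \<in> F" if "M \<in> C" for M using C that by (auto simp: subset.chain_def)
    have sub: "ksub k R M" if "M \<in> C" for M using CF[OF that] by (simp add: F_def)
    have "ksub k R (\<Union>C)" unfolding ksub_def
    proof (intro conjI ballI)
      show "\<Union>C \<subseteq> carrier R" using ksubD(1)[OF sub] by (intro Union_least subsetI)
      obtain M where "M \<in> C" using C(1) by blast
      then show "\<zero>\<^bsub>R\<^esub> \<in> \<Union>C" using ksubD(2)[OF sub] by (intro UnionI)
      fix a b assume "a \<in> \<Union>C" "b \<in> \<Union>C"
      then obtain M where "M \<in> C" "a \<in> M" "b \<in> M" using two by blast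
      then show "a \<oplus>\<^bsub>R\<^esub> b \<in> \<Union>C" using ksubD(3)[OF sub] by (intro UnionI)
    next
      fix c a assume c: "c \<in> carrier k" "a \<in> \<Union>C"
      then obtain M where "M \<in> C" "a \<in> M" by blast
      then show "smul R c a \<in> \<Union>C" using ksubD(4)[OF sub] c(1) by (intro UnionI)
    qed
    then show "\<Union>C \<in> F" using CF C(1) by (auto simp: F_def)
  qed
  then obtain M where M: "M \<in> F" and max: "\<And>Y. Y \<in> F \<Longrightarrow> M \<subseteq> Y \<Longrightarrow> Y = M" by blast
  show thesis
  proof (rule that[of M])
    fix N assume "ksub k R N" "M \<subseteq> N" "x \<notin> N"
    then show "N = M" using max[of N] M by (auto simp: F_def)
  qed (use M in \<open>auto simp: F_def\<close>)
qed

end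

section \<open>Linear functionals and dual families over a field\<close>

locale algebra_over_field = algebra_over k R + k: field k
  for k :: "('k, 'm) ring_scheme" and R :: "('k, 'a, 'n) salg_scheme"
begin

text \<open>A subspace \<open>M\<close> that contains \<open>W\<close> and is maximal among those
  avoiding \<open>x\<close> is a hyperplane complementary to \<open>x\<close>: each vector is
  congruent modulo \<open>M\<close> to exactly one multiple of \<open>x\<close>, and
  \<open>f\<close> returns that scalar. No bound on the dimension of \<open>R\<close>
  enters.\<close>

lemma functional_ext:
  assumes W: "ksub k R W" and x: "x \<in> carrier R" "x \<notin> W"
  obtains f where "lin k R f" "\<And>w. w \<in> W \<Longrightarrow> f w = \<zero>\<^bsub>k\<^esub>" "f x = \<one>\<^bsub>k\<^esub>"
proof -
  obtain M where M': "ksub k R M" "W \<subseteq> M" "x \<notin> M"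
    and max: "\<And>N. ksub k R N \<Longrightarrow> M \<subseteq> N \<Longrightarrow> x \<notin> N \<Longrightarrow> N = M"
    by (rule ksub_maximal[OF W x(2)]) blast
  note D = ksubD[OF M'(1)]
  have ex: "\<exists>c\<in>carrier k. v \<ominus>\<^bsub>R\<^esub> smul R c x \<in> M" if v: "v \<in> carrier R" for v
  proof (cases "v \<in> M")
    case True
    then show ?thesis using x v by (intro bexI[of _ "\<zero>\<^bsub>k\<^esub>"]) (auto simp: a_minus_def)
  next
    case False
    \<comment> \<open>The span of \<open>v\<close> and \<open>M\<close> is strictly larger than
      \<open>M\<close>, so by maximality it contains \<open>x = c v + m\<close>. Here
      \<open>c\<close> is invertible because \<open>x\<close> is not in \<open>M\<close>; solving
      for \<open>v\<close> gives the scalar.\<close>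
    let ?N = "{smul R c v \<oplus>\<^bsub>R\<^esub> m | c m. c \<in> carrier k \<and> m \<in> M}"
    have "ksub k R ?N" unfolding ksub_def
    proof (intro conjI ballI)
      show "?N \<subseteq> carrier R" using D(1) v by auto
      show "\<zero>\<^bsub>R\<^esub> \<in> ?N" using D(2) v by (auto intro!: exI[of _ "\<zero>\<^bsub>k\<^esub>"] exI[of _ "\<zero>\<^bsub>R\<^esub>"])
      fix a b assume "a \<in> ?N" "b \<in> ?N"
      then obtain c w d u where "c \<in> carrier k" "d \<in> carrier k" "w \<in> M" "u \<in> M"
        "a = smul R c v \<oplus>\<^bsub>R\<^esub> w" "b = smul R d v \<oplus>\<^bsub>R\<^esub> u" by auto
      moreover have "(smul R c v \<oplus>\<^bsub>R\<^esub> w) \<oplus>\<^bsub>R\<^esub> (smul R d v \<oplus>\<^bsub>R\<^esub> u) = smul R (c \<oplus>\<^bsub>k\<^esub> d) v \<oplus>\<^bsub>R\<^esub> (w \<oplus>\<^bsub>R\<^esub> u)"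
        using calculation v D(1) by (simp add: add_smul R.a_ac)
      ultimately show "a \<oplus>\<^bsub>R\<^esub> b \<in> ?N" using D(3) k.add.m_closed by auto
    next
      fix c a assume c: "c \<in> carrier k" and "a \<in> ?N"
      then obtain d w where "d \<in> carrier k" "w \<in> M" "a = smul R d v \<oplus>\<^bsub>R\<^esub> w" by auto
      moreover have "smul R c (smul R d v \<oplus>\<^bsub>R\<^esub> w) = smul R (c \<otimes>\<^bsub>k\<^esub> d) v \<oplus>\<^bsub>R\<^esub> smul R c w"
        using calculation v D(1) c by (simp add: smul_add smul_smul)
      ultimately show "smul R c a \<in> ?N" using D(4) c k.m_closed by auto
    qed
    moreover have MN: "M \<subseteq> ?N"
    proof
      fix m assume "m \<in> M"
      then have "m = smul R \<zero>\<^bsub>k\<^esub> v \<oplus>\<^bsub>R\<^esub> m" using v D(1) by simp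
      then show "m \<in> ?N" using \<open>m \<in> M\<close> k.zero_closed by blast
    qed
    moreover have "v \<in> ?N"
    proof -
      have "v = smul R \<one>\<^bsub>k\<^esub> v \<oplus>\<^bsub>R\<^esub> \<zero>\<^bsub>R\<^esub>" using v by simp
      then show ?thesis using D(2) k.one_closed by blast
    qed
    ultimately have "x \<in> ?N" using max[of ?N] False by blast
    then obtain c m where cm: "c \<in> carrier k" "m \<in> M" "x = smul R c v \<oplus>\<^bsub>R\<^esub> m" by blast
    have c0: "c \<noteq> \<zero>\<^bsub>k\<^esub>" using cm M'(3) v D(1) by auto
    then have ci: "inv\<^bsub>k\<^esub> c \<in> carrier k" "inv\<^bsub>k\<^esub> c \<otimes>\<^bsub>k\<^esub> c = \<one>\<^bsub>k\<^esub>"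
      using cm(1) k.field_Units by auto
    have "smul R (inv\<^bsub>k\<^esub> c) x = v \<oplus>\<^bsub>R\<^esub> smul R (inv\<^bsub>k\<^esub> c) m"
      using cm ci v D(1) by (simp add: smul_add smul_smul)
    moreover have "v \<ominus>\<^bsub>R\<^esub> (v \<oplus>\<^bsub>R\<^esub> smul R (inv\<^bsub>k\<^esub> c) m) = \<ominus>\<^bsub>R\<^esub> smul R (inv\<^bsub>k\<^esub> c) m"
      using v ci cm D(1) by (simp add: a_minus_def R.minus_add R.r_neg2)
    ultimately have "v \<ominus>\<^bsub>R\<^esub> smul R (inv\<^bsub>k\<^esub> c) x \<in> M"
      using ksub_uminus[OF M'(1) D(4)[OF ci(1) cm(2)]] by simp
    then show ?thesis by (rule bexI[OF _ ci(1)])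
  qed
  have uniq: "c = d" if cd: "c \<in> carrier k" "d \<in> carrier k" "v \<in> carrier R"
    "v \<ominus>\<^bsub>R\<^esub> smul R c x \<in> M" "v \<ominus>\<^bsub>R\<^esub> smul R d x \<in> M" for c d v
  proof (rule ccontr)
    assume "c \<noteq> d"
    then have nz: "d \<ominus>\<^bsub>k\<^esub> c \<noteq> \<zero>\<^bsub>k\<^esub>" using cd by (simp add: k.r_right_minus_eq)
    have "(v \<ominus>\<^bsub>R\<^esub> smul R c x) \<ominus>\<^bsub>R\<^esub> (v \<ominus>\<^bsub>R\<^esub> smul R d x) \<in> M" by (rule ksub_minus[OF M'(1) cd(4,5)])
    also have "(v \<ominus>\<^bsub>R\<^esub> smul R c x) \<ominus>\<^bsub>R\<^esub> (v \<ominus>\<^bsub>R\<^esub> smul R d x) = smul R (d \<ominus>\<^bsub>k\<^esub> c) x"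
      using cd x R.add_minus_cancel[of v "\<ominus>\<^bsub>R\<^esub> smul R c x" "\<ominus>\<^bsub>R\<^esub> smul R d x"]
      by (simp add: a_minus_def add_smul smul_uminus R.a_comm)
    finally have mem: "smul R (d \<ominus>\<^bsub>k\<^esub> c) x \<in> M" .
    have U: "d \<ominus>\<^bsub>k\<^esub> c \<in> Units k" using nz cd by (simp add: k.field_Units)
    have "smul R (inv\<^bsub>k\<^esub> (d \<ominus>\<^bsub>k\<^esub> c)) (smul R (d \<ominus>\<^bsub>k\<^esub> c) x) = x"
      using U cd x by (simp add: smul_smul)
    then show False using D(4)[OF k.Units_inv_closed[OF U] mem] M'(3) by simp
  qed
  define f where "f v = (THE c. c \<in> carrier k \<and> v \<ominus>\<^bsub>R\<^esub> smul R c x \<in> M)" for v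
  have f: "f v \<in> carrier k \<and> v \<ominus>\<^bsub>R\<^esub> smul R (f v) x \<in> M" if "v \<in> carrier R" for v
    unfolding f_def by (rule theI') (use ex[OF that] uniq that in blast)
  have feq: "f v = c" if "v \<in> carrier R" "c \<in> carrier k" "v \<ominus>\<^bsub>R\<^esub> smul R c x \<in> M" for v c
    using uniq f that by blast
  have "lin k R f" unfolding lin_def additive_def
  proof (intro conjI ballI)
    show "f \<in> carrier R \<rightarrow> carrier k" using f by auto
    fix v w assume vw: "v \<in> carrier R" "w \<in> carrier R"
    have "(v \<ominus>\<^bsub>R\<^esub> smul R (f v) x) \<oplus>\<^bsub>R\<^esub> (w \<ominus>\<^bsub>R\<^esub> smul R (f w) x) =
        (v \<oplus>\<^bsub>R\<^esub> w) \<ominus>\<^bsub>R\<^esub> smul R (f v \<oplus>\<^bsub>k\<^esub> f w) x"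
      using vw f x by (simp add: a_minus_def add_smul R.minus_add R.a_ac)
    then show "f (v \<oplus>\<^bsub>R\<^esub> w) = f v \<oplus>\<^bsub>k\<^esub> f w"
      using vw f[OF vw(1)] f[OF vw(2)] D(3)[of "v \<ominus>\<^bsub>R\<^esub> smul R (f v) x" "w \<ominus>\<^bsub>R\<^esub> smul R (f w) x"]
      by (intro feq) auto
  next
    fix c v assume cv: "c \<in> carrier k" "v \<in> carrier R"
    have "smul R c (v \<ominus>\<^bsub>R\<^esub> smul R (f v) x) = smul R c v \<ominus>\<^bsub>R\<^esub> smul R (c \<otimes>\<^bsub>k\<^esub> f v) x"
      using cv f x by (simp add: a_minus_def smul_add smul_smul smul_uminus[symmetric] k.r_minus)
    then show "f (smul R c v) = c \<otimes>\<^bsub>k\<^esub> f v"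
      using cv f[OF cv(2)] D(4)[of c "v \<ominus>\<^bsub>R\<^esub> smul R (f v) x"] by (intro feq) auto
  qed
  moreover have "f w = \<zero>\<^bsub>k\<^esub>" if "w \<in> W" for w
    using that M'(2) D(1) x by (intro feq) (auto simp: a_minus_def)
  moreover have "f x = \<one>\<^bsub>k\<^esub>"
    using x D(2) by (intro feq) (auto simp: a_minus_def R.r_neg)
  ultimately show ?thesis using that by blast
qed

text \<open>Coordinate functionals are the working form of independence: they carry over to a tensor
  product, where contraction with \<open>f i\<close> extracts a single coefficient.\<close>

definition dual :: "'a list \<Rightarrow> (nat \<Rightarrow> 'a \<Rightarrow> 'k) \<Rightarrow> bool"
  where "dual us f \<longleftrightarrow> set us \<subseteq> carrier R \<and> (\<forall>i < length us. lin k R (f i) \<and>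
    (\<forall>j < length us. f i (us ! j) = (if i = j then \<one>\<^bsub>k\<^esub> else \<zero>\<^bsub>k\<^esub>)))"

text \<open>Steinitz exchange, by induction on the spanning list. The family is indexed by a finite
  set instead of a list, so that one index can be removed while the others keep their
  functionals.\<close>

lemma card_dual_le:
  assumes "finite I" "set vs \<subseteq> carrier R" "\<And>i. i \<in> I \<Longrightarrow> u i \<in> lspan k R vs" "\<And>i. i \<in> I \<Longrightarrow> lin k R (f i)"
    "\<And>i j. i \<in> I \<Longrightarrow> j \<in> I \<Longrightarrow> f i (u j) = (if i = j then \<one>\<^bsub>k\<^esub> else \<zero>\<^bsub>k\<^esub>)"
  shows "card I \<le> length vs"
  using assms
proof (induction vs arbitrary: I u)
  case Nil
  have "I = {}"
  proof (rule ccontr)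
    assume "I \<noteq> {}"
    then obtain i where "i \<in> I" by blast
    then have "f i \<zero>\<^bsub>R\<^esub> = \<one>\<^bsub>k\<^esub>" "f i \<zero>\<^bsub>R\<^esub> = \<zero>\<^bsub>k\<^esub>" using Nil.prems lin_zero by (metis lspan.simps(1) singletonD)+
    then show False by simp
  qed
  then show ?case by simp
next
  case (Cons v vs)
  have "\<exists>c w. c \<in> carrier k \<and> w \<in> lspan k R vs \<and> u i = smul R c v \<oplus>\<^bsub>R\<^esub> w" if "i \<in> I" for i
    using Cons.prems(3)[OF that] by auto
  then obtain c w where cw: "\<And>i. i \<in> I \<Longrightarrow> c i \<in> carrier k \<and> w i \<in> lspan k R vs \<and> u i = smul R (c i) v \<oplus>\<^bsub>R\<^esub> w i"
    by metis
  have v: "v \<in> carrier R" "set vs \<subseteq> carrier R" using Cons.prems by auto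
  note D = ksubD[OF lspan_ksub[OF v(2)]]
  show ?case
  proof (cases "\<forall>i \<in> I. c i = \<zero>\<^bsub>k\<^esub>")
    case True
    then have "u i \<in> lspan k R vs" if "i \<in> I" for i
      using cw[OF that] that v D(1) by simp
    then have "card I \<le> length vs" using Cons.prems v by (intro Cons.IH[of I u]) auto
    then show ?thesis by simp
  next
    case False
    then obtain j where j: "j \<in> I" "c j \<noteq> \<zero>\<^bsub>k\<^esub>" by blast
    \<comment> \<open>Adding this multiple of \<open>u j\<close> removes the component of
      \<open>u i\<close> along \<open>v\<close>. For the remaining indices \<open>f i\<close>
      vanishes on \<open>u j\<close>, so the biorthogonality relations persist.\<close>
    define a where "a i = \<ominus>\<^bsub>k\<^esub> (c i \<otimes>\<^bsub>k\<^esub> inv\<^bsub>k\<^esub> c j)" for i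
    define u' where "u' i = u i \<oplus>\<^bsub>R\<^esub> smul R (a i) (u j)" for i
    have cj: "inv\<^bsub>k\<^esub> c j \<in> carrier k" "inv\<^bsub>k\<^esub> c j \<otimes>\<^bsub>k\<^esub> c j = \<one>\<^bsub>k\<^esub>" using j cw k.field_Units by auto
    have a: "a i \<in> carrier k" if "i \<in> I" for i using that cw cj by (simp add: a_def)
    have uR: "u i \<in> carrier R" if "i \<in> I" for i using that cw v D(1) by simp
    have u'in: "u' i \<in> lspan k R vs" if i: "i \<in> I" for i
    proof -
      have "a i \<otimes>\<^bsub>k\<^esub> c j = \<ominus>\<^bsub>k\<^esub> c i" using cw[OF i] cw[OF j(1)] cj by (simp add: a_def k.l_minus k.m_assoc)
      then have "u' i = w i \<oplus>\<^bsub>R\<^esub> smul R (a i) (w j)"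
        using cw[OF i] cw[OF j(1)] v D(1) a[OF i]
        by (simp add: u'_def smul_add smul_smul smul_uminus R.a_ac R.r_neg R.add.m_lcomm[of "smul R (c i) v"])
      then show ?thesis using D cw i j a by simp
    qed
    have "card (I - {j}) \<le> length vs"
    proof (rule Cons.IH[of _ u'])
      fix i l assume il: "i \<in> I - {j}" "l \<in> I - {j}"
      have "lin k R (f i)" using Cons.prems(4) il by blast
      note L = linD[OF this]
      have "f i (u' l) = f i (u l) \<oplus>\<^bsub>k\<^esub> a l \<otimes>\<^bsub>k\<^esub> f i (u j)"
        using L il j a uR by (simp add: u'_def)
      also have "f i (u j) = \<zero>\<^bsub>k\<^esub>" using Cons.prems(5) il j by auto
      finally show "f i (u' l) = (if i = l then \<one>\<^bsub>k\<^esub> else \<zero>\<^bsub>k\<^esub>)"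
        using Cons.prems(5) il a by auto
    qed (use Cons.prems v u'in in auto)
    then show ?thesis using j Cons.prems(1) by simp
  qed
qed

lemma length_dual_le:
  "dual us f \<Longrightarrow> set us \<subseteq> lspan k R vs \<Longrightarrow> set vs \<subseteq> carrier R \<Longrightarrow> length us \<le> length vs"
  unfolding dual_def using card_dual_le[of "{..<length us}" vs "\<lambda>i. us ! i" f]
  by (metis card_lessThan finite_lessThan lessThan_iff nth_mem subsetD)

lemma dual_exists:
  assumes "set us \<subseteq> carrier R" "\<And>i. i < length us \<Longrightarrow> us ! i \<notin> lspan k R (take i us @ drop (Suc i) us)"
  obtains f where "dual us f"
proof -
  have "\<exists>g. lin k R g \<and> (\<forall>j < length us. g (us ! j) = (if i = j then \<one>\<^bsub>k\<^esub> else \<zero>\<^bsub>k\<^esub>))" if i: "i < length us" for i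
  proof -
    let ?o = "take i us @ drop (Suc i) us"
    have o: "set ?o \<subseteq> carrier R" using assms(1) by (auto dest: in_set_takeD in_set_dropD)
    have ui: "us ! i \<in> carrier R" using assms(1) i nth_mem by blast
    obtain g where g: "lin k R g" "\<And>w. w \<in> lspan k R ?o \<Longrightarrow> g w = \<zero>\<^bsub>k\<^esub>" "g (us ! i) = \<one>\<^bsub>k\<^esub>"
      using functional_ext[OF lspan_ksub[OF o] ui assms(2)[OF i]] by blast
    have "us ! j \<in> set ?o" if "j < length us" "i \<noteq> j" for j
    proof (cases "j < i")
      case True
      then have "us ! j \<in> set (take i us)" using i by (auto simp: in_set_conv_nth intro!: exI[of _ j])
      then show ?thesis by simp
    next
      case False
      then have "us ! j = drop (Suc i) us ! (j - Suc i)" "j - Suc i < length (drop (Suc i) us)" using that by auto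
      then have "us ! j \<in> set (drop (Suc i) us)" by (metis nth_mem)
      then show ?thesis by simp
    qed
    then show ?thesis using g lspan_mem[OF o] by (intro exI[of _ g]) auto
  qed
  then obtain f where "\<And>i. i < length us \<Longrightarrow> lin k R (f i) \<and> (\<forall>j < length us. f i (us ! j) = (if i = j then \<one>\<^bsub>k\<^esub> else \<zero>\<^bsub>k\<^esub>))"
    by metis
  then show ?thesis using that[of f] assms(1) by (simp add: dual_def)
qed

text \<open>The functional \<open>g\<close> that separates \<open>x\<close> from the span of
  \<open>us\<close> becomes the new first coordinate; every old functional is corrected by a
  multiple of \<open>g\<close> so that it vanishes on \<open>x\<close>.\<close>

lemma dual_Cons:
  assumes us: "dual us f" and xR: "x \<in> carrier R" and x: "x \<notin> lspan k R us"
  obtains f' where "dual (x # us) f'"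
proof -
  have usR: "set us \<subseteq> carrier R" using us by (simp add: dual_def)
  obtain g where g: "lin k R g" "\<And>w. w \<in> lspan k R us \<Longrightarrow> g w = \<zero>\<^bsub>k\<^esub>" "g x = \<one>\<^bsub>k\<^esub>"
    using functional_ext[OF lspan_ksub[OF usR] xR x] by blast
    define f' where "f' i = (case i of 0 \<Rightarrow> g | Suc i \<Rightarrow> (\<lambda>y. f i y \<oplus>\<^bsub>k\<^esub> \<ominus>\<^bsub>k\<^esub> (f i x) \<otimes>\<^bsub>k\<^esub> g y))" for i
    have fi: "lin k R (f i)" if "i < length us" for i using us that by (simp add: dual_def)
    have "dual (x # us) f'" unfolding dual_def
    proof (intro conjI allI impI)
      show "set (x # us) \<subseteq> carrier R" using usR xR by simp
      fix i assume i: "i < length (x # us)"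
      show "lin k R (f' i)"
      proof (cases i)
        case 0
        then show ?thesis using g by (simp add: f'_def)
      next
        case (Suc m)
        have "lin k R (f m)" using fi Suc i by simp
        moreover have "\<ominus>\<^bsub>k\<^esub> (f m x) \<in> carrier k" using linD(1)[OF calculation xR] by simp
        ultimately show ?thesis using lin_comb g(1) Suc by (simp add: f'_def)
      qed
      fix j assume j: "j < length (x # us)"
      show "f' i ((x # us) ! j) = (if i = j then \<one>\<^bsub>k\<^esub> else \<zero>\<^bsub>k\<^esub>)"
      proof (cases i)
        case 0
        then show ?thesis using g j lspan_mem[OF usR] by (cases j) (auto simp: f'_def)
      next
        case (Suc m)
        note L = linD[OF fi[of m]]
        have fx: "f m x \<in> carrier k" using L Suc i xR by simp
        show ?thesis
        proof (cases j)
          case 0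
          then show ?thesis using Suc g fx by (simp add: f'_def k.r_neg)
        next
          case (Suc l)
          then have "g (us ! l) = \<zero>\<^bsub>k\<^esub>" using g j lspan_mem[OF usR] by auto
          then show ?thesis using Suc \<open>i = Suc m\<close> fx us i j by (auto simp: f'_def dual_def)
        qed
      qed
    qed
  then show thesis by (rule that)
qed

text \<open>An element of the larger span outside the smaller one would extend \<open>us\<close> to
  an independent family longer than a list that spans it.\<close>

lemma lspan_dual_eq:
  assumes us: "dual us f" "set us \<subseteq> lspan k R vs" and vs: "set vs \<subseteq> carrier R" "length vs \<le> length us"
  shows "lspan k R vs \<subseteq> lspan k R us"
proof
  fix x assume x: "x \<in> lspan k R vs"
  have xR: "x \<in> carrier R" using x lspan_closed[OF vs(1)] by blast
  show "x \<in> lspan k R us"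
  proof (rule ccontr)
    assume "x \<notin> lspan k R us"
    then obtain f' where "dual (x # us) f'" using dual_Cons[OF us(1) xR] by blast
    moreover have "set (x # us) \<subseteq> lspan k R vs" using x us by simp
    ultimately have "length (x # us) \<le> length vs" using length_dual_le vs by blast
    then show False using vs by simp
  qed
qed

text \<open>If an entry of \<open>vs\<close> lay in the span of the others, a list shorter than
  \<open>us\<close> would span the independent family \<open>us\<close>.\<close>

lemma spanning_dual:
  assumes us: "dual us f" "set us \<subseteq> lspan k R vs" and vs: "set vs \<subseteq> carrier R" "length vs \<le> length us"
  obtains g where "dual vs g"
proof (rule dual_exists[OF vs(1)])
  fix i assume i: "i < length vs"
  let ?o = "take i vs @ drop (Suc i) vs"
  have o: "set ?o \<subseteq> carrier R" using vs(1) by (auto dest: in_set_takeD in_set_dropD)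
  show "vs ! i \<notin> lspan k R ?o"
  proof
    assume a: "vs ! i \<in> lspan k R ?o"
    have "set vs = set (take i vs @ vs ! i # drop (Suc i) vs)" using i by (simp add: id_take_nth_drop[symmetric])
    then have "set vs \<subseteq> lspan k R ?o" using a lspan_mem[OF o] by auto
    then have "lspan k R vs \<subseteq> lspan k R ?o" by (rule lspan_mono[OF _ o])
    then have "length us \<le> length ?o" using length_dual_le[OF us(1) _ o] us(2) by blast
    then show False using i vs(2) by simp
  qed
qed (use that in blast)

end

section \<open>Tensor products\<close>

text \<open>The map \<open>b\<close> is a parameter because one list is evaluated in several ways:
  with pure tensors it is an element of a tensor product, and with the images of pure tensors it is
  the value of a homomorphism, for instance with the multiplication of \<open>R\<close> the image
  under \<open>R \<otimes> R \<rightarrow> R\<close>.\<close>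

definition tsum :: "('c, 'm) ring_scheme \<Rightarrow> ('a \<Rightarrow> 'b \<Rightarrow> 'c) \<Rightarrow> ('a \<times> 'b) list \<Rightarrow> 'c"
  where "tsum T b xs = lsum T (map (case_prod b) xs)"

lemma tsum_simps [simp]: "tsum T b [] = \<zero>\<^bsub>T\<^esub>"
  "tsum T b (x # xs) = b (fst x) (snd x) \<oplus>\<^bsub>T\<^esub> tsum T b xs"
  by (simp_all add: tsum_def case_prod_beta)

text \<open>A model \<open>T\<close> of \<open>R \<otimes> S\<close> with pure tensors \<open>b r s\<close>. This covers the quotient \<open>tensor\<close> as well as its
  copy \<open>tensor_ob\<close> inside the universe.\<close>

locale tensor_product = R: algebra_over k R + S: algebra_over k S + T: algebra_over k T
  for k :: "('k, 'm) ring_scheme" and R :: "('k, 'a) salg" and S :: "('k, 'b) salg" and T :: "('k, 'c) salg" +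
  fixes b :: "'a \<Rightarrow> 'b \<Rightarrow> 'c"
  assumes b_closed [simp]: "r \<in> carrier R \<Longrightarrow> s \<in> carrier S \<Longrightarrow> b r s \<in> carrier T"
    and b_add_left: "r \<in> carrier R \<Longrightarrow> r' \<in> carrier R \<Longrightarrow> s \<in> carrier S \<Longrightarrow>
      b (r \<oplus>\<^bsub>R\<^esub> r') s = b r s \<oplus>\<^bsub>T\<^esub> b r' s"
    and b_add_right: "r \<in> carrier R \<Longrightarrow> s \<in> carrier S \<Longrightarrow> s' \<in> carrier S \<Longrightarrow>
      b r (s \<oplus>\<^bsub>S\<^esub> s') = b r s \<oplus>\<^bsub>T\<^esub> b r s'"
    and b_smul: "c \<in> carrier k \<Longrightarrow> r \<in> carrier R \<Longrightarrow> s \<in> carrier S \<Longrightarrow> b (smul R c r) s = b r (smul S c s)"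
    and b_mult: "r \<in> carrier R \<Longrightarrow> r' \<in> carrier R \<Longrightarrow> s \<in> carrier S \<Longrightarrow> s' \<in> carrier S \<Longrightarrow>
      b r s \<otimes>\<^bsub>T\<^esub> b r' s' = b (r \<otimes>\<^bsub>R\<^esub> r') (s \<otimes>\<^bsub>S\<^esub> s')"
    and b_one [simp]: "b \<one>\<^bsub>R\<^esub> \<one>\<^bsub>S\<^esub> = \<one>\<^bsub>T\<^esub>"
    and b_str: "c \<in> carrier k \<Longrightarrow> str T c = b (str R c) \<one>\<^bsub>S\<^esub>"
    and b_generate: "t \<in> carrier T \<Longrightarrow> \<exists>xs \<in> lists (carrier R \<times> carrier S). t = tsum T b xs"
    and b_faithful: "xs \<in> lists (carrier R \<times> carrier S) \<Longrightarrow> ys \<in> lists (carrier R \<times> carrier S) \<Longrightarrow>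
      tsum T b xs = tsum T b ys \<Longrightarrow> tensor_eq k R (str R) S (str S) xs ys"

section \<open>The quotient of lists of pairs as a tensor product\<close>

definition prodl :: "('a, 'n) ring_scheme \<Rightarrow> ('b, 'p) ring_scheme \<Rightarrow> ('a \<times> 'b) list \<Rightarrow> ('a \<times> 'b) list \<Rightarrow> ('a \<times> 'b) list"
  where "prodl R S xs ys = [(r \<otimes>\<^bsub>R\<^esub> r', s \<otimes>\<^bsub>S\<^esub> s'). (r, s) \<leftarrow> xs, (r', s') \<leftarrow> ys]"

lemma prodl_Nil [simp]: "prodl R S [] ys = []"
  and prodl_Cons [simp]: "prodl R S (x # xs) ys =
    map (\<lambda>y. (fst x \<otimes>\<^bsub>R\<^esub> fst y, snd x \<otimes>\<^bsub>S\<^esub> snd y)) ys @ prodl R S xs ys"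
  by (simp_all add: prodl_def case_prod_beta)

lemma prodl_append: "prodl R S (xs @ xs') ys = prodl R S xs ys @ prodl R S xs' ys"
  by (induction xs) auto

locale tensor_construction = R: algebra_over k R + S: algebra_over k S
  for k :: "('k, 'm) ring_scheme" and R :: "('k, 'a) salg" and S :: "('k, 'b) salg"
begin

abbreviation "L \<equiv> lists (carrier R \<times> carrier S)"
abbreviation teq (infix "\<bowtie>" 50) where "teq \<equiv> tensor_eq k R (str R) S (str S)"
abbreviation "cl \<equiv> tensor_class k R (str R) S (str S)"
abbreviation "prd \<equiv> prodl R S"

lemma teq_lists: "xs \<bowtie> ys \<Longrightarrow> xs \<in> L \<and> ys \<in> L"
  by (rule tensor_eq_lists) (auto simp: R.R.is_cring S.R.is_cring)

lemma cl_eq: "xs \<in> L \<Longrightarrow> cl xs = cl ys \<longleftrightarrow> xs \<bowtie> ys"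
  by (rule tensor_eq_equiv) (auto simp: R.R.is_cring S.R.is_cring)

lemma cl_cong: "xs \<bowtie> ys \<Longrightarrow> cl xs = cl ys"
  using cl_eq teq_lists by blast

lemma teq_Cons: "x \<in> carrier R \<times> carrier S \<Longrightarrow> xs \<bowtie> ys \<Longrightarrow> x # xs \<bowtie> x # ys"
  using tensor_eq.append[OF tensor_eq.refl[of "[x]"], of R S k "str R" "str S" xs ys] by auto

text \<open>The rule \<open>commute\<close> exchanges whole blocks of a sum; moving one entry to the
  front at a time generates all permutations.\<close>

lemma teq_perm: "mset xs = mset ys \<Longrightarrow> xs \<in> L \<Longrightarrow> xs \<bowtie> ys"
proof (induction xs arbitrary: ys)
  case Nil
  then show ?case by (simp add: tensor_eq.refl)
next
  case (Cons x xs)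
  then have "x \<in> set ys" by (metis list.set_intros(1) set_mset_mset)
  then obtain ys1 ys2 where ys: "ys = ys1 @ x # ys2" by (meson split_list)
  have xsL: "xs \<in> L" "x \<in> carrier R \<times> carrier S" using Cons.prems(2) by auto
  have "mset (x # xs) = mset ys" by fact
  then have "set (x # xs) = set ys" by (metis set_mset_mset)
  then have ysL: "ys1 \<in> L" "ys2 \<in> L" using Cons.prems(2) ys by (auto simp: in_lists_conv_set)
  have "xs \<bowtie> ys1 @ ys2" using Cons ys xsL by simp
  then have "x # xs \<bowtie> x # ys1 @ ys2" using xsL teq_Cons by blast
  moreover have "([x] @ ys1) @ ys2 \<bowtie> (ys1 @ [x]) @ ys2"
    using xsL ysL by (intro tensor_eq.append tensor_eq.commute tensor_eq.refl) auto
  ultimately show ?case using ys tensor_eq.trans by fastforce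
qed

lemma prd_lists: "xs \<in> L \<Longrightarrow> ys \<in> L \<Longrightarrow> prd xs ys \<in> L"
  by (induction xs) (auto simp: in_lists_conv_set)

text \<open>\<open>prodl\<close> runs through the second list once for each entry of the first, so
  splitting off an entry of the second list rearranges the result. This is why products are compared
  as multisets.\<close>

lemma mset_prd_Cons:
  "mset (prd xs (y # ys)) = mset (map (\<lambda>x. (fst x \<otimes>\<^bsub>R\<^esub> fst y, snd x \<otimes>\<^bsub>S\<^esub> snd y)) xs @ prd xs ys)"
  by (induction xs) (auto simp: add_ac)

lemma mset_prd_Nil: "prd xs [] = []"
  by (induction xs) auto

lemma prd_commute: "xs \<in> L \<Longrightarrow> ys \<in> L \<Longrightarrow> mset (prd xs ys) = mset (prd ys xs)"
proof (induction xs)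
  case Nil
  then show ?case by (simp add: mset_prd_Nil)
next
  case (Cons x xs)
  have "mset (map (\<lambda>y. (fst x \<otimes>\<^bsub>R\<^esub> fst y, snd x \<otimes>\<^bsub>S\<^esub> snd y)) ys) =
    mset (map (\<lambda>y. (fst y \<otimes>\<^bsub>R\<^esub> fst x, snd y \<otimes>\<^bsub>S\<^esub> snd x)) ys)"
    using Cons.prems by (intro arg_cong[of _ _ mset] map_cong refl)
      (auto simp: in_lists_conv_set R.R.m_comm S.R.m_comm)
  then show ?case using Cons by (simp add: mset_prd_Cons del: mset_map)
qed

lemma teq_map_mult:
  assumes "xs \<bowtie> ys" "y \<in> carrier R \<times> carrier S"
  shows "map (\<lambda>x. (fst x \<otimes>\<^bsub>R\<^esub> fst y, snd x \<otimes>\<^bsub>S\<^esub> snd y)) xs \<bowtie>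
    map (\<lambda>x. (fst x \<otimes>\<^bsub>R\<^esub> fst y, snd x \<otimes>\<^bsub>S\<^esub> snd y)) ys"
proof -
  have L: "map (\<lambda>x. (fst x \<otimes>\<^bsub>R\<^esub> fst y, snd x \<otimes>\<^bsub>S\<^esub> snd y)) zs \<in> L" if "zs \<in> L" for zs
    using that assms(2) by (auto simp: in_lists_conv_set)
  have y: "fst y \<in> carrier R" "snd y \<in> carrier S" using assms(2) by auto
  show ?thesis
    using assms(1)
  proof induction
    case (refl xs)
    then show ?case using L by (blast intro: tensor_eq.refl)
  next
    case (sym xs ys)
    then show ?case by (blast intro: tensor_eq.sym)
  next
    case (trans xs ys zs)
    then show ?case by (blast intro: tensor_eq.trans)
  next
    case (append xs xs' ys ys')
    then show ?case by (simp add: tensor_eq.append)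
  next
    case (commute xs ys)
    then show ?case using L by (simp add: tensor_eq.commute)
  next
    case (zero s)
    then show ?case using y by (simp add: tensor_eq.zero)
  next
    case (add_left r r' s)
    then show ?case using y by (simp add: tensor_eq.add_left R.R.l_distr)
  next
    case (add_right r s s')
    then show ?case using y by (simp add: tensor_eq.add_right S.R.l_distr)
  next
    case (balanced c r s)
    then show ?case
      using y tensor_eq.balanced[of c k "r \<otimes>\<^bsub>R\<^esub> fst y" R "s \<otimes>\<^bsub>S\<^esub> snd y" S "str R" "str S"]
      by (simp add: R.R.m_assoc S.R.m_assoc)
  qed
qed

lemma prd_cong_left:
  assumes "xs \<bowtie> xs'" "ys \<in> L"
  shows "prd xs ys \<bowtie> prd xs' ys"
  using assms(2)
proof (induction ys)
  case Nil
  then show ?case by (simp add: mset_prd_Nil tensor_eq.refl)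
next
  case (Cons y ys)
  let ?f = "\<lambda>x. (fst x \<otimes>\<^bsub>R\<^esub> fst y, snd x \<otimes>\<^bsub>S\<^esub> snd y)"
  have L: "xs \<in> L" "xs' \<in> L" using teq_lists assms by auto
  have yL: "y \<in> carrier R \<times> carrier S" "ys \<in> L" "y # ys \<in> L" using Cons by auto
  have "prd xs (y # ys) \<bowtie> map ?f xs @ prd xs ys"
    by (rule teq_perm[OF mset_prd_Cons prd_lists[OF L(1) yL(3)]])
  moreover have "map ?f xs @ prd xs ys \<bowtie> map ?f xs' @ prd xs' ys"
    using Cons.IH yL teq_map_mult[OF assms(1) yL(1)] by (intro tensor_eq.append)
  moreover have "prd xs' (y # ys) \<bowtie> map ?f xs' @ prd xs' ys"
    by (rule teq_perm[OF mset_prd_Cons prd_lists[OF L(2) yL(3)]])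
  ultimately show ?case using tensor_eq.trans tensor_eq.sym by meson
qed

text \<open>Only the left factor is checked against the generating relations. The right factor
  follows because exchanging the factors permutes the entries of the product up to commutativity of
  \<open>R\<close> and \<open>S\<close>.\<close>

lemma prd_cong:
  assumes "xs \<bowtie> xs'" "ys \<bowtie> ys'"
  shows "prd xs ys \<bowtie> prd xs' ys'"
proof -
  have L: "xs \<in> L" "xs' \<in> L" "ys \<in> L" "ys' \<in> L" using teq_lists assms by auto
  have "prd xs ys \<bowtie> prd xs' ys" using prd_cong_left assms L by blast
  moreover have "prd xs' ys \<bowtie> prd ys xs'" using L by (intro teq_perm prd_commute prd_lists)
  moreover have "prd ys xs' \<bowtie> prd ys' xs'" using prd_cong_left assms L by blast
  moreover have "prd ys' xs' \<bowtie> prd xs' ys'" using L by (intro teq_perm prd_commute prd_lists)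
  ultimately show ?thesis using tensor_eq.trans by meson
qed

abbreviation "Q \<equiv> tensor k R S"

lemma tensor_carrier: "carrier Q = cl ` L"
  and tensor_one: "\<one>\<^bsub>Q\<^esub> = cl [(\<one>\<^bsub>R\<^esub>, \<one>\<^bsub>S\<^esub>)]"
  and tensor_zero: "\<zero>\<^bsub>Q\<^esub> = cl []"
  and tensor_str: "str Q c = cl [(str R c, \<one>\<^bsub>S\<^esub>)]"
  by (simp_all add: tensor_def tensor_ring_def Let_def)

text \<open>The operations of \<open>tensor_ring\<close> are unions over all representatives.
  Congruence makes all classes in such a union equal, so the union is the class computed from any
  one representative.\<close>

lemma UN_class:
  assumes "xs \<in> L" "ys \<in> L" "\<And>xs' ys'. xs \<bowtie> xs' \<Longrightarrow> ys \<bowtie> ys' \<Longrightarrow> f xs ys \<bowtie> f xs' ys'"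
  shows "(\<Union>xs' \<in> cl xs. \<Union>ys' \<in> cl ys. cl (f xs' ys')) = cl (f xs ys)"
proof -
  have "xs \<in> cl xs" "ys \<in> cl ys" using assms by (auto simp: tensor_class_def tensor_eq.refl)
  moreover have "cl (f xs' ys') = cl (f xs ys)" if "xs' \<in> cl xs" "ys' \<in> cl ys" for xs' ys'
    by (rule cl_cong[symmetric]) (use assms(3) that in \<open>auto simp: tensor_class_def\<close>)
  ultimately show ?thesis by blast
qed

lemma tensor_add: "xs \<in> L \<Longrightarrow> ys \<in> L \<Longrightarrow> cl xs \<oplus>\<^bsub>Q\<^esub> cl ys = cl (xs @ ys)"
  using UN_class[of xs ys "\<lambda>xs ys. xs @ ys"]
  by (simp add: tensor_def tensor_ring_def Let_def tensor_eq.append)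

lemma tensor_mult: "xs \<in> L \<Longrightarrow> ys \<in> L \<Longrightarrow> cl xs \<otimes>\<^bsub>Q\<^esub> cl ys = cl (prd xs ys)"
  using UN_class[of xs ys prd] prd_cong
  by (simp add: tensor_def tensor_ring_def Let_def prodl_def)

lemma cl_closed: "xs \<in> L \<Longrightarrow> cl xs \<in> carrier Q"
  by (simp add: tensor_carrier)

lemma prd_map:
  assumes "x \<in> carrier R \<times> carrier S" "ys \<in> L" "zs \<in> L"
  shows "prd (map (\<lambda>y. (fst x \<otimes>\<^bsub>R\<^esub> fst y, snd x \<otimes>\<^bsub>S\<^esub> snd y)) ys) zs =
    map (\<lambda>y. (fst x \<otimes>\<^bsub>R\<^esub> fst y, snd x \<otimes>\<^bsub>S\<^esub> snd y)) (prd ys zs)"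
  using assms(2) by (induction ys) (use assms in \<open>auto simp: in_lists_conv_set R.R.m_assoc S.R.m_assoc\<close>)

lemma prd_assoc:
  assumes "xs \<in> L" "ys \<in> L" "zs \<in> L"
  shows "prd (prd xs ys) zs = prd xs (prd ys zs)"
  using assms(1)
proof (induction xs)
  case (Cons x xs)
  then show ?case using prd_map[OF _ assms(2,3), of x] by (simp add: prodl_append)
qed simp

lemma prd_one: "xs \<in> L \<Longrightarrow> prd [(\<one>\<^bsub>R\<^esub>, \<one>\<^bsub>S\<^esub>)] xs = xs"
  by (auto simp: in_lists_conv_set intro!: map_idI)

lemma teq_uminus: "xs \<in> L \<Longrightarrow> map (\<lambda>x. (\<ominus>\<^bsub>R\<^esub> fst x, snd x)) xs @ xs \<bowtie> []"
proof (induction xs)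
  case Nil
  then show ?case by (simp add: tensor_eq.refl)
next
  case (Cons x xs)
  let ?n = "\<lambda>x. (\<ominus>\<^bsub>R\<^esub> fst x, snd x)"
  have x: "fst x \<in> carrier R" "snd x \<in> carrier S" "xs \<in> L" and nL: "map ?n xs \<in> L"
    using Cons by (auto simp: in_lists_conv_set)
  have "map ?n (x # xs) @ x # xs \<bowtie> [?n x, x] @ (map ?n xs @ xs)"
    using x nL by (intro teq_perm) (auto simp: mem_Times_iff)
  moreover have "[?n x, x] \<bowtie> []"
    using tensor_eq.add_left[of "\<ominus>\<^bsub>R\<^esub> fst x" R "fst x" "snd x" S k "str R" "str S"] x
      tensor_eq.zero[of "snd x" S k R "str R" "str S"]
    by (metis R.R.add.inv_closed R.R.l_neg tensor_eq.sym tensor_eq.trans prod.collapse)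
  then have "[?n x, x] @ (map ?n xs @ xs) \<bowtie> [] @ []"
    using Cons.IH x by (intro tensor_eq.append)
  ultimately show ?case using tensor_eq.trans by fastforce
qed

lemma tensor_cring: "cring Q"
proof (intro cringI abelian_groupI comm_monoidI)
  show "\<zero>\<^bsub>Q\<^esub> \<in> carrier Q" "\<one>\<^bsub>Q\<^esub> \<in> carrier Q"
    by (auto simp: tensor_zero tensor_one intro!: cl_closed)
next
  fix U assume "U \<in> carrier Q"
  then obtain xs where xs: "xs \<in> L" "U = cl xs" by (auto simp: tensor_carrier)
  have "map (\<lambda>x. (\<ominus>\<^bsub>R\<^esub> fst x, snd x)) xs \<in> L" using xs(1) by (auto simp: in_lists_conv_set)
  then show "\<exists>V \<in> carrier Q. V \<oplus>\<^bsub>Q\<^esub> U = \<zero>\<^bsub>Q\<^esub>"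
    using xs teq_uminus[OF xs(1)]
    by (intro bexI[of _ "cl (map (\<lambda>x. (\<ominus>\<^bsub>R\<^esub> fst x, snd x)) xs)"])
      (auto simp: tensor_add tensor_zero cl_closed intro!: cl_cong)
  show "\<zero>\<^bsub>Q\<^esub> \<oplus>\<^bsub>Q\<^esub> U = U" using xs by (simp add: tensor_zero tensor_add)
  have "[(\<one>\<^bsub>R\<^esub>, \<one>\<^bsub>S\<^esub>)] \<in> L" by simp
  then show "\<one>\<^bsub>Q\<^esub> \<otimes>\<^bsub>Q\<^esub> U = U"
    unfolding tensor_one xs(2) by (simp only: tensor_mult[OF _ xs(1)] prd_one[OF xs(1)])
next
  fix U V assume "U \<in> carrier Q" "V \<in> carrier Q"
  then obtain xs ys where xs: "xs \<in> L" "U = cl xs" and ys: "ys \<in> L" "V = cl ys" by (auto simp: tensor_carrier)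
  show "U \<oplus>\<^bsub>Q\<^esub> V \<in> carrier Q" using xs ys by (simp add: tensor_add cl_closed)
  show "U \<otimes>\<^bsub>Q\<^esub> V \<in> carrier Q" using xs ys by (simp add: tensor_mult cl_closed prd_lists)
  show "U \<oplus>\<^bsub>Q\<^esub> V = V \<oplus>\<^bsub>Q\<^esub> U"
    unfolding xs(2) ys(2) tensor_add[OF xs(1) ys(1)] tensor_add[OF ys(1) xs(1)]
    by (rule cl_cong[OF tensor_eq.commute[OF xs(1) ys(1)]])
  show "U \<otimes>\<^bsub>Q\<^esub> V = V \<otimes>\<^bsub>Q\<^esub> U"
    unfolding xs(2) ys(2) tensor_mult[OF xs(1) ys(1)] tensor_mult[OF ys(1) xs(1)]
    by (rule cl_cong[OF teq_perm[OF prd_commute[OF xs(1) ys(1)] prd_lists[OF xs(1) ys(1)]]])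
next
  fix U V W assume "U \<in> carrier Q" "V \<in> carrier Q" "W \<in> carrier Q"
  then obtain xs ys zs where xs: "xs \<in> L" "U = cl xs" and ys: "ys \<in> L" "V = cl ys" and zs: "zs \<in> L" "W = cl zs"
    by (auto simp: tensor_carrier)
  have LL: "us @ vs \<in> L" if "us \<in> L" "vs \<in> L" for us vs using that by simp
  show "U \<oplus>\<^bsub>Q\<^esub> V \<oplus>\<^bsub>Q\<^esub> W = U \<oplus>\<^bsub>Q\<^esub> (V \<oplus>\<^bsub>Q\<^esub> W)"
    unfolding xs(2) ys(2) zs(2) using xs(1) ys(1) zs(1) by (simp only: tensor_add LL append_assoc)
  show "U \<otimes>\<^bsub>Q\<^esub> V \<otimes>\<^bsub>Q\<^esub> W = U \<otimes>\<^bsub>Q\<^esub> (V \<otimes>\<^bsub>Q\<^esub> W)"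
    unfolding xs(2) ys(2) zs(2) using xs(1) ys(1) zs(1) by (simp only: tensor_mult prd_lists prd_assoc)
  show "(U \<oplus>\<^bsub>Q\<^esub> V) \<otimes>\<^bsub>Q\<^esub> W = U \<otimes>\<^bsub>Q\<^esub> W \<oplus>\<^bsub>Q\<^esub> V \<otimes>\<^bsub>Q\<^esub> W"
    unfolding xs(2) ys(2) zs(2) using xs(1) ys(1) zs(1)
    by (simp only: tensor_mult tensor_add LL prd_lists prodl_append)
qed

lemma cl_tsum: "xs \<in> L \<Longrightarrow> tsum Q (\<lambda>r s. cl [(r, s)]) xs = cl xs"
proof (induction xs)
  case Nil
  then show ?case by (simp add: tensor_zero)
next
  case (Cons x xs)
  have L: "[(fst x, snd x)] \<in> L" "xs \<in> L" using Cons by auto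
  show ?case using Cons.IH[OF L(2)] tensor_add[OF L] by simp
qed

theorem tensor_tensor_product: "tensor_product k R S Q (\<lambda>r s. cl [(r, s)])"
proof -
  interpret Q: cring Q by (rule tensor_cring)
  have Q: "algebra_over k Q"
  proof (unfold_locales, rule ring_hom_memI)
    fix c d assume c: "c \<in> carrier k" and d: "d \<in> carrier k"
    show "str Q c \<in> carrier Q" using c by (auto simp: tensor_str intro!: cl_closed)
    show "str Q (c \<otimes>\<^bsub>k\<^esub> d) = str Q c \<otimes>\<^bsub>Q\<^esub> str Q d"
      using c d by (simp add: tensor_str tensor_mult R.str_mult)
    show "str Q (c \<oplus>\<^bsub>k\<^esub> d) = str Q c \<oplus>\<^bsub>Q\<^esub> str Q d"
      using c d by (simp add: tensor_str tensor_add R.str_add cl_eq tensor_eq.add_left)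
  next
    show "str Q \<one>\<^bsub>k\<^esub> = \<one>\<^bsub>Q\<^esub>" by (simp add: tensor_str tensor_one)
  qed
  show ?thesis
  proof (intro tensor_product.intro tensor_product_axioms.intro R.algebra_over_axioms S.algebra_over_axioms Q)
    fix r r' s assume "r \<in> carrier R" "r' \<in> carrier R" "s \<in> carrier S"
    then show "cl [(r \<oplus>\<^bsub>R\<^esub> r', s)] = cl [(r, s)] \<oplus>\<^bsub>Q\<^esub> cl [(r', s)]"
      by (simp add: tensor_add cl_eq tensor_eq.add_left)
  next
    fix r s s' assume "r \<in> carrier R" "s \<in> carrier S" "s' \<in> carrier S"
    then show "cl [(r, s \<oplus>\<^bsub>S\<^esub> s')] = cl [(r, s)] \<oplus>\<^bsub>Q\<^esub> cl [(r, s')]"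
      by (simp add: tensor_add cl_eq tensor_eq.add_right)
  next
    fix t assume "t \<in> carrier Q"
    then show "\<exists>xs\<in>L. t = tsum Q (\<lambda>r s. cl [(r, s)]) xs"
      using cl_tsum by (auto simp: tensor_carrier)
  qed (auto simp: tensor_mult tensor_one tensor_str smul_def cl_eq cl_tsum tensor_eq.balanced intro!: cl_closed)
qed

end

lemma tensor_product_copy:
  fixes T :: "('k, 'c) salg" and e :: "'c \<Rightarrow> 'd"
  assumes "tensor_product k R S T b" and e: "inj_on e (carrier T)"
  shows "tensor_product k R S (copy_alg e T) (\<lambda>r s. e (b r s))"
proof -
  interpret tensor_product k R S T b by fact
  let ?C = "copy_alg e T"
  have iso: "e \<in> ring_iso T ?C" by (rule copy_alg_iso[OF T.R.ring_axioms e])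
  have C: "cring ?C"
    using T.R.ring_iso_imp_img_cring[OF iso] by (simp add: copy_alg_sel(3)[symmetric])
  then interpret C: cring ?C .
  have eh: "e \<in> ring_hom T ?C" using iso by (simp add: ring_iso_def)
  have CA: "algebra_over k ?C"
  proof unfold_locales
    have "str ?C = e \<circ> str T" by (auto simp: copy_alg_sel)
    then show "str ?C \<in> ring_hom k ?C" using ring_hom_trans[OF T.str_hom eh] by simp
  qed
  have ts: "tsum ?C (\<lambda>r s. e (b r s)) xs = e (tsum T b xs)" if "xs \<in> lists (carrier R \<times> carrier S)" for xs
  proof -
    have "set (map (case_prod b) xs) \<subseteq> carrier T" using that by (auto simp: in_lists_conv_set)
    from additive_lsum[OF T.R.abelian_group_axioms C.abelian_group_axioms ring_hom_additive[OF eh] this]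
    show ?thesis by (simp add: tsum_def comp_def case_prod_unfold)
  qed
  have tc: "tsum T b xs \<in> carrier T" if "xs \<in> lists (carrier R \<times> carrier S)" for xs
    unfolding tsum_def using that by (intro T.R.lsum_map_closed) (auto simp: in_lists_conv_set)
  show ?thesis
  proof (intro tensor_product.intro tensor_product_axioms.intro R.algebra_over_axioms S.algebra_over_axioms CA)
    fix t assume "t \<in> carrier ?C"
    then obtain u where "u \<in> carrier T" "t = e u" by (auto simp: copy_alg_sel)
    then show "\<exists>xs\<in>lists (carrier R \<times> carrier S). t = tsum ?C (\<lambda>r s. e (b r s)) xs"
      using b_generate[of u] ts by auto
  next
    fix xs ys assume "xs \<in> lists (carrier R \<times> carrier S)" "ys \<in> lists (carrier R \<times> carrier S)"
      "tsum ?C (\<lambda>r s. e (b r s)) xs = tsum ?C (\<lambda>r s. e (b r s)) ys"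
    then show "tensor_eq k R (str R) S (str S) xs ys"
      using b_faithful ts tc inj_onD[OF e] by metis
  qed (use e in \<open>auto simp: copy_alg_sel copy_alg_ops b_add_left b_add_right b_mult b_str b_smul\<close>)
qed

section \<open>The endomorphism \<sigma> of a tensor product\<close>

lemma sigma_alg_algebra_over: "cring k \<Longrightarrow> sigma_alg k R \<Longrightarrow> algebra_over k R"
  by (simp add: sigma_alg_def sigma_ring_def algebra_over_def algebra_over_axioms_def)

lemma sigma_alg_tensor:
  fixes R :: "('k, 'a) salg" and S :: "('k, 'b) salg"
  assumes k: "sigma_ring k" and R: "sigma_alg k R" and S: "sigma_alg k S"
  shows "sigma_alg k (tensor k R S)"
    and "r \<in> carrier R \<Longrightarrow> s \<in> carrier S \<Longrightarrow> sig (tensor k R S) (tensor_class k R (str R) S (str S) [(r, s)]) =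
      tensor_class k R (str R) S (str S) [(sig R r, sig S s)]"
proof -
  have ck: "cring k" using k by (simp add: sigma_ring_def)
  interpret tensor_construction k R S
    using sigma_alg_algebra_over[OF ck R] sigma_alg_algebra_over[OF ck S] by (simp add: tensor_construction_def)
  interpret Q: tensor_product k R S Q "\<lambda>r s. cl [(r, s)]" by (rule tensor_tensor_product)
  note sc = sig_tensor_class[OF k R S]
  show "r \<in> carrier R \<Longrightarrow> s \<in> carrier S \<Longrightarrow> sig Q (cl [(r, s)]) = cl [(sig R r, sig S s)]"
    using sc[of "[(r, s)]"] by simp
  let ?m = "map (map_prod (sig R) (sig S))"
  have sR: "sig R \<in> ring_hom R R" and sS: "sig S \<in> ring_hom S S"
    using R S by (auto simp: sigma_alg_def sigma_ring_def)
  have mL: "?m xs \<in> L" if "xs \<in> L" for xs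
    using that sR sS by (force simp: in_lists_conv_set ring_hom_def)
  have mp: "?m (prd xs ys) = prd (?m xs) (?m ys)" if "xs \<in> L" "ys \<in> L" for xs ys
    using that(1)
    by (induction xs) (use that(2) in \<open>auto simp: in_lists_conv_set ring_hom_mult[OF sR] ring_hom_mult[OF sS]\<close>)
  have "sig Q \<in> ring_hom Q Q"
  proof (rule ring_hom_memI)
    fix U V assume "U \<in> carrier Q" "V \<in> carrier Q"
    then obtain xs ys where xs: "xs \<in> L" "U = cl xs" and ys: "ys \<in> L" "V = cl ys" by (auto simp: tensor_carrier)
    show "sig Q U \<in> carrier Q" using xs mL by (simp only: sc cl_closed)
    have LL: "xs @ ys \<in> L" using xs(1) ys(1) by simp
    show "sig Q (U \<otimes>\<^bsub>Q\<^esub> V) = sig Q U \<otimes>\<^bsub>Q\<^esub> sig Q V"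
      unfolding xs(2) ys(2) using xs(1) ys(1) by (simp only: sc tensor_mult mL prd_lists mp)
    show "sig Q (U \<oplus>\<^bsub>Q\<^esub> V) = sig Q U \<oplus>\<^bsub>Q\<^esub> sig Q V"
      unfolding xs(2) ys(2) tensor_add[OF xs(1) ys(1)] sc[OF xs(1)] sc[OF ys(1)] sc[OF LL]
        tensor_add[OF mL[OF xs(1)] mL[OF ys(1)]] map_append ..
  next
    have "[(\<one>\<^bsub>R\<^esub>, \<one>\<^bsub>S\<^esub>)] \<in> L" by simp
    then have "sig Q \<one>\<^bsub>Q\<^esub> = cl (?m [(\<one>\<^bsub>R\<^esub>, \<one>\<^bsub>S\<^esub>)])" unfolding tensor_one by (rule sc)
    also have "?m [(\<one>\<^bsub>R\<^esub>, \<one>\<^bsub>S\<^esub>)] = [(\<one>\<^bsub>R\<^esub>, \<one>\<^bsub>S\<^esub>)]"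
      by (simp only: list.map map_prod_simp ring_hom_one[OF sR] ring_hom_one[OF sS])
    finally show "sig Q \<one>\<^bsub>Q\<^esub> = \<one>\<^bsub>Q\<^esub>" unfolding tensor_one .
  qed
  moreover have "str Q (sig k c) = sig Q (str Q c)" if "c \<in> carrier k" for c
  proof -
    have "[(str R c, \<one>\<^bsub>S\<^esub>)] \<in> L" using that by simp
    then have "sig Q (str Q c) = cl (?m [(str R c, \<one>\<^bsub>S\<^esub>)])" unfolding tensor_str by (rule sc)
    moreover have "str R (sig k c) = sig R (str R c)" using R that by (simp add: sigma_alg_def)
    ultimately show ?thesis by (simp only: tensor_str list.map map_prod_simp ring_hom_one[OF sS])
  qed
  ultimately show "sigma_alg k Q"
    using Q.T.str_hom by (simp add: sigma_alg_def sigma_ring_def tensor_cring)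
qed

lemma (in abelian_monoid) lsum_single:
  "set xs \<subseteq> carrier G \<Longrightarrow> i < length xs \<Longrightarrow> (\<And>j. j < length xs \<Longrightarrow> j \<noteq> i \<Longrightarrow> xs ! j = \<zero>) \<Longrightarrow> lsum G xs = xs ! i"
proof (induction xs arbitrary: i)
  case (Cons x xs)
  show ?case
  proof (cases i)
    case 0
    have "set xs \<subseteq> {\<zero>}"
      using Cons.prems(3)[of "Suc _"] 0 by (force simp: in_set_conv_nth)
    then show ?thesis using 0 Cons.prems lsum_zero by simp
  next
    case (Suc m)
    have "lsum G xs = xs ! m"
      using Cons.prems(1,2) Cons.prems(3)[of "Suc _"] Suc by (intro Cons.IH) auto
    moreover have "x = \<zero>" using Cons.prems(3)[of 0] Suc by simp
    moreover have "xs ! m \<in> carrier G" using Cons.prems Suc by (auto simp: subset_iff)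
    ultimately show ?thesis using Suc by simp
  qed
qed simp

text \<open>In contrast to \<open>dual\<close>, this form does not refer to functionals on the whole
  carrier. It is therefore insensitive to a change of carrier (\<open>indep_restrict\<close>), which
  is the key to embedding \<open>A \<otimes> B\<close> into \<open>R \<otimes> S\<close>.\<close>

definition indep :: "('k, 'm) ring_scheme \<Rightarrow> ('k, 'a, 'n) salg_scheme \<Rightarrow> 'a list \<Rightarrow> bool"
  where "indep k R us \<longleftrightarrow> (\<forall>i < length us. us ! i \<notin> lspan k R (take i us @ drop (Suc i) us))"

lemma smul_restrict [simp]: "smul (R\<lparr>carrier := A\<rparr>) = smul R"
  by (simp add: smul_def fun_eq_iff)

lemma lspan_restrict [simp]: "lspan k (R\<lparr>carrier := A\<rparr>) vs = lspan k R vs"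
  by (induction vs) auto

lemma indep_restrict [simp]: "indep k (R\<lparr>carrier := A\<rparr>) us = indep k R us"
  by (simp add: indep_def)

lemma lsum_restrict [simp]: "lsum (R\<lparr>carrier := A\<rparr>) xs = lsum R xs"
  by (induction xs) auto

lemma (in algebra_over_field) indep_dual:
  assumes "set us \<subseteq> carrier R" "indep k R us" obtains f where "dual us f"
  using dual_exists[OF assms(1)] assms(2) by (auto simp: indep_def)

lemma (in algebra_over) indep_nonzero: "set us \<subseteq> carrier R \<Longrightarrow> indep k R us \<Longrightarrow> \<zero>\<^bsub>R\<^esub> \<notin> set us"
proof
  assume us: "set us \<subseteq> carrier R" "indep k R us" "\<zero>\<^bsub>R\<^esub> \<in> set us"
  then obtain i where i: "i < length us" "us ! i = \<zero>\<^bsub>R\<^esub>" by (auto simp: in_set_conv_nth)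
  have "set (take i us @ drop (Suc i) us) \<subseteq> carrier R" using us(1) by (auto dest: in_set_takeD in_set_dropD)
  from ksubD(2)[OF lspan_ksub[OF this]] show False using us(2) i unfolding indep_def by auto
qed

section \<open>Universal property, contractions and reduced representations\<close>

definition balanced_map ::
  "('k, 'm) ring_scheme \<Rightarrow> ('k, 'a) salg \<Rightarrow> ('k, 'b) salg \<Rightarrow> ('c, 'q) ring_scheme \<Rightarrow> ('a \<Rightarrow> 'b \<Rightarrow> 'c) \<Rightarrow> bool"
  where "balanced_map k R S Q g \<longleftrightarrow>
    (\<forall>r \<in> carrier R. \<forall>s \<in> carrier S. g r s \<in> carrier Q) \<and>
    (\<forall>r \<in> carrier R. \<forall>r' \<in> carrier R. \<forall>s \<in> carrier S. g (r \<oplus>\<^bsub>R\<^esub> r') s = g r s \<oplus>\<^bsub>Q\<^esub> g r' s) \<and>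
    (\<forall>r \<in> carrier R. \<forall>s \<in> carrier S. \<forall>s' \<in> carrier S. g r (s \<oplus>\<^bsub>S\<^esub> s') = g r s \<oplus>\<^bsub>Q\<^esub> g r s') \<and>
    (\<forall>c \<in> carrier k. \<forall>r \<in> carrier R. \<forall>s \<in> carrier S. g (smul R c r) s = g r (smul S c s))"

lemma tensor_eq_tsum:
  assumes "tensor_eq k R (str R) S (str S) xs ys" and g: "balanced_map k R S Q g"
    and R: "algebra_over k R" and S: "algebra_over k S" and Q: "abelian_group Q"
  shows "tsum Q g xs = tsum Q g ys"
proof -
  interpret R: algebra_over k R by fact
  interpret S: algebra_over k S by fact
  interpret Q: abelian_group Q by fact
  have gc: "g r s \<in> carrier Q" if "r \<in> carrier R" "s \<in> carrier S" for r s
    using g that by (simp add: balanced_map_def)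
  have cl: "set (map (case_prod g) zs) \<subseteq> carrier Q" if "zs \<in> lists (carrier R \<times> carrier S)" for zs
    using that gc by (auto simp: in_lists_conv_set)
  have app: "tsum Q g (us @ vs) = tsum Q g us \<oplus>\<^bsub>Q\<^esub> tsum Q g vs"
    if "us \<in> lists (carrier R \<times> carrier S)" "vs \<in> lists (carrier R \<times> carrier S)" for us vs
    unfolding tsum_def map_append by (rule Q.lsum_append[OF cl[OF that(1)] cl[OF that(2)]])
  have tl: "us \<in> lists (carrier R \<times> carrier S) \<and> vs \<in> lists (carrier R \<times> carrier S)"
    if "tensor_eq k R (str R) S (str S) us vs" for us vs
    using tensor_eq_lists[OF that] R.R.is_cring S.R.is_cring by auto
  show ?thesis
    using assms(1)
  proof induction
    case (append xs xs' ys ys')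
    then show ?case using app tl by metis
  next
    case (commute xs ys)
    then show ?case using app Q.lsum_closed[OF cl] by (simp add: Q.a_comm tsum_def)
  next
    case (zero s)
    have "g \<zero>\<^bsub>R\<^esub> s \<oplus>\<^bsub>Q\<^esub> g \<zero>\<^bsub>R\<^esub> s = g (\<zero>\<^bsub>R\<^esub> \<oplus>\<^bsub>R\<^esub> \<zero>\<^bsub>R\<^esub>) s"
      using g zero R.R.zero_closed unfolding balanced_map_def by metis
    then show ?case using gc[OF R.R.zero_closed zero] by (simp add: Q.add.l_cancel_one)
  next
    case (add_left r r' s)
    then show ?case using g gc by (simp add: balanced_map_def Q.a_assoc)
  next
    case (add_right r s s')
    then show ?case using g gc by (simp add: balanced_map_def Q.a_assoc)
  next
    case (balanced c r s)
    then show ?case using g by (simp add: balanced_map_def smul_def)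
  qed auto
qed

lemma tensor_eq_swap:
  "tensor_eq k R i S j xs ys \<Longrightarrow> tensor_eq k S j R i (map prod.swap xs) (map prod.swap ys)"
  if "cring R" "cring S" "i \<in> carrier k \<rightarrow> carrier R" "j \<in> carrier k \<rightarrow> carrier S"
proof (induction rule: tensor_eq.induct)
  case (refl xs)
  then show ?case by (intro tensor_eq.refl) (auto simp: in_lists_conv_set)
next
  case (sym xs ys)
  then show ?case by (blast intro: tensor_eq.sym)
next
  case (trans xs ys zs)
  then show ?case by (blast intro: tensor_eq.trans)
next
  case (append xs xs' ys ys')
  then show ?case by (simp add: tensor_eq.append)
next
  case (commute xs ys)
  have "map prod.swap zs \<in> lists (carrier S \<times> carrier R)" if "zs \<in> lists (carrier R \<times> carrier S)" for zs
    using that by (auto simp: in_lists_conv_set)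
  then show ?case using commute by (simp add: tensor_eq.commute)
next
  \<comment> \<open>The rule \<open>zero\<close> only removes a vanishing left factor, whereas the
    exchanged relation has a vanishing right factor. By additivity on the right
    \<open>s \<otimes> 0\<close> is twice itself, and adding \<open>(-s) \<otimes> 0\<close> cancels
    one copy, since \<open>(s - s) \<otimes> 0\<close> falls under \<open>zero\<close>.\<close>
  case (zero s)
  interpret R: cring R by fact
  interpret S: cring S by fact
  let ?z = "(s, \<zero>\<^bsub>R\<^esub>)" and ?n = "(\<ominus>\<^bsub>S\<^esub> s, \<zero>\<^bsub>R\<^esub>)"
  have s: "\<ominus>\<^bsub>S\<^esub> s \<in> carrier S" using zero by simp
  have 1: "tensor_eq k S j R i [?z] [?z, ?z]"
    using tensor_eq.add_right[of s S "\<zero>\<^bsub>R\<^esub>" R "\<zero>\<^bsub>R\<^esub>" k j i] zero by simp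
  have 2: "tensor_eq k S j R i ([?z] @ [?n]) ([?z, ?z] @ [?n])"
    using 1 s by (intro tensor_eq.append tensor_eq.refl) auto
  have 3: "tensor_eq k S j R i ([?z] @ [?n]) []"
    using tensor_eq.trans[OF tensor_eq.sym[OF tensor_eq.add_left[of s S "\<ominus>\<^bsub>S\<^esub> s" "\<zero>\<^bsub>R\<^esub>" R k j i]]
        tensor_eq.zero[of "\<zero>\<^bsub>R\<^esub>" R k S j i, folded S.r_neg[OF zero]]] zero s by simp
  have 4: "tensor_eq k S j R i ([?z] @ ([?z] @ [?n])) ([?z] @ [])"
    using 3 zero by (intro tensor_eq.append tensor_eq.refl) auto
  have 5: "tensor_eq k S j R i ([?z, ?z] @ [?n]) [?z]" using 4 by simp
  show ?case using tensor_eq.trans[OF tensor_eq.sym[OF 5] tensor_eq.trans[OF tensor_eq.sym[OF 2] 3]] by simp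
next
  case (add_left r r' s)
  then show ?case by (simp add: tensor_eq.add_right)
next
  case (add_right r s s')
  then show ?case by (simp add: tensor_eq.add_left)
next
  case (balanced c r s)
  then show ?case by (auto intro: tensor_eq.sym tensor_eq.balanced)
qed

lemma tsum_swap: "tsum T (\<lambda>s r. b r s) (map prod.swap xs) = tsum T b xs"
  by (induction xs) auto

lemma swap_lists: "map prod.swap xs \<in> lists (B \<times> A) \<longleftrightarrow> xs \<in> lists (A \<times> B)"
  by (induction xs) auto

context tensor_product
begin

abbreviation "L \<equiv> lists (carrier R \<times> carrier S)"

lemma tsum_closed [simp]: "xs \<in> L \<Longrightarrow> tsum T b xs \<in> carrier T"
  unfolding tsum_def by (intro T.R.lsum_map_closed) (auto simp: in_lists_conv_set)

lemma tsum_append: "xs \<in> L \<Longrightarrow> ys \<in> L \<Longrightarrow> tsum T b (xs @ ys) = tsum T b xs \<oplus>\<^bsub>T\<^esub> tsum T b ys"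
  unfolding tsum_def map_append by (rule T.R.lsum_append) (auto simp: in_lists_conv_set)

lemma b_additive_left: "s \<in> carrier S \<Longrightarrow> additive R T (\<lambda>r. b r s)"
  by (simp add: additive_def b_add_left)

lemma b_additive_right: "r \<in> carrier R \<Longrightarrow> additive S T (b r)"
  by (simp add: additive_def b_add_right)

lemma b_zero [simp]: "s \<in> carrier S \<Longrightarrow> b \<zero>\<^bsub>R\<^esub> s = \<zero>\<^bsub>T\<^esub>" "r \<in> carrier R \<Longrightarrow> b r \<zero>\<^bsub>S\<^esub> = \<zero>\<^bsub>T\<^esub>"
  using additive_zero[OF R.R.abelian_group_axioms T.R.abelian_group_axioms b_additive_left]
    additive_zero[OF S.R.abelian_group_axioms T.R.abelian_group_axioms b_additive_right] by auto

lemma b_smul_left: "c \<in> carrier k \<Longrightarrow> r \<in> carrier R \<Longrightarrow> s \<in> carrier S \<Longrightarrow> b (smul R c r) s = smul T c (b r s)"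
  by (simp add: smul_def b_str b_mult)

lemma b_smul_right: "c \<in> carrier k \<Longrightarrow> r \<in> carrier R \<Longrightarrow> s \<in> carrier S \<Longrightarrow> b r (smul S c s) = smul T c (b r s)"
  using b_smul b_smul_left by simp

lemma b_str_right: "c \<in> carrier k \<Longrightarrow> str T c = b \<one>\<^bsub>R\<^esub> (str S c)"
  using b_smul[of c "\<one>\<^bsub>R\<^esub>" "\<one>\<^bsub>S\<^esub>"] by (simp add: smul_def b_str)

lemma tensor_induct [consumes 1, case_names zero add]:
  assumes "t \<in> carrier T" "P \<zero>\<^bsub>T\<^esub>"
    "\<And>r s t. r \<in> carrier R \<Longrightarrow> s \<in> carrier S \<Longrightarrow> t \<in> carrier T \<Longrightarrow> P t \<Longrightarrow> P (b r s \<oplus>\<^bsub>T\<^esub> t)"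
  shows "P t"
proof -
  have "P (tsum T b xs)" if "xs \<in> L" for xs
    using that by (induction xs) (use assms(2,3) in \<open>auto simp: mem_Times_iff\<close>)
  then show ?thesis using b_generate[OF assms(1)] by blast
qed

lemma additive_eq:
  assumes "abelian_group Q" "additive T Q f" "additive T Q g"
    "\<And>r s. r \<in> carrier R \<Longrightarrow> s \<in> carrier S \<Longrightarrow> f (b r s) = g (b r s)" "t \<in> carrier T"
  shows "f t = g t"
  using assms(5)
proof (induction rule: tensor_induct)
  case zero
  then show ?case using additive_zero[OF T.R.abelian_group_axioms assms(1)] assms(2,3) by metis
next
  case (add r s t)
  then show ?case using additiveD(2)[OF assms(2)] additiveD(2)[OF assms(3)] assms(4) by simp
qed

text \<open>The value is computed from a chosen representing list. Faithfulness of the model turns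
  equality of two sums into \<open>tensor_eq\<close>, and a balanced map respects the generating
  relations, so the choice does not matter.\<close>

lemma additive_lift:
  assumes Q: "abelian_group Q" and g: "balanced_map k R S Q g"
  obtains h where "additive T Q h" "\<And>r s. r \<in> carrier R \<Longrightarrow> s \<in> carrier S \<Longrightarrow> h (b r s) = g r s"
proof -
  interpret Q: abelian_group Q by fact
  define h where "h t = tsum Q g (SOME xs. xs \<in> L \<and> t = tsum T b xs)" for t
  have h: "h (tsum T b xs) = tsum Q g xs" if "xs \<in> L" for xs
  proof -
    let ?ys = "SOME ys. ys \<in> L \<and> tsum T b xs = tsum T b ys"
    have "?ys \<in> L \<and> tsum T b xs = tsum T b ?ys"
      by (rule someI[of "\<lambda>ys. ys \<in> L \<and> tsum T b xs = tsum T b ys" xs]) (use that in simp)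
    then have "tensor_eq k R (str R) S (str S) xs ?ys" using b_faithful[OF that] by blast
    from tensor_eq_tsum[OF this g R.algebra_over_axioms S.algebra_over_axioms Q]
    show ?thesis by (simp add: h_def)
  qed
  have gc: "g r s \<in> carrier Q" if "r \<in> carrier R" "s \<in> carrier S" for r s
    using g that by (simp add: balanced_map_def)
  have cl: "set (map (case_prod g) zs) \<subseteq> carrier Q" if "zs \<in> L" for zs
    using that gc by (auto simp: in_lists_conv_set)
  have "additive T Q h" unfolding additive_def
  proof (intro conjI ballI funcsetI)
    fix t assume "t \<in> carrier T"
    then obtain xs where xs: "xs \<in> L" "t = tsum T b xs" using b_generate by blast
    then show "h t \<in> carrier Q" using h Q.lsum_closed[OF cl] by (simp add: tsum_def)
    fix u assume "u \<in> carrier T"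
    then obtain ys where ys: "ys \<in> L" "u = tsum T b ys" using b_generate by blast
    have "xs @ ys \<in> L" using xs ys by simp
    then have "h (t \<oplus>\<^bsub>T\<^esub> u) = tsum Q g (xs @ ys)" using h[of "xs @ ys"] xs ys tsum_append by simp
    also have "\<dots> = tsum Q g xs \<oplus>\<^bsub>Q\<^esub> tsum Q g ys"
      unfolding tsum_def map_append by (rule Q.lsum_append[OF cl[OF xs(1)] cl[OF ys(1)]])
    finally show "h (t \<oplus>\<^bsub>T\<^esub> u) = h t \<oplus>\<^bsub>Q\<^esub> h u" using h xs ys by simp
  qed
  moreover have "h (b r s) = g r s" if "r \<in> carrier R" "s \<in> carrier S" for r s
    using h[of "[(r, s)]"] that gc by simp
  ultimately show ?thesis using that by blast
qed

lemma hom_lift: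
  assumes Q: "cring Q" and f: "f \<in> ring_hom R Q" and g: "g \<in> ring_hom S Q"
    and fg: "\<And>c. c \<in> carrier k \<Longrightarrow> f (str R c) = g (str S c)"
  obtains h where "h \<in> ring_hom T Q" "\<And>r s. r \<in> carrier R \<Longrightarrow> s \<in> carrier S \<Longrightarrow> h (b r s) = f r \<otimes>\<^bsub>Q\<^esub> g s"
proof -
  interpret Q: cring Q by fact
  note F = ring_hom_closed[OF f] ring_hom_add[OF f] ring_hom_mult[OF f] ring_hom_one[OF f]
  note G = ring_hom_closed[OF g] ring_hom_add[OF g] ring_hom_mult[OF g] ring_hom_one[OF g]
  have "balanced_map k R S Q (\<lambda>r s. f r \<otimes>\<^bsub>Q\<^esub> g s)"
    by (simp add: balanced_map_def F G fg smul_def Q.l_distr Q.r_distr Q.m_ac)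
  then obtain h where h: "additive T Q h" "\<And>r s. r \<in> carrier R \<Longrightarrow> s \<in> carrier S \<Longrightarrow> h (b r s) = f r \<otimes>\<^bsub>Q\<^esub> g s"
    using additive_lift[OF Q.abelian_group_axioms] by blast
  have h0: "h \<zero>\<^bsub>T\<^esub> = \<zero>\<^bsub>Q\<^esub>" by (rule additive_zero[OF T.R.abelian_group_axioms Q.abelian_group_axioms h(1)])
  note H = additiveD[OF h(1)]
  \<comment> \<open>Both sides of the multiplicativity law are biadditive, so the law is first
    proved for a pure left factor, by induction on the right one.\<close>
  have m1: "h (b r s \<otimes>\<^bsub>T\<^esub> u) = h (b r s) \<otimes>\<^bsub>Q\<^esub> h u" if rs: "r \<in> carrier R" "s \<in> carrier S" and "u \<in> carrier T" for r s u
    using that(3)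
  proof (induction rule: tensor_induct)
    case zero
    then show ?case using rs by (simp add: h0 H)
  next
    case (add r' s' t)
    then show ?case using rs by (simp add: T.R.r_distr H Q.r_distr b_mult h(2) F G Q.m_ac)
  qed
  have "h (t \<otimes>\<^bsub>T\<^esub> u) = h t \<otimes>\<^bsub>Q\<^esub> h u" if t: "t \<in> carrier T" and u: "u \<in> carrier T" for t u
    using t
  proof (induction rule: tensor_induct)
    case zero
    then show ?case using u by (simp add: h0 H)
  next
    case (add r s t)
    then show ?case using u by (simp add: T.R.l_distr H Q.l_distr m1)
  qed
  then have "h \<in> ring_hom T Q"
    using H h(2)[of "\<one>\<^bsub>R\<^esub>" "\<one>\<^bsub>S\<^esub>"] F(4) G(4) by (intro ring_hom_memI) auto
  then show ?thesis using that h(2) by blast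
qed

text \<open>All later notions are developed for one side only, contracting or shortening on the
  left. Interpreting the locale with exchanged factors gives their mirror images.\<close>

lemma swap: "tensor_product k S R T (\<lambda>s r. b r s)"
proof (intro tensor_product.intro tensor_product_axioms.intro R.algebra_over_axioms S.algebra_over_axioms T.algebra_over_axioms)
  fix t assume "t \<in> carrier T"
  then obtain xs where "xs \<in> L" "t = tsum T b xs" using b_generate by blast
  then show "\<exists>xs\<in>lists (carrier S \<times> carrier R). t = tsum T (\<lambda>s r. b r s) xs"
    by (intro bexI[of _ "map prod.swap xs"]) (auto simp: tsum_swap swap_lists)
next
  fix xs ys assume xs: "xs \<in> lists (carrier S \<times> carrier R)" and ys: "ys \<in> lists (carrier S \<times> carrier R)"
    and eq: "tsum T (\<lambda>s r. b r s) xs = tsum T (\<lambda>s r. b r s) ys"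
  have "tensor_eq k R (str R) S (str S) (map prod.swap xs) (map prod.swap ys)"
    using b_faithful[of "map prod.swap xs" "map prod.swap ys"] xs ys eq tsum_swap[of T "\<lambda>s r. b r s"]
    by (simp add: swap_lists)
  from tensor_eq_swap[OF _ _ _ _ this] R.R.is_cring S.R.is_cring
  have "tensor_eq k S (str S) R (str R) (map prod.swap (map prod.swap xs)) (map prod.swap (map prod.swap ys))" by simp
  moreover have "map prod.swap (map prod.swap zs) = zs" for zs :: "('b \<times> 'a) list" by (simp add: comp_def)
  ultimately show "tensor_eq k S (str S) R (str R) xs ys" by simp
qed (auto simp: b_add_left b_add_right b_mult b_smul b_str_right)

text \<open>This is the contraction \<open>f \<otimes> id\<close> from \<open>R \<otimes> S\<close>
  to \<open>k \<otimes> S = S\<close>. It is picked by description because the universal property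
  yields only its existence; the two conditions determine its values on the tensor product.\<close>

definition lslice :: "('a \<Rightarrow> 'k) \<Rightarrow> 'c \<Rightarrow> 'b" where
  "lslice f = (SOME h. additive T S h \<and> (\<forall>r \<in> carrier R. \<forall>s \<in> carrier S. h (b r s) = smul S (f r) s))"

context
  fixes f assumes f: "lin k R f"
begin

lemma lslice: "additive T S (lslice f)"
  and lslice_b [simp]: "r \<in> carrier R \<Longrightarrow> s \<in> carrier S \<Longrightarrow> lslice f (b r s) = smul S (f r) s"
proof -
  note F = linD[OF f]
  have "balanced_map k R S S (\<lambda>r s. smul S (f r) s)"
    by (simp add: balanced_map_def F S.add_smul S.smul_add S.smul_smul R.k.m_comm)
  then obtain h where "additive T S h" "\<And>r s. r \<in> carrier R \<Longrightarrow> s \<in> carrier S \<Longrightarrow> h (b r s) = smul S (f r) s"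
    using additive_lift[OF S.R.abelian_group_axioms] by blast
  then have "\<exists>h. additive T S h \<and> (\<forall>r \<in> carrier R. \<forall>s \<in> carrier S. h (b r s) = smul S (f r) s)" by blast
  from someI_ex[OF this] show "additive T S (lslice f)"
    "r \<in> carrier R \<Longrightarrow> s \<in> carrier S \<Longrightarrow> lslice f (b r s) = smul S (f r) s"
    unfolding lslice_def by blast+
qed

lemma lslice_closed [simp]: "t \<in> carrier T \<Longrightarrow> lslice f t \<in> carrier S"
  and lslice_add: "t \<in> carrier T \<Longrightarrow> u \<in> carrier T \<Longrightarrow> lslice f (t \<oplus>\<^bsub>T\<^esub> u) = lslice f t \<oplus>\<^bsub>S\<^esub> lslice f u"
  using additiveD[OF lslice] by auto

lemma lslice_zero [simp]: "lslice f \<zero>\<^bsub>T\<^esub> = \<zero>\<^bsub>S\<^esub>"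
  by (rule additive_zero[OF T.R.abelian_group_axioms S.R.abelian_group_axioms lslice])

lemma lslice_uminus: "t \<in> carrier T \<Longrightarrow> lslice f (\<ominus>\<^bsub>T\<^esub> t) = \<ominus>\<^bsub>S\<^esub> lslice f t"
  by (rule additive_minus[OF T.R.abelian_group_axioms S.R.abelian_group_axioms lslice])

text \<open>Contraction is linear over \<open>S\<close> acting through the right factor. It thereby
  turns an identity \<open>x (1 \<otimes> y) = z (1 \<otimes> y)\<close> in
  \<open>R \<otimes> S\<close> into identities between coefficients in \<open>S\<close>.\<close>

lemma lslice_mult:
  assumes t: "t \<in> carrier T" and s: "s \<in> carrier S"
  shows "lslice f (t \<otimes>\<^bsub>T\<^esub> b \<one>\<^bsub>R\<^esub> s) = lslice f t \<otimes>\<^bsub>S\<^esub> s"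
  using t
proof (induction rule: tensor_induct)
  case zero
  then show ?case using s by simp
next
  case (add r s' t)
  then show ?case using s linD(1)[OF f]
    by (simp add: T.R.l_distr S.R.l_distr lslice_add b_mult smul_def S.R.m_assoc)
qed

lemma lslice_tsum: "xs \<in> L \<Longrightarrow> lslice f (tsum T b xs) = lsum S (map (\<lambda>x. smul S (f (fst x)) (snd x)) xs)"
proof (induction xs)
  case (Cons x xs)
  then have "xs \<in> L" "fst x \<in> carrier R" "snd x \<in> carrier S" by auto
  then show ?case using Cons.IH by (simp add: lslice_add)
qed simp

lemma lslice_mem:
  assumes B: "ksub k S B" and xs: "xs \<in> lists (carrier R \<times> B)"
  shows "lslice f (tsum T b xs) \<in> B"
proof -
  have "xs \<in> L" using xs ksubD(1)[OF B] by (auto simp: in_lists_conv_set)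
  moreover have "lsum S (map (\<lambda>x. smul S (f (fst x)) (snd x)) xs) \<in> B"
    using xs ksubD(4)[OF B] linD(1)[OF f] by (intro ksub_lsum[OF B]) (auto simp: in_lists_conv_set)
  ultimately show ?thesis by (simp add: lslice_tsum)
qed

end

text \<open>A left component that depends on those of \<open>ws\<close> can be distributed over the
  entries of \<open>ws\<close>, one at a time: \<open>(c x + z) \<otimes> s + x \<otimes> y = x
  \<otimes> (c s + y) + z \<otimes> s\<close>. The number of entries stays the same, so that
  deleting a dependent entry and absorbing it shortens a representation.\<close>

lemma tsum_absorb:
  assumes "ws \<in> lists (A \<times> B)" "ksub k R A" "ksub k S B" "r \<in> lspan k R (map fst ws)" "s \<in> B"
  shows "\<exists>vs \<in> lists (A \<times> B). length vs = length ws \<and> tsum T b vs = b r s \<oplus>\<^bsub>T\<^esub> tsum T b ws"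
  using assms(1,4)
proof (induction ws arbitrary: r)
  case Nil
  then show ?case using ksubD(1)[OF assms(3,5)] by simp
next
  case (Cons w ws)
  obtain x y where w: "w = (x, y)" by (cases w)
  from Cons.prems w obtain c z where cz: "c \<in> carrier k" "z \<in> lspan k R (map fst ws)" "r = smul R c x \<oplus>\<^bsub>R\<^esub> z" by auto
  have xy: "x \<in> A" "y \<in> B" "x \<in> carrier R" "y \<in> carrier S" "s \<in> carrier S"
    using Cons.hyps w assms(5) ksubD(1)[OF assms(2)] ksubD(1)[OF assms(3)] by auto
  have wsL: "ws \<in> L" using Cons.hyps ksubD(1)[OF assms(2)] ksubD(1)[OF assms(3)] by (auto simp: in_lists_conv_set)
  then have "set (map fst ws) \<subseteq> carrier R" by (auto simp: in_lists_conv_set)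
  from ksubD(1)[OF R.lspan_ksub[OF this]] cz have z: "z \<in> carrier R" by blast
  obtain vs where vs: "vs \<in> lists (A \<times> B)" "length vs = length ws" "tsum T b vs = b z s \<oplus>\<^bsub>T\<^esub> tsum T b ws"
    using Cons.IH[OF cz(2)] by blast
  have "smul S c s \<oplus>\<^bsub>S\<^esub> y \<in> B" using ksubD(3,4)[OF assms(3)] cz xy assms(5) by blast
  moreover have "b x (smul S c s \<oplus>\<^bsub>S\<^esub> y) \<oplus>\<^bsub>T\<^esub> (b z s \<oplus>\<^bsub>T\<^esub> tsum T b ws) = b r s \<oplus>\<^bsub>T\<^esub> (b x y \<oplus>\<^bsub>T\<^esub> tsum T b ws)"
    using cz xy z wsL by (simp add: b_add_left b_add_right b_smul T.R.a_ac)
  ultimately show ?case using vs xy w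
    by (intro bexI[of _ "(x, smul S c s \<oplus>\<^bsub>S\<^esub> y) # vs"]) auto
qed

lemma tsum_shorten:
  assumes xs: "xs \<in> lists (A \<times> B)" and A: "ksub k R A" and B: "ksub k S B" and "\<not> indep k R (map fst xs)"
  shows "\<exists>vs \<in> lists (A \<times> B). length vs < length xs \<and> tsum T b vs = tsum T b xs"
proof -
  from assms(4) obtain i where i: "i < length xs"
    "fst (xs ! i) \<in> lspan k R (map fst (take i xs @ drop (Suc i) xs))"
    by (auto simp: indep_def take_map drop_map)
  let ?w = "take i xs @ drop (Suc i) xs"
  have w: "?w \<in> lists (A \<times> B)" using xs by (auto simp: in_lists_conv_set dest: in_set_takeD in_set_dropD)
  have xi: "xs ! i \<in> A \<times> B" using xs i nth_mem by (fastforce simp: in_lists_conv_set)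
  obtain vs where vs: "vs \<in> lists (A \<times> B)" "length vs = length ?w"
    "tsum T b vs = b (fst (xs ! i)) (snd (xs ! i)) \<oplus>\<^bsub>T\<^esub> tsum T b ?w"
    using tsum_absorb[OF w A B i(2), of "snd (xs ! i)"] xi by (metis mem_Times_iff)
  have L: "take i xs \<in> L" "drop (Suc i) xs \<in> L" "xs ! i \<in> carrier R \<times> carrier S"
    using w xi ksubD(1)[OF A] ksubD(1)[OF B] by (auto simp: in_lists_conv_set)
  have "tsum T b xs = tsum T b (take i xs @ xs ! i # drop (Suc i) xs)" using i by (simp add: id_take_nth_drop[symmetric])
  also have "\<dots> = tsum T b vs"
    using L vs(3) tsum_closed[OF L(1)] tsum_closed[OF L(2)]
    by (simp add: tsum_append mem_Times_iff T.R.a_ac)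
  finally show ?thesis using vs i by (intro bexI[of _ vs]) auto
qed

text \<open>Every dependence among the left components, or after exchanging the factors among the
  right ones, permits a shorter representation; induction on the length ends with both families
  independent. The entries never leave \<open>A\<close> and \<open>B\<close>, so reduced
  representations exist relative to subspaces.\<close>

lemma tsum_reduce:
  assumes "xs \<in> lists (A \<times> B)" and A: "ksub k R A" and B: "ksub k S B"
  shows "\<exists>vs \<in> lists (A \<times> B). tsum T b vs = tsum T b xs \<and> indep k R (map fst vs) \<and> indep k S (map snd vs)"
  using assms(1)
proof (induction "length xs" arbitrary: xs rule: less_induct)
  case less
  show ?case
  proof (cases "indep k R (map fst xs)")
    case False
    then show ?thesis using tsum_shorten[OF less.prems A B] less.hyps by metis
  next
    case 1: True
    show ?thesis
    proof (cases "indep k S (map snd xs)")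
      case True
      then show ?thesis using 1 less.prems by blast
    next
      case False
      interpret sw: tensor_product k S R T "\<lambda>s r. b r s" by (rule swap)
      have "\<not> indep k S (map fst (map prod.swap xs))" using False by (simp add: comp_def)
      from sw.tsum_shorten[OF _ B A this] obtain vs where "vs \<in> lists (B \<times> A)" "length vs < length xs"
        "tsum T (\<lambda>s r. b r s) vs = tsum T b xs"
        using less.prems by (auto simp: swap_lists tsum_swap)
      then have "map prod.swap vs \<in> lists (A \<times> B)" "length (map prod.swap vs) < length xs"
        "tsum T b (map prod.swap vs) = tsum T b xs"
        using tsum_swap[of T "\<lambda>s r. b r s" vs] by (auto simp: swap_lists)
      then show ?thesis using less.hyps by metis
    qed
  qed
qed

text \<open>The image of \<open>A \<otimes> B\<close> in \<open>R \<otimes> S\<close>, which makes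
  it possible to intersect and compare such tensor products as sets inside one ring.\<close>

definition tsub :: "'a set \<Rightarrow> 'b set \<Rightarrow> 'c set" where
  "tsub A B = tsum T b ` lists (A \<times> B)"

lemma tsub_carrier: "tsub (carrier R) (carrier S) = carrier T"
  unfolding tsub_def using b_generate tsum_closed by blast

lemma tsub_swap: "tensor_product.tsub T (\<lambda>s r. b r s) B A = tsub A B"
proof -
  interpret sw: tensor_product k S R T "\<lambda>s r. b r s" by (rule swap)
  show ?thesis
  proof safe
    fix t assume "t \<in> sw.tsub B A"
    then obtain xs where "xs \<in> lists (B \<times> A)" "t = tsum T (\<lambda>s r. b r s) xs" by (auto simp: sw.tsub_def)
    then show "t \<in> tsub A B" unfolding tsub_def using tsum_swap[of T "\<lambda>s r. b r s" xs]
      by (intro image_eqI[of _ _ "map prod.swap xs"]) (auto simp: swap_lists)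
  next
    fix t assume "t \<in> tsub A B"
    then obtain xs where "xs \<in> lists (A \<times> B)" "t = tsum T b xs" by (auto simp: tsub_def)
    then show "t \<in> sw.tsub B A" unfolding sw.tsub_def
      by (intro image_eqI[of _ _ "map prod.swap xs"]) (auto simp: swap_lists tsum_swap)
  qed
qed

lemma tsub_reduced:
  assumes "t \<in> tsub A B" "ksub k R A" "ksub k S B"
  obtains xs where "xs \<in> lists (A \<times> B)" "t = tsum T b xs" "indep k R (map fst xs)" "indep k S (map snd xs)"
proof -
  obtain ys where "ys \<in> lists (A \<times> B)" "t = tsum T b ys" using assms(1) by (auto simp: tsub_def)
  then show thesis using tsum_reduce[OF _ assms(2,3)] that by metis
qed

end

locale tensor_product_field = tensor_product k R S T b + R: algebra_over_field k R + S: algebra_over_field k S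
  for k :: "('k, 'm) ring_scheme" and R :: "('k, 'a) salg" and S :: "('k, 'b) salg" and T :: "('k, 'c) salg" and b
begin

lemma swap_field: "tensor_product_field k S R T (\<lambda>s r. b r s)"
  by (intro tensor_product_field.intro swap R.algebra_over_field_axioms S.algebra_over_field_axioms)

lemma lslice_nth:
  assumes "xs \<in> L" "R.dual (map fst xs) f" "i < length xs"
  shows "lslice (f i) (tsum T b xs) = snd (xs ! i)"
proof -
  have fi: "lin k R (f i)" using assms(2,3) by (simp add: R.dual_def)
  have d: "f i (fst (xs ! j)) = (if i = j then \<one>\<^bsub>k\<^esub> else \<zero>\<^bsub>k\<^esub>)" if "j < length xs" for j
    using assms(2,3) that by (simp add: R.dual_def)
  have c: "fst (xs ! j) \<in> carrier R \<and> snd (xs ! j) \<in> carrier S" if "j < length xs" for j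
    using assms(1) nth_mem[OF that] by (auto simp: in_lists_conv_set)
  have "lsum S (map (\<lambda>x. smul S (f i (fst x)) (snd x)) xs) = map (\<lambda>x. smul S (f i (fst x)) (snd x)) xs ! i"
    using assms d c linD(1)[OF fi]
    by (intro S.R.lsum_single) (auto simp: in_set_conv_nth)
  then show ?thesis using assms d c by (simp add: lslice_tsum[OF fi])
qed

text \<open>Contracting with the coordinate functional of the first left component would leave a
  right component equal to zero, against independence.\<close>

lemma tsum_indep_zero:
  assumes "xs \<in> L" "indep k R (map fst xs)" "indep k S (map snd xs)" "tsum T b xs = \<zero>\<^bsub>T\<^esub>"
  shows "xs = []"
proof (rule ccontr)
  assume ne: "xs \<noteq> []"
  have sR: "set (map fst xs) \<subseteq> carrier R" and sS: "set (map snd xs) \<subseteq> carrier S"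
    using assms(1) by (auto simp: in_lists_conv_set)
  obtain f where f: "R.dual (map fst xs) f" using R.indep_dual[OF sR assms(2)] .
  have f0: "lin k R (f 0)" using f ne by (simp add: R.dual_def)
  have "snd (xs ! 0) = \<zero>\<^bsub>S\<^esub>" using lslice_nth[OF assms(1) f, of 0] ne assms(4) lslice_zero[OF f0] by simp
  then have "\<zero>\<^bsub>S\<^esub> \<in> set (map snd xs)" using ne by (metis length_greater_0_conv image_eqI list.set_map nth_mem)
  then show False using S.indep_nonzero[OF sS assms(3)] by blast
qed

lemma zero_if_slices_zero:
  assumes t: "t \<in> carrier T" and z: "\<And>f. lin k R f \<Longrightarrow> lslice f t = \<zero>\<^bsub>S\<^esub>"
  shows "t = \<zero>\<^bsub>T\<^esub>"
proof -
  obtain xs where xs: "xs \<in> L" "t = tsum T b xs" "indep k R (map fst xs)" "indep k S (map snd xs)"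
    using tsub_reduced[of t "carrier R" "carrier S"] t R.ksub_carrier S.ksub_carrier by (auto simp: tsub_carrier)
  have sR: "set (map fst xs) \<subseteq> carrier R" and sS: "set (map snd xs) \<subseteq> carrier S"
    using xs(1) by (auto simp: in_lists_conv_set)
  obtain f where f: "R.dual (map fst xs) f" using R.indep_dual[OF sR xs(3)] .
  have "xs = []"
  proof (rule ccontr)
    assume ne: "xs \<noteq> []"
    have "lin k R (f 0)" using f ne by (simp add: R.dual_def)
    then have "snd (xs ! 0) = \<zero>\<^bsub>S\<^esub>" using lslice_nth[OF xs(1) f, of 0] ne xs(2) z by simp
    then have "\<zero>\<^bsub>S\<^esub> \<in> set (map snd xs)" using ne by (metis length_greater_0_conv image_eqI list.set_map nth_mem)
    then show False using S.indep_nonzero[OF sS xs(4)] by blast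
  qed
  then show ?thesis using xs by simp
qed

text \<open>Take a representation over \<open>A\<close> with independent left components.
  Contraction with their coordinate functionals shows that the right components are themselves
  slices of \<open>t\<close>, hence elements of \<open>B\<close>.\<close>

lemma tsub_slices:
  assumes A: "ksub k R A" and B: "ksub k S B" and t: "t \<in> tsub A (carrier S)"
    and sl: "\<And>f. lin k R f \<Longrightarrow> lslice f t \<in> B"
  shows "t \<in> tsub A B"
proof -
  obtain xs where xs: "xs \<in> lists (A \<times> carrier S)" "t = tsum T b xs" "indep k R (map fst xs)" "indep k S (map snd xs)"
    using tsub_reduced[OF t A S.ksub_carrier] .
  have xL: "xs \<in> L" using xs(1) ksubD(1)[OF A] by (auto simp: in_lists_conv_set)
  then have "set (map fst xs) \<subseteq> carrier R" by (auto simp: in_lists_conv_set)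
  then obtain f where f: "R.dual (map fst xs) f" using R.indep_dual xs(3) by blast
  have "snd (xs ! i) \<in> B" if "i < length xs" for i
    using lslice_nth[OF xL f that] sl[of "f i"] f that xs(2) by (simp add: R.dual_def)
  then have "xs \<in> lists (A \<times> B)" using xs(1) by (force simp: in_lists_conv_set in_set_conv_nth)
  then show ?thesis using xs(2) by (simp add: tsub_def)
qed

text \<open>Slices of an element of \<open>R \<otimes> B\<close> lie in \<open>B\<close>, so
  \<open>tsub_slices\<close> applies to it as an element of \<open>A \<otimes> S\<close>.\<close>

lemma tsub_inter:
  assumes A: "ksub k R A" and B: "ksub k S B" and t: "t \<in> tsub A (carrier S)" "t \<in> tsub (carrier R) B"
  shows "t \<in> tsub A B"
  using tsub_slices[OF A B t(1)] lslice_mem[OF _ B] t(2) by (auto simp: tsub_def)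

end

section \<open>Subalgebras and the embedding of their tensor products\<close>

definition ksubalg :: "('k, 'm) ring_scheme \<Rightarrow> ('k, 'a, 'n) salg_scheme \<Rightarrow> 'a set \<Rightarrow> bool"
  where "ksubalg k R A \<longleftrightarrow> subcring A R \<and> str R ` carrier k \<subseteq> A"

lemma ksubalgD:
  assumes "ksubalg k R A"
  shows "x \<in> A \<Longrightarrow> x \<in> carrier R" "\<zero>\<^bsub>R\<^esub> \<in> A" "\<one>\<^bsub>R\<^esub> \<in> A" "x \<in> A \<Longrightarrow> \<ominus>\<^bsub>R\<^esub> x \<in> A"
    "x \<in> A \<Longrightarrow> y \<in> A \<Longrightarrow> x \<oplus>\<^bsub>R\<^esub> y \<in> A" "x \<in> A \<Longrightarrow> y \<in> A \<Longrightarrow> x \<otimes>\<^bsub>R\<^esub> y \<in> A"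
    "c \<in> carrier k \<Longrightarrow> str R c \<in> A"
  using assms subcringE[of A R] by (auto simp: ksubalg_def)

lemma ksubalg_ksub: "ksubalg k R A \<Longrightarrow> ksub k R A"
  using ksubalgD[of k R A] by (auto simp: ksub_def smul_def)

context algebra_over
begin

lemma ksubalg_carrier: "ksubalg k R (carrier R)"
  using R.carrier_is_subcring by (auto simp: ksubalg_def)

lemma ksubalgI:
  assumes "ksub k R A" "\<one>\<^bsub>R\<^esub> \<in> A" "\<And>x y. x \<in> A \<Longrightarrow> y \<in> A \<Longrightarrow> x \<otimes>\<^bsub>R\<^esub> y \<in> A"
  shows "ksubalg k R A"
proof -
  have A: "A \<subseteq> carrier R" using ksubD(1)[OF assms(1)] by blast
  have "subring A R"
    by (rule R.subringI[OF A assms(2)]) (use ksub_uminus[OF assms(1)] ksubD(3)[OF assms(1)] assms(3) in auto)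
  moreover have "str R c \<in> A" if "c \<in> carrier k" for c
    using ksubD(4)[OF assms(1) that assms(2)] that by (simp add: smul_def)
  ultimately show ?thesis using R.subcringI' by (auto simp: ksubalg_def)
qed

lemma ksubalg_algebra_over: "ksubalg k R A \<Longrightarrow> algebra_over k (R\<lparr>carrier := A\<rparr>)"
proof -
  assume A: "ksubalg k R A"
  have "cring (R\<lparr>carrier := A\<rparr>)" using A R.subcring_iff[of A] ksubalgD(1)[OF A] by (auto simp: ksubalg_def)
  moreover have "str R \<in> ring_hom k (R\<lparr>carrier := A\<rparr>)"
    using str_hom ksubalgD(7)[OF A] by (auto simp: ring_hom_def)
  ultimately show ?thesis
    using k.is_cring by (simp add: algebra_over_def algebra_over_axioms_def)
qed

lemma ksubalg_str: "ksubalg k R (str R ` carrier k)"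
proof (rule ksubalgI)
  show "ksub k R (str R ` carrier k)" unfolding ksub_def
  proof (intro conjI ballI)
    show "\<zero>\<^bsub>R\<^esub> \<in> str R ` carrier k" by (rule image_eqI[of _ _ "\<zero>\<^bsub>k\<^esub>"]) auto
  qed (auto simp: smul_def str_add[symmetric] str_mult[symmetric])
  show "\<one>\<^bsub>R\<^esub> \<in> str R ` carrier k" by (rule image_eqI[of _ _ "\<one>\<^bsub>k\<^esub>"]) auto
qed (auto simp: str_mult[symmetric])

end

lemma (in tensor_construction) tensor_field:
  "field k \<Longrightarrow> tensor_product_field k R S (tensor k R S) (\<lambda>r s. cl [(r, s)])"
  using tensor_tensor_product R.algebra_over_axioms S.algebra_over_axioms
  by (simp add: tensor_product_field_def algebra_over_field_def)

context tensor_product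
begin

lemma b_hom_left: "(\<lambda>r. b r \<one>\<^bsub>S\<^esub>) \<in> ring_hom R T"
  by (rule ring_hom_memI) (auto simp: b_add_left b_mult)

lemma b_hom_right: "(\<lambda>s. b \<one>\<^bsub>R\<^esub> s) \<in> ring_hom S T"
  by (rule ring_hom_memI) (auto simp: b_add_right b_mult)

lemma b_split: "r \<in> carrier R \<Longrightarrow> s \<in> carrier S \<Longrightarrow> b r s = b r \<one>\<^bsub>S\<^esub> \<otimes>\<^bsub>T\<^esub> b \<one>\<^bsub>R\<^esub> s"
  by (simp add: b_mult)

lemma hom_eq:
  assumes "cring Q" "f \<in> ring_hom T Q" "g \<in> ring_hom T Q"
    "\<And>r s. r \<in> carrier R \<Longrightarrow> s \<in> carrier S \<Longrightarrow> f (b r s) = g (b r s)" "t \<in> carrier T"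
  shows "f t = g t"
proof -
  interpret Q: cring Q by fact
  show ?thesis
    by (rule additive_eq[OF Q.abelian_group_axioms ring_hom_additive[OF assms(2)] ring_hom_additive[OF assms(3)] assms(4,5)])
qed

lemma tsum_mult:
  "xs \<in> L \<Longrightarrow> a \<in> carrier R \<Longrightarrow> c \<in> carrier S \<Longrightarrow>
    b a c \<otimes>\<^bsub>T\<^esub> tsum T b xs = tsum T b (map (\<lambda>(u, v). (a \<otimes>\<^bsub>R\<^esub> u, c \<otimes>\<^bsub>S\<^esub> v)) xs)"
proof (induction xs)
  case (Cons x xs)
  then have "xs \<in> L" "fst x \<in> carrier R" "snd x \<in> carrier S" by auto
  then show ?case using Cons by (simp add: T.R.r_distr b_mult case_prod_unfold)
qed simp

lemma tensor_eq_iff: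
  assumes "xs \<in> L" "ys \<in> L"
  shows "tensor_eq k R (str R) S (str S) xs ys \<longleftrightarrow> tsum T b xs = tsum T b ys"
proof
  assume "tensor_eq k R (str R) S (str S) xs ys"
  moreover have "balanced_map k R S T b"
    by (simp add: balanced_map_def b_add_left b_add_right b_smul)
  ultimately show "tsum T b xs = tsum T b ys"
    using tensor_eq_tsum R.algebra_over_axioms S.algebra_over_axioms T.R.abelian_group_axioms by blast
qed (rule b_faithful[OF assms])

lemma hom_tsum:
  assumes "cring Q" "h \<in> ring_hom T Q" "xs \<in> L" "\<And>r s. r \<in> carrier R \<Longrightarrow> s \<in> carrier S \<Longrightarrow> h (b r s) = g r s"
  shows "h (tsum T b xs) = tsum Q g xs"
proof -
  interpret Q: cring Q by fact
  have "h (tsum T b xs) = lsum Q (map h (map (case_prod b) xs))"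
    unfolding tsum_def using assms(3)
    by (intro additive_lsum[OF T.R.abelian_group_axioms Q.abelian_group_axioms ring_hom_additive[OF assms(2)]])
      (auto simp: in_lists_conv_set)
  also have "map h (map (case_prod b) xs) = map (case_prod g) xs"
    using assms(3,4) by (auto simp: in_lists_conv_set)
  finally show ?thesis by (simp add: tsum_def)
qed

end

text \<open>Over a field \<open>A \<otimes> B\<close> embeds into \<open>R \<otimes> S\<close>. A
  reduced representation over \<open>A\<close> and \<open>B\<close> of the difference of the two
  tensors remains reduced over \<open>R\<close> and \<open>S\<close>, because independence does not
  see the ambient carrier, and a reduced representation of zero is empty.\<close>

lemma (in tensor_product_field) tensor_eq_restrict:
  assumes A: "ksubalg k R A" and B: "ksubalg k S B" and xs: "xs \<in> lists (A \<times> B)" and ys: "ys \<in> lists (A \<times> B)"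
    and eq: "tsum T b xs = tsum T b ys"
  shows "tensor_eq k (R\<lparr>carrier := A\<rparr>) (str R) (S\<lparr>carrier := B\<rparr>) (str S) xs ys"
proof -
  let ?R = "R\<lparr>carrier := A\<rparr>" and ?S = "S\<lparr>carrier := B\<rparr>"
  interpret RA: algebra_over k ?R by (rule R.ksubalg_algebra_over[OF A])
  interpret SB: algebra_over k ?S by (rule S.ksubalg_algebra_over[OF B])
  interpret TC: tensor_construction k ?R ?S ..
  interpret Q: tensor_product_field k ?R ?S "tensor k ?R ?S" "\<lambda>r s. TC.cl [(r, s)]"
    by (rule TC.tensor_field) (rule R.k.field_axioms)
  have AB: "a \<in> A \<Longrightarrow> a \<in> carrier R" "c \<in> B \<Longrightarrow> c \<in> carrier S" for a c using ksubalgD(1)[OF A] ksubalgD(1)[OF B] by auto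
  have f: "(\<lambda>r. b r \<one>\<^bsub>S\<^esub>) \<in> ring_hom ?R T" using b_hom_left AB by (auto simp: ring_hom_def)
  have g: "(\<lambda>s. b \<one>\<^bsub>R\<^esub> s) \<in> ring_hom ?S T" using b_hom_right AB by (auto simp: ring_hom_def)
  obtain h where h: "h \<in> ring_hom (tensor k ?R ?S) T"
    and hb: "\<And>r s. r \<in> carrier ?R \<Longrightarrow> s \<in> carrier ?S \<Longrightarrow> h (TC.cl [(r, s)]) = b r \<one>\<^bsub>S\<^esub> \<otimes>\<^bsub>T\<^esub> b \<one>\<^bsub>R\<^esub> s"
    by (rule Q.hom_lift[OF T.R.is_cring f g]) (use b_str b_str_right in auto)
  have hb': "h (TC.cl [(r, s)]) = b r s" if "r \<in> carrier ?R" "s \<in> carrier ?S" for r s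
    using hb[OF that] that AB by (simp add: b_split[symmetric])
  have hs: "h (tsum (tensor k ?R ?S) (\<lambda>r s. TC.cl [(r, s)]) zs) = tsum T b zs" if "zs \<in> lists (A \<times> B)" for zs
    by (rule Q.hom_tsum[OF T.R.is_cring h _ hb']) (use that in auto)
  let ?s = "tsum (tensor k ?R ?S) (\<lambda>r s. TC.cl [(r, s)])"
  have sx: "?s xs \<in> carrier (tensor k ?R ?S)" "?s ys \<in> carrier (tensor k ?R ?S)"
    by (rule Q.tsum_closed; use xs ys in simp)+
  then have "?s xs \<ominus>\<^bsub>tensor k ?R ?S\<^esub> ?s ys \<in> carrier (tensor k ?R ?S)" by simp
  then obtain zs where zs: "zs \<in> lists (carrier ?R \<times> carrier ?S)" "?s xs \<ominus>\<^bsub>tensor k ?R ?S\<^esub> ?s ys = ?s zs"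
    "indep k ?R (map fst zs)" "indep k ?S (map snd zs)"
    using Q.tsub_reduced[OF _ RA.ksub_carrier SB.ksub_carrier] unfolding Q.tsub_carrier by blast
  have zsL: "zs \<in> L" using zs(1) AB by (auto simp: in_lists_conv_set)
  have "tsum T b zs = h (?s xs \<ominus>\<^bsub>tensor k ?R ?S\<^esub> ?s ys)" using zs hs by simp
  also have "\<dots> = tsum T b xs \<ominus>\<^bsub>T\<^esub> tsum T b ys"
    using sx hs[OF xs] hs[OF ys] ring_hom_add[OF h]
      additive_minus[OF Q.T.R.abelian_group_axioms T.R.abelian_group_axioms ring_hom_additive[OF h] sx(2)]
    by (simp add: a_minus_def)
  also have "\<dots> = \<zero>\<^bsub>T\<^esub>"
    using eq ys AB by (auto simp: a_minus_def in_lists_conv_set intro!: T.R.r_neg tsum_closed)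
  finally have "zs = []" using tsum_indep_zero[OF zsL] zs(3,4) by simp
  then have "?s xs = ?s ys" using zs(2) sx by (simp add: Q.T.R.r_right_minus_eq)
  then show ?thesis using Q.b_faithful[of xs ys] xs ys by simp
qed

section \<open>Separability idempotents\<close>

text \<open>The list stands for a tensor \<open>e \<in> R \<otimes> R\<close> of product \<open>1\<close> with \<open>(a \<otimes> 1) e = (1 \<otimes> a) e\<close>.\<close>

definition sep_idem :: "('k, 'm) ring_scheme \<Rightarrow> ('k, 'a) salg \<Rightarrow> ('a \<times> 'a) list \<Rightarrow> bool"
  where "sep_idem k R xs \<longleftrightarrow> xs \<in> lists (carrier R \<times> carrier R) \<and> tsum R (\<otimes>\<^bsub>R\<^esub>) xs = \<one>\<^bsub>R\<^esub> \<and>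
    (\<forall>a \<in> carrier R. tensor_eq k R (str R) R (str R)
      (map (\<lambda>(u, v). (a \<otimes>\<^bsub>R\<^esub> u, v)) xs) (map (\<lambda>(u, v). (u, a \<otimes>\<^bsub>R\<^esub> v)) xs))"

lemma sep_idemI:
  assumes "tensor_product k R R T b" "xs \<in> lists (carrier R \<times> carrier R)" "tsum R (\<otimes>\<^bsub>R\<^esub>) xs = \<one>\<^bsub>R\<^esub>"
    "\<And>a. a \<in> carrier R \<Longrightarrow> b a \<one>\<^bsub>R\<^esub> \<otimes>\<^bsub>T\<^esub> tsum T b xs = b \<one>\<^bsub>R\<^esub> a \<otimes>\<^bsub>T\<^esub> tsum T b xs"
  shows "sep_idem k R xs"
  unfolding sep_idem_def
proof (intro conjI ballI assms)
  interpret tensor_product k R R T b by fact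
  fix a assume a: "a \<in> carrier R"
  have 1: "map (\<lambda>(u, v). (a \<otimes>\<^bsub>R\<^esub> u, \<one>\<^bsub>R\<^esub> \<otimes>\<^bsub>R\<^esub> v)) xs = map (\<lambda>(u, v). (a \<otimes>\<^bsub>R\<^esub> u, v)) xs"
    "map (\<lambda>(u, v). (\<one>\<^bsub>R\<^esub> \<otimes>\<^bsub>R\<^esub> u, a \<otimes>\<^bsub>R\<^esub> v)) xs = map (\<lambda>(u, v). (u, a \<otimes>\<^bsub>R\<^esub> v)) xs"
    using assms(2) by (auto simp: in_lists_conv_set)
  have 2: "map (\<lambda>(u, v). (a \<otimes>\<^bsub>R\<^esub> u, v)) xs \<in> L" "map (\<lambda>(u, v). (u, a \<otimes>\<^bsub>R\<^esub> v)) xs \<in> L"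
    using assms(2) a by (auto simp: in_lists_conv_set)
  show "tensor_eq k R (str R) R (str R) (map (\<lambda>(u, v). (a \<otimes>\<^bsub>R\<^esub> u, v)) xs) (map (\<lambda>(u, v). (u, a \<otimes>\<^bsub>R\<^esub> v)) xs)"
    unfolding tensor_eq_iff[OF 2]
    using assms(4)[OF a] tsum_mult[OF assms(2) a R.R.one_closed] tsum_mult[OF assms(2) R.R.one_closed a]
    unfolding 1 by metis
qed

text \<open>The pair \<open>f\<close>, \<open>g\<close> induces a homomorphism
  \<open>R \<otimes> R \<rightarrow> Q\<close>, and \<open>e\<close> is the image of the
  separability idempotent: the locus where \<open>f\<close> and \<open>g\<close> agree. Allowing two
  different homomorphisms covers the coprojections of the descent as well as the evaluation of
  \<open>R \<otimes> L\<close> at a character of \<open>R\<close>.\<close>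

lemma sep_idem_hom:
  fixes f g :: "'a \<Rightarrow> 'q" and Q :: "('q, 'z) ring_scheme"
  assumes R: "algebra_over k R" and xs: "sep_idem k R xs" and Q: "cring Q"
    and f: "f \<in> ring_hom R Q" and g: "g \<in> ring_hom R Q"
    and fg: "\<And>c. c \<in> carrier k \<Longrightarrow> f (str R c) = g (str R c)"
  defines "e \<equiv> tsum Q (\<lambda>u v. f u \<otimes>\<^bsub>Q\<^esub> g v) xs"
  shows "e \<in> carrier Q" "\<And>a. a \<in> carrier R \<Longrightarrow> f a \<otimes>\<^bsub>Q\<^esub> e = g a \<otimes>\<^bsub>Q\<^esub> e" "e \<otimes>\<^bsub>Q\<^esub> e = e"
proof -
  interpret R: algebra_over k R by fact
  interpret Q: cring Q by fact
  note F = ring_hom_closed[OF f] ring_hom_add[OF f] ring_hom_mult[OF f] ring_hom_one[OF f]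
  note G = ring_hom_closed[OF g] ring_hom_add[OF g] ring_hom_mult[OF g] ring_hom_one[OF g]
  have bal: "balanced_map k R R Q (\<lambda>r s. f r \<otimes>\<^bsub>Q\<^esub> g s)"
    by (simp add: balanced_map_def F G fg smul_def Q.l_distr Q.r_distr Q.m_ac)
  have xsL: "u \<in> carrier R \<and> v \<in> carrier R" if "(u, v) \<in> set xs" for u v
    using xs that by (auto simp: sep_idem_def in_lists_conv_set)
  have tc: "tsum Q h zs \<in> carrier Q" if "\<And>u v. (u, v) \<in> set zs \<Longrightarrow> h u v \<in> carrier Q" for h and zs :: "('a \<times> 'a) list"
    unfolding tsum_def by (rule Q.lsum_map_closed) (use that in auto)
  show e: "e \<in> carrier Q" unfolding e_def by (rule tc) (use xsL F G in auto)
  have tm: "x \<otimes>\<^bsub>Q\<^esub> tsum Q h zs = tsum Q (\<lambda>u v. x \<otimes>\<^bsub>Q\<^esub> h u v) zs"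
    if "x \<in> carrier Q" "\<And>u v. (u, v) \<in> set zs \<Longrightarrow> h u v \<in> carrier Q" for x h and zs :: "('a \<times> 'a) list"
    unfolding tsum_def
    using Q.lsum_rdistr[OF that(1), of zs "case_prod h"] that(2) by (auto simp: case_prod_unfold)
  have cong: "tsum Q h zs = tsum Q h' zs" if "\<And>u v. (u, v) \<in> set zs \<Longrightarrow> h u v = h' u v" for h h' and zs :: "('a \<times> 'a) list"
    unfolding tsum_def using that by (auto intro!: arg_cong[of _ _ "lsum Q"])
  show fe: "f a \<otimes>\<^bsub>Q\<^esub> e = g a \<otimes>\<^bsub>Q\<^esub> e" if a: "a \<in> carrier R" for a
  proof -
    have "tensor_eq k R (str R) R (str R)
      (map (\<lambda>(u, v). (a \<otimes>\<^bsub>R\<^esub> u, v)) xs) (map (\<lambda>(u, v). (u, a \<otimes>\<^bsub>R\<^esub> v)) xs)" using xs a by (simp add: sep_idem_def)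
    from tensor_eq_tsum[OF this bal R R Q.abelian_group_axioms]
    have "tsum Q (\<lambda>u v. f (a \<otimes>\<^bsub>R\<^esub> u) \<otimes>\<^bsub>Q\<^esub> g v) xs = tsum Q (\<lambda>u v. f u \<otimes>\<^bsub>Q\<^esub> g (a \<otimes>\<^bsub>R\<^esub> v)) xs"
      by (simp add: tsum_def comp_def case_prod_unfold)
    moreover have "f a \<otimes>\<^bsub>Q\<^esub> e = tsum Q (\<lambda>u v. f (a \<otimes>\<^bsub>R\<^esub> u) \<otimes>\<^bsub>Q\<^esub> g v) xs"
      unfolding e_def using a xsL F G by (subst tm) (auto intro!: cong simp: Q.m_assoc)
    moreover have "g a \<otimes>\<^bsub>Q\<^esub> e = tsum Q (\<lambda>u v. f u \<otimes>\<^bsub>Q\<^esub> g (a \<otimes>\<^bsub>R\<^esub> v)) xs"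
      unfolding e_def using a xsL F G by (subst tm) (auto intro!: cong simp: Q.m_lcomm)
    ultimately show ?thesis by simp
  qed
  \<comment> \<open>Next to a factor \<open>e\<close>, \<open>f u\<close> may be replaced by
    \<open>g u\<close>. Each term of \<open>e e\<close> thus becomes \<open>e g (u v)\<close>, and
    the products \<open>u v\<close> add up to one.\<close>
  have "e \<otimes>\<^bsub>Q\<^esub> e = tsum Q (\<lambda>u v. e \<otimes>\<^bsub>Q\<^esub> (f u \<otimes>\<^bsub>Q\<^esub> g v)) xs"
    using tm[OF e, of xs "\<lambda>u v. f u \<otimes>\<^bsub>Q\<^esub> g v"] xsL F G by (simp add: e_def)
  also have "\<dots> = tsum Q (\<lambda>u v. e \<otimes>\<^bsub>Q\<^esub> g (u \<otimes>\<^bsub>R\<^esub> v)) xs"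
  proof (rule cong)
    fix u v assume "(u, v) \<in> set xs"
    then have uv: "u \<in> carrier R" "v \<in> carrier R" using xsL by auto
    have "e \<otimes>\<^bsub>Q\<^esub> (f u \<otimes>\<^bsub>Q\<^esub> g v) = (f u \<otimes>\<^bsub>Q\<^esub> e) \<otimes>\<^bsub>Q\<^esub> g v" using uv e F G by (simp add: Q.m_ac)
    also have "\<dots> = (g u \<otimes>\<^bsub>Q\<^esub> e) \<otimes>\<^bsub>Q\<^esub> g v" using uv fe by simp
    also have "\<dots> = e \<otimes>\<^bsub>Q\<^esub> g (u \<otimes>\<^bsub>R\<^esub> v)" using uv e F G by (simp add: Q.m_ac)
    finally show "e \<otimes>\<^bsub>Q\<^esub> (f u \<otimes>\<^bsub>Q\<^esub> g v) = e \<otimes>\<^bsub>Q\<^esub> g (u \<otimes>\<^bsub>R\<^esub> v)" .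
  qed
  also have "\<dots> = e \<otimes>\<^bsub>Q\<^esub> tsum Q (\<lambda>u v. g (u \<otimes>\<^bsub>R\<^esub> v)) xs"
    using tm[OF e, of xs "\<lambda>u v. g (u \<otimes>\<^bsub>R\<^esub> v)"] xsL G by simp
  also have "tsum Q (\<lambda>u v. g (u \<otimes>\<^bsub>R\<^esub> v)) xs = g (tsum R (\<otimes>\<^bsub>R\<^esub>) xs)"
  proof -
    have "set (map (case_prod (\<otimes>\<^bsub>R\<^esub>)) xs) \<subseteq> carrier R" using xsL by auto
    from additive_lsum[OF R.R.abelian_group_axioms Q.abelian_group_axioms ring_hom_additive[OF g] this]
    show ?thesis by (simp add: tsum_def comp_def case_prod_unfold)
  qed
  also have "\<dots> = \<one>\<^bsub>Q\<^esub>" using xs G by (simp add: sep_idem_def)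
  finally show "e \<otimes>\<^bsub>Q\<^esub> e = e" using e by simp
qed

lemma tsum_cong: "(\<And>u v. (u, v) \<in> set xs \<Longrightarrow> g u v = h u v) \<Longrightarrow> tsum Q g xs = tsum Q h xs"
  by (induction xs) auto

lemma tsum_map_eq:
  "(\<And>u v. (u, v) \<in> set xs \<Longrightarrow> g (p u) (q v) = h u v) \<Longrightarrow> tsum Q g (map (map_prod p q) xs) = tsum Q h xs"
  by (induction xs) auto

text \<open>Comparison of coefficients shows that the span of the left components is stable under
  multiplication by \<open>B\<close>. Since the product of the tensor is one, every \<open>a\<close>
  in \<open>B\<close> is the sum of the elements \<open>(a v) u\<close>, which lie in this span. In
  particular \<open>B\<close> has finite dimension.\<close>

lemma sep_idem_span:
  assumes SS: "tensor_product_field k S S T b" and B: "ksubalg k S B" and xs: "xs \<in> lists (B \<times> B)" "indep k S (map snd xs)"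
    and one: "tsum S (\<otimes>\<^bsub>S\<^esub>) xs = \<one>\<^bsub>S\<^esub>"
    and eq: "\<And>a. a \<in> B \<Longrightarrow> b a \<one>\<^bsub>S\<^esub> \<otimes>\<^bsub>T\<^esub> tsum T b xs = b \<one>\<^bsub>S\<^esub> a \<otimes>\<^bsub>T\<^esub> tsum T b xs"
  shows "B \<subseteq> lspan k S (map fst xs)"
proof
  interpret tensor_product_field k S S T b by fact
  note BD = ksubalgD[OF B]
  have uv: "u \<in> B" "v \<in> B" "u \<in> carrier S" "v \<in> carrier S" if "(u, v) \<in> set xs" for u v
    using xs(1) that BD(1) by (auto simp: in_lists_conv_set)
  have xsL: "xs \<in> L" using xs(1) BD(1) by (auto simp: in_lists_conv_set)
  have fs: "set (map fst xs) \<subseteq> carrier S" "set (map snd xs) \<subseteq> carrier S" using uv by auto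
  obtain f where f: "R.dual (map snd xs) f" using R.indep_dual[OF fs(2) xs(2)] .
  interpret sw: tensor_product_field k S S T "\<lambda>s r. b r s" by (rule swap_field)
  \<comment> \<open>Contract \<open>(a \<otimes> 1) e = (1 \<otimes> a) e\<close> with the
    functional dual to the \<open>i\<close>-th right component: one side becomes \<open>a\<close>
    times the \<open>i\<close>-th left component, the other a linear combination of the left
    components.\<close>
  have ideal: "a \<otimes>\<^bsub>S\<^esub> fst (xs ! i) \<in> lspan k S (map fst xs)" if a: "a \<in> B" and i: "i < length xs" for a i
  proof -
    have fi: "lin k S (f i)" using f i by (simp add: R.dual_def)
    have aS: "a \<in> carrier S" using BD(1) a by simp
    let ?l = "map prod.swap (map (\<lambda>(u, v). (a \<otimes>\<^bsub>S\<^esub> u, v)) xs)" and ?r = "map prod.swap (map (\<lambda>(u, v). (u, a \<otimes>\<^bsub>S\<^esub> v)) xs)"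
    have L: "?l \<in> lists (carrier S \<times> carrier S)" "?r \<in> lists (carrier S \<times> carrier S)"
      using uv aS by (auto simp: in_lists_conv_set)
    have id: "map (\<lambda>(u, v). (a \<otimes>\<^bsub>S\<^esub> u, \<one>\<^bsub>S\<^esub> \<otimes>\<^bsub>S\<^esub> v)) xs = map (\<lambda>(u, v). (a \<otimes>\<^bsub>S\<^esub> u, v)) xs"
      "map (\<lambda>(u, v). (\<one>\<^bsub>S\<^esub> \<otimes>\<^bsub>S\<^esub> u, a \<otimes>\<^bsub>S\<^esub> v)) xs = map (\<lambda>(u, v). (u, a \<otimes>\<^bsub>S\<^esub> v)) xs"
      using uv by auto
    have "tsum T b (map (\<lambda>(u, v). (a \<otimes>\<^bsub>S\<^esub> u, v)) xs) = tsum T b (map (\<lambda>(u, v). (u, a \<otimes>\<^bsub>S\<^esub> v)) xs)"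
      using eq[OF a] tsum_mult[OF xsL, of a "\<one>\<^bsub>S\<^esub>"] tsum_mult[OF xsL _ aS, of "\<one>\<^bsub>S\<^esub>"] aS id by simp
    then have "sw.lslice (f i) (tsum T (\<lambda>s r. b r s) ?l) = sw.lslice (f i) (tsum T (\<lambda>s r. b r s) ?r)"
      by (simp only: tsum_swap)
    moreover have "sw.lslice (f i) (tsum T (\<lambda>s r. b r s) ?l) = snd (?l ! i)"
      by (rule sw.lslice_nth[OF L(1)]) (use f i in \<open>simp_all add: comp_def case_prod_unfold\<close>)
    moreover have "sw.lslice (f i) (tsum T (\<lambda>s r. b r s) ?r) = lsum S (map (\<lambda>x. smul S (f i (fst x)) (snd x)) ?r)"
      by (rule sw.lslice_tsum[OF fi L(2)])
    moreover have "\<dots> \<in> lspan k S (map fst xs)"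
      using uv linD(1)[OF fi] R.lspan_mem[OF fs(1)] aS
      by (intro ksub_lsum[OF R.lspan_ksub[OF fs(1)]])
        (force intro!: ksubD(4)[OF R.lspan_ksub[OF fs(1)]])
    ultimately show ?thesis using i by (simp add: case_prod_unfold)
  qed
  fix a assume a: "a \<in> B"
  have aS: "a \<in> carrier S" using BD(1) a by simp
  have "a = a \<otimes>\<^bsub>S\<^esub> tsum S (\<otimes>\<^bsub>S\<^esub>) xs" using one aS by simp
  also have "\<dots> = lsum S (map (\<lambda>x. a \<otimes>\<^bsub>S\<^esub> (fst x \<otimes>\<^bsub>S\<^esub> snd x)) xs)"
    unfolding tsum_def using R.R.lsum_rdistr[OF aS, of xs "case_prod (\<otimes>\<^bsub>S\<^esub>)"] uv by (auto simp: case_prod_unfold)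
  also have "map (\<lambda>x. a \<otimes>\<^bsub>S\<^esub> (fst x \<otimes>\<^bsub>S\<^esub> snd x)) xs = map (\<lambda>x. (a \<otimes>\<^bsub>S\<^esub> snd x) \<otimes>\<^bsub>S\<^esub> fst x) xs"
    using uv aS by (auto simp: R.R.m_ac)
  also have "lsum S \<dots> \<in> lspan k S (map fst xs)"
  proof (rule ksub_lsum[OF R.lspan_ksub[OF fs(1)]], safe)
    fix y assume "y \<in> set (map (\<lambda>x. (a \<otimes>\<^bsub>S\<^esub> snd x) \<otimes>\<^bsub>S\<^esub> fst x) xs)"
    then obtain i where "i < length xs" "y = (a \<otimes>\<^bsub>S\<^esub> snd (xs ! i)) \<otimes>\<^bsub>S\<^esub> fst (xs ! i)" by (auto simp: in_set_conv_nth)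
    moreover have "a \<otimes>\<^bsub>S\<^esub> snd (xs ! i) \<in> B"
      using BD(6)[OF a] uv(2)[of "fst (xs ! i)" "snd (xs ! i)"] nth_mem[OF calculation(1)] by simp
    ultimately show "y \<in> lspan k S (map fst xs)" using ideal by simp
  qed
  finally show "a \<in> lspan k S (map fst xs)" .
qed

text \<open>Passing to a reduced representation keeps the tensor and hence its two defining
  properties. The left components are then independent, and they span by
  \<open>sep_idem_span\<close>. All dimension counts for etale algebras rest on this basis.\<close>

lemma sep_idem_basis:
  fixes R :: "('k, 'a) salg"
  assumes "algebra_over_field k R" and "sep_idem k R xs"
  obtains ys f where "sep_idem k R ys" "algebra_over_field.dual k R (map fst ys) f"
    "carrier R = lspan k R (map fst ys)"
proof -
  interpret algebra_over_field k R by fact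
  interpret TC: tensor_construction k R R ..
  interpret Q: tensor_product_field k R R "tensor k R R" "\<lambda>r s. TC.cl [(r, s)]"
    by (rule TC.tensor_field) (rule k.field_axioms)
  let ?s = "tsum (tensor k R R) (\<lambda>r s. TC.cl [(r, s)])"
  have xL: "xs \<in> Q.L" using assms(2) by (simp add: sep_idem_def)
  obtain ys where ys: "ys \<in> Q.L" "?s xs = ?s ys" "indep k R (map fst ys)" "indep k R (map snd ys)"
    using Q.tsub_reduced[OF _ ksub_carrier ksub_carrier, of "?s xs"] Q.tsum_closed[OF xL] Q.tsub_carrier by auto
  have bal: "balanced_map k R R R (\<otimes>\<^bsub>R\<^esub>)" by (simp add: balanced_map_def R.l_distr R.r_distr smul_def R.m_ac)
  have one: "tsum R (\<otimes>\<^bsub>R\<^esub>) ys = \<one>\<^bsub>R\<^esub>"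
    using tensor_eq_tsum[OF Q.b_faithful[OF xL ys(1,2)] bal] assms algebra_over_axioms R.abelian_group_axioms
    by (simp add: sep_idem_def)
  have l: "(\<lambda>r. TC.cl [(r, \<one>\<^bsub>R\<^esub>)]) \<in> ring_hom R (tensor k R R)" by (rule Q.b_hom_left)
  have r: "(\<lambda>r. TC.cl [(\<one>\<^bsub>R\<^esub>, r)]) \<in> ring_hom R (tensor k R R)" by (rule Q.b_hom_right)
  have "TC.cl [(u, \<one>\<^bsub>R\<^esub>)] \<otimes>\<^bsub>tensor k R R\<^esub> TC.cl [(\<one>\<^bsub>R\<^esub>, v)] = TC.cl [(u, v)]" if "(u, v) \<in> set xs" for u v
    using xL that by (subst Q.b_mult) (auto simp: in_lists_conv_set)
  then have "tsum (tensor k R R) (\<lambda>u v. TC.cl [(u, \<one>\<^bsub>R\<^esub>)] \<otimes>\<^bsub>tensor k R R\<^esub> TC.cl [(\<one>\<^bsub>R\<^esub>, v)]) xs = ?s xs"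
    by (rule tsum_cong)
  then have eq: "TC.cl [(a, \<one>\<^bsub>R\<^esub>)] \<otimes>\<^bsub>tensor k R R\<^esub> ?s ys = TC.cl [(\<one>\<^bsub>R\<^esub>, a)] \<otimes>\<^bsub>tensor k R R\<^esub> ?s ys"
    if "a \<in> carrier R" for a
    using sep_idem_hom(2)[OF algebra_over_axioms assms(2) Q.T.R.is_cring l r _ that] ys(2) Q.b_str Q.b_str_right by simp
  have "sep_idem k R ys" by (rule sep_idemI[OF Q.tensor_product_axioms ys(1) one eq])
  moreover have sR: "set (map fst ys) \<subseteq> carrier R" using ys(1) by (auto simp: in_lists_conv_set)
  moreover obtain f where "dual (map fst ys) f" using indep_dual[OF sR ys(3)] .
  moreover have "carrier R \<subseteq> lspan k R (map fst ys)"
    by (rule sep_idem_span[OF Q.tensor_product_field_axioms ksubalg_carrier ys(1) ys(4) one eq])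
  ultimately show thesis using that lspan_closed[OF sR] by blast
qed

section \<open>From a splitting over an extension field to a separability idempotent\<close>

lemma replicate_ring_carrier:
  "as \<in> carrier (RDirProd_list (replicate n L)) \<longleftrightarrow> length as = n \<and> set as \<subseteq> carrier L"
proof
  assume "as \<in> carrier (RDirProd_list (replicate n L))"
  from RDirProd_list_carrier_mem[OF this] show "length as = n \<and> set as \<subseteq> carrier L"
    by (auto simp: in_set_conv_nth)
next
  assume "length as = n \<and> set as \<subseteq> carrier L"
  then show "as \<in> carrier (RDirProd_list (replicate n L))"
    by (intro RDirProd_list_carrier_memI) auto
qed

lemma replicate_ring_ops:
  assumes "as \<in> carrier (RDirProd_list (replicate n L))" "bs \<in> carrier (RDirProd_list (replicate n L))"
  shows "as \<otimes>\<^bsub>RDirProd_list (replicate n L)\<^esub> bs = map2 (\<otimes>\<^bsub>L\<^esub>) as bs"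
    and "as \<oplus>\<^bsub>RDirProd_list (replicate n L)\<^esub> bs = map2 (\<oplus>\<^bsub>L\<^esub>) as bs"
proof -
  have "as \<otimes>\<^bsub>RDirProd_list (replicate n L)\<^esub> bs = map2 (\<otimes>\<^bsub>L\<^esub>) as bs \<and>
    as \<oplus>\<^bsub>RDirProd_list (replicate n L)\<^esub> bs = map2 (\<oplus>\<^bsub>L\<^esub>) as bs"
    using assms
  proof (induction n arbitrary: as bs)
    case 0
    then show ?case by (simp add: monoid.defs)
  next
    case (Suc n)
    let ?P = "RDirProd_list (replicate n L)"
    have "length as = Suc n \<and> set as \<subseteq> carrier L" "length bs = Suc n \<and> set bs \<subseteq> carrier L"
      using Suc.prems replicate_ring_carrier[of _ "Suc n" L] by blast+
    then obtain a as' c bs' where ab: "as = a # as'" "bs = c # bs'" "a \<in> carrier L" "c \<in> carrier L"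
      "as' \<in> carrier ?P" "bs' \<in> carrier ?P"
      by (auto simp: replicate_ring_carrier length_Suc_conv)
    have hom: "(\<lambda>(a, as). a # as) \<in> ring_hom (RDirProd L ?P) (RDirProd_list (L # replicate n L))"
      using RDirProd_list_iso1 by (auto simp: ring_iso_def)
    have mem: "(a, as') \<in> carrier (RDirProd L ?P)" "(c, bs') \<in> carrier (RDirProd L ?P)"
      using ab by (auto simp: RDirProd_carrier)
    show ?case
      using ring_hom_mult[OF hom mem] ring_hom_add[OF hom mem] Suc.IH[OF ab(5,6)] ab
      by (simp add: RDirProd_def DirProd_def monoid.defs)
  qed
  then show "as \<otimes>\<^bsub>RDirProd_list (replicate n L)\<^esub> bs = map2 (\<otimes>\<^bsub>L\<^esub>) as bs"
    "as \<oplus>\<^bsub>RDirProd_list (replicate n L)\<^esub> bs = map2 (\<oplus>\<^bsub>L\<^esub>) as bs" by auto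
qed

lemma replicate_ring_one: "\<one>\<^bsub>RDirProd_list (replicate n L)\<^esub> = replicate n \<one>\<^bsub>L\<^esub>"
  unfolding RDirProd_list_one by (induction n) auto

text \<open>The condition of \<open>etale\<close> with an arbitrary algebra \<open>L\<close> in
  place of the algebraic closure. Since \<open>L\<close> carries a structure map, the tensor product
  is the one to which \<open>tensor_product\<close> applies; the closure is fitted into this form in
  \<open>etale_iff_sep_idem\<close>.\<close>

definition split_by :: "('k, 'm) ring_scheme \<Rightarrow> ('k, 'a) salg \<Rightarrow> ('k, 'l) salg \<Rightarrow> bool"
  where "split_by k R L \<longleftrightarrow> (\<exists>n. \<exists>h \<in> ring_iso (tensor k R L) (RDirProd_list (replicate n L)).
    \<forall>c \<in> carrier L. h (tensor_class k R (str R) L (str L) [(\<one>\<^bsub>R\<^esub>, c)]) = replicate n c)"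

lemma lsum_map_hom:
  assumes "abelian_group Q" "abelian_group Q'" "additive Q Q' h" "\<And>x. x \<in> set xs \<Longrightarrow> f x \<in> carrier Q"
  shows "h (lsum Q (map f xs)) = lsum Q' (map (\<lambda>x. h (f x)) xs)"
proof -
  have "set (map f xs) \<subseteq> carrier Q" using assms(4) by auto
  from additive_lsum[OF assms(1-3) this] show ?thesis by (simp add: comp_def)
qed

lemma lsum_map_cong: "(\<And>x. x \<in> set xs \<Longrightarrow> f x = g x) \<Longrightarrow> lsum Q (map f xs) = lsum Q (map g xs)"
  by (induction xs) auto

text \<open>Descent: \<open>\<Sum> e \<otimes> e\<close> is a separability idempotent of \<open>R \<otimes> L\<close> over \<open>L\<close>; a functional
  \<open>L \<rightarrow> k\<close> that maps \<open>1\<close> to \<open>1\<close> carries it to one of \<open>R\<close> over \<open>k\<close>.\<close>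

lemma sep_idem_if_idempotents:
  fixes R :: "('k, 'a) salg" and L :: "('k, 'l) salg" and E :: "('k, 'c) salg"
  assumes "tensor_product_field k R L E b" "field L"
    and es: "set es \<subseteq> carrier E" "\<And>e. e \<in> set es \<Longrightarrow> e \<otimes>\<^bsub>E\<^esub> e = e" "lsum E es = \<one>\<^bsub>E\<^esub>"
    and eig: "\<And>e r. e \<in> set es \<Longrightarrow> r \<in> carrier R \<Longrightarrow>
      \<exists>c \<in> carrier L. b r \<one>\<^bsub>L\<^esub> \<otimes>\<^bsub>E\<^esub> e = b \<one>\<^bsub>R\<^esub> c \<otimes>\<^bsub>E\<^esub> e"
  shows "\<exists>xs. sep_idem k R xs"
proof -
  interpret E: tensor_product_field k R L E b by fact
  interpret L: field L by fact
  interpret RR: tensor_construction k R R ..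
  let ?Q = "tensor k R R"
  define b2 where "b2 = (\<lambda>r s. RR.cl [(r, s)])"
  interpret Q: tensor_product_field k R R ?Q b2
    unfolding b2_def by (rule RR.tensor_field) (rule E.R.k.field_axioms)
  interpret QL: tensor_construction k ?Q L ..
  let ?F = "tensor k ?Q L"
  define bF where "bF = (\<lambda>r s. QL.cl [(r, s)])"
  interpret F: tensor_product_field k ?Q L ?F bF
    unfolding bF_def by (rule QL.tensor_field) (rule E.R.k.field_axioms)
  have f1: "(\<lambda>r. bF (b2 r \<one>\<^bsub>R\<^esub>) \<one>\<^bsub>L\<^esub>) \<in> ring_hom R ?F"
    using ring_hom_trans[OF Q.b_hom_left F.b_hom_left] by (simp add: comp_def)
  have f2: "(\<lambda>r. bF (b2 \<one>\<^bsub>R\<^esub> r) \<one>\<^bsub>L\<^esub>) \<in> ring_hom R ?F"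
    using ring_hom_trans[OF Q.b_hom_right F.b_hom_left] by (simp add: comp_def)
  \<comment> \<open>The square of \<open>R \<otimes> L\<close> over \<open>L\<close> is realised as
    \<open>(R \<otimes> R) \<otimes> L\<close>. The maps \<open>j1\<close> and \<open>j2\<close> are
    its coprojections and \<open>mL\<close> is its multiplication, the extension of \<open>m\<close>
    from \<open>k\<close> to \<open>L\<close>.\<close>
  obtain j1 where j1: "j1 \<in> ring_hom E ?F"
    "\<And>r c. r \<in> carrier R \<Longrightarrow> c \<in> carrier L \<Longrightarrow> j1 (b r c) = bF (b2 r \<one>\<^bsub>R\<^esub>) \<one>\<^bsub>L\<^esub> \<otimes>\<^bsub>?F\<^esub> bF \<one>\<^bsub>?Q\<^esub> c"
    by (rule E.hom_lift[OF F.T.R.is_cring f1 F.b_hom_right])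
      (simp add: Q.b_str[symmetric] F.b_str[symmetric] F.b_str_right[symmetric], blast)
  obtain j2 where j2: "j2 \<in> ring_hom E ?F"
    "\<And>r c. r \<in> carrier R \<Longrightarrow> c \<in> carrier L \<Longrightarrow> j2 (b r c) = bF (b2 \<one>\<^bsub>R\<^esub> r) \<one>\<^bsub>L\<^esub> \<otimes>\<^bsub>?F\<^esub> bF \<one>\<^bsub>?Q\<^esub> c"
    by (rule E.hom_lift[OF F.T.R.is_cring f2 F.b_hom_right])
      (simp add: Q.b_str_right[symmetric] F.b_str[symmetric] F.b_str_right[symmetric], blast)
  have id: "(\<lambda>r. r) \<in> ring_hom R R" by (auto simp: ring_hom_def)
  obtain m where m: "m \<in> ring_hom ?Q R" "\<And>r s. r \<in> carrier R \<Longrightarrow> s \<in> carrier R \<Longrightarrow> m (b2 r s) = r \<otimes>\<^bsub>R\<^esub> s"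
    by (rule Q.hom_lift[OF E.R.R.is_cring id id]) auto
  have bm: "(\<lambda>x. b (m x) \<one>\<^bsub>L\<^esub>) \<in> ring_hom ?Q E"
    using ring_hom_trans[OF m(1) E.b_hom_left] by (simp add: comp_def)
  obtain mL where mL: "mL \<in> ring_hom ?F E"
    "\<And>x c. x \<in> carrier ?Q \<Longrightarrow> c \<in> carrier L \<Longrightarrow> mL (bF x c) = b (m x) \<one>\<^bsub>L\<^esub> \<otimes>\<^bsub>E\<^esub> b \<one>\<^bsub>R\<^esub> c"
    by (rule F.hom_lift[OF E.T.R.is_cring bm E.b_hom_right])
      (simp add: Q.b_str m(2) E.b_str[symmetric] E.b_str_right[symmetric], blast)
  have jb: "j1 (b r \<one>\<^bsub>L\<^esub>) = bF (b2 r \<one>\<^bsub>R\<^esub>) \<one>\<^bsub>L\<^esub>" "j2 (b r \<one>\<^bsub>L\<^esub>) = bF (b2 \<one>\<^bsub>R\<^esub> r) \<one>\<^bsub>L\<^esub>" if "r \<in> carrier R" for r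
    using that j1(2) j2(2) by simp_all
  have jc: "j1 (b \<one>\<^bsub>R\<^esub> c) = bF \<one>\<^bsub>?Q\<^esub> c" "j2 (b \<one>\<^bsub>R\<^esub> c) = bF \<one>\<^bsub>?Q\<^esub> c" if "c \<in> carrier L" for c
    using that j1(2)[of "\<one>\<^bsub>R\<^esub>"] j2(2)[of "\<one>\<^bsub>R\<^esub>"] by simp_all
  note J = ring_hom_closed[OF j1(1)] ring_hom_closed[OF j2(1)]
  have mj: "mL (j1 e) = e" "mL (j2 e) = e" if "e \<in> carrier E" for e
  proof -
    have idE: "(\<lambda>x. x) \<in> ring_hom E E" by (auto simp: ring_hom_def)
    have mj1: "(\<lambda>x. mL (j1 x)) \<in> ring_hom E E" "(\<lambda>x. mL (j2 x)) \<in> ring_hom E E"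
      using ring_hom_trans[OF j1(1) mL(1)] ring_hom_trans[OF j2(1) mL(1)] by (simp_all add: comp_def)
    have m1: "m \<one>\<^bsub>?Q\<^esub> = \<one>\<^bsub>R\<^esub>" by (rule ring_hom_one[OF m(1)])
    show "mL (j1 e) = e"
      by (rule E.hom_eq[OF E.T.R.is_cring mj1(1) idE _ that])
        (simp add: j1(2) ring_hom_mult[OF mL(1)] mL(2) m(2) m1 E.b_mult)
    show "mL (j2 e) = e"
      by (rule E.hom_eq[OF E.T.R.is_cring mj1(2) idE _ that])
        (simp add: j2(2) ring_hom_mult[OF mL(1)] mL(2) m(2) m1 E.b_mult)
  qed
  define p where "p = lsum ?F (map (\<lambda>e. j1 e \<otimes>\<^bsub>?F\<^esub> j2 e) es)"
  have esE: "e \<in> carrier E" if "e \<in> set es" for e using es(1) that by auto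
  have pF: "p \<in> carrier ?F" unfolding p_def by (rule F.T.R.lsum_map_closed) (simp add: J esE)
  have mLp: "mL p = \<one>\<^bsub>E\<^esub>"
  proof -
    have "mL p = lsum E (map (\<lambda>e. mL (j1 e \<otimes>\<^bsub>?F\<^esub> j2 e)) es)" unfolding p_def
      by (rule lsum_map_hom[OF F.T.R.abelian_group_axioms E.T.R.abelian_group_axioms ring_hom_additive[OF mL(1)]])
        (simp add: J esE)
    also have "\<dots> = lsum E (map (\<lambda>e. e) es)"
      by (rule lsum_map_cong) (simp add: ring_hom_mult[OF mL(1)] J esE mj es(2))
    finally show ?thesis using es(3) by simp
  qed
  have pa: "bF (b2 a \<one>\<^bsub>R\<^esub>) \<one>\<^bsub>L\<^esub> \<otimes>\<^bsub>?F\<^esub> p = bF (b2 \<one>\<^bsub>R\<^esub> a) \<one>\<^bsub>L\<^esub> \<otimes>\<^bsub>?F\<^esub> p" if a: "a \<in> carrier R" for a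
  proof -
    have "bF (b2 a \<one>\<^bsub>R\<^esub>) \<one>\<^bsub>L\<^esub> \<otimes>\<^bsub>?F\<^esub> (j1 e \<otimes>\<^bsub>?F\<^esub> j2 e) = bF (b2 \<one>\<^bsub>R\<^esub> a) \<one>\<^bsub>L\<^esub> \<otimes>\<^bsub>?F\<^esub> (j1 e \<otimes>\<^bsub>?F\<^esub> j2 e)" if e: "e \<in> set es" for e
    proof -
      \<comment> \<open>On the component \<open>e\<close> the element \<open>a\<close> acts as a
        scalar of \<open>L\<close>, and such scalars pass freely between the two factors.\<close>
      obtain c where c: "c \<in> carrier L" "b a \<one>\<^bsub>L\<^esub> \<otimes>\<^bsub>E\<^esub> e = b \<one>\<^bsub>R\<^esub> c \<otimes>\<^bsub>E\<^esub> e" using eig[OF e a] by blast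
      have je: "bF (b2 a \<one>\<^bsub>R\<^esub>) \<one>\<^bsub>L\<^esub> \<otimes>\<^bsub>?F\<^esub> j1 e = bF \<one>\<^bsub>?Q\<^esub> c \<otimes>\<^bsub>?F\<^esub> j1 e"
        "bF (b2 \<one>\<^bsub>R\<^esub> a) \<one>\<^bsub>L\<^esub> \<otimes>\<^bsub>?F\<^esub> j2 e = bF \<one>\<^bsub>?Q\<^esub> c \<otimes>\<^bsub>?F\<^esub> j2 e"
        using arg_cong[OF c(2), of j1] arg_cong[OF c(2), of j2] c(1) a esE[OF e]
        by (simp_all add: ring_hom_mult[OF j1(1)] ring_hom_mult[OF j2(1)] jb jc)
      have cl: "bF (b2 a \<one>\<^bsub>R\<^esub>) \<one>\<^bsub>L\<^esub> \<in> carrier ?F" "bF (b2 \<one>\<^bsub>R\<^esub> a) \<one>\<^bsub>L\<^esub> \<in> carrier ?F"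
        "bF \<one>\<^bsub>?Q\<^esub> c \<in> carrier ?F" "j1 e \<in> carrier ?F" "j2 e \<in> carrier ?F"
        using a c esE[OF e] J by simp_all
      have "bF (b2 a \<one>\<^bsub>R\<^esub>) \<one>\<^bsub>L\<^esub> \<otimes>\<^bsub>?F\<^esub> (j1 e \<otimes>\<^bsub>?F\<^esub> j2 e) = bF \<one>\<^bsub>?Q\<^esub> c \<otimes>\<^bsub>?F\<^esub> j1 e \<otimes>\<^bsub>?F\<^esub> j2 e"
        using cl je(1) by (simp add: F.T.R.m_assoc[symmetric])
      also have "\<dots> = j1 e \<otimes>\<^bsub>?F\<^esub> (bF \<one>\<^bsub>?Q\<^esub> c \<otimes>\<^bsub>?F\<^esub> j2 e)" using cl by (simp add: F.T.R.m_ac)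
      also have "\<dots> = j1 e \<otimes>\<^bsub>?F\<^esub> (bF (b2 \<one>\<^bsub>R\<^esub> a) \<one>\<^bsub>L\<^esub> \<otimes>\<^bsub>?F\<^esub> j2 e)" using je(2) by simp
      also have "\<dots> = bF (b2 \<one>\<^bsub>R\<^esub> a) \<one>\<^bsub>L\<^esub> \<otimes>\<^bsub>?F\<^esub> (j1 e \<otimes>\<^bsub>?F\<^esub> j2 e)" by (rule F.T.R.m_lcomm[OF cl(4,2,5)])
      finally show ?thesis .
    qed
    then show ?thesis unfolding p_def using a J esE
      by (simp add: F.T.R.lsum_rdistr cong: map_cong)
  qed
  obtain \<rho> where \<rho>: "lin k L \<rho>" "\<rho> \<one>\<^bsub>L\<^esub> = \<one>\<^bsub>k\<^esub>"
  proof -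
    have "ksub k L {\<zero>\<^bsub>L\<^esub>}" using E.S.lspan_ksub[of "[]"] by simp
    then show thesis using E.S.functional_ext[of "{\<zero>\<^bsub>L\<^esub>}" "\<one>\<^bsub>L\<^esub>"] that by auto
  qed
  interpret sF: tensor_product_field k L ?Q ?F "\<lambda>c x. bF x c" by (rule F.swap_field)
  interpret sE: tensor_product_field k L R E "\<lambda>c r. b r c" by (rule E.swap_field)
  \<comment> \<open>Contraction along \<open>\<rho>\<close> commutes with multiplication. The
    product of the contracted tensor \<open>q\<close> is therefore the contraction of
    \<open>mL p = 1\<close>, which is \<open>1\<close> because \<open>\<rho>\<close> maps one to
    one.\<close>
  have comm: "m (sF.lslice \<rho> t) = sE.lslice \<rho> (mL t)" if t: "t \<in> carrier ?F" for t
  proof (rule F.additive_eq[OF E.R.R.abelian_group_axioms _ _ _ t])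
    show "additive ?F R (\<lambda>t. m (sF.lslice \<rho> t))"
      using additiveD[OF sF.lslice[OF \<rho>(1)]] additiveD[OF ring_hom_additive[OF m(1)]] by (auto simp: additive_def)
    show "additive ?F R (\<lambda>t. sE.lslice \<rho> (mL t))"
      using additiveD[OF sE.lslice[OF \<rho>(1)]] additiveD[OF ring_hom_additive[OF mL(1)]] by (auto simp: additive_def)
    fix x c assume x: "x \<in> carrier ?Q" and c: "c \<in> carrier L"
    have mx: "m x \<in> carrier R" using ring_hom_closed[OF m(1) x] .
    have "m (sF.lslice \<rho> (bF x c)) = m (smul ?Q (\<rho> c) x)" using sF.lslice_b[OF \<rho>(1) c x] by simp
    also have "\<dots> = smul R (\<rho> c) (m x)"
      using linD(1)[OF \<rho>(1) c] x by (simp add: smul_def ring_hom_mult[OF m(1)] Q.b_str m(2))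
    also have "\<dots> = sE.lslice \<rho> (mL (bF x c))"
      using sE.lslice_b[OF \<rho>(1) c mx] c x mx by (simp add: mL(2) E.b_mult)
    finally show "m (sF.lslice \<rho> (bF x c)) = sE.lslice \<rho> (mL (bF x c))" .
  qed
  define q where "q = sF.lslice \<rho> p"
  have q: "q \<in> carrier ?Q" using sF.lslice_closed[OF \<rho>(1) pF] by (simp add: q_def)
  obtain xs where xs: "xs \<in> lists (carrier R \<times> carrier R)" "q = tsum ?Q b2 xs" using Q.b_generate[OF q] by blast
  have "tsum R (\<otimes>\<^bsub>R\<^esub>) xs = m q"
    unfolding xs(2) by (rule Q.hom_tsum[OF E.R.R.is_cring m(1) xs(1) m(2), symmetric])
  also have "\<dots> = sE.lslice \<rho> (b \<one>\<^bsub>R\<^esub> \<one>\<^bsub>L\<^esub>)" unfolding q_def comm[OF pF] mLp by simp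
  also have "\<dots> = \<one>\<^bsub>R\<^esub>" using sE.lslice_b[OF \<rho>(1), of "\<one>\<^bsub>L\<^esub>" "\<one>\<^bsub>R\<^esub>"] \<rho>(2) by simp
  finally have one: "tsum R (\<otimes>\<^bsub>R\<^esub>) xs = \<one>\<^bsub>R\<^esub>" .
  have "sep_idem k R xs"
  proof (rule sep_idemI[OF Q.tensor_product_axioms xs(1) one])
    fix a assume a: "a \<in> carrier R"
    have ca: "b2 a \<one>\<^bsub>R\<^esub> \<in> carrier ?Q" "b2 \<one>\<^bsub>R\<^esub> a \<in> carrier ?Q" using a by simp_all
    have "b2 a \<one>\<^bsub>R\<^esub> \<otimes>\<^bsub>?Q\<^esub> q = sF.lslice \<rho> (p \<otimes>\<^bsub>?F\<^esub> bF (b2 a \<one>\<^bsub>R\<^esub>) \<one>\<^bsub>L\<^esub>)"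
      using sF.lslice_mult[OF \<rho>(1) pF ca(1)] q ca by (simp add: q_def Q.T.R.m_comm)
    also have "p \<otimes>\<^bsub>?F\<^esub> bF (b2 a \<one>\<^bsub>R\<^esub>) \<one>\<^bsub>L\<^esub> = p \<otimes>\<^bsub>?F\<^esub> bF (b2 \<one>\<^bsub>R\<^esub> a) \<one>\<^bsub>L\<^esub>"
      using pa[OF a] pF ca by (simp add: F.T.R.m_comm)
    also have "sF.lslice \<rho> \<dots> = b2 \<one>\<^bsub>R\<^esub> a \<otimes>\<^bsub>?Q\<^esub> q"
      using sF.lslice_mult[OF \<rho>(1) pF ca(2)] q ca by (simp add: q_def Q.T.R.m_comm)
    finally show "b2 a \<one>\<^bsub>R\<^esub> \<otimes>\<^bsub>?Q\<^esub> tsum ?Q b2 xs = b2 \<one>\<^bsub>R\<^esub> a \<otimes>\<^bsub>?Q\<^esub> tsum ?Q b2 xs" using xs(2) by simp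
  qed
  then show ?thesis by blast
qed

text \<open>The preimages of the unit vectors of \<open>L^n\<close> are idempotents with sum one. An
  element of \<open>R\<close> acts on the \<open>i\<close>-th of them by the \<open>i\<close>-th
  coordinate of its image, so \<open>sep_idem_if_idempotents\<close> applies.\<close>

lemma split_by_sep_idem:
  fixes R :: "('k, 'a) salg" and L :: "('k, 'l) salg"
  assumes R: "algebra_over_field k R" and L: "algebra_over_field k L" "field L" and sp: "split_by k R L"
  shows "\<exists>xs. sep_idem k R xs"
proof -
  interpret L: field L by fact
  interpret R: algebra_over_field k R by fact
  interpret AL: algebra_over_field k L by fact
  interpret TC: tensor_construction k R L ..
  let ?E = "tensor k R L"
  define b where "b = (\<lambda>r s. TC.cl [(r, s)])"
  interpret E: tensor_product_field k R L ?E b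
    unfolding b_def by (rule TC.tensor_field) (rule R.k.field_axioms)
  obtain n h where h: "h \<in> ring_iso ?E (RDirProd_list (replicate n L))"
    and hc: "\<And>c. c \<in> carrier L \<Longrightarrow> h (b \<one>\<^bsub>R\<^esub> c) = replicate n c"
    using sp by (auto simp: split_by_def b_def)
  let ?P = "RDirProd_list (replicate n L)"
  interpret P: ring ?P by (rule RDirProd_list_is_ring) (simp add: L.ring_axioms)
  have hh: "h \<in> ring_hom ?E ?P" and bij: "bij_betw h (carrier ?E) (carrier ?P)" using h by (auto simp: ring_iso_def)
  have inj: "x = y" if "x \<in> carrier ?E" "y \<in> carrier ?E" "h x = h y" for x y
    using bij that by (auto simp: bij_betw_def inj_on_def)
  define u where "u i = map (\<lambda>j. if i = j then \<one>\<^bsub>L\<^esub> else \<zero>\<^bsub>L\<^esub>) [0..<n]" for i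
  have uP: "u i \<in> carrier ?P" for i by (auto simp: replicate_ring_carrier u_def)
  define e where "e i = inv_into (carrier ?E) h (u i)" for i
  have e: "e i \<in> carrier ?E" "h (e i) = u i" for i
    using uP bij by (auto simp: e_def bij_betw_def inv_into_into f_inv_into_f)
  have hP: "length (h x) = n" "\<And>j. j < n \<Longrightarrow> h x ! j \<in> carrier L" if "x \<in> carrier ?E" for x
    using ring_hom_closed[OF hh that] by (auto simp: replicate_ring_carrier subset_iff)
  have mult: "h (x \<otimes>\<^bsub>?E\<^esub> y) = map2 (\<otimes>\<^bsub>L\<^esub>) (h x) (h y)" if "x \<in> carrier ?E" "y \<in> carrier ?E" for x y
    using ring_hom_mult[OF hh that] replicate_ring_ops(1)[OF ring_hom_closed[OF hh that(1)] ring_hom_closed[OF hh that(2)]] by simp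
  show ?thesis
  proof (rule sep_idem_if_idempotents[OF E.tensor_product_field_axioms L(2), of "map e [0..<n]"])
    show "set (map e [0..<n]) \<subseteq> carrier ?E" using e by auto
  next
    fix x assume "x \<in> set (map e [0..<n])"
    then obtain i where i: "i < n" "x = e i" by auto
    have "h (x \<otimes>\<^bsub>?E\<^esub> x) = h x" using i by (auto simp: mult e u_def intro!: nth_equalityI)
    then show "x \<otimes>\<^bsub>?E\<^esub> x = x" using e i by (intro inj) auto
    fix r assume r: "r \<in> carrier R"
    let ?c = "h (b r \<one>\<^bsub>L\<^esub>) ! i"
    have c: "?c \<in> carrier L" using hP(2)[of "b r \<one>\<^bsub>L\<^esub>" i] r i by simp
    have "h (b r \<one>\<^bsub>L\<^esub> \<otimes>\<^bsub>?E\<^esub> x) = h (b \<one>\<^bsub>R\<^esub> ?c \<otimes>\<^bsub>?E\<^esub> x)"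
      using r c i hP[of "b r \<one>\<^bsub>L\<^esub>"] by (auto simp: mult e hc u_def intro!: nth_equalityI)
    then show "\<exists>c\<in>carrier L. b r \<one>\<^bsub>L\<^esub> \<otimes>\<^bsub>?E\<^esub> x = b \<one>\<^bsub>R\<^esub> c \<otimes>\<^bsub>?E\<^esub> x"
      using e i r c by (intro bexI[OF _ c] inj) auto
  next
    have "h (lsum ?E (map e [0..<n])) = lsum ?P (map (\<lambda>i. h (e i)) [0..<n])"
      by (rule lsum_map_hom[OF E.T.R.abelian_group_axioms P.abelian_group_axioms ring_hom_additive[OF hh]]) (simp add: e)
    also have "\<dots> = lsum ?P (map u [0..<n])" by (simp add: e)
    also have "\<dots> = \<one>\<^bsub>?P\<^esub>"
    proof (rule nth_equalityI)
      have cl: "lsum ?P (map u [0..<n]) \<in> carrier ?P" by (rule P.lsum_map_closed) (rule uP)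
      then show "length (lsum ?P (map u [0..<n])) = length \<one>\<^bsub>?P\<^esub>" by (simp add: replicate_ring_carrier replicate_ring_one)
      fix j assume "j < length (lsum ?P (map u [0..<n]))"
      then have j: "j < n" using cl by (simp add: replicate_ring_carrier)
      have "additive ?P L (\<lambda>x. x ! j)" unfolding additive_def
      proof (intro conjI ballI funcsetI)
        fix x y assume xy: "x \<in> carrier ?P" "y \<in> carrier ?P"
        show "x ! j \<in> carrier L" using xy(1) j by (auto simp: replicate_ring_carrier subset_iff)
        show "(x \<oplus>\<^bsub>?P\<^esub> y) ! j = x ! j \<oplus>\<^bsub>L\<^esub> y ! j"
          using replicate_ring_ops(2)[OF xy] xy j by (simp add: replicate_ring_carrier)
      qed
      from lsum_map_hom[OF P.abelian_group_axioms L.abelian_group_axioms this, of "[0..<n]" u] uP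
      have "lsum ?P (map u [0..<n]) ! j = lsum L (map (\<lambda>i. u i ! j) [0..<n])" by simp
      also have "\<dots> = map (\<lambda>i. u i ! j) [0..<n] ! j"
        using j by (intro L.lsum_single) (auto simp: u_def)
      finally show "lsum ?P (map u [0..<n]) ! j = \<one>\<^bsub>?P\<^esub> ! j" using j by (simp add: u_def replicate_ring_one)
    qed
    also have "\<dots> = h \<one>\<^bsub>?E\<^esub>" by (rule ring_hom_one[OF hh, symmetric])
    finally show "lsum ?E (map e [0..<n]) = \<one>\<^bsub>?E\<^esub>"
      by (intro inj E.T.R.lsum_map_closed) (auto simp: e)
  qed
qed

section \<open>Etale algebras\<close>

text \<open>A monic polynomial is encoded by the list of its lower coefficients, highest degree first, and
  evaluated by Horner's scheme.\<close>

definition splits_monic :: "('l, 'n) ring_scheme \<Rightarrow> bool"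
  where "splits_monic L \<longleftrightarrow> (\<forall>cs \<in> lists (carrier L). cs \<noteq> [] \<longrightarrow>
    (\<exists>a \<in> carrier L. foldl (\<lambda>w c. w \<otimes>\<^bsub>L\<^esub> a \<oplus>\<^bsub>L\<^esub> c) \<one>\<^bsub>L\<^esub> cs = \<zero>\<^bsub>L\<^esub>))"

text \<open>The leading coefficient is implicit in the encoding, so a nonempty \<open>cs\<close>
  stands for positive degree. A split polynomial has as many roots as its degree, hence at least one
  here, and \<open>eval\<close> agrees with Horner's scheme by appending one coefficient at a
  time.\<close>

lemma (in algebraically_closed) splits_monic: "splits_monic L"
  unfolding splits_monic_def
proof (intro ballI impI)
  fix cs assume cs: "cs \<in> lists (carrier L)" "cs \<noteq> []"
  have ev: "eval (\<one> # ds) a = foldl (\<lambda>w c. w \<otimes> a \<oplus> c) \<one> ds" if "ds \<in> lists (carrier L)" "a \<in> carrier L" for ds a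
    using that(1)
  proof (induction ds rule: rev_induct)
    case Nil
    then show ?case using that(2) by simp
  next
    case (snoc d ds)
    then have "set (\<one> # ds) \<subseteq> carrier L" "set [d] \<subseteq> carrier L" by auto
    from eval_append[OF this that(2)] snoc that(2) show ?case by simp
  qed
  let ?p = "\<one> # cs"
  have p: "?p \<in> carrier (poly_ring L)"
    using cs unfolding univ_poly_carrier[symmetric] polynomial_def by (auto simp: in_lists_conv_set)
  have "size (roots ?p) = degree ?p" using roots_over_carrier[OF p] by (simp add: splitted_def)
  then have "roots ?p \<noteq> {#}" using cs(2) by auto
  then obtain a where "a \<in># roots ?p" by blast
  then have "is_root ?p a" using roots_mem_iff_is_root[OF p] by blast
  then show "\<exists>a \<in> carrier L. foldl (\<lambda>w c. w \<otimes> a \<oplus> c) \<one> cs = \<zero>"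
    using ev[OF cs(1)] by (auto simp: is_root_def)
qed

context algebra_over
begin

text \<open>The highest exponent comes first, to pair the powers with coefficients in Horner order;
  the leading power \<open>n\<close> itself is left out.\<close>

primrec powers :: "'a \<Rightarrow> nat \<Rightarrow> 'a list" where
  "powers y 0 = []"
| "powers y (Suc n) = y [^]\<^bsub>R\<^esub> n # powers y n"

lemma length_powers [simp]: "length (powers y n) = n"
  by (induction n) auto

lemma powers_closed: "y \<in> carrier R \<Longrightarrow> set (powers y n) \<subseteq> carrier R"
  by (induction n) auto

lemma horner_foldl:
  "ds \<in> lists (carrier k) \<Longrightarrow> y \<in> carrier R \<Longrightarrow> w \<in> carrier R \<Longrightarrow>
    foldl (\<lambda>w c. w \<otimes>\<^bsub>R\<^esub> y \<oplus>\<^bsub>R\<^esub> str R c) w ds =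
      w \<otimes>\<^bsub>R\<^esub> y [^]\<^bsub>R\<^esub> length ds \<oplus>\<^bsub>R\<^esub> lsum R (map2 (smul R) ds (powers y (length ds)))"
proof (induction ds arbitrary: w)
  case (Cons d ds)
  have s: "lsum R (map2 (smul R) ds (powers y (length ds))) \<in> carrier R"
    using Cons.prems powers_closed[of y "length ds"]
    by (intro R.lsum_map_closed) (force simp: in_lists_conv_set dest: set_zip_leftD set_zip_rightD)
  have d: "d \<in> carrier k" "ds \<in> lists (carrier k)" using Cons.prems by auto
  have "foldl (\<lambda>w c. w \<otimes>\<^bsub>R\<^esub> y \<oplus>\<^bsub>R\<^esub> str R c) w (d # ds) =
    (w \<otimes>\<^bsub>R\<^esub> y \<oplus>\<^bsub>R\<^esub> str R d) \<otimes>\<^bsub>R\<^esub> y [^]\<^bsub>R\<^esub> length ds \<oplus>\<^bsub>R\<^esub> lsum R (map2 (smul R) ds (powers y (length ds)))"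
    using Cons.IH[OF d(2) Cons.prems(2), of "w \<otimes>\<^bsub>R\<^esub> y \<oplus>\<^bsub>R\<^esub> str R d"] Cons.prems d by simp
  also have "\<dots> = w \<otimes>\<^bsub>R\<^esub> y [^]\<^bsub>R\<^esub> Suc (length ds) \<oplus>\<^bsub>R\<^esub>
    (str R d \<otimes>\<^bsub>R\<^esub> y [^]\<^bsub>R\<^esub> length ds \<oplus>\<^bsub>R\<^esub> lsum R (map2 (smul R) ds (powers y (length ds))))"
    using s d Cons.prems R.m_comm[of "y [^]\<^bsub>R\<^esub> length ds" y] by (simp add: R.l_distr R.m_assoc R.a_assoc)
  finally show ?case by (simp add: smul_def)
qed simp

end

text \<open>If no power of \<open>y\<close> were a combination of the lower ones, any number of
  powers would be independent, more than a finite spanning list admits. The negative of the first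
  dependent power supplies the lower coefficients of a monic relation.\<close>

lemma (in algebra_over_field) monic_relation:
  assumes us: "dual us f" "carrier R = lspan k R us" and y: "y \<in> carrier R"
  obtains ds where "ds \<in> lists (carrier k)" "foldl (\<lambda>w c. w \<otimes>\<^bsub>R\<^esub> y \<oplus>\<^bsub>R\<^esub> str R c) \<one>\<^bsub>R\<^esub> ds = \<zero>\<^bsub>R\<^esub>"
proof -
  have usR: "set us \<subseteq> carrier R" using us by (simp add: dual_def)
  have "\<exists>n. y [^]\<^bsub>R\<^esub> n \<in> lspan k R (powers y n)"
  proof (rule ccontr)
    assume a: "\<nexists>n. y [^]\<^bsub>R\<^esub> n \<in> lspan k R (powers y n)"
    have "\<exists>g. dual (powers y n) g" for n
    proof (induction n)
      case 0
      then show ?case by (simp add: dual_def)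
    next
      case (Suc n)
      then obtain g where "dual (powers y n) g" by blast
      from dual_Cons[OF this, of "y [^]\<^bsub>R\<^esub> n"] a y show ?case by auto
    qed
    then obtain g where "dual (powers y (Suc (length us))) g" by blast
    from length_dual_le[OF this _ usR] powers_closed[OF y, of "Suc (length us)"] us(2) show False by simp
  qed
  then obtain n where n: "y [^]\<^bsub>R\<^esub> n \<in> lspan k R (powers y n)" by blast
  have "\<ominus>\<^bsub>R\<^esub> (y [^]\<^bsub>R\<^esub> n) \<in> lspan k R (powers y n)"
    by (rule ksub_uminus[OF lspan_ksub[OF powers_closed[OF y]] n])
  then obtain ds where ds: "ds \<in> lists (carrier k)" "length ds = n"
    "\<ominus>\<^bsub>R\<^esub> (y [^]\<^bsub>R\<^esub> n) = lsum R (map2 (smul R) ds (powers y n))" by (auto simp: lspan_comb)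
  have "foldl (\<lambda>w c. w \<otimes>\<^bsub>R\<^esub> y \<oplus>\<^bsub>R\<^esub> str R c) \<one>\<^bsub>R\<^esub> ds = \<zero>\<^bsub>R\<^esub>"
    using horner_foldl[OF ds(1) y R.one_closed] ds(2) ds(3)[symmetric] y by (simp add: R.r_neg)
  then show thesis using that ds(1) by blast
qed

text \<open>Over itself, \<open>ksub\<close> of a ring means ideal and \<open>lspan\<close> means
  the ideal generated by a list.\<close>

definition self_alg :: "('a, 'm) ring_scheme \<Rightarrow> ('a, 'a) salg"
  where "self_alg T = \<lparr> carrier = carrier T, monoid.mult = monoid.mult T, monoid.one = monoid.one T,
    ring.zero = ring.zero T, ring.add = ring.add T, sig = (\<lambda>x. x), str = (\<lambda>x. x) \<rparr>"

lemma self_alg_simps [simp]: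
  "carrier (self_alg T) = carrier T" "monoid.mult (self_alg T) = monoid.mult T" "monoid.one (self_alg T) = monoid.one T"
  "ring.zero (self_alg T) = ring.zero T" "ring.add (self_alg T) = ring.add T" "str (self_alg T) = (\<lambda>x. x)"
  by (simp_all add: self_alg_def)

lemma (in cring) self_alg: "algebra_over R (self_alg R)"
proof -
  have "cring (self_alg R)"
  proof (intro cringI abelian_groupI comm_monoidI)
    fix x assume "x \<in> carrier (self_alg R)"
    then show "\<exists>y\<in>carrier (self_alg R). y \<oplus>\<^bsub>self_alg R\<^esub> x = \<zero>\<^bsub>self_alg R\<^esub>"
      by (intro bexI[of _ "\<ominus> x"]) (auto simp: l_neg)
  qed (auto simp: a_ac m_ac l_distr r_distr)
  then show ?thesis
    using is_cring by (auto simp: algebra_over_def algebra_over_axioms_def ring_hom_def)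
qed

text \<open>Adding a multiple of a polynomial of one degree less keeps a polynomial monic of the
  same degree. This is the coefficient update in synthetic division.\<close>

lemma (in algebra_over) horner_add:
  assumes "a \<in> carrier k" "y \<in> carrier R"
  shows "ds \<in> lists (carrier k) \<Longrightarrow> cs \<in> lists (carrier k) \<Longrightarrow> length cs = Suc (length ds) \<Longrightarrow>
    \<exists>es \<in> lists (carrier k). length es = length cs \<and>
      foldl (\<lambda>w c. w \<otimes>\<^bsub>R\<^esub> y \<oplus>\<^bsub>R\<^esub> str R c) \<one>\<^bsub>R\<^esub> es =
      foldl (\<lambda>w c. w \<otimes>\<^bsub>R\<^esub> y \<oplus>\<^bsub>R\<^esub> str R c) \<one>\<^bsub>R\<^esub> cs \<oplus>\<^bsub>R\<^esub>
      str R a \<otimes>\<^bsub>R\<^esub> foldl (\<lambda>w c. w \<otimes>\<^bsub>R\<^esub> y \<oplus>\<^bsub>R\<^esub> str R c) \<one>\<^bsub>R\<^esub> ds"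
proof -
  let ?h = "foldl (\<lambda>w c. w \<otimes>\<^bsub>R\<^esub> y \<oplus>\<^bsub>R\<^esub> str R c) \<one>\<^bsub>R\<^esub>"
  have h: "?h es \<in> carrier R" if "es \<in> lists (carrier k)" for es
    using that by (induction es rule: rev_induct) (use assms in auto)
  show "\<exists>es \<in> lists (carrier k). length es = length cs \<and> ?h es = ?h cs \<oplus>\<^bsub>R\<^esub> str R a \<otimes>\<^bsub>R\<^esub> ?h ds"
    if "ds \<in> lists (carrier k)" "cs \<in> lists (carrier k)" "length cs = Suc (length ds)"
    using that
  proof (induction "length ds" arbitrary: ds cs)
    case 0
    then obtain c where c: "ds = []" "cs = [c]" "c \<in> carrier k" by (auto simp: length_Suc_conv)
    then show ?case using assms by (intro bexI[of _ "[c \<oplus>\<^bsub>k\<^esub> a]"]) (auto simp: str_add R.a_ac)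
  next
    case (Suc n)
    from Suc.hyps(2) Suc.prems obtain ds' d cs' c where dc: "ds = ds' @ [d]" "cs = cs' @ [c]"
      by (metis length_0_conv nat.distinct(1) rev_exhaust)
    have L: "ds' \<in> lists (carrier k)" "cs' \<in> lists (carrier k)" "d \<in> carrier k" "c \<in> carrier k"
      using Suc.prems dc by auto
    obtain es where es: "es \<in> lists (carrier k)" "length es = length cs'"
      "?h es = ?h cs' \<oplus>\<^bsub>R\<^esub> str R a \<otimes>\<^bsub>R\<^esub> ?h ds'"
      using Suc.hyps(1)[of ds' cs'] Suc.hyps(2) Suc.prems dc L by auto
    have "?h (es @ [c \<oplus>\<^bsub>k\<^esub> a \<otimes>\<^bsub>k\<^esub> d]) = ?h cs \<oplus>\<^bsub>R\<^esub> str R a \<otimes>\<^bsub>R\<^esub> ?h ds"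
      using es(3) h[OF L(1)] h[OF L(2)] L assms
      by (simp add: dc str_add str_mult R.l_distr R.r_distr R.a_ac R.m_ac)
    then show ?case using es L assms dc by (intro bexI[of _ "es @ [c \<oplus>\<^bsub>k\<^esub> a \<otimes>\<^bsub>k\<^esub> d]"]) auto
  qed
qed

text \<open>Synthetic division by \<open>y - a\<close>, with the remainder \<open>p(a)\<close> moved
  to the left. Appending a coefficient \<open>c\<close> replaces \<open>p\<close> by
  \<open>p y + c\<close>, and \<open>p(y) y - p(a) a = (y - a) p(y) + a (p(y) - p(a))\<close>; the
  quotient of the second summand is added to \<open>p\<close> by means of \<open>horner_add\<close>,
  so the new quotient is monic again.\<close>

lemma (in algebra_over) horner_divide:
  assumes "a \<in> carrier k" "y \<in> carrier R" "cs \<in> lists (carrier k)" "cs \<noteq> []"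
  obtains ds where "ds \<in> lists (carrier k)" "length cs = Suc (length ds)"
    "foldl (\<lambda>w c. w \<otimes>\<^bsub>R\<^esub> y \<oplus>\<^bsub>R\<^esub> str R c) \<one>\<^bsub>R\<^esub> cs \<ominus>\<^bsub>R\<^esub> str R (foldl (\<lambda>w c. w \<otimes>\<^bsub>k\<^esub> a \<oplus>\<^bsub>k\<^esub> c) \<one>\<^bsub>k\<^esub> cs) =
      (y \<ominus>\<^bsub>R\<^esub> str R a) \<otimes>\<^bsub>R\<^esub> foldl (\<lambda>w c. w \<otimes>\<^bsub>R\<^esub> y \<oplus>\<^bsub>R\<^esub> str R c) \<one>\<^bsub>R\<^esub> ds"
proof -
  let ?h = "foldl (\<lambda>w c. w \<otimes>\<^bsub>R\<^esub> y \<oplus>\<^bsub>R\<^esub> str R c) \<one>\<^bsub>R\<^esub>"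
  let ?g = "foldl (\<lambda>w c. w \<otimes>\<^bsub>k\<^esub> a \<oplus>\<^bsub>k\<^esub> c) \<one>\<^bsub>k\<^esub>"
  have h: "?h es \<in> carrier R" "?g es \<in> carrier k" if "es \<in> lists (carrier k)" for es
    using that by (induction es rule: rev_induct) (use assms in auto)
  have "\<exists>ds \<in> lists (carrier k). length cs = Suc (length ds) \<and> ?h cs \<ominus>\<^bsub>R\<^esub> str R (?g cs) = (y \<ominus>\<^bsub>R\<^esub> str R a) \<otimes>\<^bsub>R\<^esub> ?h ds"
    using assms(3,4)
  proof (induction cs rule: rev_induct)
    case (snoc c cs)
    have L: "cs \<in> lists (carrier k)" "c \<in> carrier k" using snoc.prems by auto
    show ?case
    proof (cases "cs = []")
      case True
      have "(y \<oplus>\<^bsub>R\<^esub> str R c) \<ominus>\<^bsub>R\<^esub> (str R a \<oplus>\<^bsub>R\<^esub> str R c) = y \<ominus>\<^bsub>R\<^esub> str R a"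
        using R.add_minus_cancel[of "str R c" y "str R a"] L assms by (simp add: R.a_comm)
      then show ?thesis using True L assms by (intro bexI[of _ "[]"]) (auto simp: str_add)
    next
      case False
      then obtain ds where ds: "ds \<in> lists (carrier k)" "length cs = Suc (length ds)"
        "?h cs \<ominus>\<^bsub>R\<^esub> str R (?g cs) = (y \<ominus>\<^bsub>R\<^esub> str R a) \<otimes>\<^bsub>R\<^esub> ?h ds"
        using snoc.IH L by blast
      obtain es where es: "es \<in> lists (carrier k)" "length es = length cs"
        "?h es = ?h cs \<oplus>\<^bsub>R\<^esub> str R a \<otimes>\<^bsub>R\<^esub> ?h ds"
        using horner_add[OF assms(1,2) ds(1) L(1) ds(2)] by blast
      let ?a = "str R a" and ?c = "str R c" and ?G = "str R (?g cs)"
      have cl: "?a \<in> carrier R" "?c \<in> carrier R" "?G \<in> carrier R" "?h cs \<in> carrier R" "?h ds \<in> carrier R"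
        using L ds h assms by auto
      have "?h (cs @ [c]) \<ominus>\<^bsub>R\<^esub> str R (?g (cs @ [c])) = (?h cs \<otimes>\<^bsub>R\<^esub> y \<oplus>\<^bsub>R\<^esub> ?c) \<ominus>\<^bsub>R\<^esub> (?G \<otimes>\<^bsub>R\<^esub> ?a \<oplus>\<^bsub>R\<^esub> ?c)"
        using L h assms by (simp add: str_add str_mult)
      also have "\<dots> = ?h cs \<otimes>\<^bsub>R\<^esub> y \<ominus>\<^bsub>R\<^esub> ?G \<otimes>\<^bsub>R\<^esub> ?a"
        using R.add_minus_cancel[of ?c "?h cs \<otimes>\<^bsub>R\<^esub> y" "?G \<otimes>\<^bsub>R\<^esub> ?a"] cl assms by (simp add: R.a_comm)
      also have "\<dots> = (y \<ominus>\<^bsub>R\<^esub> ?a) \<otimes>\<^bsub>R\<^esub> ?h cs \<oplus>\<^bsub>R\<^esub> ?a \<otimes>\<^bsub>R\<^esub> (?h cs \<ominus>\<^bsub>R\<^esub> ?G)"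
        using cl assms
        by (simp add: a_minus_def R.l_distr R.r_distr R.l_minus R.r_minus R.a_assoc R.r_neg1 R.r_neg2 R.m_comm)
      also have "\<dots> = (y \<ominus>\<^bsub>R\<^esub> ?a) \<otimes>\<^bsub>R\<^esub> ?h cs \<oplus>\<^bsub>R\<^esub> (y \<ominus>\<^bsub>R\<^esub> ?a) \<otimes>\<^bsub>R\<^esub> (?a \<otimes>\<^bsub>R\<^esub> ?h ds)"
        unfolding ds(3) using cl assms by (simp add: R.m_lcomm)
      also have "\<dots> = (y \<ominus>\<^bsub>R\<^esub> ?a) \<otimes>\<^bsub>R\<^esub> ?h es"
        unfolding es(3) using cl assms by (simp add: R.r_distr)
      finally show ?thesis using es(1,2) by (intro bexI[of _ es]) auto
    qed
  qed simp
  then show thesis using that by blast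
qed

text \<open>An ideal that is maximal among those avoiding an idempotent \<open>f\<close> behaves like a prime ideal
  on \<open>f\<close>: a product of factors can only be caught by catching one of them.\<close>

lemma (in algebra_over) root_mod_maximal:
  assumes sp: "splits_monic k" and M: "ksub R (self_alg R) M" and f: "f \<in> carrier R" "f \<otimes>\<^bsub>R\<^esub> f = f" "f \<notin> M"
    and max: "\<And>N. ksub R (self_alg R) N \<Longrightarrow> M \<subseteq> N \<Longrightarrow> f \<notin> N \<Longrightarrow> N = M"
    and y: "y \<in> carrier R"
  shows "cs \<in> lists (carrier k) \<Longrightarrow> foldl (\<lambda>w c. w \<otimes>\<^bsub>R\<^esub> y \<oplus>\<^bsub>R\<^esub> str R c) \<one>\<^bsub>R\<^esub> cs \<otimes>\<^bsub>R\<^esub> f \<in> M \<Longrightarrow>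
    \<exists>a \<in> carrier k. (y \<ominus>\<^bsub>R\<^esub> str R a) \<otimes>\<^bsub>R\<^esub> f \<in> M"
proof (induction "length cs" arbitrary: cs)
  case 0
  then show ?case using f by simp
next
  case (Suc n)
  let ?h = "foldl (\<lambda>w c. w \<otimes>\<^bsub>R\<^esub> y \<oplus>\<^bsub>R\<^esub> str R c) \<one>\<^bsub>R\<^esub>"
  interpret self: algebra_over R "self_alg R" by (rule R.self_alg)
  note MD = ksubD[OF M, unfolded smul_def, simplified]
  have ne: "cs \<noteq> []" using Suc.hyps(2) by auto
  obtain a where a: "a \<in> carrier k" "foldl (\<lambda>w c. w \<otimes>\<^bsub>k\<^esub> a \<oplus>\<^bsub>k\<^esub> c) \<one>\<^bsub>k\<^esub> cs = \<zero>\<^bsub>k\<^esub>"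
    using sp ne Suc.prems(1) by (auto simp: splits_monic_def)
  obtain ds where ds: "ds \<in> lists (carrier k)" "length cs = Suc (length ds)"
    "?h cs \<ominus>\<^bsub>R\<^esub> str R (foldl (\<lambda>w c. w \<otimes>\<^bsub>k\<^esub> a \<oplus>\<^bsub>k\<^esub> c) \<one>\<^bsub>k\<^esub> cs) = (y \<ominus>\<^bsub>R\<^esub> str R a) \<otimes>\<^bsub>R\<^esub> ?h ds"
    by (rule horner_divide[OF a(1) y Suc.prems(1) ne])
  have h: "?h es \<in> carrier R" if "es \<in> lists (carrier k)" for es
    using that by (induction es rule: rev_induct) (use y in auto)
  let ?z = "y \<ominus>\<^bsub>R\<^esub> str R a"
  have z: "?z \<in> carrier R" using y a by simp
  have eq: "?h cs = ?z \<otimes>\<^bsub>R\<^esub> ?h ds" using ds(3) a h[OF Suc.prems(1)] by (simp add: a_minus_def)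
  show ?case
  proof (cases "?z \<otimes>\<^bsub>R\<^esub> f \<in> M")
    case True
    then show ?thesis using a by blast
  next
    case False
    \<comment> \<open>The ideal generated by \<open>M\<close> and \<open>?z\<close> times
      \<open>f\<close>. It is strictly larger than \<open>M\<close>, so maximality forces it to
      contain \<open>f\<close>.\<close>
    let ?N = "{m \<oplus>\<^bsub>R\<^esub> x \<otimes>\<^bsub>R\<^esub> (?z \<otimes>\<^bsub>R\<^esub> f) | m x. m \<in> M \<and> x \<in> carrier R}"
    have "ksub R (self_alg R) ?N" unfolding ksub_def
    proof (intro conjI ballI)
      show "?N \<subseteq> carrier (self_alg R)" using MD(1) z f by auto
      show "\<zero>\<^bsub>self_alg R\<^esub> \<in> ?N" using MD(2) z f by (auto intro!: exI[of _ "\<zero>\<^bsub>R\<^esub>"])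
      fix u v assume "u \<in> ?N" "v \<in> ?N"
      then obtain m x n w where "m \<in> M" "n \<in> M" "x \<in> carrier R" "w \<in> carrier R"
        "u = m \<oplus>\<^bsub>R\<^esub> x \<otimes>\<^bsub>R\<^esub> (?z \<otimes>\<^bsub>R\<^esub> f)" "v = n \<oplus>\<^bsub>R\<^esub> w \<otimes>\<^bsub>R\<^esub> (?z \<otimes>\<^bsub>R\<^esub> f)" by auto
      moreover from this have "u \<oplus>\<^bsub>R\<^esub> v = (m \<oplus>\<^bsub>R\<^esub> n) \<oplus>\<^bsub>R\<^esub> (x \<oplus>\<^bsub>R\<^esub> w) \<otimes>\<^bsub>R\<^esub> (?z \<otimes>\<^bsub>R\<^esub> f)"
        using MD(1) z f(1) by (simp add: R.l_distr R.a_ac)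
      ultimately show "u \<oplus>\<^bsub>self_alg R\<^esub> v \<in> ?N" using MD(3) by auto
    next
      fix c u assume c: "c \<in> carrier R" and "u \<in> ?N"
      then obtain m x where "m \<in> M" "x \<in> carrier R" "u = m \<oplus>\<^bsub>R\<^esub> x \<otimes>\<^bsub>R\<^esub> (?z \<otimes>\<^bsub>R\<^esub> f)" by auto
      moreover from this have "c \<otimes>\<^bsub>R\<^esub> u = c \<otimes>\<^bsub>R\<^esub> m \<oplus>\<^bsub>R\<^esub> (c \<otimes>\<^bsub>R\<^esub> x) \<otimes>\<^bsub>R\<^esub> (?z \<otimes>\<^bsub>R\<^esub> f)"
        using MD(1) z f(1) c by (simp add: R.r_distr R.m_assoc)
      ultimately show "smul (self_alg R) c u \<in> ?N" using MD(4)[OF c] c R.m_closed by (auto simp: smul_def)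
    qed
    moreover have "M \<subseteq> ?N"
    proof
      fix m assume "m \<in> M"
      moreover have "m = m \<oplus>\<^bsub>R\<^esub> \<zero>\<^bsub>R\<^esub> \<otimes>\<^bsub>R\<^esub> (?z \<otimes>\<^bsub>R\<^esub> f)" using z f MD(1)[OF calculation] by simp
      ultimately show "m \<in> ?N" using R.zero_closed by blast
    qed
    moreover have "?N \<noteq> M"
    proof -
      have "?z \<otimes>\<^bsub>R\<^esub> f = \<zero>\<^bsub>R\<^esub> \<oplus>\<^bsub>R\<^esub> \<one>\<^bsub>R\<^esub> \<otimes>\<^bsub>R\<^esub> (?z \<otimes>\<^bsub>R\<^esub> f)" using z f by simp
      then have "?z \<otimes>\<^bsub>R\<^esub> f \<in> ?N" using MD(2) R.one_closed by blast
      then show ?thesis using False by blast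
    qed
    ultimately have "f \<in> ?N" using max by blast
    then obtain m x where mx: "m \<in> M" "x \<in> carrier R" "f = m \<oplus>\<^bsub>R\<^esub> x \<otimes>\<^bsub>R\<^esub> (?z \<otimes>\<^bsub>R\<^esub> f)" by blast
    \<comment> \<open>Multiplying the expression for \<open>f\<close> by the quotient turns its
      second summand into a multiple of the value of \<open>cs\<close> times \<open>f\<close>, which
      is in \<open>M\<close>. The quotient thus satisfies the hypothesis in place of
      \<open>cs\<close>, with one coefficient less.\<close>
    have "?h ds \<otimes>\<^bsub>R\<^esub> f = ?h ds \<otimes>\<^bsub>R\<^esub> (m \<oplus>\<^bsub>R\<^esub> x \<otimes>\<^bsub>R\<^esub> (?z \<otimes>\<^bsub>R\<^esub> f))" using mx(3) by simp
    also have "\<dots> = ?h ds \<otimes>\<^bsub>R\<^esub> m \<oplus>\<^bsub>R\<^esub> x \<otimes>\<^bsub>R\<^esub> (?h cs \<otimes>\<^bsub>R\<^esub> f)"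
      unfolding eq using h[OF ds(1)] mx(1,2) MD(1) z f(1) by (simp add: R.r_distr R.m_ac)
    also have "\<dots> \<in> M" using MD(3,4) h[OF ds(1)] mx Suc.prems(2) by blast
    finally show ?thesis using Suc.hyps ds by auto
  qed
qed

text \<open>A change of the structure map: it makes \<open>R \<otimes> L\<close> an algebra over
  \<open>L\<close>, and the algebraic closure an algebra over \<open>k\<close>.\<close>

definition alg_on :: "('a, 'm) ring_scheme \<Rightarrow> ('l \<Rightarrow> 'a) \<Rightarrow> ('l, 'a) salg"
  where "alg_on T j = \<lparr> carrier = carrier T, monoid.mult = monoid.mult T, monoid.one = monoid.one T,
    ring.zero = ring.zero T, ring.add = ring.add T, sig = (\<lambda>x. x), str = j \<rparr>"

lemma alg_on_simps [simp]:
  "carrier (alg_on T j) = carrier T" "monoid.mult (alg_on T j) = monoid.mult T" "monoid.one (alg_on T j) = monoid.one T"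
  "ring.zero (alg_on T j) = ring.zero T" "ring.add (alg_on T j) = ring.add T" "str (alg_on T j) = j"
  by (simp_all add: alg_on_def)

lemma (in cring) alg_on_cring: "cring (alg_on R j)"
proof (intro cringI abelian_groupI comm_monoidI)
  fix x assume "x \<in> carrier (alg_on R j)"
  then show "\<exists>y\<in>carrier (alg_on R j). y \<oplus>\<^bsub>alg_on R j\<^esub> x = \<zero>\<^bsub>alg_on R j\<^esub>"
    by (intro bexI[of _ "\<ominus> x"]) (auto simp: l_neg)
qed (auto simp: a_ac m_ac l_distr r_distr)

lemma (in cring) alg_on_algebra: "cring L \<Longrightarrow> j \<in> ring_hom L R \<Longrightarrow> algebra_over L (alg_on R j)"
  using alg_on_cring[of j] by (auto simp: algebra_over_def algebra_over_axioms_def ring_hom_def)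

section \<open>Splitting an algebra that has a separability idempotent\<close>

locale splitting = tensor_product_field k R L E b + L: field L
  for k :: "('k, 'm) ring_scheme" and R :: "('k, 'a) salg" and L :: "('k, 'l) salg" and E :: "('k, 'c) salg" and b +
  fixes xs
  assumes splits: "splits_monic L" and sep: "sep_idem k R xs"
begin

abbreviation "EL \<equiv> alg_on E (b \<one>\<^bsub>R\<^esub>)"

lemma EL: "algebra_over_field L EL"
  using T.R.alg_on_algebra[OF S.R.is_cring b_hom_right] L.field_axioms by (simp add: algebra_over_field_def)

text \<open>The ideal \<open>e E\<close> is a line over \<open>L\<close>: such an \<open>e\<close>
  is the unit of a direct factor \<open>L\<close> of \<open>E\<close>. Stating this through scalars
  avoids quotient rings.\<close>

definition rank1 :: "'c \<Rightarrow> bool" where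
  "rank1 e \<longleftrightarrow> e \<in> carrier E \<and> e \<noteq> \<zero>\<^bsub>E\<^esub> \<and> e \<otimes>\<^bsub>E\<^esub> e = e \<and>
    (\<forall>x \<in> carrier E. \<exists>c \<in> carrier L. x \<otimes>\<^bsub>E\<^esub> e = b \<one>\<^bsub>R\<^esub> c \<otimes>\<^bsub>E\<^esub> e)"

lemma minus_EL [simp]: "x \<in> carrier E \<Longrightarrow> y \<in> carrier E \<Longrightarrow> x \<ominus>\<^bsub>EL\<^esub> y = x \<ominus>\<^bsub>E\<^esub> y"
  by (simp add: a_minus_def a_inv_def m_inv_def)

lemma b_right_uminus: "c \<in> carrier L \<Longrightarrow> b \<one>\<^bsub>R\<^esub> (\<ominus>\<^bsub>L\<^esub> c) = \<ominus>\<^bsub>E\<^esub> b \<one>\<^bsub>R\<^esub> c"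
  by (rule additive_minus[OF S.R.abelian_group_axioms T.R.abelian_group_axioms b_additive_right]) auto

lemma rank1_coef_unique:
  assumes e: "e \<in> carrier E" "e \<noteq> \<zero>\<^bsub>E\<^esub>" and c: "c \<in> carrier L" "d \<in> carrier L"
    and eq: "b \<one>\<^bsub>R\<^esub> c \<otimes>\<^bsub>E\<^esub> e = b \<one>\<^bsub>R\<^esub> d \<otimes>\<^bsub>E\<^esub> e"
  shows "c = d"
proof (rule ccontr)
  assume "c \<noteq> d"
  then have U: "c \<ominus>\<^bsub>L\<^esub> d \<in> Units L" using c by (simp add: L.field_Units)
  have z: "b \<one>\<^bsub>R\<^esub> (c \<ominus>\<^bsub>L\<^esub> d) \<otimes>\<^bsub>E\<^esub> e = \<zero>\<^bsub>E\<^esub>"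
    using eq e c by (simp add: a_minus_def b_add_right b_right_uminus T.R.l_distr T.R.l_minus T.R.r_neg)
  have "e = b \<one>\<^bsub>R\<^esub> (inv\<^bsub>L\<^esub> (c \<ominus>\<^bsub>L\<^esub> d) \<otimes>\<^bsub>L\<^esub> (c \<ominus>\<^bsub>L\<^esub> d)) \<otimes>\<^bsub>E\<^esub> e" using U e by simp
  also have "\<dots> = b \<one>\<^bsub>R\<^esub> (inv\<^bsub>L\<^esub> (c \<ominus>\<^bsub>L\<^esub> d)) \<otimes>\<^bsub>E\<^esub> (b \<one>\<^bsub>R\<^esub> (c \<ominus>\<^bsub>L\<^esub> d) \<otimes>\<^bsub>E\<^esub> e)"
    using U e c b_mult[of "\<one>\<^bsub>R\<^esub>" "\<one>\<^bsub>R\<^esub>" "inv\<^bsub>L\<^esub> (c \<ominus>\<^bsub>L\<^esub> d)" "c \<ominus>\<^bsub>L\<^esub> d"]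
    by (simp add: T.R.m_assoc[symmetric])
  also have "\<dots> = \<zero>\<^bsub>E\<^esub>" using z U by simp
  finally show False using e by simp
qed

text \<open>On the line \<open>e E\<close> the idempotent \<open>g\<close> acts as a scalar
  \<open>c\<close> of the field \<open>L\<close> with \<open>c c = c\<close>, so \<open>c\<close> is
  \<open>0\<close> or \<open>1\<close>.\<close>

lemma rank1_mult_idem:
  assumes e: "rank1 e" and g: "g \<in> carrier E" "g \<otimes>\<^bsub>E\<^esub> g = g"
  shows "e \<otimes>\<^bsub>E\<^esub> g = \<zero>\<^bsub>E\<^esub> \<or> e \<otimes>\<^bsub>E\<^esub> g = e"
proof -
  have eE: "e \<in> carrier E" "e \<noteq> \<zero>\<^bsub>E\<^esub>" "e \<otimes>\<^bsub>E\<^esub> e = e" using e by (auto simp: rank1_def)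
  obtain c where c: "c \<in> carrier L" "g \<otimes>\<^bsub>E\<^esub> e = b \<one>\<^bsub>R\<^esub> c \<otimes>\<^bsub>E\<^esub> e" using e g by (auto simp: rank1_def)
  have "b \<one>\<^bsub>R\<^esub> (c \<otimes>\<^bsub>L\<^esub> c) \<otimes>\<^bsub>E\<^esub> e = b \<one>\<^bsub>R\<^esub> c \<otimes>\<^bsub>E\<^esub> (b \<one>\<^bsub>R\<^esub> c \<otimes>\<^bsub>E\<^esub> e)"
    using b_mult[of "\<one>\<^bsub>R\<^esub>" "\<one>\<^bsub>R\<^esub>" c c] c eE by (simp add: T.R.m_assoc[symmetric])
  also have "\<dots> = g \<otimes>\<^bsub>E\<^esub> (b \<one>\<^bsub>R\<^esub> c \<otimes>\<^bsub>E\<^esub> e)" using c g eE by (simp add: T.R.m_lcomm c(2)[symmetric])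
  also have "\<dots> = (g \<otimes>\<^bsub>E\<^esub> g) \<otimes>\<^bsub>E\<^esub> e" using c(2)[symmetric] g(1) eE by (simp add: T.R.m_assoc)
  also have "\<dots> = b \<one>\<^bsub>R\<^esub> c \<otimes>\<^bsub>E\<^esub> e" using g c by simp
  finally have "c \<otimes>\<^bsub>L\<^esub> c = c" using rank1_coef_unique[OF eE(1,2)] c by simp
  then have "c \<otimes>\<^bsub>L\<^esub> (c \<ominus>\<^bsub>L\<^esub> \<one>\<^bsub>L\<^esub>) = \<zero>\<^bsub>L\<^esub>" using c by (simp add: a_minus_def S.R.r_distr S.R.r_minus S.R.r_neg)
  then have "c = \<zero>\<^bsub>L\<^esub> \<or> c = \<one>\<^bsub>L\<^esub>" using L.integral[of c "c \<ominus>\<^bsub>L\<^esub> \<one>\<^bsub>L\<^esub>"] c by auto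
  then show ?thesis using c(2) eE g by (auto simp: T.R.m_comm)
qed

lemma R_basis: obtains us f where "R.dual us f" "carrier R = lspan k R us"
  by (rule sep_idem_basis[OF R.algebra_over_field_axioms sep]) blast

lemma eigen_extend:
  assumes e: "e \<in> carrier E" and eig: "\<And>r. r \<in> carrier R \<Longrightarrow> \<exists>c \<in> carrier L. b r \<one>\<^bsub>L\<^esub> \<otimes>\<^bsub>E\<^esub> e = b \<one>\<^bsub>R\<^esub> c \<otimes>\<^bsub>E\<^esub> e"
    and x: "x \<in> carrier E"
  shows "\<exists>c \<in> carrier L. x \<otimes>\<^bsub>E\<^esub> e = b \<one>\<^bsub>R\<^esub> c \<otimes>\<^bsub>E\<^esub> e"
  using x
proof (induction rule: tensor_induct)
  case zero
  then show ?case using e by (intro bexI[of _ "\<zero>\<^bsub>L\<^esub>"]) auto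
next
  case (add r s t)
  then obtain c d where c: "c \<in> carrier L" "t \<otimes>\<^bsub>E\<^esub> e = b \<one>\<^bsub>R\<^esub> c \<otimes>\<^bsub>E\<^esub> e"
    and d: "d \<in> carrier L" "b r \<one>\<^bsub>L\<^esub> \<otimes>\<^bsub>E\<^esub> e = b \<one>\<^bsub>R\<^esub> d \<otimes>\<^bsub>E\<^esub> e" using eig by blast
  have "b r s \<otimes>\<^bsub>E\<^esub> e = b \<one>\<^bsub>R\<^esub> s \<otimes>\<^bsub>E\<^esub> (b r \<one>\<^bsub>L\<^esub> \<otimes>\<^bsub>E\<^esub> e)"
    using add e b_mult[of "\<one>\<^bsub>R\<^esub>" r s "\<one>\<^bsub>L\<^esub>"] by (simp add: T.R.m_assoc[symmetric])
  also have "\<dots> = b \<one>\<^bsub>R\<^esub> (s \<otimes>\<^bsub>L\<^esub> d) \<otimes>\<^bsub>E\<^esub> e"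
    unfolding d(2) using d(1) add e b_mult[of "\<one>\<^bsub>R\<^esub>" "\<one>\<^bsub>R\<^esub>" s d] by (simp add: T.R.m_assoc[symmetric])
  finally have "(b r s \<oplus>\<^bsub>E\<^esub> t) \<otimes>\<^bsub>E\<^esub> e = b \<one>\<^bsub>R\<^esub> (s \<otimes>\<^bsub>L\<^esub> d \<oplus>\<^bsub>L\<^esub> c) \<otimes>\<^bsub>E\<^esub> e"
    using add c d e by (simp add: T.R.l_distr b_add_right)
  then show ?case using add c d by (intro bexI[of _ "s \<otimes>\<^bsub>L\<^esub> d \<oplus>\<^bsub>L\<^esub> c"]) auto
qed

text \<open>An ideal \<open>M\<close> maximal among those avoiding \<open>g\<close> behaves like a
  point of the spectrum of \<open>E\<close> at which \<open>g\<close> does not vanish. The elements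
  of \<open>R\<close> have values in \<open>L\<close> there, which form a character
  \<open>\<chi>\<close>. The separability idempotent, evaluated at \<open>r \<otimes> 1\<close> on
  one side and \<open>1 \<otimes> \<chi> r\<close> on the other, is an idempotent \<open>e\<close>
  on which every \<open>r\<close> acts as \<open>\<chi> r\<close>. It does not vanish at the point,
  hence \<open>e g\<close> is nonzero, and then \<open>e g = e\<close>.\<close>

lemma exists_rank1:
  assumes g: "g \<in> carrier E" "g \<otimes>\<^bsub>E\<^esub> g = g" "g \<noteq> \<zero>\<^bsub>E\<^esub>"
  shows "\<exists>e. rank1 e \<and> e \<otimes>\<^bsub>E\<^esub> g = e"
proof -
  interpret EL: algebra_over_field L EL by (rule EL)
  interpret self: algebra_over EL "self_alg EL" by (rule EL.R.self_alg)
  have "ksub EL (self_alg EL) {\<zero>\<^bsub>E\<^esub>}" using self.lspan_ksub[of "[]"] by simp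
  then obtain M where M: "ksub EL (self_alg EL) M" "g \<notin> M"
    and max: "\<And>N. ksub EL (self_alg EL) N \<Longrightarrow> M \<subseteq> N \<Longrightarrow> g \<notin> N \<Longrightarrow> N = M"
    using self.ksub_maximal[of "{\<zero>\<^bsub>E\<^esub>}" g] g(3) by (metis singletonD)
  note MD = ksubD[OF M(1), unfolded smul_def, simplified]
  have Mum: "\<ominus>\<^bsub>E\<^esub> m \<in> M" if "m \<in> M" for m
    using MD(4)[of "\<ominus>\<^bsub>E\<^esub> \<one>\<^bsub>E\<^esub>" m] MD(1) that by (simp add: T.R.l_minus)
  \<comment> \<open>\<open>ok y a\<close> expresses that \<open>y\<close> has the value
    \<open>a\<close> at the point given by \<open>M\<close>: the two become congruent modulo
    \<open>M\<close> after multiplication by \<open>g\<close>.\<close>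
  define ok where "ok y a \<longleftrightarrow> (y \<ominus>\<^bsub>E\<^esub> b \<one>\<^bsub>R\<^esub> a) \<otimes>\<^bsub>E\<^esub> g \<in> M" for y a
  have ok_add: "ok (y \<oplus>\<^bsub>E\<^esub> z) (a \<oplus>\<^bsub>L\<^esub> c)"
    if "y \<in> carrier E" "z \<in> carrier E" "a \<in> carrier L" "c \<in> carrier L" "ok y a" "ok z c" for y z a c
  proof -
    have "(y \<ominus>\<^bsub>E\<^esub> b \<one>\<^bsub>R\<^esub> a) \<otimes>\<^bsub>E\<^esub> g \<oplus>\<^bsub>E\<^esub> (z \<ominus>\<^bsub>E\<^esub> b \<one>\<^bsub>R\<^esub> c) \<otimes>\<^bsub>E\<^esub> g \<in> M"
      using that MD(3) by (simp add: ok_def)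
    moreover have "(y \<ominus>\<^bsub>E\<^esub> b \<one>\<^bsub>R\<^esub> a) \<otimes>\<^bsub>E\<^esub> g \<oplus>\<^bsub>E\<^esub> (z \<ominus>\<^bsub>E\<^esub> b \<one>\<^bsub>R\<^esub> c) \<otimes>\<^bsub>E\<^esub> g =
      ((y \<oplus>\<^bsub>E\<^esub> z) \<ominus>\<^bsub>E\<^esub> b \<one>\<^bsub>R\<^esub> (a \<oplus>\<^bsub>L\<^esub> c)) \<otimes>\<^bsub>E\<^esub> g"
      using that(1-4) g(1) by (simp add: a_minus_def T.R.l_distr[symmetric] b_add_right T.R.minus_add T.R.a_ac)
    ultimately show ?thesis by (simp add: ok_def)
  qed
  have ok_mult: "ok (y \<otimes>\<^bsub>E\<^esub> z) (a \<otimes>\<^bsub>L\<^esub> c)"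
    if "y \<in> carrier E" "z \<in> carrier E" "a \<in> carrier L" "c \<in> carrier L" "ok y a" "ok z c" for y z a c
  proof -
    let ?a = "b \<one>\<^bsub>R\<^esub> a" and ?c = "b \<one>\<^bsub>R\<^esub> c"
    have cl: "?a \<in> carrier E" "?c \<in> carrier E" using that by auto
    have bm: "b \<one>\<^bsub>R\<^esub> (a \<otimes>\<^bsub>L\<^esub> c) = ?a \<otimes>\<^bsub>E\<^esub> ?c" using that b_mult[of "\<one>\<^bsub>R\<^esub>" "\<one>\<^bsub>R\<^esub>" a c] by simp
    have "y \<otimes>\<^bsub>E\<^esub> ((z \<ominus>\<^bsub>E\<^esub> ?c) \<otimes>\<^bsub>E\<^esub> g) \<oplus>\<^bsub>E\<^esub> ?c \<otimes>\<^bsub>E\<^esub> ((y \<ominus>\<^bsub>E\<^esub> ?a) \<otimes>\<^bsub>E\<^esub> g) \<in> M"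
      using that cl MD(3,4) by (simp add: ok_def)
    moreover have "y \<otimes>\<^bsub>E\<^esub> ((z \<ominus>\<^bsub>E\<^esub> ?c) \<otimes>\<^bsub>E\<^esub> g) \<oplus>\<^bsub>E\<^esub> ?c \<otimes>\<^bsub>E\<^esub> ((y \<ominus>\<^bsub>E\<^esub> ?a) \<otimes>\<^bsub>E\<^esub> g) =
      (y \<otimes>\<^bsub>E\<^esub> (z \<ominus>\<^bsub>E\<^esub> ?c) \<oplus>\<^bsub>E\<^esub> ?c \<otimes>\<^bsub>E\<^esub> (y \<ominus>\<^bsub>E\<^esub> ?a)) \<otimes>\<^bsub>E\<^esub> g"
      using that(1,2) cl g(1) by (simp add: T.R.l_distr T.R.m_assoc)
    moreover have "y \<otimes>\<^bsub>E\<^esub> (z \<ominus>\<^bsub>E\<^esub> ?c) \<oplus>\<^bsub>E\<^esub> ?c \<otimes>\<^bsub>E\<^esub> (y \<ominus>\<^bsub>E\<^esub> ?a) = y \<otimes>\<^bsub>E\<^esub> z \<ominus>\<^bsub>E\<^esub> ?a \<otimes>\<^bsub>E\<^esub> ?c"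
      using that(1,2) cl
      by (simp add: a_minus_def T.R.r_distr T.R.r_minus T.R.a_assoc T.R.r_neg1 T.R.m_comm)
    ultimately show ?thesis by (simp add: ok_def bm)
  qed
  have ok_const: "ok (b \<one>\<^bsub>R\<^esub> c) c" if "c \<in> carrier L" for c
    using that MD(2) g(1) by (simp add: ok_def a_minus_def T.R.r_neg)
  \<comment> \<open>The difference of two values would be a unit of \<open>L\<close> whose product
    with \<open>g\<close> is in \<open>M\<close>, so \<open>g\<close> itself would be in
    \<open>M\<close>.\<close>
  have ok_unique: "a = c" if ac: "y \<in> carrier E" "a \<in> carrier L" "c \<in> carrier L" "ok y a" "ok y c" for y a c
  proof (rule ccontr)
    assume "a \<noteq> c"
    then have U: "a \<ominus>\<^bsub>L\<^esub> c \<in> Units L" using ac by (simp add: L.field_Units)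
    have "\<ominus>\<^bsub>E\<^esub> ((y \<ominus>\<^bsub>E\<^esub> b \<one>\<^bsub>R\<^esub> a) \<otimes>\<^bsub>E\<^esub> g) \<oplus>\<^bsub>E\<^esub> (y \<ominus>\<^bsub>E\<^esub> b \<one>\<^bsub>R\<^esub> c) \<otimes>\<^bsub>E\<^esub> g \<in> M"
      using ac MD(3) Mum by (simp add: ok_def)
    moreover have "\<ominus>\<^bsub>E\<^esub> ((y \<ominus>\<^bsub>E\<^esub> b \<one>\<^bsub>R\<^esub> a) \<otimes>\<^bsub>E\<^esub> g) \<oplus>\<^bsub>E\<^esub> (y \<ominus>\<^bsub>E\<^esub> b \<one>\<^bsub>R\<^esub> c) \<otimes>\<^bsub>E\<^esub> g = b \<one>\<^bsub>R\<^esub> (a \<ominus>\<^bsub>L\<^esub> c) \<otimes>\<^bsub>E\<^esub> g"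
    proof -
      have "\<ominus>\<^bsub>E\<^esub> ((y \<ominus>\<^bsub>E\<^esub> b \<one>\<^bsub>R\<^esub> a) \<otimes>\<^bsub>E\<^esub> g) \<oplus>\<^bsub>E\<^esub> (y \<ominus>\<^bsub>E\<^esub> b \<one>\<^bsub>R\<^esub> c) \<otimes>\<^bsub>E\<^esub> g =
        ((y \<ominus>\<^bsub>E\<^esub> b \<one>\<^bsub>R\<^esub> c) \<ominus>\<^bsub>E\<^esub> (y \<ominus>\<^bsub>E\<^esub> b \<one>\<^bsub>R\<^esub> a)) \<otimes>\<^bsub>E\<^esub> g"
        using ac(1-3) g(1) by (simp add: a_minus_def T.R.l_distr[symmetric] T.R.l_minus[symmetric] T.R.a_comm)
      also have "(y \<ominus>\<^bsub>E\<^esub> b \<one>\<^bsub>R\<^esub> c) \<ominus>\<^bsub>E\<^esub> (y \<ominus>\<^bsub>E\<^esub> b \<one>\<^bsub>R\<^esub> a) = \<ominus>\<^bsub>E\<^esub> b \<one>\<^bsub>R\<^esub> c \<ominus>\<^bsub>E\<^esub> (\<ominus>\<^bsub>E\<^esub> b \<one>\<^bsub>R\<^esub> a)"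
        using ac(1-3) T.R.add_minus_cancel[of y "\<ominus>\<^bsub>E\<^esub> b \<one>\<^bsub>R\<^esub> c" "\<ominus>\<^bsub>E\<^esub> b \<one>\<^bsub>R\<^esub> a"] by (simp add: a_minus_def)
      also have "\<dots> = b \<one>\<^bsub>R\<^esub> (a \<ominus>\<^bsub>L\<^esub> c)"
        using ac(1-3) by (simp add: a_minus_def b_add_right b_right_uminus T.R.a_comm)
      finally show ?thesis .
    qed
    ultimately have "b \<one>\<^bsub>R\<^esub> (a \<ominus>\<^bsub>L\<^esub> c) \<otimes>\<^bsub>E\<^esub> g \<in> M" by simp
    then have "b \<one>\<^bsub>R\<^esub> (inv\<^bsub>L\<^esub> (a \<ominus>\<^bsub>L\<^esub> c)) \<otimes>\<^bsub>E\<^esub> (b \<one>\<^bsub>R\<^esub> (a \<ominus>\<^bsub>L\<^esub> c) \<otimes>\<^bsub>E\<^esub> g) \<in> M"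
      using U MD(4) by simp
    moreover have "b \<one>\<^bsub>R\<^esub> (inv\<^bsub>L\<^esub> (a \<ominus>\<^bsub>L\<^esub> c)) \<otimes>\<^bsub>E\<^esub> (b \<one>\<^bsub>R\<^esub> (a \<ominus>\<^bsub>L\<^esub> c) \<otimes>\<^bsub>E\<^esub> g) = g"
      using U g(1) ac b_mult[of "\<one>\<^bsub>R\<^esub>" "\<one>\<^bsub>R\<^esub>" "inv\<^bsub>L\<^esub> (a \<ominus>\<^bsub>L\<^esub> c)" "a \<ominus>\<^bsub>L\<^esub> c"]
      by (simp add: T.R.m_assoc[symmetric])
    ultimately show False using M(2) by simp
  qed
  obtain us f where us: "R.dual us f" "carrier R = lspan k R us" by (rule R_basis)
  \<comment> \<open>The monic equation of \<open>r\<close> over \<open>k\<close> becomes an equation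
    over \<open>L\<close> for its image in \<open>E\<close>. Its value zero lies in
    \<open>M\<close>, and \<open>root_mod_maximal\<close> picks a root in \<open>L\<close> that is a
    value of \<open>r\<close>.\<close>
  have "\<exists>a \<in> carrier L. ok (b r \<one>\<^bsub>L\<^esub>) a" if r: "r \<in> carrier R" for r
  proof -
    obtain ds where ds: "ds \<in> lists (carrier k)" "foldl (\<lambda>w c. w \<otimes>\<^bsub>R\<^esub> r \<oplus>\<^bsub>R\<^esub> str R c) \<one>\<^bsub>R\<^esub> ds = \<zero>\<^bsub>R\<^esub>"
      by (rule R.monic_relation[OF us r])
    let ?cs = "map (str L) ds"
    have fc: "foldl (\<lambda>w c. w \<otimes>\<^bsub>R\<^esub> r \<oplus>\<^bsub>R\<^esub> str R c) \<one>\<^bsub>R\<^esub> es \<in> carrier R" if "es \<in> lists (carrier k)" for es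
      using that by (induction es rule: rev_induct) (use r in auto)
    have "foldl (\<lambda>w c. w \<otimes>\<^bsub>E\<^esub> b r \<one>\<^bsub>L\<^esub> \<oplus>\<^bsub>E\<^esub> b \<one>\<^bsub>R\<^esub> c) \<one>\<^bsub>E\<^esub> (map (str L) es) =
      b (foldl (\<lambda>w c. w \<otimes>\<^bsub>R\<^esub> r \<oplus>\<^bsub>R\<^esub> str R c) \<one>\<^bsub>R\<^esub> es) \<one>\<^bsub>L\<^esub>" if "es \<in> lists (carrier k)" for es
      using that
    proof (induction es rule: rev_induct)
      case (snoc c es)
      then have L: "es \<in> lists (carrier k)" "c \<in> carrier k" by auto
      then show ?case using snoc.IH r fc[OF L(1)]
        by (simp add: b_mult b_add_left b_str[symmetric] b_str_right[symmetric])
    qed simp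
    from this[OF ds(1)] have z: "foldl (\<lambda>w c. w \<otimes>\<^bsub>E\<^esub> b r \<one>\<^bsub>L\<^esub> \<oplus>\<^bsub>E\<^esub> b \<one>\<^bsub>R\<^esub> c) \<one>\<^bsub>E\<^esub> ?cs = \<zero>\<^bsub>E\<^esub>" using ds(2) by simp
    have "\<exists>a \<in> carrier L. (b r \<one>\<^bsub>L\<^esub> \<ominus>\<^bsub>EL\<^esub> str EL a) \<otimes>\<^bsub>EL\<^esub> g \<in> M"
      using EL.root_mod_maximal[OF splits M(1) _ _ M(2) max, of "b r \<one>\<^bsub>L\<^esub>" ?cs] g ds(1) r z MD(2)
      by (auto simp: in_lists_conv_set)
    then show ?thesis using r by (auto simp: ok_def)
  qed
  then obtain \<chi> where \<chi>: "\<And>r. r \<in> carrier R \<Longrightarrow> \<chi> r \<in> carrier L \<and> ok (b r \<one>\<^bsub>L\<^esub>) (\<chi> r)" by metis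
  have \<chi>eq: "\<chi> r = c" if "r \<in> carrier R" "c \<in> carrier L" "ok (b r \<one>\<^bsub>L\<^esub>) c" for r c
    using ok_unique[of "b r \<one>\<^bsub>L\<^esub>"] \<chi> that by simp
  have \<chi>h: "\<chi> \<in> ring_hom R L"
  proof (rule ring_hom_memI)
    fix x y assume xy: "x \<in> carrier R" "y \<in> carrier R"
    show "\<chi> (x \<otimes>\<^bsub>R\<^esub> y) = \<chi> x \<otimes>\<^bsub>L\<^esub> \<chi> y"
      using xy \<chi> ok_mult[of "b x \<one>\<^bsub>L\<^esub>" "b y \<one>\<^bsub>L\<^esub>" "\<chi> x" "\<chi> y"] by (intro \<chi>eq) (auto simp: b_mult)
    show "\<chi> (x \<oplus>\<^bsub>R\<^esub> y) = \<chi> x \<oplus>\<^bsub>L\<^esub> \<chi> y"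
      using xy \<chi> ok_add[of "b x \<one>\<^bsub>L\<^esub>" "b y \<one>\<^bsub>L\<^esub>" "\<chi> x" "\<chi> y"] by (intro \<chi>eq) (auto simp: b_add_left)
  next
    show "\<chi> \<one>\<^bsub>R\<^esub> = \<one>\<^bsub>L\<^esub>" using ok_const[of "\<one>\<^bsub>L\<^esub>"] by (intro \<chi>eq) auto
  qed (use \<chi> in blast)
  have \<chi>s: "\<chi> (str R c) = str L c" if "c \<in> carrier k" for c
    using ok_const[of "str L c"] that by (intro \<chi>eq) (auto simp: b_str[symmetric] b_str_right[symmetric])
  have h2: "(\<lambda>r. b \<one>\<^bsub>R\<^esub> (\<chi> r)) \<in> ring_hom R E"
    using ring_hom_trans[OF \<chi>h b_hom_right] by (simp add: comp_def)
  \<comment> \<open>The image of the separability idempotent under the maps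
    \<open>r \<mapsto> r \<otimes> 1\<close> and \<open>r \<mapsto> 1 \<otimes> \<chi> r\<close>,
    which agree on \<open>k\<close>. Since values are compatible with sums and products, its value
    at the point is \<open>\<chi>\<close> of the product of \<open>xs\<close>, that is
    \<open>1\<close>.\<close>
  define e where "e = tsum E (\<lambda>u v. b u \<one>\<^bsub>L\<^esub> \<otimes>\<^bsub>E\<^esub> b \<one>\<^bsub>R\<^esub> (\<chi> v)) xs"
  have agree: "b (str R c) \<one>\<^bsub>L\<^esub> = b \<one>\<^bsub>R\<^esub> (\<chi> (str R c))" if "c \<in> carrier k" for c
    using that \<chi>s by (simp add: b_str[symmetric] b_str_right[symmetric])
  note E3 = sep_idem_hom[OF R.algebra_over_axioms sep T.R.is_cring b_hom_left h2 agree, folded e_def]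
  have xsL: "xs \<in> lists (carrier R \<times> carrier R)" using sep by (simp add: sep_idem_def)
  have "tsum E (\<lambda>u v. b u \<one>\<^bsub>L\<^esub> \<otimes>\<^bsub>E\<^esub> b \<one>\<^bsub>R\<^esub> (\<chi> v)) ys \<in> carrier E \<and> tsum L (\<lambda>u v. \<chi> u \<otimes>\<^bsub>L\<^esub> \<chi> v) ys \<in> carrier L \<and>
    ok (tsum E (\<lambda>u v. b u \<one>\<^bsub>L\<^esub> \<otimes>\<^bsub>E\<^esub> b \<one>\<^bsub>R\<^esub> (\<chi> v)) ys) (tsum L (\<lambda>u v. \<chi> u \<otimes>\<^bsub>L\<^esub> \<chi> v) ys)"
    if "ys \<in> lists (carrier R \<times> carrier R)" for ys
    using that
  proof (induction ys)
    case Nil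
    then show ?case using ok_const[of "\<zero>\<^bsub>L\<^esub>"] by simp
  next
    case (Cons x ys)
    then have "fst x \<in> carrier R" "snd x \<in> carrier R" by auto
    then show ?case using Cons.IH \<chi> ok_const by (auto intro!: ok_add ok_mult)
  qed
  from this[OF xsL] have "ok e (tsum L (\<lambda>u v. \<chi> u \<otimes>\<^bsub>L\<^esub> \<chi> v) xs)" by (simp add: e_def)
  also have "tsum L (\<lambda>u v. \<chi> u \<otimes>\<^bsub>L\<^esub> \<chi> v) xs = \<chi> (tsum R (\<otimes>\<^bsub>R\<^esub>) xs)"
  proof -
    have "\<chi> (tsum R (\<otimes>\<^bsub>R\<^esub>) xs) = lsum L (map (\<lambda>x. \<chi> (case_prod (\<otimes>\<^bsub>R\<^esub>) x)) xs)" unfolding tsum_def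
      by (rule lsum_map_hom[OF R.R.abelian_group_axioms S.R.abelian_group_axioms ring_hom_additive[OF \<chi>h]])
        (use xsL in \<open>auto simp: in_lists_conv_set\<close>)
    also have "\<dots> = tsum L (\<lambda>u v. \<chi> u \<otimes>\<^bsub>L\<^esub> \<chi> v) xs" unfolding tsum_def
      by (rule lsum_map_cong) (use xsL in \<open>auto simp: in_lists_conv_set ring_hom_mult[OF \<chi>h]\<close>)
    finally show ?thesis by simp
  qed
  also have "\<dots> = \<one>\<^bsub>L\<^esub>" using sep ring_hom_one[OF \<chi>h] by (simp add: sep_idem_def)
  finally have ok1: "(e \<ominus>\<^bsub>E\<^esub> \<one>\<^bsub>E\<^esub>) \<otimes>\<^bsub>E\<^esub> g \<in> M" by (simp add: ok_def)
  \<comment> \<open>If \<open>e g\<close> were zero, value \<open>1\<close> of \<open>e\<close>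
    would say that \<open>-g\<close> lies in \<open>M\<close>.\<close>
  have nz: "e \<otimes>\<^bsub>E\<^esub> g \<noteq> \<zero>\<^bsub>E\<^esub>"
  proof
    assume "e \<otimes>\<^bsub>E\<^esub> g = \<zero>\<^bsub>E\<^esub>"
    then have "(e \<ominus>\<^bsub>E\<^esub> \<one>\<^bsub>E\<^esub>) \<otimes>\<^bsub>E\<^esub> g = \<ominus>\<^bsub>E\<^esub> g" using E3(1) g(1) by (simp add: a_minus_def T.R.l_distr T.R.l_minus)
    then have "g \<in> M" using Mum[OF ok1] g(1) by simp
    then show False using M(2) by simp
  qed
  have "\<exists>c \<in> carrier L. b r \<one>\<^bsub>L\<^esub> \<otimes>\<^bsub>E\<^esub> e = b \<one>\<^bsub>R\<^esub> c \<otimes>\<^bsub>E\<^esub> e" if "r \<in> carrier R" for r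
    using E3(2)[OF _ that] \<chi>[OF that] by blast
  then have "rank1 e" using eigen_extend E3(1,3) nz g(1) by (auto simp: rank1_def)
  then show ?thesis using rank1_mult_idem[OF _ g(1,2)] nz by blast
qed

definition coef :: "'c \<Rightarrow> 'c \<Rightarrow> 'l" where
  "coef e x = (THE c. c \<in> carrier L \<and> x \<otimes>\<^bsub>E\<^esub> e = b \<one>\<^bsub>R\<^esub> c \<otimes>\<^bsub>E\<^esub> e)"

lemma coef:
  assumes "rank1 e" "x \<in> carrier E"
  shows coef_closed: "coef e x \<in> carrier L" and coef_mult: "x \<otimes>\<^bsub>E\<^esub> e = b \<one>\<^bsub>R\<^esub> (coef e x) \<otimes>\<^bsub>E\<^esub> e"
proof -
  have "\<exists>!c. c \<in> carrier L \<and> x \<otimes>\<^bsub>E\<^esub> e = b \<one>\<^bsub>R\<^esub> c \<otimes>\<^bsub>E\<^esub> e"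
    using assms rank1_coef_unique[of e] unfolding rank1_def by metis
  from theI'[OF this] show "coef e x \<in> carrier L" "x \<otimes>\<^bsub>E\<^esub> e = b \<one>\<^bsub>R\<^esub> (coef e x) \<otimes>\<^bsub>E\<^esub> e"
    by (auto simp: coef_def)
qed

lemma coef_eq:
  assumes "rank1 e" "x \<in> carrier E" "c \<in> carrier L" "x \<otimes>\<^bsub>E\<^esub> e = b \<one>\<^bsub>R\<^esub> c \<otimes>\<^bsub>E\<^esub> e"
  shows "coef e x = c"
  using rank1_coef_unique[of e] coef[OF assms(1,2)] assms by (auto simp: rank1_def)

lemma coef_hom: "rank1 e \<Longrightarrow> coef e \<in> ring_hom E L"
proof (rule ring_hom_memI)
  assume e: "rank1 e"
  then have eE: "e \<in> carrier E" by (simp add: rank1_def)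
  note C = coef[OF e]
  show "coef e \<one>\<^bsub>E\<^esub> = \<one>\<^bsub>L\<^esub>" using e by (intro coef_eq) auto
  fix x y assume xy: "x \<in> carrier E" "y \<in> carrier E"
  show "coef e x \<in> carrier L" using C xy by simp
  show "coef e (x \<oplus>\<^bsub>E\<^esub> y) = coef e x \<oplus>\<^bsub>L\<^esub> coef e y"
    using e xy C(1)[OF xy(1)] C(1)[OF xy(2)] C(2)[OF xy(1)] C(2)[OF xy(2)] eE
    by (intro coef_eq) (auto simp: T.R.l_distr b_add_right)
  have "(x \<otimes>\<^bsub>E\<^esub> y) \<otimes>\<^bsub>E\<^esub> e = x \<otimes>\<^bsub>E\<^esub> (b \<one>\<^bsub>R\<^esub> (coef e y) \<otimes>\<^bsub>E\<^esub> e)" using xy eE C(2)[OF xy(2)] by (simp add: T.R.m_assoc)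
  also have "\<dots> = b \<one>\<^bsub>R\<^esub> (coef e y) \<otimes>\<^bsub>E\<^esub> (x \<otimes>\<^bsub>E\<^esub> e)" using xy eE C(1)[OF xy(2)] by (simp add: T.R.m_lcomm)
  also have "\<dots> = b \<one>\<^bsub>R\<^esub> (coef e y) \<otimes>\<^bsub>E\<^esub> (b \<one>\<^bsub>R\<^esub> (coef e x) \<otimes>\<^bsub>E\<^esub> e)" using C(2)[OF xy(1)] by simp
  also have "\<dots> = b \<one>\<^bsub>R\<^esub> (coef e x \<otimes>\<^bsub>L\<^esub> coef e y) \<otimes>\<^bsub>E\<^esub> e"
    using xy eE C(1) b_mult[of "\<one>\<^bsub>R\<^esub>" "\<one>\<^bsub>R\<^esub>" "coef e y" "coef e x"] S.R.m_comm[of "coef e x" "coef e y"]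
    by (simp add: T.R.m_assoc[symmetric])
  finally show "coef e (x \<otimes>\<^bsub>E\<^esub> y) = coef e x \<otimes>\<^bsub>L\<^esub> coef e y" using xy C(1) e by (intro coef_eq) auto
qed

definition orth :: "'c list \<Rightarrow> bool" where
  "orth es \<longleftrightarrow> (\<forall>e \<in> set es. rank1 e) \<and>
    (\<forall>i < length es. \<forall>j < length es. i \<noteq> j \<longrightarrow> es ! i \<otimes>\<^bsub>E\<^esub> es ! j = \<zero>\<^bsub>E\<^esub>)"

lemma orth_coef:
  assumes "orth es" "i < length es" "j < length es"
  shows "coef (es ! i) (es ! j) = (if i = j then \<one>\<^bsub>L\<^esub> else \<zero>\<^bsub>L\<^esub>)"
proof -
  have r: "rank1 (es ! i)" "rank1 (es ! j)" using assms by (auto simp: orth_def)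
  then have E: "es ! i \<in> carrier E" "es ! j \<in> carrier E" "es ! i \<otimes>\<^bsub>E\<^esub> es ! i = es ! i" by (auto simp: rank1_def)
  show ?thesis
    using assms r(1) E unfolding orth_def by (intro coef_eq) auto
qed

text \<open>The coefficient maps \<open>coef e\<close> of an orthogonal family are linear over
  \<open>L\<close> and dual to it, so the family is independent over \<open>L\<close>. On the other
  hand \<open>E\<close> is spanned over \<open>L\<close> by the image of a finite basis of
  \<open>R\<close>.\<close>

lemma orth_bounded: "\<exists>N. \<forall>es. orth es \<longrightarrow> length es \<le> N"
proof -
  interpret EL: algebra_over_field L EL by (rule EL)
  obtain us f where us: "R.dual us f" "carrier R = lspan k R us" by (rule R_basis)
  have usR: "set us \<subseteq> carrier R" using us by (simp add: R.dual_def)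
  let ?vs = "map (\<lambda>u. b u \<one>\<^bsub>L\<^esub>) us"
  have vs: "set ?vs \<subseteq> carrier EL" using usR by auto
  note W = ksubD[OF EL.lspan_ksub[OF vs], unfolded smul_def, simplified]
  have "ksub k R {r \<in> carrier R. b r \<one>\<^bsub>L\<^esub> \<in> lspan L EL ?vs}"
    unfolding ksub_def smul_def
  proof (intro conjI ballI)
    fix c r assume c: "c \<in> carrier k" and r: "r \<in> {r \<in> carrier R. b r \<one>\<^bsub>L\<^esub> \<in> lspan L EL ?vs}"
    have "b (str R c \<otimes>\<^bsub>R\<^esub> r) \<one>\<^bsub>L\<^esub> = b \<one>\<^bsub>R\<^esub> (str L c) \<otimes>\<^bsub>E\<^esub> b r \<one>\<^bsub>L\<^esub>"
      using c r b_mult[of "str R c" r "\<one>\<^bsub>L\<^esub>" "\<one>\<^bsub>L\<^esub>"] by (simp add: b_str[symmetric] b_str_right[symmetric])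
    then show "str R c \<otimes>\<^bsub>R\<^esub> r \<in> {r \<in> carrier R. b r \<one>\<^bsub>L\<^esub> \<in> lspan L EL ?vs}"
      using c r W(4)[of "str L c" "b r \<one>\<^bsub>L\<^esub>"] by simp
  qed (use W(2,3) in \<open>auto simp: b_add_left\<close>)
  moreover have "u \<in> {r \<in> carrier R. b r \<one>\<^bsub>L\<^esub> \<in> lspan L EL ?vs}" if "u \<in> set us" for u
    using EL.lspan_mem[OF vs, of "b u \<one>\<^bsub>L\<^esub>"] that usR by auto
  ultimately have bR: "b r \<one>\<^bsub>L\<^esub> \<in> lspan L EL ?vs" if "r \<in> carrier R" for r
    using R.lspan_least[of "{r \<in> carrier R. b r \<one>\<^bsub>L\<^esub> \<in> lspan L EL ?vs}" us] us(2) that by blast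
  have "x \<in> lspan L EL ?vs" if "x \<in> carrier E" for x
    using that
  proof (induction rule: tensor_induct)
    case zero
    then show ?case using W(2) by simp
  next
    case (add r s t)
    have "b r s = b \<one>\<^bsub>R\<^esub> s \<otimes>\<^bsub>E\<^esub> b r \<one>\<^bsub>L\<^esub>" using add b_mult[of "\<one>\<^bsub>R\<^esub>" r s "\<one>\<^bsub>L\<^esub>"] by simp
    then show ?case using W(3,4) bR add by simp
  qed
  then have span: "carrier E \<subseteq> lspan L EL ?vs" by blast
  have "length es \<le> length us" if es: "orth es" for es
  proof -
    have r: "rank1 (es ! i)" if "i < length es" for i using es that by (auto simp: orth_def)
    have eE: "set es \<subseteq> carrier E" using es by (auto simp: orth_def rank1_def)
    have "lin L EL (coef (es ! i))" if i: "i < length es" for i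
    proof -
      note H = coef_hom[OF r[OF i]]
      have "coef (es ! i) (b \<one>\<^bsub>R\<^esub> c) = c" if "c \<in> carrier L" for c using that r[OF i] by (intro coef_eq) auto
      then show ?thesis using ring_hom_closed[OF H] ring_hom_add[OF H] ring_hom_mult[OF H]
        by (auto simp: lin_def additive_def smul_def)
    qed
    then have "EL.dual es (\<lambda>i. coef (es ! i))"
      using eE orth_coef[OF es] by (simp add: EL.dual_def)
    from EL.length_dual_le[OF this _ vs] eE span show ?thesis by auto
  qed
  then show ?thesis by blast
qed

text \<open>Take an orthogonal family of maximal length, with sum \<open>s\<close>. If
  \<open>1 - s\<close> were nonzero, \<open>exists_rank1\<close> would give a rank one idempotent
  below it, orthogonal to all members of the family, and the family could be extended.\<close>

lemma orth_complete: obtains es where "orth es" "lsum E es = \<one>\<^bsub>E\<^esub>"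
proof -
  obtain N where N: "\<And>es. orth es \<Longrightarrow> length es \<le> N" using orth_bounded by blast
  have "\<exists>es. orth es \<and> (\<forall>es'. orth es' \<longrightarrow> length es' \<le> length es)"
    using ex_has_greatest_nat[of orth "[]" length "Suc N"] N by (force simp: orth_def)
  then obtain es where es: "orth es" and max: "\<And>es'. orth es' \<Longrightarrow> length es' \<le> length es" by blast
  have r: "rank1 (es ! i)" if "i < length es" for i using es that by (auto simp: orth_def)
  have eE: "set es \<subseteq> carrier E" using es by (auto simp: orth_def rank1_def)
  let ?s = "lsum E es"
  have s: "?s \<in> carrier E" using eE by blast
  have se: "?s \<otimes>\<^bsub>E\<^esub> es ! i = es ! i" if i: "i < length es" for i
  proof -
    have ei: "es ! i \<in> carrier E" "es ! i \<otimes>\<^bsub>E\<^esub> es ! i = es ! i" using r[OF i] by (auto simp: rank1_def)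
    have "?s \<otimes>\<^bsub>E\<^esub> es ! i = lsum E (map (\<lambda>x. x \<otimes>\<^bsub>E\<^esub> es ! i) es)"
      using T.R.lsum_ldistr[OF ei(1), of es "\<lambda>x. x"] eE by auto
    also have "\<dots> = map (\<lambda>x. x \<otimes>\<^bsub>E\<^esub> es ! i) es ! i"
      using es i eE ei by (intro T.R.lsum_single) (auto simp: orth_def)
    finally show ?thesis using i ei by simp
  qed
  have "?s \<otimes>\<^bsub>E\<^esub> ?s = lsum E (map (\<lambda>x. ?s \<otimes>\<^bsub>E\<^esub> x) es)"
    using T.R.lsum_rdistr[OF s, of es "\<lambda>x. x"] eE by auto
  also have "\<dots> = ?s"
    using se lsum_map_cong[of es "\<lambda>x. ?s \<otimes>\<^bsub>E\<^esub> x" "\<lambda>x. x" E] by (auto simp: in_set_conv_nth)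
  finally have ss: "?s \<otimes>\<^bsub>E\<^esub> ?s = ?s" .
  let ?g = "\<one>\<^bsub>E\<^esub> \<ominus>\<^bsub>E\<^esub> ?s"
  have g: "?g \<in> carrier E" using s by simp
  have sg: "?s \<otimes>\<^bsub>E\<^esub> ?g = \<zero>\<^bsub>E\<^esub>" using s ss by (simp add: a_minus_def T.R.r_distr T.R.r_minus T.R.r_neg)
  have gg: "?g \<otimes>\<^bsub>E\<^esub> ?g = ?g"
  proof -
    have "?g \<otimes>\<^bsub>E\<^esub> ?g = \<one>\<^bsub>E\<^esub> \<otimes>\<^bsub>E\<^esub> ?g \<oplus>\<^bsub>E\<^esub> (\<ominus>\<^bsub>E\<^esub> ?s) \<otimes>\<^bsub>E\<^esub> ?g"
      using s g T.R.l_distr[of "\<one>\<^bsub>E\<^esub>" "\<ominus>\<^bsub>E\<^esub> ?s" ?g] by (simp add: a_minus_def)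
    then show ?thesis using s g sg by (simp add: T.R.l_minus)
  qed
  have "?g = \<zero>\<^bsub>E\<^esub>"
  proof (rule ccontr)
    assume "?g \<noteq> \<zero>\<^bsub>E\<^esub>"
    then obtain e where e: "rank1 e" "e \<otimes>\<^bsub>E\<^esub> ?g = e" using exists_rank1[OF g gg] by blast
    have eE': "e \<in> carrier E" using e by (simp add: rank1_def)
    have 0: "e \<otimes>\<^bsub>E\<^esub> es ! i = \<zero>\<^bsub>E\<^esub>" if i: "i < length es" for i
    proof -
      have ei: "es ! i \<in> carrier E" using r[OF i] by (auto simp: rank1_def)
      have "e \<otimes>\<^bsub>E\<^esub> es ! i = (e \<otimes>\<^bsub>E\<^esub> ?g) \<otimes>\<^bsub>E\<^esub> (?s \<otimes>\<^bsub>E\<^esub> es ! i)" using e se[OF i] by simp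
      also have "\<dots> = e \<otimes>\<^bsub>E\<^esub> ((?s \<otimes>\<^bsub>E\<^esub> ?g) \<otimes>\<^bsub>E\<^esub> es ! i)" using eE' g s ei by (simp add: T.R.m_ac)
      finally show ?thesis using sg eE' ei by simp
    qed
    have "(e # es) ! i \<otimes>\<^bsub>E\<^esub> (e # es) ! j = \<zero>\<^bsub>E\<^esub>" if ij: "i < Suc (length es)" "j < Suc (length es)" "i \<noteq> j" for i j
    proof (cases i)
      case 0
      then show ?thesis using ij \<open>\<And>i. i < length es \<Longrightarrow> e \<otimes>\<^bsub>E\<^esub> es ! i = \<zero>\<^bsub>E\<^esub>\<close> by (cases j) auto
    next
      case (Suc n)
      have "es ! n \<in> carrier E" using r[of n] ij Suc by (auto simp: rank1_def)
      then show ?thesis using ij Suc 0[of n] es eE' by (cases j) (auto simp: orth_def T.R.m_comm)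
    qed
    then have "orth (e # es)" using es e(1) unfolding orth_def by auto
    from max[OF this] show False by simp
  qed
  then have "?s = \<one>\<^bsub>E\<^esub>" using s by (simp add: T.R.r_right_minus_eq)
  then show thesis using that es by blast
qed

text \<open>The coordinates are the coefficient maps of a complete orthogonal family. Writing
  \<open>1\<close> as the sum of the family shows that an element is the sum of its coordinates
  times the idempotents, which gives injectivity; orthogonality gives surjectivity.\<close>

lemma split_iso:
  "\<exists>n. \<exists>h \<in> ring_iso E (RDirProd_list (replicate n L)). \<forall>c \<in> carrier L. h (b \<one>\<^bsub>R\<^esub> c) = replicate n c"
proof -
  obtain es where es: "orth es" "lsum E es = \<one>\<^bsub>E\<^esub>" by (rule orth_complete)
  have r: "rank1 (es ! i)" if "i < length es" for i using es that by (auto simp: orth_def)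
  have r': "rank1 e" if "e \<in> set es" for e using es that by (auto simp: orth_def)
  have eE: "set es \<subseteq> carrier E" using es by (auto simp: orth_def rank1_def)
  let ?n = "length es"
  let ?P = "RDirProd_list (replicate ?n L)"
  define h where "h x = map (\<lambda>e. coef e x) es" for x
  have hP: "h x \<in> carrier ?P" if "x \<in> carrier E" for x
    using that coef_closed[OF r'] by (auto simp: replicate_ring_carrier h_def)
  have hh: "h \<in> ring_hom E ?P"
  proof (rule ring_hom_memI)
    fix x y assume xy: "x \<in> carrier E" "y \<in> carrier E"
    show "h x \<in> carrier ?P" using hP xy by simp
    show "h (x \<otimes>\<^bsub>E\<^esub> y) = h x \<otimes>\<^bsub>?P\<^esub> h y"
      unfolding replicate_ring_ops(1)[OF hP[OF xy(1)] hP[OF xy(2)]]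
      by (auto simp: h_def ring_hom_mult[OF coef_hom[OF r]] xy intro!: nth_equalityI)
    show "h (x \<oplus>\<^bsub>E\<^esub> y) = h x \<oplus>\<^bsub>?P\<^esub> h y"
      unfolding replicate_ring_ops(2)[OF hP[OF xy(1)] hP[OF xy(2)]]
      by (auto simp: h_def ring_hom_add[OF coef_hom[OF r]] xy intro!: nth_equalityI)
  next
    show "h \<one>\<^bsub>E\<^esub> = \<one>\<^bsub>?P\<^esub>"
      by (auto simp: h_def replicate_ring_one ring_hom_one[OF coef_hom[OF r]] intro!: nth_equalityI)
  qed
  have expand: "x = lsum E (map (\<lambda>e. b \<one>\<^bsub>R\<^esub> (coef e x) \<otimes>\<^bsub>E\<^esub> e) es)" if x: "x \<in> carrier E" for x
  proof -
    have "x = x \<otimes>\<^bsub>E\<^esub> lsum E es" using es x by simp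
    also have "\<dots> = lsum E (map (\<lambda>e. x \<otimes>\<^bsub>E\<^esub> e) es)" using T.R.lsum_rdistr[OF x, of es "\<lambda>x. x"] eE by auto
    also have "\<dots> = lsum E (map (\<lambda>e. b \<one>\<^bsub>R\<^esub> (coef e x) \<otimes>\<^bsub>E\<^esub> e) es)"
      by (rule lsum_map_cong) (rule coef_mult[OF r' x])
    finally show ?thesis .
  qed
  have "inj_on h (carrier E)"
  proof (rule inj_onI)
    fix x y assume xy: "x \<in> carrier E" "y \<in> carrier E" "h x = h y"
    then have "coef e x = coef e y" if "e \<in> set es" for e using that by (auto simp: h_def)
    then have eq: "lsum E (map (\<lambda>e. b \<one>\<^bsub>R\<^esub> (coef e x) \<otimes>\<^bsub>E\<^esub> e) es) = lsum E (map (\<lambda>e. b \<one>\<^bsub>R\<^esub> (coef e y) \<otimes>\<^bsub>E\<^esub> e) es)"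
      by (intro lsum_map_cong) simp
    show "x = y"
      by (rule HOL.trans[OF expand[OF xy(1)] HOL.trans[OF eq expand[OF xy(2), symmetric]]])
  qed
  moreover have "carrier ?P \<subseteq> h ` carrier E"
  proof
    fix cs assume "cs \<in> carrier ?P"
    then have cs: "length cs = ?n" "set cs \<subseteq> carrier L" by (auto simp: replicate_ring_carrier)
    let ?x = "lsum E (map (\<lambda>i. b \<one>\<^bsub>R\<^esub> (cs ! i) \<otimes>\<^bsub>E\<^esub> es ! i) [0..<?n])"
    have ci: "cs ! i \<in> carrier L" "es ! i \<in> carrier E" if "i < ?n" for i using that cs eE by auto
    have x: "?x \<in> carrier E" by (rule T.R.lsum_map_closed) (use ci in auto)
    have "coef (es ! j) ?x = cs ! j" if j: "j < ?n" for j
    proof -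
      note H = coef_hom[OF r[OF j]]
      have cb: "coef (es ! j) (b \<one>\<^bsub>R\<^esub> c) = c" if "c \<in> carrier L" for c using that r[OF j] by (intro coef_eq) auto
      have "coef (es ! j) ?x = lsum L (map (\<lambda>i. coef (es ! j) (b \<one>\<^bsub>R\<^esub> (cs ! i) \<otimes>\<^bsub>E\<^esub> es ! i)) [0..<?n])"
        by (rule lsum_map_hom[OF T.R.abelian_group_axioms S.R.abelian_group_axioms ring_hom_additive[OF H]]) (use ci in auto)
      also have "\<dots> = lsum L (map (\<lambda>i. cs ! i \<otimes>\<^bsub>L\<^esub> (if j = i then \<one>\<^bsub>L\<^esub> else \<zero>\<^bsub>L\<^esub>)) [0..<?n])"
        by (rule lsum_map_cong) (use ci j in \<open>auto simp: ring_hom_mult[OF H] cb orth_coef[OF es(1)]\<close>)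
      also have "\<dots> = map (\<lambda>i. cs ! i \<otimes>\<^bsub>L\<^esub> (if j = i then \<one>\<^bsub>L\<^esub> else \<zero>\<^bsub>L\<^esub>)) [0..<?n] ! j"
        using j ci by (intro S.R.lsum_single) auto
      finally show ?thesis using j ci by simp
    qed
    then have hx: "h ?x = cs" using cs by (auto simp: h_def intro!: nth_equalityI)
    show "cs \<in> h ` carrier E" using imageI[OF x, of h] unfolding hx .
  qed
  ultimately have "h \<in> ring_iso E ?P" using hh hP by (auto simp: ring_iso_def bij_betw_def)
  moreover have "h (b \<one>\<^bsub>R\<^esub> c) = replicate ?n c" if "c \<in> carrier L" for c
    using that r by (auto simp: h_def intro!: nth_equalityI coef_eq)
  ultimately show ?thesis by blast
qed

end

lemma sep_idem_split_by:
  fixes R :: "('k, 'a) salg" and L :: "('k, 'l) salg"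
  assumes R: "algebra_over_field k R" and L: "algebra_over_field k L" "field L" "splits_monic L" and xs: "sep_idem k R xs"
  shows "split_by k R L"
proof -
  interpret R: algebra_over_field k R by fact
  interpret AL: algebra_over_field k L by fact
  interpret TC: tensor_construction k R L ..
  have "tensor_product_field k R L (tensor k R L) (\<lambda>r s. TC.cl [(r, s)])"
    by (rule TC.tensor_field) (rule R.k.field_axioms)
  then have "splitting k R L (tensor k R L) (\<lambda>r s. TC.cl [(r, s)]) xs"
    using L xs by (simp add: splitting_def splitting_axioms_def)
  from splitting.split_iso[OF this] show ?thesis by (simp add: split_by_def)
qed

text \<open>The algebraic closure comes as a bare ring with an embedding of \<open>k\<close>.
  Equipped with that embedding as structure map it is an admissible \<open>L\<close> for
  \<open>split_by\<close>, and it has roots of all monic polynomials, so both directions of the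
  splitting argument apply.\<close>

theorem etale_iff_sep_idem:
  fixes R :: "('k, 'a) salg"
  assumes R: "algebra_over_field k R"
  shows "etale k R \<longleftrightarrow> (\<exists>xs. sep_idem k R xs)"
proof -
  interpret R: algebra_over_field k R by fact
  let ?L = "R.k.alg_closure" and ?j = "R.k.indexed_const"
  interpret L: algebraic_closure ?L "?j ` carrier k" by (rule R.k.alg_closureE)
  have j: "?j \<in> ring_hom k ?L" by (rule R.k.alg_closureE)
  let ?A = "alg_on ?L ?j"
  have A: "algebra_over k ?A" by (rule L.alg_on_algebra[OF R.k.is_cring j])
  have fA: "field ?A"
  proof -
    have id: "(\<lambda>x. x) \<in> ring_iso ?L ?A" by (auto simp: ring_iso_def ring_hom_def bij_betw_def inj_on_def)
    show ?thesis using L.ring_iso_imp_img_field[OF id] by (simp add: alg_on_def)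
  qed
  have cA: "cring ?A" using A by (simp add: algebra_over_def)
  have AF: "algebra_over_field k ?A" using A R.k.field_axioms by (simp add: algebra_over_field_def)
  have sA: "splits_monic ?A" using L.splits_monic by (simp add: splits_monic_def)
  have jc: "?j \<in> carrier k \<rightarrow> carrier ?L" "?j \<in> carrier k \<rightarrow> carrier ?A" using j by (auto simp: ring_hom_def)
  \<comment> \<open>The two records have the same carrier and operations but different types, so the
    congruences are identified by transport along the identity map.\<close>
  have te: "tensor_eq k R (str R) ?L ?j = tensor_eq k R (str R) ?A ?j"
  proof (intro ext iffI)
    have id: "(\<lambda>x. x) \<in> ring_hom R R" "(\<lambda>x. x) \<in> ring_hom ?L ?A" "(\<lambda>x. x) \<in> ring_hom ?A ?L"
      by (auto simp: ring_hom_def)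
    have mid: "map (map_prod (\<lambda>x. x) (\<lambda>x. x)) zs = zs" for zs :: "('a \<times> _) list" by (induction zs) auto
    fix xs ys
    show "tensor_eq k R (str R) ?A ?j xs ys" if "tensor_eq k R (str R) ?L ?j xs ys"
      using tensor_eq_map[OF that id(1,2) R.R.is_cring L.is_cring R.R.is_cring cA, of "\<lambda>x. x" k "str R" ?j] jc by (simp add: mid)
    show "tensor_eq k R (str R) ?L ?j xs ys" if "tensor_eq k R (str R) ?A ?j xs ys"
      using tensor_eq_map[OF that id(1,3) R.R.is_cring cA R.R.is_cring L.is_cring, of "\<lambda>x. x" k "str R" ?j] jc by (simp add: mid)
  qed
  have tc: "tensor_class k R (str R) ?L ?j = tensor_class k R (str R) ?A ?j"
    by (simp add: tensor_class_def te fun_eq_iff)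
  have rd: "RDirProd_list (replicate n ?L) = RDirProd_list (replicate n ?A)" for n
    by (induction n) (simp_all add: RDirProd_list_def RDirProd_def DirProd_def monoid.defs)
  have ri: "ring_iso (tensor_ring k R (str R) ?L ?j) P = ring_iso (tensor k R ?A) P" for P :: "'z ring"
    by (simp add: ring_iso_def ring_hom_def tensor_def tensor_ring_def tc Let_def)
  have "etale k R \<longleftrightarrow> split_by k R ?A"
    by (simp add: etale_def split_by_def Let_def ri tc rd)
  then show ?thesis
    using split_by_sep_idem[OF R AF fA] sep_idem_split_by[OF R AF fA sA] by blast
qed

section \<open>Separability with respect to \<open>\<sigma>\<close>\<close>

text \<open>This says that the linear map induced by \<open>\<sigma>\<close> from the base change of
  \<open>R\<close> along \<open>\<sigma>\<close> of \<open>k\<close> back to \<open>R\<close> is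
  surjective. For finite dimension surjectivity and injectivity of this map are equivalent, and
  separability is a matter of its injectivity.\<close>

definition sig_spans :: "('k, 'm) ring_scheme \<Rightarrow> ('k, 'a) salg \<Rightarrow> bool"
  where "sig_spans k R \<longleftrightarrow> (\<forall>W. ksub k R W \<longrightarrow> sig R ` carrier R \<subseteq> W \<longrightarrow> carrier R \<subseteq> W)"

lemma sigma_field_cring: "sigma_field k \<Longrightarrow> cring k" "sigma_field k \<Longrightarrow> field k" "sigma_field k \<Longrightarrow> sigma_ring k"
  by (auto simp: sigma_field_def sigma_ring_def)

lemma sigma_alg_field:
  assumes "sigma_field k" "sigma_alg k R"
  shows "algebra_over_field k R"
  using sigma_alg_algebra_over[OF sigma_field_cring(1)[OF assms(1)] assms(2)] sigma_field_cring(2)[OF assms(1)]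
  by (simp add: algebra_over_field_def)

lemma sigma_algD:
  assumes "sigma_alg k R"
  shows "sig R \<in> ring_hom R R" "c \<in> carrier k \<Longrightarrow> sig R (str R c) = str R (sig k c)"
  using assms by (auto simp: sigma_alg_def sigma_ring_def)

lemma sigma_tensor:
  fixes R :: "('k, 'a) salg" and S :: "('k, 'b) salg"
  assumes k: "sigma_field k" and R: "sigma_alg k R" and S: "sigma_alg k S"
  shows "tensor_product_field k R S (tensor k R S) (\<lambda>r s. tensor_class k R (str R) S (str S) [(r, s)])"
proof -
  interpret R: algebra_over_field k R by (rule sigma_alg_field[OF k R])
  interpret S: algebra_over_field k S by (rule sigma_alg_field[OF k S])
  interpret TC: tensor_construction k R S ..
  show ?thesis by (rule TC.tensor_field) (rule R.k.field_axioms)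
qed

lemma (in algebra_over) indep_if_no_relation:
  assumes vs: "set vs \<subseteq> carrier R"
    and rel: "\<And>cs. cs \<in> lists (carrier k) \<Longrightarrow> length cs = length vs \<Longrightarrow> lsum R (map2 (smul R) cs vs) = \<zero>\<^bsub>R\<^esub> \<Longrightarrow> set cs \<subseteq> {\<zero>\<^bsub>k\<^esub>}"
    and nz: "\<one>\<^bsub>k\<^esub> \<noteq> \<zero>\<^bsub>k\<^esub>"
  shows "indep k R vs"
  unfolding indep_def
proof (intro allI impI notI)
  fix i assume i: "i < length vs" and "vs ! i \<in> lspan k R (take i vs @ drop (Suc i) vs)"
  then obtain ds where ds: "ds \<in> lists (carrier k)" "length ds = length vs - 1"
    "vs ! i = lsum R (map2 (smul R) ds (take i vs @ drop (Suc i) vs))"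
    unfolding lspan_comb by auto
  let ?p = "map2 (smul R) (take i ds) (take i vs)" and ?q = "map2 (smul R) (drop i ds) (drop (Suc i) vs)"
  \<comment> \<open>The relation that says entry \<open>i\<close> depends on the others: it has the
    coefficient \<open>-1\<close> in position \<open>i\<close>, which cannot vanish.\<close>
  let ?cs = "take i ds @ (\<ominus>\<^bsub>k\<^esub> \<one>\<^bsub>k\<^esub>) # drop i ds"
  have mem: "c \<in> carrier k \<and> w \<in> carrier R" if "(c, w) \<in> set (zip (take i ds) (take i vs)) \<or>
    (c, w) \<in> set (zip (drop i ds) (drop (Suc i) vs))" for c w
    using that ds(1) vs
    by (auto simp: in_lists_conv_set dest: in_set_takeD[OF set_zip_leftD] in_set_takeD[OF set_zip_rightD]
          in_set_dropD[OF set_zip_leftD] in_set_dropD[OF set_zip_rightD])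
  then have pq: "set ?p \<subseteq> carrier R" "set ?q \<subseteq> carrier R" by (auto intro!: smul_closed)
  have v: "vs ! i \<in> carrier R" using vs i by auto
  have "zip ds (take i vs @ drop (Suc i) vs) = zip (take i ds) (take i vs) @ zip (drop i ds) (drop (Suc i) vs)"
    using ds(2) i zip_append[of "take i ds" "take i vs" "drop i ds" "drop (Suc i) vs"] by simp
  then have 1: "vs ! i = lsum R ?p \<oplus>\<^bsub>R\<^esub> lsum R ?q" using ds(3) R.lsum_append[OF pq] by simp
  have "zip ?cs (take i vs @ vs ! i # drop (Suc i) vs) =
    zip (take i ds) (take i vs) @ (\<ominus>\<^bsub>k\<^esub> \<one>\<^bsub>k\<^esub>, vs ! i) # zip (drop i ds) (drop (Suc i) vs)"
    using ds(2) i by simp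
  then have "zip ?cs vs = zip (take i ds) (take i vs) @ (\<ominus>\<^bsub>k\<^esub> \<one>\<^bsub>k\<^esub>, vs ! i) # zip (drop i ds) (drop (Suc i) vs)"
    using i by (simp add: id_take_nth_drop[symmetric])
  then have "lsum R (map2 (smul R) ?cs vs) = lsum R ?p \<oplus>\<^bsub>R\<^esub> (\<ominus>\<^bsub>R\<^esub> (vs ! i) \<oplus>\<^bsub>R\<^esub> lsum R ?q)"
    using R.lsum_append[OF pq(1), of "smul R (\<ominus>\<^bsub>k\<^esub> \<one>\<^bsub>k\<^esub>) (vs ! i) # ?q"] pq v by (simp add: smul_uminus)
  also have "\<dots> = \<ominus>\<^bsub>R\<^esub> (vs ! i) \<oplus>\<^bsub>R\<^esub> (lsum R ?p \<oplus>\<^bsub>R\<^esub> lsum R ?q)"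
    using R.lsum_closed[OF pq(1)] R.lsum_closed[OF pq(2)] v by (simp add: R.a_lcomm)
  also have "\<dots> = \<zero>\<^bsub>R\<^esub>" using v 1 R.l_neg by metis
  finally have "set ?cs \<subseteq> {\<zero>\<^bsub>k\<^esub>}"
    using ds i by (intro rel) (auto simp: in_lists_conv_set dest: in_set_takeD in_set_dropD)
  then have "\<ominus>\<^bsub>k\<^esub> \<one>\<^bsub>k\<^esub> = \<zero>\<^bsub>k\<^esub>" by auto
  then show False using nz by (metis k.minus_minus k.minus_zero k.one_closed)
qed

lemma (in algebra_over_field) dual_expansion:
  assumes us: "dual us f" and r: "r \<in> lspan k R us"
  shows "r = lsum R (map (\<lambda>i. smul R (f i r) (us ! i)) [0..<length us])"
proof -
  let ?e = "\<lambda>r. lsum R (map (\<lambda>i. smul R (f i r) (us ! i)) [0..<length us])"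
  have u: "us ! i \<in> carrier R" if "i < length us" for i using us that by (auto simp: dual_def)
  have f: "lin k R (f i)" if "i < length us" for i using us that by (auto simp: dual_def)
  have "ksub k R {r \<in> carrier R. r = ?e r}" unfolding ksub_def
  proof (intro conjI ballI)
    have "?e \<zero>\<^bsub>R\<^esub> = \<zero>\<^bsub>R\<^esub>" using u lin_zero[OF f] by (intro R.lsum_zero) auto
    then show "\<zero>\<^bsub>R\<^esub> \<in> {r \<in> carrier R. r = ?e r}" by simp
    fix x y assume xy: "x \<in> {r \<in> carrier R. r = ?e r}" "y \<in> {r \<in> carrier R. r = ?e r}"
    have "?e (x \<oplus>\<^bsub>R\<^esub> y) = lsum R (map (\<lambda>i. smul R (f i x) (us ! i) \<oplus>\<^bsub>R\<^esub> smul R (f i y) (us ! i)) [0..<length us])"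
      using xy u linD[OF f] by (intro lsum_map_cong) (auto simp: add_smul)
    also have "\<dots> = ?e x \<oplus>\<^bsub>R\<^esub> ?e y" using xy u linD(1)[OF f] by (intro R.lsum_map_add) auto
    finally show "x \<oplus>\<^bsub>R\<^esub> y \<in> {r \<in> carrier R. r = ?e r}" using xy by auto
  next
    fix c x assume c: "c \<in> carrier k" and x: "x \<in> {r \<in> carrier R. r = ?e r}"
    have "?e (smul R c x) = lsum R (map (\<lambda>i. str R c \<otimes>\<^bsub>R\<^esub> smul R (f i x) (us ! i)) [0..<length us])"
      using c x u linD[OF f] by (intro lsum_map_cong) (auto simp: smul_smul smul_def[of R c, symmetric])
    also have "\<dots> = str R c \<otimes>\<^bsub>R\<^esub> ?e x" using c x u linD(1)[OF f] by (intro R.lsum_rdistr[symmetric]) auto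
    finally show "smul R c x \<in> {r \<in> carrier R. r = ?e r}" using c x by (auto simp: smul_def)
  qed auto
  moreover have "us ! j = ?e (us ! j)" if j: "j < length us" for j
  proof -
    have "?e (us ! j) = map (\<lambda>i. smul R (f i (us ! j)) (us ! i)) [0..<length us] ! j"
      using us j u by (intro R.lsum_single) (auto simp: dual_def)
    then show ?thesis using us j u by (simp add: dual_def)
  qed
  then have "set us \<subseteq> {r \<in> carrier R. r = ?e r}" using u by (auto simp: in_set_conv_nth)
  ultimately show ?thesis using lspan_least r by blast
qed

text \<open>The field \<open>k\<close> itself, with \<open>\<sigma>\<close> as structure map, is the only extension needed to test separability.\<close>

lemma sig_spans_if_separable:
  fixes k :: "('k, 'm) sring_scheme" and R :: "('k, 'a) salg"
  assumes k: "sigma_field k" and R: "sigma_alg k R" and xs: "sep_idem k R xs" and sep: "sigma_separable k R"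
  shows "sig_spans k R"
proof -
  interpret R: algebra_over_field k R by (rule sigma_alg_field[OF k R])
  note sR = sigma_algD[OF R]
  have sk: "sig k \<in> ring_hom k k" using k by (simp add: sigma_field_def sigma_ring_def)
  define K where "K = \<lparr> carrier = carrier k, monoid.mult = monoid.mult k, monoid.one = monoid.one k,
    ring.zero = ring.zero k, ring.add = ring.add k, sig = sig k, str = sig k \<rparr>"
  have K: "carrier K = carrier k" "monoid.mult K = monoid.mult k" "monoid.one K = monoid.one k"
    "ring.zero K = ring.zero k" "ring.add K = ring.add k" "sig K = sig k" "str K = sig k" by (simp_all add: K_def)
  have fK: "field K"
  proof -
    have id: "(\<lambda>x. x) \<in> ring_iso k K" by (auto simp: ring_iso_def ring_hom_def bij_betw_def inj_on_def K)
    show ?thesis using R.k.ring_iso_imp_img_field[OF id] by (simp add: K_def)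
  qed
  interpret K: field K by fact
  have aK: "sigma_alg k K"
    using sk K.is_cring by (auto simp: sigma_alg_def sigma_ring_def ring_hom_def K)
  let ?T = "tensor k R K"
  define b where "b = (\<lambda>r s. tensor_class k R (str R) K (str K) [(r, s)])"
  interpret T: tensor_product_field k R K ?T b unfolding b_def by (rule sigma_tensor[OF k R aK])
  have sT: "sigma_alg k ?T" "\<And>r s. r \<in> carrier R \<Longrightarrow> s \<in> carrier K \<Longrightarrow> sig ?T (b r s) = b (sig R r) (sig K s)"
    unfolding b_def using sigma_alg_tensor[OF sigma_field_cring(3)[OF k] R aK] by auto
  have inj: "inj_on (sig ?T) (carrier ?T)" using sep aK fK by (simp add: sigma_separable_def)
  obtain ys us f where us: "R.dual us f" "carrier R = lspan k R us"
    by (rule sep_idem_basis[OF R.algebra_over_field_axioms xs]) blast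
  have usR: "set us \<subseteq> carrier R" using us(1) by (simp add: R.dual_def)
  let ?vs = "map (sig R) us"
  have vsR: "set ?vs \<subseteq> carrier R" using usR ring_hom_closed[OF sR(1)] by auto
  have "indep k R ?vs"
  proof (rule R.indep_if_no_relation[OF vsR])
    fix cs assume cs: "cs \<in> lists (carrier k)" "length cs = length ?vs" "lsum R (map2 (smul R) cs ?vs) = \<zero>\<^bsub>R\<^esub>"
    let ?z = "zip us cs"
    have zL: "?z \<in> T.L" using cs(1) usR by (auto simp: in_lists_conv_set K dest: set_zip_leftD set_zip_rightD)
    \<comment> \<open>As the structure map of \<open>K\<close> is \<open>\<sigma>\<close> itself,
      \<open>\<sigma>\<close> maps \<open>u \<otimes> c\<close> to \<open>\<sigma>(u) \<otimes>
      \<sigma>(c) = c \<sigma>(u) \<otimes> 1\<close>. A linear relation between the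
      \<open>\<sigma>(u)\<close> is therefore an element of the kernel.\<close>
    have *: "sig ?T (tsum ?T b (zip us cs)) = b (lsum R (map2 (smul R) cs (map (sig R) us))) \<one>\<^bsub>K\<^esub> \<and> lsum R (map2 (smul R) cs (map (sig R) us)) \<in> carrier R"
      if "length us = length cs" "set us \<subseteq> carrier R" "set cs \<subseteq> carrier k" for us cs
      using that
    proof (induction us cs rule: list_induct2)
      case Nil
      then show ?case
        using additive_zero[OF T.T.R.abelian_group_axioms T.T.R.abelian_group_axioms ring_hom_additive[OF sigma_algD(1)[OF sT(1)]]]
        by simp
    next
      case (Cons u us c cs)
      have zL: "zip us cs \<in> T.L" using Cons.prems by (auto simp: in_lists_conv_set K dest: set_zip_leftD set_zip_rightD)
      have cu: "c \<in> carrier k" "u \<in> carrier R" "c \<in> carrier K" "sig R u \<in> carrier R" "sig k c \<in> carrier K"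
        using Cons.prems ring_hom_closed[OF sR(1)] ring_hom_closed[OF sk] by (auto simp: K)
      have "b (sig R u) (sig k c) = b (smul R c (sig R u)) \<one>\<^bsub>K\<^esub>"
        using T.b_smul[of c "sig R u" "\<one>\<^bsub>K\<^esub>"] cu by (simp add: smul_def K)
      then show ?case
        using Cons cu T.tsum_closed[OF zL] ring_hom_add[OF sigma_algD(1)[OF sT(1)], of "b u c" "tsum ?T b (zip us cs)"]
        by (simp add: sT(2) T.b_add_left K)
    qed
    have "sig ?T (tsum ?T b ?z) = \<zero>\<^bsub>?T\<^esub>" using *[of us cs] cs usR by (auto simp: in_lists_conv_set)
    also have "\<dots> = sig ?T \<zero>\<^bsub>?T\<^esub>"
      using additive_zero[OF T.T.R.abelian_group_axioms T.T.R.abelian_group_axioms ring_hom_additive[OF sigma_algD(1)[OF sT(1)]]] by simp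
    finally have z: "tsum ?T b ?z = \<zero>\<^bsub>?T\<^esub>" using inj T.tsum_closed[OF zL] by (auto simp: inj_on_def)
    \<comment> \<open>Injectivity has made the tensor with left components \<open>us\<close> vanish;
      its coefficients are read off by the functionals dual to the basis.\<close>
    have "cs ! i = \<zero>\<^bsub>k\<^esub>" if i: "i < length cs" for i
    proof -
      have fz: "map fst ?z = us" using cs(2) by simp
      have fi: "lin k R (f i)" using us(1) i cs(2) by (simp add: R.dual_def)
      have "T.lslice (f i) (tsum ?T b ?z) = snd (?z ! i)"
        using T.lslice_nth[OF zL, of f i] us(1) i cs(2) unfolding fz by simp
      then show ?thesis using z T.lslice_zero[OF fi] i cs(2) by (simp add: K)
    qed
    then show "set cs \<subseteq> {\<zero>\<^bsub>k\<^esub>}" by (auto simp: in_set_conv_nth)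
  qed simp
  then obtain g where g: "R.dual ?vs g" using R.indep_dual[OF vsR] by blast
  \<comment> \<open>The elements \<open>\<sigma>(u)\<close> are independent and as many as the basis
    elements, hence they span.\<close>
  have "lspan k R us \<subseteq> lspan k R ?vs"
    by (rule R.lspan_dual_eq[OF g _ usR]) (use vsR us(2) in auto)
  then have "carrier R \<subseteq> lspan k R ?vs" using us(2) by simp
  moreover have "lspan k R ?vs \<subseteq> W" if "ksub k R W" "sig R ` carrier R \<subseteq> W" for W
    by (rule R.lspan_least[OF that(1)]) (use that(2) usR in auto)
  ultimately show ?thesis unfolding sig_spans_def by blast
qed

text \<open>The images \<open>\<sigma>(u)\<close> of a basis span and have the right number, so they
  form a basis again. A tensor is the sum of \<open>u \<otimes> s\<close> with its slices
  \<open>s\<close> as coefficients, and \<open>\<sigma>\<close> turns it into the sum of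
  \<open>\<sigma>(u) \<otimes> \<sigma>(s)\<close>. If this vanishes then every
  \<open>\<sigma>(s)\<close> does, and \<open>\<sigma>\<close> is injective on the field
  \<open>K\<close>.\<close>

lemma separable_if_sig_spans:
  fixes k :: "('k, 'm) sring_scheme" and R :: "('k, 'a) salg"
  assumes k: "sigma_field k" and R: "sigma_alg k R" and xs: "sep_idem k R xs" and sp: "sig_spans k R"
  shows "sigma_separable k R"
  unfolding sigma_separable_def
proof (intro allI impI, elim conjE)
  fix K :: "('k, 'k) salg" assume aK: "sigma_alg k K" and fK: "field K"
  interpret K: field K by fact
  interpret R: algebra_over_field k R by (rule sigma_alg_field[OF k R])
  note sR = sigma_algD[OF R] and sK = sigma_algD[OF aK]
  have sk: "sig k \<in> ring_hom k k" using k by (simp add: sigma_field_def sigma_ring_def)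
  let ?T = "tensor k R K"
  define b where "b = (\<lambda>r s. tensor_class k R (str R) K (str K) [(r, s)])"
  interpret T: tensor_product_field k R K ?T b unfolding b_def by (rule sigma_tensor[OF k R aK])
  have sT: "sigma_alg k ?T" "\<And>r s. r \<in> carrier R \<Longrightarrow> s \<in> carrier K \<Longrightarrow> sig ?T (b r s) = b (sig R r) (sig K s)"
    unfolding b_def using sigma_alg_tensor[OF sigma_field_cring(3)[OF k] R aK] by auto
  note hT = sigma_algD(1)[OF sT(1)]
  obtain ys us f where us: "R.dual us f" "carrier R = lspan k R us"
    by (rule sep_idem_basis[OF R.algebra_over_field_axioms xs]) blast
  have usR: "set us \<subseteq> carrier R" using us(1) by (simp add: R.dual_def)
  let ?vs = "map (sig R) us"
  have vsR: "set ?vs \<subseteq> carrier R" using usR ring_hom_closed[OF sR(1)] by auto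
  note V = R.lspan_ksub[OF vsR]
  \<comment> \<open>\<open>\<sigma>\<close> is additive and twists scalars by
    \<open>\<sigma>\<close> of \<open>k\<close>, so the elements that it maps into a given subspace
    form a subspace. It suffices to look at the basis.\<close>
  have "ksub k R {r \<in> carrier R. sig R r \<in> lspan k R ?vs}"
    unfolding ksub_def
  proof (intro conjI ballI)
    show "\<zero>\<^bsub>R\<^esub> \<in> {r \<in> carrier R. sig R r \<in> lspan k R ?vs}"
      using additive_zero[OF R.R.abelian_group_axioms R.R.abelian_group_axioms ring_hom_additive[OF sR(1)]] ksubD(2)[OF V] by simp
    fix x y assume "x \<in> {r \<in> carrier R. sig R r \<in> lspan k R ?vs}" "y \<in> {r \<in> carrier R. sig R r \<in> lspan k R ?vs}"
    then show "x \<oplus>\<^bsub>R\<^esub> y \<in> {r \<in> carrier R. sig R r \<in> lspan k R ?vs}"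
      using ksubD(3)[OF V] by (simp add: ring_hom_add[OF sR(1)])
  next
    fix c x assume "c \<in> carrier k" "x \<in> {r \<in> carrier R. sig R r \<in> lspan k R ?vs}"
    then show "smul R c x \<in> {r \<in> carrier R. sig R r \<in> lspan k R ?vs}"
      using ksubD(4)[OF V, of "sig k c" "sig R x"] ring_hom_closed[OF sk]
      by (simp add: smul_def ring_hom_mult[OF sR(1)] sR(2))
  qed auto
  moreover have "set us \<subseteq> {r \<in> carrier R. sig R r \<in> lspan k R ?vs}"
    using usR R.lspan_mem[OF vsR] by auto
  ultimately have "lspan k R us \<subseteq> {r \<in> carrier R. sig R r \<in> lspan k R ?vs}" by (rule R.lspan_least)
  then have "sig R ` carrier R \<subseteq> lspan k R ?vs" using us(2) by blast
  then have span: "carrier R \<subseteq> lspan k R ?vs" using sp V by (simp add: sig_spans_def)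
  obtain g where g: "R.dual ?vs g"
    by (rule R.spanning_dual[OF us(1) _ vsR]) (use usR span in auto)
  let ?n = "length us"
  have fi: "lin k R (f i)" if "i < ?n" for i using us(1) that by (simp add: R.dual_def)
  have ui: "us ! i \<in> carrier R" if "i < ?n" for i using usR that by auto
  \<comment> \<open>Both sides are additive in the tensor, so they are compared on pure tensors,
    where this is the expansion of the left factor in the basis.\<close>
  have expand: "t = lsum ?T (map (\<lambda>i. b (us ! i) (T.lslice (f i) t)) [0..<?n])" if t: "t \<in> carrier ?T" for t
  proof (rule T.additive_eq[OF T.T.R.abelian_group_axioms _ _ _ t])
    show "additive ?T ?T (\<lambda>t. t)" by (auto simp: additive_def)
    show "additive ?T ?T (\<lambda>t. lsum ?T (map (\<lambda>i. b (us ! i) (T.lslice (f i) t)) [0..<?n]))"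
      unfolding additive_def
    proof (intro conjI ballI funcsetI)
      fix x y assume xy: "x \<in> carrier ?T" "y \<in> carrier ?T"
      show "lsum ?T (map (\<lambda>i. b (us ! i) (T.lslice (f i) x)) [0..<?n]) \<in> carrier ?T"
        by (rule T.T.R.lsum_map_closed) (use xy ui T.lslice_closed[OF fi] in auto)
      have "lsum ?T (map (\<lambda>i. b (us ! i) (T.lslice (f i) (x \<oplus>\<^bsub>?T\<^esub> y))) [0..<?n]) =
        lsum ?T (map (\<lambda>i. b (us ! i) (T.lslice (f i) x) \<oplus>\<^bsub>?T\<^esub> b (us ! i) (T.lslice (f i) y)) [0..<?n])"
        by (rule lsum_map_cong) (use xy ui T.lslice_closed[OF fi] T.lslice_add[OF fi] in \<open>auto simp: T.b_add_right\<close>)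
      also have "\<dots> = lsum ?T (map (\<lambda>i. b (us ! i) (T.lslice (f i) x)) [0..<?n]) \<oplus>\<^bsub>?T\<^esub>
          lsum ?T (map (\<lambda>i. b (us ! i) (T.lslice (f i) y)) [0..<?n])"
        by (rule T.T.R.lsum_map_add) (use xy ui T.lslice_closed[OF fi] in auto)
      finally show "lsum ?T (map (\<lambda>i. b (us ! i) (T.lslice (f i) (x \<oplus>\<^bsub>?T\<^esub> y))) [0..<?n]) =
          lsum ?T (map (\<lambda>i. b (us ! i) (T.lslice (f i) x)) [0..<?n]) \<oplus>\<^bsub>?T\<^esub>
          lsum ?T (map (\<lambda>i. b (us ! i) (T.lslice (f i) y)) [0..<?n])" .
    qed
    fix r s assume r: "r \<in> carrier R" and s: "s \<in> carrier K"
    have "b r s = b (lsum R (map (\<lambda>i. smul R (f i r) (us ! i)) [0..<?n])) s"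
      using R.dual_expansion[OF us(1)] us(2) r by simp
    also have "\<dots> = lsum ?T (map (\<lambda>i. b (smul R (f i r) (us ! i)) s) [0..<?n])"
      by (rule lsum_map_hom[OF R.R.abelian_group_axioms T.T.R.abelian_group_axioms T.b_additive_left[OF s]])
        (use r ui linD(1)[OF fi] in auto)
    also have "\<dots> = lsum ?T (map (\<lambda>i. b (us ! i) (T.lslice (f i) (b r s))) [0..<?n])"
      by (rule lsum_map_cong) (use r s ui linD(1)[OF fi] T.lslice_b[OF fi] T.b_smul in auto)
    finally show "b r s = lsum ?T (map (\<lambda>i. b (us ! i) (T.lslice (f i) (b r s))) [0..<?n])" .
  qed
  have ker: "t = \<zero>\<^bsub>?T\<^esub>" if t: "t \<in> carrier ?T" and z: "sig ?T t = \<zero>\<^bsub>?T\<^esub>" for t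
  proof -
    have sl: "T.lslice (f i) t \<in> carrier K" if "i < ?n" for i using T.lslice_closed[OF fi[OF that] t] .
    have sK': "sig K s \<in> carrier K" if "s \<in> carrier K" for s using ring_hom_closed[OF sK(1) that] .
    let ?z = "map (\<lambda>i. (?vs ! i, sig K (T.lslice (f i) t))) [0..<?n]"
    have zL: "?z \<in> T.L" using vsR sK' sl by (auto simp: in_lists_conv_set)
    have "sig ?T t = sig ?T (lsum ?T (map (\<lambda>i. b (us ! i) (T.lslice (f i) t)) [0..<?n]))"
      by (rule arg_cong[OF expand[OF t]])
    also have "\<dots> = lsum ?T (map (\<lambda>i. sig ?T (b (us ! i) (T.lslice (f i) t))) [0..<?n])"
      by (rule lsum_map_hom[OF T.T.R.abelian_group_axioms T.T.R.abelian_group_axioms ring_hom_additive[OF hT]])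
        (use ui sl in auto)
    also have "\<dots> = lsum ?T (map (\<lambda>i. b (?vs ! i) (sig K (T.lslice (f i) t))) [0..<?n])"
      by (rule lsum_map_cong) (use ui sl sT(2) in auto)
    also have "\<dots> = tsum ?T b ?z" by (simp add: tsum_def comp_def)
    finally have tz: "tsum ?T b ?z = \<zero>\<^bsub>?T\<^esub>" using z by simp
    have fz: "map fst ?z = ?vs" by (auto intro!: nth_equalityI)
    have "T.lslice (f i) t = \<zero>\<^bsub>K\<^esub>" if i: "i < ?n" for i
    proof -
      have gi: "lin k R (g i)" using g i by (simp add: R.dual_def)
      have "sig K (T.lslice (f i) t) = T.lslice (g i) (tsum ?T b ?z)"
        using T.lslice_nth[OF zL, of g i] g i unfolding fz by simp
      also have "\<dots> = \<zero>\<^bsub>K\<^esub>" unfolding tz by (rule T.lslice_zero[OF gi])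
      finally have s0: "sig K (T.lslice (f i) t) = \<zero>\<^bsub>K\<^esub>" .
      show ?thesis
      proof (rule ccontr)
        assume "T.lslice (f i) t \<noteq> \<zero>\<^bsub>K\<^esub>"
        then have U: "T.lslice (f i) t \<in> Units K" using sl[OF i] by (simp add: K.field_Units)
        have "\<one>\<^bsub>K\<^esub> = sig K (inv\<^bsub>K\<^esub> T.lslice (f i) t \<otimes>\<^bsub>K\<^esub> T.lslice (f i) t)"
          using U ring_hom_one[OF sK(1)] by simp
        also have "\<dots> = sig K (inv\<^bsub>K\<^esub> T.lslice (f i) t) \<otimes>\<^bsub>K\<^esub> sig K (T.lslice (f i) t)"
          by (rule ring_hom_mult[OF sK(1)]) (use U sl[OF i] in auto)
        also have "\<dots> = \<zero>\<^bsub>K\<^esub>" using U s0 sK' by simp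
        finally show False by simp
      qed
    qed
    then have "lsum ?T (map (\<lambda>i. b (us ! i) (T.lslice (f i) t)) [0..<?n]) = \<zero>\<^bsub>?T\<^esub>"
      using ui by (intro T.T.R.lsum_zero) auto
    then show ?thesis using expand[OF t] by simp
  qed
  show "inj_on (sig ?T) (carrier ?T)"
  proof (rule inj_onI)
    fix x y assume xy: "x \<in> carrier ?T" "y \<in> carrier ?T" "sig ?T x = sig ?T y"
    have "sig ?T (x \<ominus>\<^bsub>?T\<^esub> y) = sig ?T x \<ominus>\<^bsub>?T\<^esub> sig ?T y"
      using xy ring_hom_add[OF hT]
        additive_minus[OF T.T.R.abelian_group_axioms T.T.R.abelian_group_axioms ring_hom_additive[OF hT]]
      by (simp add: a_minus_def)
    also have "\<dots> = \<zero>\<^bsub>?T\<^esub>" using xy ring_hom_closed[OF hT] by (simp add: a_minus_def T.T.R.r_neg)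
    finally have "x \<ominus>\<^bsub>?T\<^esub> y = \<zero>\<^bsub>?T\<^esub>" by (rule ker[OF T.T.R.minus_closed[OF xy(1,2)]])
    then show "x = y" using xy by (simp add: T.T.R.r_right_minus_eq)
  qed
qed

text \<open>From here on strong etaleness enters only through this criterion, so that neither
  extension fields nor the algebraic closure occur again.\<close>

theorem strongly_etale_iff:
  fixes k :: "('k, 'm) sring_scheme" and R :: "('k, 'a) salg"
  assumes k: "sigma_field k" and R: "sigma_alg k R"
  shows "strongly_etale k R \<longleftrightarrow> (\<exists>xs. sep_idem k R xs) \<and> sig_spans k R"
  using etale_iff_sep_idem[OF sigma_alg_field[OF k R]] sig_spans_if_separable[OF k R] separable_if_sig_spans[OF k R]
  unfolding strongly_etale_def by blast

section \<open>Strongly etale subalgebras and the strong core\<close>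

definition etale_sub :: "('k, 'm) sring_scheme \<Rightarrow> ('k, 'a) salg \<Rightarrow> 'a set \<Rightarrow> bool"
  where "etale_sub k R A \<longleftrightarrow> sigma_subalg k R A \<and> strongly_etale k (R\<lparr>carrier := A\<rparr>)"

lemma sigma_subalgD:
  assumes "sigma_subalg k R A"
  shows "ksubalg k R A" "x \<in> A \<Longrightarrow> sig R x \<in> A"
  using assms by (auto simp: sigma_subalg_def ksubalg_def)

lemma sigma_alg_sub:
  assumes "cring k" and R: "sigma_alg k R" and A: "sigma_subalg k R A"
  shows "sigma_alg k (R\<lparr>carrier := A\<rparr>)"
proof -
  interpret R: algebra_over k R by (rule sigma_alg_algebra_over[OF assms(1) R])
  interpret A: algebra_over k "R\<lparr>carrier := A\<rparr>" by (rule R.ksubalg_algebra_over[OF sigma_subalgD(1)[OF A]])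
  have "sig R \<in> ring_hom (R\<lparr>carrier := A\<rparr>) (R\<lparr>carrier := A\<rparr>)"
    using sigma_algD(1)[OF R] sigma_subalgD(2)[OF A] ksubalgD(1)[OF sigma_subalgD(1)[OF A]] by (auto simp: ring_hom_def)
  then show ?thesis using A.R.is_cring A.str_hom sigma_algD(2)[OF R] by (simp add: sigma_alg_def sigma_ring_def)
qed

lemma ksub_restrict: "A \<subseteq> carrier R \<Longrightarrow> ksub k (R\<lparr>carrier := A\<rparr>) W \<longleftrightarrow> ksub k R W \<and> W \<subseteq> A"
  by (auto simp: ksub_def)

lemma etale_sub_iff:
  fixes k :: "('k, 'm) sring_scheme" and R :: "('k, 'a) salg"
  assumes k: "sigma_field k" and R: "sigma_alg k R"
  shows "etale_sub k R A \<longleftrightarrow> sigma_subalg k R A \<and> (\<exists>xs. sep_idem k (R\<lparr>carrier := A\<rparr>) xs) \<and>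
    (\<forall>W. ksub k R W \<longrightarrow> W \<subseteq> A \<longrightarrow> sig R ` A \<subseteq> W \<longrightarrow> A \<subseteq> W)"
proof (cases "sigma_subalg k R A")
  case True
  have "A \<subseteq> carrier R" using ksubalgD(1)[OF sigma_subalgD(1)[OF True]] by blast
  then show ?thesis
    using strongly_etale_iff[OF k sigma_alg_sub[OF sigma_field_cring(1)[OF k] R True]] True
    by (auto simp: etale_sub_def sig_spans_def ksub_restrict)
qed (simp add: etale_sub_def)

lemma sigma_alg_homD:
  assumes "f \<in> sigma_alg_hom k R S"
  shows "f \<in> ring_hom R S" "x \<in> carrier R \<Longrightarrow> f (sig R x) = sig S (f x)" "c \<in> carrier k \<Longrightarrow> f (str R c) = str S c"
  using assms by (auto simp: sigma_alg_hom_def)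

lemma sigma_subalg_iff: "sigma_subalg k R A \<longleftrightarrow> ksubalg k R A \<and> sig R ` A \<subseteq> A"
  by (simp add: sigma_subalg_def ksubalg_def)

lemma sig_spansD:
  "sig_spans k R \<Longrightarrow> ksub k R W \<Longrightarrow> (\<And>x. x \<in> carrier R \<Longrightarrow> sig R x \<in> W) \<Longrightarrow> x \<in> carrier R \<Longrightarrow> x \<in> W"
  unfolding sig_spans_def by blast

lemma ksub_vimage:
  assumes R: "algebra_over k R" and S: "algebra_over k S" and f: "additive R S f"
    and sm: "\<And>c x. c \<in> carrier k \<Longrightarrow> x \<in> carrier R \<Longrightarrow> f (smul R c x) = smul S c (f x)" and W: "ksub k S W"
  shows "ksub k R {x \<in> carrier R. f x \<in> W}"
proof -
  interpret R: algebra_over k R by fact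
  interpret S: algebra_over k S by fact
  have "f \<zero>\<^bsub>R\<^esub> = \<zero>\<^bsub>S\<^esub>" by (rule additive_zero[OF R.R.abelian_group_axioms S.R.abelian_group_axioms f])
  then show ?thesis using additiveD[OF f] sm ksubD[OF W] by (auto simp: ksub_def)
qed

lemma sigma_alg_hom_smul:
  assumes "f \<in> sigma_alg_hom k R S" "algebra_over k R" "c \<in> carrier k" "x \<in> carrier R"
  shows "f (smul R c x) = smul S c (f x)"
proof -
  interpret R: algebra_over k R by fact
  show ?thesis using assms sigma_alg_homD[OF assms(1)] ring_hom_mult[of f R S "str R c" x] by (simp add: smul_def)
qed

lemma sep_idem_image:
  fixes R :: "('k, 'a) salg" and S :: "('k, 'b) salg"
  assumes f: "f \<in> ring_hom R S" "\<And>c. c \<in> carrier k \<Longrightarrow> f (str R c) = str S c"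
    and R: "algebra_over k R" and S: "algebra_over k S" and surj: "f ` carrier R = carrier S" and xs: "sep_idem k R xs"
  shows "sep_idem k S (map (map_prod f f) xs)"
  unfolding sep_idem_def
proof (intro conjI ballI)
  interpret R: algebra_over k R by fact
  interpret S: algebra_over k S by fact
  have xsL: "u \<in> carrier R \<and> v \<in> carrier R" if "(u, v) \<in> set xs" for u v
    using xs that by (auto simp: sep_idem_def in_lists_conv_set)
  show "map (map_prod f f) xs \<in> lists (carrier S \<times> carrier S)"
    using xsL ring_hom_closed[OF f(1)] by (auto simp: in_lists_conv_set)
  have "tsum S (\<otimes>\<^bsub>S\<^esub>) (map (map_prod f f) xs) = tsum S (\<lambda>u v. f (u \<otimes>\<^bsub>R\<^esub> v)) xs"
    by (rule tsum_map_eq) (use xsL in \<open>auto simp: ring_hom_mult[OF f(1)]\<close>)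
  also have "\<dots> = f (tsum R (\<otimes>\<^bsub>R\<^esub>) xs)" unfolding tsum_def
    by (subst lsum_map_hom[OF R.R.abelian_group_axioms S.R.abelian_group_axioms ring_hom_additive[OF f(1)]])
      (use xsL in \<open>auto simp: case_prod_unfold\<close>)
  also have "\<dots> = \<one>\<^bsub>S\<^esub>" using xs ring_hom_one[OF f(1)] by (simp add: sep_idem_def)
  finally show "tsum S (\<otimes>\<^bsub>S\<^esub>) (map (map_prod f f) xs) = \<one>\<^bsub>S\<^esub>" .
  fix a assume "a \<in> carrier S"
  then obtain r where r: "r \<in> carrier R" "a = f r" using surj by blast
  have "tensor_eq k R (str R) R (str R) (map (\<lambda>(u, v). (r \<otimes>\<^bsub>R\<^esub> u, v)) xs) (map (\<lambda>(u, v). (u, r \<otimes>\<^bsub>R\<^esub> v)) xs)"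
    using xs r by (simp add: sep_idem_def)
  from tensor_eq_map[OF this f(1) f(1), of "\<lambda>c. c" k "str S" "str S"]
  have "tensor_eq k S (str S) S (str S) (map (map_prod f f) (map (\<lambda>(u, v). (r \<otimes>\<^bsub>R\<^esub> u, v)) xs))
      (map (map_prod f f) (map (\<lambda>(u, v). (u, r \<otimes>\<^bsub>R\<^esub> v)) xs))"
    using R.R.is_cring S.R.is_cring f(2) by auto
  moreover have "map (map_prod f f) (map (\<lambda>(u, v). (r \<otimes>\<^bsub>R\<^esub> u, v)) xs) =
      map (\<lambda>(u, v). (a \<otimes>\<^bsub>S\<^esub> u, v)) (map (map_prod f f) xs)"
    "map (map_prod f f) (map (\<lambda>(u, v). (u, r \<otimes>\<^bsub>R\<^esub> v)) xs) =
      map (\<lambda>(u, v). (u, a \<otimes>\<^bsub>S\<^esub> v)) (map (map_prod f f) xs)"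
    using xsL r by (auto simp: ring_hom_mult[OF f(1)])
  ultimately show "tensor_eq k S (str S) S (str S) (map (\<lambda>(u, v). (a \<otimes>\<^bsub>S\<^esub> u, v)) (map (map_prod f f) xs))
      (map (\<lambda>(u, v). (u, a \<otimes>\<^bsub>S\<^esub> v)) (map (map_prod f f) xs))" by (simp only:)
qed

text \<open>The separability idempotent is pushed forward along the surjection from \<open>A\<close>
  to its image. For the spanning condition, a test subspace is pulled back to \<open>A\<close>,
  where it contains the image of \<open>\<sigma>\<close> and is therefore everything. Functoriality
  of the core rests on this.\<close>

lemma etale_sub_image:
  fixes k :: "('k, 'm) sring_scheme" and R :: "('k, 'a) salg" and S :: "('k, 'b) salg"
  assumes k: "sigma_field k" and R: "sigma_alg k R" and S: "sigma_alg k S"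
    and f: "f \<in> sigma_alg_hom k R S" and A: "etale_sub k R A"
  shows "etale_sub k S (f ` A)"
proof -
  interpret R: algebra_over_field k R by (rule sigma_alg_field[OF k R])
  interpret S: algebra_over_field k S by (rule sigma_alg_field[OF k S])
  note F = sigma_alg_homD[OF f]
  have sA: "sigma_subalg k R A" using A by (simp add: etale_sub_def)
  have AR: "a \<in> A \<Longrightarrow> a \<in> carrier R" for a using ksubalgD(1)[OF sigma_subalgD(1)[OF sA]] .
  note AD = ksubalgD[OF sigma_subalgD(1)[OF sA]]
  have sm: "f (smul R c x) = smul S c (f x)" if "c \<in> carrier k" "x \<in> carrier R" for c x
    by (rule sigma_alg_hom_smul[OF f R.algebra_over_axioms that])
  have kf: "ksubalg k S (f ` A)"
  proof (rule S.ksubalgI)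
    show "ksub k S (f ` A)" unfolding ksub_def
    proof (intro conjI ballI)
      show "f ` A \<subseteq> carrier S" using AR ring_hom_closed[OF F(1)] by auto
      have "f \<zero>\<^bsub>R\<^esub> = \<zero>\<^bsub>S\<^esub>"
        by (rule additive_zero[OF R.R.abelian_group_axioms S.R.abelian_group_axioms ring_hom_additive[OF F(1)]])
      then show "\<zero>\<^bsub>S\<^esub> \<in> f ` A" using AD(2) by (metis image_eqI)
      fix x y assume "x \<in> f ` A" "y \<in> f ` A"
      then obtain a c where "a \<in> A" "c \<in> A" "x = f a" "y = f c" by blast
      then show "x \<oplus>\<^bsub>S\<^esub> y \<in> f ` A" using AD(5) AR by (metis ring_hom_add[OF F(1)] image_eqI)
    next
      fix c x assume c: "c \<in> carrier k" and "x \<in> f ` A"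
      then obtain a where "a \<in> A" "x = f a" by blast
      then show "smul S c x \<in> f ` A" using AR sm[OF c] ksubD(4)[OF ksubalg_ksub[OF sigma_subalgD(1)[OF sA]] c] by (metis image_eqI)
    qed
    show "\<one>\<^bsub>S\<^esub> \<in> f ` A" using AD(3) ring_hom_one[OF F(1)] by (metis image_eqI)
    fix x y assume "x \<in> f ` A" "y \<in> f ` A"
    then obtain a c where "a \<in> A" "c \<in> A" "x = f a" "y = f c" by blast
    then show "x \<otimes>\<^bsub>S\<^esub> y \<in> f ` A" using AD(6) AR by (metis ring_hom_mult[OF F(1)] image_eqI)
  qed
  have "sig S (f a) \<in> f ` A" if a: "a \<in> A" for a
    using imageI[OF sigma_subalgD(2)[OF sA a], of f] F(2)[OF AR[OF a]] by simp
  then have sub: "sigma_subalg k S (f ` A)" using kf by (auto simp: sigma_subalg_iff)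
  obtain xs where xs: "sep_idem k (R\<lparr>carrier := A\<rparr>) xs" using A etale_sub_iff[OF k R, of A] by blast
  have "f \<in> ring_hom (R\<lparr>carrier := A\<rparr>) (S\<lparr>carrier := f ` A\<rparr>)"
    using F(1) AR by (auto simp: ring_hom_def)
  then have "sep_idem k (S\<lparr>carrier := f ` A\<rparr>) (map (map_prod f f) xs)"
    by (rule sep_idem_image) (use F(3) xs R.ksubalg_algebra_over[OF sigma_subalgD(1)[OF sA]] S.ksubalg_algebra_over[OF kf] in auto)
  moreover have "f ` A \<subseteq> W" if W: "ksub k S W" "sig S ` f ` A \<subseteq> W" for W
  proof -
    have "ksub k R {x \<in> carrier R. f x \<in> W}"
      by (rule ksub_vimage[OF R.algebra_over_axioms S.algebra_over_axioms ring_hom_additive[OF F(1)] sm W(1)])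
    then have "ksub k R ({x \<in> carrier R. f x \<in> W} \<inter> A)"
      using ksubalg_ksub[OF sigma_subalgD(1)[OF sA]] by (auto simp: ksub_def)
    moreover have "sig R ` A \<subseteq> {x \<in> carrier R. f x \<in> W} \<inter> A"
      using sigma_subalgD(2)[OF sA] AR F(2) W(2) by (auto simp: image_subset_iff)
    ultimately have "A \<subseteq> {x \<in> carrier R. f x \<in> W} \<inter> A" using A etale_sub_iff[OF k R, of A] by blast
    then show ?thesis by blast
  qed
  ultimately show ?thesis using sub etale_sub_iff[OF k S, of "f ` A"] by blast
qed

lemma tsum_product:
  assumes Q: "cring Q" and g: "\<And>u v. (u, v) \<in> set xs \<Longrightarrow> g1 u v \<in> carrier Q" "\<And>u v. (u, v) \<in> set ys \<Longrightarrow> g2 u v \<in> carrier Q"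
    and h: "\<And>u v u' v'. (u, v) \<in> set xs \<Longrightarrow> (u', v') \<in> set ys \<Longrightarrow> h (p u u') (q v v') = g1 u v \<otimes>\<^bsub>Q\<^esub> g2 u' v'"
  shows "tsum Q h [(p u u', q v v'). (u, v) \<leftarrow> xs, (u', v') \<leftarrow> ys] = tsum Q g1 xs \<otimes>\<^bsub>Q\<^esub> tsum Q g2 ys"
proof -
  interpret Q: cring Q by fact
  have c2: "tsum Q g2 ys \<in> carrier Q" unfolding tsum_def by (rule Q.lsum_map_closed) (use g in auto)
  have app: "tsum Q h (us @ vs) = tsum Q h us \<oplus>\<^bsub>Q\<^esub> tsum Q h vs"
    if "\<And>u v. (u, v) \<in> set us \<union> set vs \<Longrightarrow> h u v \<in> carrier Q" for us vs
    unfolding tsum_def map_append by (rule Q.lsum_append) (use that in auto)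
  show ?thesis using g(1) h
  proof (induction xs)
    case (Cons x xs)
    obtain u v where x: "x = (u, v)" by (cases x)
    have c1: "tsum Q g1 xs \<in> carrier Q" unfolding tsum_def by (rule Q.lsum_map_closed) (use Cons.prems in auto)
    have gx: "g1 u v \<in> carrier Q" using Cons.prems x by auto
    have "tsum Q h [(p u u', q v v'). (u', v') \<leftarrow> ys] = lsum Q (map (\<lambda>y. g1 u v \<otimes>\<^bsub>Q\<^esub> case_prod g2 y) ys)"
      unfolding tsum_def using Cons.prems(2) x by (auto simp: case_prod_unfold comp_def intro!: lsum_map_cong)
    also have "\<dots> = g1 u v \<otimes>\<^bsub>Q\<^esub> tsum Q g2 ys"
      unfolding tsum_def by (rule Q.lsum_rdistr[symmetric]) (use gx g(2) in auto)
    finally have 1: "tsum Q h [(p u u', q v v'). (u', v') \<leftarrow> ys] = g1 u v \<otimes>\<^bsub>Q\<^esub> tsum Q g2 ys" .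
    have IH: "tsum Q h [(p u u', q v v'). (u, v) \<leftarrow> xs, (u', v') \<leftarrow> ys] = tsum Q g1 xs \<otimes>\<^bsub>Q\<^esub> tsum Q g2 ys"
      using Cons by auto
    have "tsum Q h [(p u u', q v v'). (u, v) \<leftarrow> x # xs, (u', v') \<leftarrow> ys] =
      tsum Q h [(p u u', q v v'). (u', v') \<leftarrow> ys] \<oplus>\<^bsub>Q\<^esub> tsum Q h [(p u u', q v v'). (u, v) \<leftarrow> xs, (u', v') \<leftarrow> ys]"
      using Cons.prems g(2) unfolding x by (subst app[symmetric]) (auto simp: image_iff)
    also have "\<dots> = (g1 u v \<oplus>\<^bsub>Q\<^esub> tsum Q g1 xs) \<otimes>\<^bsub>Q\<^esub> tsum Q g2 ys"
      unfolding 1 IH using c1 c2 gx by (simp add: Q.l_distr)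
    finally show ?case using x by simp
  qed (use c2 in simp)
qed

text \<open>Inside \<open>T \<otimes> T\<close> the list represents the product of the images
  \<open>e1\<close> of \<open>xs\<close> and \<open>e2\<close> of \<open>ys\<close>. An element
  \<open>r \<otimes> 1\<close> crosses over at \<open>e1\<close> and an element
  \<open>1 \<otimes> s\<close> at \<open>e2\<close>.\<close>

lemma (in tensor_product) sep_idem_tensor:
  assumes xs: "sep_idem k R xs" and ys: "sep_idem k S ys"
  shows "sep_idem k T [(b u u', b v v'). (u, v) \<leftarrow> xs, (u', v') \<leftarrow> ys]" (is "sep_idem k T ?zs")
proof -
  interpret TT: tensor_construction k T T ..
  let ?Q = "tensor k T T"
  define c where "c = (\<lambda>r s. TT.cl [(r, s)])"
  interpret Q: tensor_product k T T ?Q c unfolding c_def by (rule TT.tensor_tensor_product)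
  have X: "u \<in> carrier R \<and> v \<in> carrier R" if "(u, v) \<in> set xs" for u v
    using xs that by (auto simp: sep_idem_def in_lists_conv_set)
  have Y: "u \<in> carrier S \<and> v \<in> carrier S" if "(u, v) \<in> set ys" for u v
    using ys that by (auto simp: sep_idem_def in_lists_conv_set)
  have a1: "(\<lambda>r. c (b r \<one>\<^bsub>S\<^esub>) \<one>\<^bsub>T\<^esub>) \<in> ring_hom R ?Q" and a2: "(\<lambda>r. c \<one>\<^bsub>T\<^esub> (b r \<one>\<^bsub>S\<^esub>)) \<in> ring_hom R ?Q"
    and b1: "(\<lambda>s. c (b \<one>\<^bsub>R\<^esub> s) \<one>\<^bsub>T\<^esub>) \<in> ring_hom S ?Q" and b2: "(\<lambda>s. c \<one>\<^bsub>T\<^esub> (b \<one>\<^bsub>R\<^esub> s)) \<in> ring_hom S ?Q"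
    using ring_hom_trans[OF b_hom_left Q.b_hom_left] ring_hom_trans[OF b_hom_left Q.b_hom_right]
      ring_hom_trans[OF b_hom_right Q.b_hom_left] ring_hom_trans[OF b_hom_right Q.b_hom_right] by (simp_all add: comp_def)
  define e1 where "e1 = tsum ?Q (\<lambda>u v. c (b u \<one>\<^bsub>S\<^esub>) \<one>\<^bsub>T\<^esub> \<otimes>\<^bsub>?Q\<^esub> c \<one>\<^bsub>T\<^esub> (b v \<one>\<^bsub>S\<^esub>)) xs"
  define e2 where "e2 = tsum ?Q (\<lambda>u v. c (b \<one>\<^bsub>R\<^esub> u) \<one>\<^bsub>T\<^esub> \<otimes>\<^bsub>?Q\<^esub> c \<one>\<^bsub>T\<^esub> (b \<one>\<^bsub>R\<^esub> v)) ys"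
  have ag: "c (b (str R d) \<one>\<^bsub>S\<^esub>) \<one>\<^bsub>T\<^esub> = c \<one>\<^bsub>T\<^esub> (b (str R d) \<one>\<^bsub>S\<^esub>)" "c (b \<one>\<^bsub>R\<^esub> (str S d)) \<one>\<^bsub>T\<^esub> = c \<one>\<^bsub>T\<^esub> (b \<one>\<^bsub>R\<^esub> (str S d))"
    if "d \<in> carrier k" for d
    using that by (simp_all add: b_str[symmetric] b_str_right[symmetric] Q.b_str[symmetric] Q.b_str_right[symmetric])
  note E1 = sep_idem_hom[OF R.algebra_over_axioms xs Q.T.R.is_cring a1 a2 ag(1), folded e1_def]
  note E2 = sep_idem_hom[OF S.algebra_over_axioms ys Q.T.R.is_cring b1 b2 ag(2), folded e2_def]
  have zL: "?zs \<in> lists (carrier T \<times> carrier T)" using X Y by (auto simp: in_lists_conv_set)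
  have z: "tsum ?Q c ?zs = e1 \<otimes>\<^bsub>?Q\<^esub> e2" unfolding e1_def e2_def
  proof (rule tsum_product[OF Q.T.R.is_cring])
    fix u v u' v' assume "(u, v) \<in> set xs" "(u', v') \<in> set ys"
    then have uv: "u \<in> carrier R" "v \<in> carrier R" "u' \<in> carrier S" "v' \<in> carrier S" using X Y by auto
    show "c (b u u') (b v v') = c (b u \<one>\<^bsub>S\<^esub>) \<one>\<^bsub>T\<^esub> \<otimes>\<^bsub>?Q\<^esub> c \<one>\<^bsub>T\<^esub> (b v \<one>\<^bsub>S\<^esub>) \<otimes>\<^bsub>?Q\<^esub>
        (c (b \<one>\<^bsub>R\<^esub> u') \<one>\<^bsub>T\<^esub> \<otimes>\<^bsub>?Q\<^esub> c \<one>\<^bsub>T\<^esub> (b \<one>\<^bsub>R\<^esub> v'))"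
      using uv by (simp add: Q.b_mult b_mult)
  qed (use X Y in auto)
  have one: "tsum T (\<otimes>\<^bsub>T\<^esub>) ?zs = \<one>\<^bsub>T\<^esub>"
  proof -
    have "tsum T (\<otimes>\<^bsub>T\<^esub>) ?zs = tsum T (\<lambda>u v. b (u \<otimes>\<^bsub>R\<^esub> v) \<one>\<^bsub>S\<^esub>) xs \<otimes>\<^bsub>T\<^esub> tsum T (\<lambda>u v. b \<one>\<^bsub>R\<^esub> (u \<otimes>\<^bsub>S\<^esub> v)) ys"
      by (rule tsum_product[OF T.R.is_cring]) (use X Y in \<open>auto simp: b_mult\<close>)
    also have "tsum T (\<lambda>u v. b (u \<otimes>\<^bsub>R\<^esub> v) \<one>\<^bsub>S\<^esub>) xs = b (tsum R (\<otimes>\<^bsub>R\<^esub>) xs) \<one>\<^bsub>S\<^esub>" unfolding tsum_def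
      by (subst lsum_map_hom[OF R.R.abelian_group_axioms T.R.abelian_group_axioms b_additive_left[OF S.R.one_closed]])
        (use X in \<open>auto simp: case_prod_unfold\<close>)
    also have "tsum T (\<lambda>u v. b \<one>\<^bsub>R\<^esub> (u \<otimes>\<^bsub>S\<^esub> v)) ys = b \<one>\<^bsub>R\<^esub> (tsum S (\<otimes>\<^bsub>S\<^esub>) ys)" unfolding tsum_def
      by (subst lsum_map_hom[OF S.R.abelian_group_axioms T.R.abelian_group_axioms b_additive_right[OF R.R.one_closed]])
        (use Y in \<open>auto simp: case_prod_unfold\<close>)
    finally show ?thesis using xs ys by (simp add: sep_idem_def)
  qed
  have eq: "c t \<one>\<^bsub>T\<^esub> \<otimes>\<^bsub>?Q\<^esub> (e1 \<otimes>\<^bsub>?Q\<^esub> e2) = c \<one>\<^bsub>T\<^esub> t \<otimes>\<^bsub>?Q\<^esub> (e1 \<otimes>\<^bsub>?Q\<^esub> e2)" if "t \<in> carrier T" for t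
    using that
  proof (induction rule: tensor_induct)
    case zero
    then show ?case using E1(1) E2(1) by simp
  next
    case (add r s t)
    have rs: "c (b r s) \<one>\<^bsub>T\<^esub> = c (b r \<one>\<^bsub>S\<^esub>) \<one>\<^bsub>T\<^esub> \<otimes>\<^bsub>?Q\<^esub> c (b \<one>\<^bsub>R\<^esub> s) \<one>\<^bsub>T\<^esub>"
      "c \<one>\<^bsub>T\<^esub> (b r s) = c \<one>\<^bsub>T\<^esub> (b r \<one>\<^bsub>S\<^esub>) \<otimes>\<^bsub>?Q\<^esub> c \<one>\<^bsub>T\<^esub> (b \<one>\<^bsub>R\<^esub> s)"
      using add by (simp_all add: Q.b_mult b_mult)
    let ?r1 = "c (b r \<one>\<^bsub>S\<^esub>) \<one>\<^bsub>T\<^esub>" and ?r2 = "c \<one>\<^bsub>T\<^esub> (b r \<one>\<^bsub>S\<^esub>)" and ?s1 = "c (b \<one>\<^bsub>R\<^esub> s) \<one>\<^bsub>T\<^esub>" and ?s2 = "c \<one>\<^bsub>T\<^esub> (b \<one>\<^bsub>R\<^esub> s)"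
    have cl: "?r1 \<in> carrier ?Q" "?r2 \<in> carrier ?Q" "?s1 \<in> carrier ?Q" "?s2 \<in> carrier ?Q" using add by auto
    have "?r1 \<otimes>\<^bsub>?Q\<^esub> ?s1 \<otimes>\<^bsub>?Q\<^esub> (e1 \<otimes>\<^bsub>?Q\<^esub> e2) = (?r1 \<otimes>\<^bsub>?Q\<^esub> e1) \<otimes>\<^bsub>?Q\<^esub> (?s1 \<otimes>\<^bsub>?Q\<^esub> e2)"
      using cl E1(1) E2(1) by (simp add: Q.T.R.m_ac)
    also have "\<dots> = (?r2 \<otimes>\<^bsub>?Q\<^esub> e1) \<otimes>\<^bsub>?Q\<^esub> (?s2 \<otimes>\<^bsub>?Q\<^esub> e2)" using E1(2) E2(2) add by simp
    also have "\<dots> = ?r2 \<otimes>\<^bsub>?Q\<^esub> ?s2 \<otimes>\<^bsub>?Q\<^esub> (e1 \<otimes>\<^bsub>?Q\<^esub> e2)" using cl E1(1) E2(1) by (simp add: Q.T.R.m_ac)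
    finally have "c (b r s) \<one>\<^bsub>T\<^esub> \<otimes>\<^bsub>?Q\<^esub> (e1 \<otimes>\<^bsub>?Q\<^esub> e2) = c \<one>\<^bsub>T\<^esub> (b r s) \<otimes>\<^bsub>?Q\<^esub> (e1 \<otimes>\<^bsub>?Q\<^esub> e2)" by (simp only: rs)
    then show ?case using add E1(1) E2(1) by (simp add: Q.b_add_left Q.b_add_right Q.T.R.l_distr)
  qed
  show ?thesis by (rule sep_idemI[OF Q.tensor_product_axioms zL one]) (simp only: z eq)
qed

text \<open>A subspace that contains all \<open>\<sigma>(r) \<otimes> \<sigma>(s)\<close> is filled
  up one factor at a time: with \<open>\<sigma>(s)\<close> fixed the spanning condition of
  \<open>R\<close> frees the left factor, and then that of \<open>S\<close> frees the right
  one.\<close>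

lemma (in tensor_product) sig_spans_tensor:
  assumes R: "sig_spans k R" "sig R \<in> carrier R \<rightarrow> carrier R" and S: "sig_spans k S" "sig S \<in> carrier S \<rightarrow> carrier S"
    and sT: "\<And>r s. r \<in> carrier R \<Longrightarrow> s \<in> carrier S \<Longrightarrow> sig T (b r s) = b (sig R r) (sig S s)"
  shows "sig_spans k T"
  unfolding sig_spans_def
proof (intro allI impI subsetI)
  fix W t assume W: "ksub k T W" and sW: "sig T ` carrier T \<subseteq> W" and t: "t \<in> carrier T"
  have 1: "b r (sig S s) \<in> W" if r: "r \<in> carrier R" and s: "s \<in> carrier S" for r s
  proof -
    have ss: "sig S s \<in> carrier S" using S(2) s by auto
    have "ksub k R {r \<in> carrier R. b r (sig S s) \<in> W}"
      by (rule ksub_vimage[OF R.algebra_over_axioms T.algebra_over_axioms b_additive_left[OF ss] _ W])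
        (use ss b_smul_left in auto)
    moreover have "sig R x \<in> {r \<in> carrier R. b r (sig S s) \<in> W}" if x: "x \<in> carrier R" for x
    proof -
      have "sig T (b x s) \<in> W" by (rule subsetD[OF sW imageI[OF b_closed[OF x s]]])
      then show ?thesis using sT[OF x s] R(2) x by auto
    qed
    ultimately show ?thesis using sig_spansD[OF R(1) _ _ r] by blast
  qed
  have 2: "b r s \<in> W" if r: "r \<in> carrier R" and s: "s \<in> carrier S" for r s
  proof -
    have "ksub k S {s \<in> carrier S. b r s \<in> W}"
      by (rule ksub_vimage[OF S.algebra_over_axioms T.algebra_over_axioms b_additive_right[OF r] _ W])
        (use r b_smul_right in auto)
    moreover have "sig S x \<in> {s \<in> carrier S. b r s \<in> W}" if x: "x \<in> carrier S" for x
      using 1[OF r x] S(2) x by auto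
    ultimately show ?thesis using sig_spansD[OF S(1) _ _ s] by blast
  qed
  show "t \<in> W" using t by (induction rule: tensor_induct) (use 2 ksubD[OF W] in auto)
qed

text \<open>The multiplication map from \<open>A \<otimes> B\<close> to \<open>R\<close> is a
  morphism of difference algebras, and its image contains both. The family is thus directed, which
  is what makes its union, the strong core, closed under the ring operations.\<close>

lemma etale_sub_sup:
  fixes k :: "('k, 'm) sring_scheme" and R :: "('k, 'a) salg"
  assumes k: "sigma_field k" and R: "sigma_alg k R" and A: "etale_sub k R A" and B: "etale_sub k R B"
  shows "\<exists>C. etale_sub k R C \<and> A \<subseteq> C \<and> B \<subseteq> C"
proof -
  interpret R: algebra_over_field k R by (rule sigma_alg_field[OF k R])
  have sA: "sigma_subalg k R A" and sB: "sigma_subalg k R B" using A B by (auto simp: etale_sub_def)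
  let ?A = "R\<lparr>carrier := A\<rparr>" and ?B = "R\<lparr>carrier := B\<rparr>"
  have aA: "sigma_alg k ?A" and aB: "sigma_alg k ?B"
    using sigma_alg_sub[OF sigma_field_cring(1)[OF k] R] sA sB by auto
  let ?Q = "tensor k ?A ?B"
  define b where "b = (\<lambda>r s. tensor_class k ?A (str ?A) ?B (str ?B) [(r, s)])"
  interpret Q: tensor_product_field k ?A ?B ?Q b unfolding b_def by (rule sigma_tensor[OF k aA aB])
  have aQ: "sigma_alg k ?Q" and sQ: "\<And>r s. r \<in> A \<Longrightarrow> s \<in> B \<Longrightarrow> sig ?Q (b r s) = b (sig R r) (sig R s)"
    unfolding b_def using sigma_alg_tensor[OF sigma_field_cring(3)[OF k] aA aB] by auto
  have AR: "a \<in> A \<Longrightarrow> a \<in> carrier R" and BR: "c \<in> B \<Longrightarrow> c \<in> carrier R" for a c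
    using ksubalgD(1)[OF sigma_subalgD(1)[OF sA]] ksubalgD(1)[OF sigma_subalgD(1)[OF sB]] by auto
  obtain xs where xs: "sep_idem k ?A xs" using A etale_sub_iff[OF k R, of A] by blast
  obtain ys where ys: "sep_idem k ?B ys" using B etale_sub_iff[OF k R, of B] by blast
  have spA: "sig_spans k ?A" and spB: "sig_spans k ?B"
    using A B strongly_etale_iff[OF k aA] strongly_etale_iff[OF k aB] by (auto simp: etale_sub_def)
  have "sig_spans k ?Q"
    by (rule Q.sig_spans_tensor[OF spA _ spB]) (use sigma_subalgD(2)[OF sA] sigma_subalgD(2)[OF sB] sQ in auto)
  moreover obtain zs where "sep_idem k ?Q zs" using Q.sep_idem_tensor[OF xs ys] by blast
  moreover have "sigma_subalg k ?Q (carrier ?Q)"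
    using Q.T.ksubalg_carrier ring_hom_closed[OF sigma_algD(1)[OF aQ]] by (auto simp: sigma_subalg_iff)
  ultimately have eQ: "etale_sub k ?Q (carrier ?Q)"
    using strongly_etale_iff[OF k aQ] by (auto simp: etale_sub_def)
  have iA: "(\<lambda>x. x) \<in> ring_hom ?A R" and iB: "(\<lambda>x. x) \<in> ring_hom ?B R" using AR BR by (auto simp: ring_hom_def)
  obtain m where m: "m \<in> ring_hom ?Q R" "\<And>r s. r \<in> carrier ?A \<Longrightarrow> s \<in> carrier ?B \<Longrightarrow> m (b r s) = r \<otimes>\<^bsub>R\<^esub> s"
    by (rule Q.hom_lift[OF R.R.is_cring iA iB]) auto
  have "m (sig ?Q t) = sig R (m t)" if t: "t \<in> carrier ?Q" for t
  proof (rule Q.hom_eq[OF R.R.is_cring _ _ _ t])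
    show "(\<lambda>t. m (sig ?Q t)) \<in> ring_hom ?Q R"
      using ring_hom_trans[OF sigma_algD(1)[OF aQ] m(1)] by (simp add: comp_def)
    show "(\<lambda>t. sig R (m t)) \<in> ring_hom ?Q R"
      using ring_hom_trans[OF m(1) sigma_algD(1)[OF R]] by (simp add: comp_def)
    fix r s assume "r \<in> carrier ?A" "s \<in> carrier ?B"
    then show "m (sig ?Q (b r s)) = sig R (m (b r s))"
      using sQ m(2) sigma_subalgD(2)[OF sA] sigma_subalgD(2)[OF sB] AR BR ring_hom_mult[OF sigma_algD(1)[OF R]] by simp
  qed
  moreover have "m (str ?Q c) = str R c" if "c \<in> carrier k" for c
    using that m(2)[of "str R c" "\<one>\<^bsub>R\<^esub>"] Q.b_str[OF that] ksubalgD(3,7)[OF sigma_subalgD(1)[OF sA]]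
      ksubalgD(3)[OF sigma_subalgD(1)[OF sB]] by simp
  ultimately have "m \<in> sigma_alg_hom k ?Q R" using m(1) by (auto simp: sigma_alg_hom_def)
  then have "etale_sub k R (m ` carrier ?Q)" by (rule etale_sub_image[OF k aQ R _ eQ])
  moreover have "A \<subseteq> m ` carrier ?Q"
  proof
    fix a assume a: "a \<in> A"
    have "m (b a \<one>\<^bsub>R\<^esub>) = a" "b a \<one>\<^bsub>R\<^esub> \<in> carrier ?Q"
      using m(2)[of a "\<one>\<^bsub>R\<^esub>"] Q.b_closed[of a "\<one>\<^bsub>R\<^esub>"] a AR ksubalgD(3)[OF sigma_subalgD(1)[OF sB]] by auto
    then show "a \<in> m ` carrier ?Q" by (metis image_eqI)
  qed
  moreover have "B \<subseteq> m ` carrier ?Q"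
  proof
    fix a assume a: "a \<in> B"
    have "m (b \<one>\<^bsub>R\<^esub> a) = a" "b \<one>\<^bsub>R\<^esub> a \<in> carrier ?Q"
      using m(2)[of "\<one>\<^bsub>R\<^esub>" a] Q.b_closed[of "\<one>\<^bsub>R\<^esub>" a] a BR ksubalgD(3)[OF sigma_subalgD(1)[OF sA]] by auto
    then show "a \<in> m ` carrier ?Q" by (metis image_eqI)
  qed
  ultimately show ?thesis by blast
qed

text \<open>Scalars move across the tensor sign, so \<open>1 \<otimes> 1\<close> is a separability
  idempotent, and \<open>\<sigma>(1) = 1\<close> spans. This puts zero and one into the core and
  later shows that the core of the unit object is the unit object.\<close>

lemma etale_sub_base:
  fixes k :: "('k, 'm) sring_scheme" and R :: "('k, 'a) salg"
  assumes k: "sigma_field k" and R: "sigma_alg k R"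
  shows "etale_sub k R (str R ` carrier k)"
proof -
  interpret R: algebra_over_field k R by (rule sigma_alg_field[OF k R])
  let ?A = "str R ` carrier k"
  have sk: "sig k c \<in> carrier k" if "c \<in> carrier k" for c
    using k that by (auto simp: sigma_field_def sigma_ring_def ring_hom_def)
  have one: "\<one>\<^bsub>R\<^esub> \<in> ?A" by (rule ksubalgD(3)[OF R.ksubalg_str])
  have "sigma_subalg k R ?A" using R.ksubalg_str sk sigma_algD(2)[OF R] by (auto simp: sigma_subalg_iff)
  moreover have "sep_idem k (R\<lparr>carrier := ?A\<rparr>) [(\<one>\<^bsub>R\<^esub>, \<one>\<^bsub>R\<^esub>)]"
    unfolding sep_idem_def
  proof (intro conjI ballI)
    fix a assume "a \<in> carrier (R\<lparr>carrier := ?A\<rparr>)"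
    then obtain c where c: "c \<in> carrier k" "a = str R c" by auto
    show "tensor_eq k (R\<lparr>carrier := ?A\<rparr>) (str (R\<lparr>carrier := ?A\<rparr>)) (R\<lparr>carrier := ?A\<rparr>) (str (R\<lparr>carrier := ?A\<rparr>))
      (map (\<lambda>(u, v). (a \<otimes>\<^bsub>R\<lparr>carrier := ?A\<rparr>\<^esub> u, v)) [(\<one>\<^bsub>R\<^esub>, \<one>\<^bsub>R\<^esub>)])
      (map (\<lambda>(u, v). (u, a \<otimes>\<^bsub>R\<lparr>carrier := ?A\<rparr>\<^esub> v)) [(\<one>\<^bsub>R\<^esub>, \<one>\<^bsub>R\<^esub>)])"
      using tensor_eq.balanced[of c k "\<one>\<^bsub>R\<^esub>" "R\<lparr>carrier := ?A\<rparr>" "\<one>\<^bsub>R\<^esub>" "R\<lparr>carrier := ?A\<rparr>" "str R" "str R"] c one by simp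
  qed (use one in auto)
  moreover have "?A \<subseteq> W" if W: "ksub k R W" "sig R ` ?A \<subseteq> W" for W
  proof -
    have "sig R \<one>\<^bsub>R\<^esub> \<in> W" using W(2) one by blast
    then have "\<one>\<^bsub>R\<^esub> \<in> W" using ring_hom_one[OF sigma_algD(1)[OF R]] by simp
    then show ?thesis using ksubD(4)[OF W(1), of _ "\<one>\<^bsub>R\<^esub>"] by (auto simp: smul_def)
  qed
  ultimately show ?thesis unfolding etale_sub_iff[OF k R] by (intro conjI exI allI impI)
qed

lemma core_carrier: "carrier (strong_core k R) = \<Union>{A. etale_sub k R A}"
  by (simp add: strong_core_def etale_sub_def)

lemma sigma_subalg_core:
  fixes k :: "('k, 'm) sring_scheme" and R :: "('k, 'a) salg"
  assumes k: "sigma_field k" and R: "sigma_alg k R"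
  shows "sigma_subalg k R (carrier (strong_core k R))"
proof -
  interpret R: algebra_over_field k R by (rule sigma_alg_field[OF k R])
  let ?C = "carrier (strong_core k R)"
  have sub: "sigma_subalg k R A" if "etale_sub k R A" for A using that by (simp add: etale_sub_def)
  note D = ksubalgD[OF sigma_subalgD(1)[OF sub]] and K = ksubD[OF ksubalg_ksub[OF sigma_subalgD(1)[OF sub]]]
  have two: "\<exists>A. etale_sub k R A \<and> x \<in> A \<and> y \<in> A" if "x \<in> ?C" "y \<in> ?C" for x y
    using that etale_sub_sup[OF k R] unfolding core_carrier by blast
  note base = etale_sub_base[OF k R]
  have "ksubalg k R ?C"
  proof (rule R.ksubalgI)
    show "ksub k R ?C" unfolding ksub_def
    proof (intro conjI ballI)
      show "?C \<subseteq> carrier R" using D(1) unfolding core_carrier by blast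
      show "\<zero>\<^bsub>R\<^esub> \<in> ?C" using D(2)[OF base] base unfolding core_carrier by blast
      fix x y assume "x \<in> ?C" "y \<in> ?C"
      then show "x \<oplus>\<^bsub>R\<^esub> y \<in> ?C" using two D(5) unfolding core_carrier by blast
    next
      fix c x assume "c \<in> carrier k" "x \<in> ?C"
      then show "smul R c x \<in> ?C" using K(4) unfolding core_carrier by blast
    qed
    show "\<one>\<^bsub>R\<^esub> \<in> ?C" using D(3)[OF base] base unfolding core_carrier by blast
    show "x \<otimes>\<^bsub>R\<^esub> y \<in> ?C" if "x \<in> ?C" "y \<in> ?C" for x y
      using two[OF that] D(6) unfolding core_carrier by blast
  qed
  moreover have "sig R ` ?C \<subseteq> ?C" using sigma_subalgD(2)[OF sub] unfolding core_carrier by blast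
  ultimately show ?thesis by (simp add: sigma_subalg_iff)
qed

lemma core_eq: "strong_core k R = R\<lparr>carrier := carrier (strong_core k R)\<rparr>"
  by (simp add: strong_core_def)

lemma sigma_alg_core:
  fixes k :: "('k, 'm) sring_scheme" and R :: "('k, 'a) salg"
  assumes k: "sigma_field k" and R: "sigma_alg k R"
  shows "sigma_alg k (strong_core k R)"
  using sigma_alg_sub[OF sigma_field_cring(1)[OF k] R sigma_subalg_core[OF k R]] core_eq[of k R] by simp

lemma core_hom:
  fixes k :: "('k, 'm) sring_scheme" and R :: "('k, 'a) salg" and S :: "('k, 'b) salg"
  assumes k: "sigma_field k" and R: "sigma_alg k R" and S: "sigma_alg k S" and f: "f \<in> sigma_alg_hom k R S"
    and x: "x \<in> carrier (strong_core k R)"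
  shows "f x \<in> carrier (strong_core k S)"
  using x etale_sub_image[OF k R S f] unfolding core_carrier by blast

section \<open>Descent of strongly etale subalgebras\<close>

text \<open>The generators are discarded one at a time: \<open>1 - e\<close> maps the ideal into the one spanned by the
  generators that are still left.\<close>

lemma (in cring) idempotent_ideal_unit:
  defines "A \<equiv> self_alg R"
  assumes ts: "set ts \<subseteq> carrier R"
    and sq: "\<And>y W. y \<in> set ts \<Longrightarrow> ksub R A W \<Longrightarrow>
      (\<And>m z. m \<in> lspan R A ts \<Longrightarrow> z \<in> lspan R A ts \<Longrightarrow> m \<otimes> z \<in> W) \<Longrightarrow> y \<in> W"
  shows "\<exists>e \<in> lspan R A ts. \<forall>x \<in> lspan R A ts. e \<otimes> x = x"
proof -
  interpret A: algebra_over R A unfolding A_def by (rule self_alg)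
  have A [simp]: "carrier A = carrier R" "monoid.mult A = monoid.mult R" "ring.add A = ring.add R"
    "ring.zero A = ring.zero R" "monoid.one A = monoid.one R" "smul A c x = c \<otimes> x" for c x
    by (simp_all add: A_def smul_def)
  let ?J = "lspan R A ts"
  have J: "ksub R A ?J" using A.lspan_ksub[of ts] ts by simp
  note JD = ksubD[OF J, simplified]
  have Jm: "x \<otimes> y \<in> ?J" if "x \<in> ?J" "y \<in> carrier R" for x y
    using JD(4)[OF that(2,1)] JD(1)[OF that(1)] that(2) by (simp add: m_comm)
  have "\<exists>e \<in> ?J. \<forall>x \<in> ?J. (\<one> \<ominus> e) \<otimes> x \<in> lspan R A ys" if "ts = xs @ ys" for xs ys
    using that
  proof (induction xs arbitrary: ys rule: rev_induct)
    case Nil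
    have "(\<one> \<ominus> \<zero>) \<otimes> x = x" if "x \<in> ?J" for x using JD(1)[OF that] by (simp add: a_minus_def)
    then show ?case using JD(2) Nil by (intro bexI[of _ "\<zero>"]) auto
  next
    case (snoc y xs)
    obtain e where e: "e \<in> ?J" "\<And>x. x \<in> ?J \<Longrightarrow> (\<one> \<ominus> e) \<otimes> x \<in> lspan R A (y # ys)"
      using snoc.IH[of "y # ys"] snoc.prems by auto
    have ysR: "set ys \<subseteq> carrier A" and y: "y \<in> set ts" "y \<in> carrier R" using snoc.prems ts by auto
    have Y: "ksub R A (lspan R A ys)" by (rule A.lspan_ksub[OF ysR])
    note YD = ksubD[OF Y, simplified]
    have eR: "e \<in> carrier R" "\<one> \<ominus> e \<in> carrier R" using JD(1) e(1) by auto
    \<comment> \<open>The elements that \<open>1 - e\<close> maps into the multiples of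
      \<open>y\<close> by \<open>?J\<close>, up to the ideal spanned by the remaining
      generators.\<close>
    let ?W = "{x \<in> carrier R. \<exists>m \<in> ?J. \<exists>w \<in> lspan R A ys. (\<one> \<ominus> e) \<otimes> x = m \<otimes> y \<oplus> w}"
    have "ksub R A ?W" unfolding ksub_def
    proof (intro conjI ballI)
      show "?W \<subseteq> carrier A" by auto
      show "\<zero>\<^bsub>A\<^esub> \<in> ?W" using JD(2) YD(2) eR y by (auto intro!: bexI[of _ "\<zero>"])
      fix u v assume "u \<in> ?W" "v \<in> ?W"
      then obtain m w n z where mw: "u \<in> carrier R" "m \<in> ?J" "w \<in> lspan R A ys" "(\<one> \<ominus> e) \<otimes> u = m \<otimes> y \<oplus> w"
        "v \<in> carrier R" "n \<in> ?J" "z \<in> lspan R A ys" "(\<one> \<ominus> e) \<otimes> v = n \<otimes> y \<oplus> z" by blast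
      have "(\<one> \<ominus> e) \<otimes> (u \<oplus> v) = (m \<oplus> n) \<otimes> y \<oplus> (w \<oplus> z)"
        using mw JD(1) YD(1) y eR by (simp add: r_distr l_distr a_ac)
      then have "\<exists>m' \<in> ?J. \<exists>w' \<in> lspan R A ys. (\<one> \<ominus> e) \<otimes> (u \<oplus> v) = m' \<otimes> y \<oplus> w'"
        using JD(3)[OF mw(2,6)] YD(3)[OF mw(3,7)] by blast
      then show "u \<oplus>\<^bsub>A\<^esub> v \<in> ?W" using mw(1,5) by simp
    next
      fix c u assume c: "c \<in> carrier R" and "u \<in> ?W"
      then obtain m w where mw: "u \<in> carrier R" "m \<in> ?J" "w \<in> lspan R A ys" "(\<one> \<ominus> e) \<otimes> u = m \<otimes> y \<oplus> w" by blast
      have "(\<one> \<ominus> e) \<otimes> (c \<otimes> u) = c \<otimes> ((\<one> \<ominus> e) \<otimes> u)" using mw c eR by (simp add: m_lcomm)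
      also have "\<dots> = (c \<otimes> m) \<otimes> y \<oplus> c \<otimes> w"
        unfolding mw(4) using mw c JD(1) YD(1) y by (simp add: r_distr m_assoc)
      finally have "\<exists>m' \<in> ?J. \<exists>w' \<in> lspan R A ys. (\<one> \<ominus> e) \<otimes> (c \<otimes> u) = m' \<otimes> y \<oplus> w'"
        using JD(4)[OF c mw(2)] YD(4)[OF c mw(3)] by blast
      then show "smul A c u \<in> ?W" using mw(1) c by simp
    qed
    moreover have "m \<otimes> z \<in> ?W" if m: "m \<in> ?J" and z: "z \<in> ?J" for m z
    proof -
      obtain t w where tw: "t \<in> carrier R" "w \<in> lspan R A ys" "(\<one> \<ominus> e) \<otimes> z = t \<otimes> y \<oplus> w" using e(2)[OF z] by auto
      have "(\<one> \<ominus> e) \<otimes> (m \<otimes> z) = m \<otimes> ((\<one> \<ominus> e) \<otimes> z)" using JD(1) m z eR by (simp add: m_lcomm)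
      also have "\<dots> = (m \<otimes> t) \<otimes> y \<oplus> m \<otimes> w" unfolding tw(3) using JD(1)[OF m] tw y YD(1) by (simp add: r_distr m_assoc)
      finally have "\<exists>m' \<in> ?J. \<exists>w' \<in> lspan R A ys. (\<one> \<ominus> e) \<otimes> (m \<otimes> z) = m' \<otimes> y \<oplus> w'"
        using Jm[OF m tw(1)] YD(4)[OF JD(1)[OF m] tw(2)] by blast
      then show ?thesis using JD(1) m z by auto
    qed
    \<comment> \<open>The ideal \<open>?W\<close> contains all products of two elements of
      \<open>?J\<close>, and the assumption says that the generators lie in the square of
      \<open>?J\<close>. The resulting equation \<open>(1 - e) y = m y + w\<close> has its
      coefficient \<open>m\<close> in \<open>?J\<close>, as in the proof of Nakayama's
      lemma.\<close>
    ultimately have "y \<in> ?W" using sq[OF y(1)] by blast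
    then obtain m w where mw: "m \<in> ?J" "w \<in> lspan R A ys" "(\<one> \<ominus> e) \<otimes> y = m \<otimes> y \<oplus> w" by blast
    \<comment> \<open>Moving \<open>m y\<close> to the left gives \<open>f y = w\<close>:
      multiplication by \<open>f\<close> eliminates the generator \<open>y\<close>.\<close>
    define f where "f = (\<one> \<ominus> e) \<ominus> m"
    have mR: "m \<in> carrier R" "w \<in> carrier R" using JD(1)[OF mw(1)] YD(1)[OF mw(2)] by auto
    have f: "f \<in> carrier R" using eR mR by (simp add: f_def)
    have fy: "f \<otimes> y = w"
    proof -
      have "f \<otimes> y = (\<one> \<ominus> e) \<otimes> y \<oplus> \<ominus> (m \<otimes> y)"
        unfolding f_def a_minus_def[of R "\<one> \<ominus> e" m] using eR mR y by (simp add: l_distr l_minus)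
      also have "\<dots> = w" unfolding mw(3) using mR y by (simp add: a_comm[of "m \<otimes> y"] a_assoc r_neg)
      finally show ?thesis .
    qed
    \<comment> \<open>Chosen so that \<open>1 - ?e = (1 - e) f\<close>; it lies in \<open>?J\<close>
      because \<open>f\<close> differs from \<open>1\<close> by an element of
      \<open>?J\<close>.\<close>
    let ?e = "(e \<oplus> m) \<oplus> e \<otimes> f"
    have eJ: "?e \<in> ?J" using JD(3) Jm e(1) mw(1) f by blast
    have 1: "\<one> \<ominus> ?e = (\<one> \<ominus> e) \<otimes> f"
    proof -
      have "(\<one> \<ominus> e) \<otimes> f = f \<oplus> \<ominus> (e \<otimes> f)" unfolding a_minus_def[of R "\<one>" e] using JD(1)[OF e(1)] f by (simp add: l_distr l_minus)
      also have "\<dots> = \<one> \<ominus> ?e" unfolding f_def using eR mR by (simp add: a_minus_def minus_add a_assoc)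
      finally show ?thesis by simp
    qed
    have "(\<one> \<ominus> ?e) \<otimes> x \<in> lspan R A ys" if x: "x \<in> ?J" for x
    proof -
      obtain t v where tv: "t \<in> carrier R" "v \<in> lspan R A ys" "(\<one> \<ominus> e) \<otimes> x = t \<otimes> y \<oplus> v" using e(2)[OF x] by auto
      have "(\<one> \<ominus> ?e) \<otimes> x = f \<otimes> ((\<one> \<ominus> e) \<otimes> x)" unfolding 1 using f eR JD(1)[OF x] by (simp add: m_ac)
      also have "\<dots> = t \<otimes> (f \<otimes> y) \<oplus> f \<otimes> v" unfolding tv(3) using f tv y YD(1) by (simp add: r_distr m_lcomm)
      finally show ?thesis using YD(3,4) tv f mw(2) fy by simp
    qed
    then show ?case using eJ by blast
  qed
  from this[of ts "[]"] obtain e where e: "e \<in> ?J" "\<And>x. x \<in> ?J \<Longrightarrow> (\<one> \<ominus> e) \<otimes> x = \<zero>" by auto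
  have "e \<otimes> x = x" if x: "x \<in> ?J" for x
  proof -
    have c: "e \<in> carrier R" "x \<in> carrier R" using JD(1) e x by auto
    then have "x \<ominus> e \<otimes> x = \<zero>" using e(2)[OF x] by (simp add: a_minus_def l_distr l_minus)
    then show ?thesis using c by (simp add: r_right_minus_eq)
  qed
  then show ?thesis using e(1) by blast
qed

lemma (in algebra_over) ksub_self: "ksub R (self_alg R) W \<Longrightarrow> ksub k R W"
  by (auto simp: ksub_def smul_def)

lemma (in tensor_product) id_hom:
  assumes "tensor_product k R S' T' b'" and h: "h \<in> ring_hom S S'" "\<And>c. c \<in> carrier k \<Longrightarrow> h (str S c) = str S' c"
  obtains q where "q \<in> ring_hom T T'" "\<And>r s. r \<in> carrier R \<Longrightarrow> s \<in> carrier S \<Longrightarrow> q (b r s) = b' r (h s)"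
proof -
  interpret T': tensor_product k R S' T' b' by fact
  have g: "(\<lambda>s. b' \<one>\<^bsub>R\<^esub> (h s)) \<in> ring_hom S T'" using ring_hom_trans[OF h(1) T'.b_hom_right] by (simp add: comp_def)
  obtain q where q: "q \<in> ring_hom T T'"
    "\<And>r s. r \<in> carrier R \<Longrightarrow> s \<in> carrier S \<Longrightarrow> q (b r s) = b' r \<one>\<^bsub>S'\<^esub> \<otimes>\<^bsub>T'\<^esub> b' \<one>\<^bsub>R\<^esub> (h s)"
    by (rule hom_lift[OF T'.T.R.is_cring T'.b_hom_left g]) (auto simp: T'.b_str[symmetric] T'.b_str_right[symmetric] h(2))
  then show thesis using that[OF q(1)] ring_hom_closed[OF h(1)] by (simp add: T'.b_split[symmetric])
qed

text \<open>Contraction touches the left factor only and is therefore natural in the right one.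
  Coefficients can thus be compared after the maps from \<open>S\<close> to
  \<open>S \<otimes> S\<close> and from \<open>S \<otimes> S\<close> to
  \<open>S \<otimes> S \<otimes> S\<close>.\<close>

lemma (in tensor_product) lslice_id_hom:
  assumes "tensor_product k R S' T' b'" and h: "h \<in> ring_hom S S'" "\<And>c. c \<in> carrier k \<Longrightarrow> h (str S c) = str S' c"
    and q: "q \<in> ring_hom T T'" "\<And>r s. r \<in> carrier R \<Longrightarrow> s \<in> carrier S \<Longrightarrow> q (b r s) = b' r (h s)"
    and f: "lin k R f" and t: "t \<in> carrier T"
  shows "tensor_product.lslice R S' T' b' f (q t) = h (lslice f t)"
proof -
  interpret T': tensor_product k R S' T' b' by fact
  note Q = additiveD[OF ring_hom_additive[OF q(1)]] and H = additiveD[OF ring_hom_additive[OF h(1)]]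
  note L = additiveD[OF lslice[OF f]] and L' = additiveD[OF T'.lslice[OF f]]
  show ?thesis
  proof (rule additive_eq[OF T'.S.R.abelian_group_axioms _ _ _ t])
    show "additive T S' (\<lambda>t. T'.lslice f (q t))" using Q L' by (auto simp: additive_def)
    show "additive T S' (\<lambda>t. h (lslice f t))" using H L by (auto simp: additive_def)
    fix r s assume rs: "r \<in> carrier R" "s \<in> carrier S"
    have fr: "f r \<in> carrier k" using linD(1)[OF f] rs by simp
    show "T'.lslice f (q (b r s)) = h (lslice f (b r s))"
      using rs fr q(2) T'.lslice_b[OF f] lslice_b[OF f] H ring_hom_mult[OF h(1)] h(2) by (simp add: smul_def)
  qed
qed

context tensor_product_field
begin

text \<open>\<open>e\<close> generates the ideal of \<open>S\<close> spanned by the coefficients of \<open>d \<in> R \<otimes> S\<close>.\<close>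

definition content :: "'c \<Rightarrow> 'b \<Rightarrow> bool" where
  "content d e \<longleftrightarrow> e \<in> carrier S \<and> d \<otimes>\<^bsub>T\<^esub> b \<one>\<^bsub>R\<^esub> e = d \<and>
    (\<forall>W. ksub S (self_alg S) W \<longrightarrow> (\<forall>f. lin k R f \<longrightarrow> lslice f d \<in> W) \<longrightarrow> e \<in> W)"

text \<open>The coefficients of \<open>d\<close> generate a finitely generated ideal, and those of
  \<open>d d\<close> are combinations of products of two of them. As \<open>d d = d\<close>, the
  ideal equals its square, so \<open>idempotent_ideal_unit\<close> supplies an element of it that
  acts on it as identity.\<close>

lemma exists_content:
  assumes d: "d \<in> carrier T" "d \<otimes>\<^bsub>T\<^esub> d = d"
  shows "\<exists>e. content d e"
proof -
  interpret self: algebra_over S "self_alg S" by (rule S.R.self_alg)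
  obtain xs where xs: "xs \<in> L" "d = tsum T b xs" "indep k R (map fst xs)" "indep k S (map snd xs)"
    using tsub_reduced[OF _ R.ksub_carrier S.ksub_carrier] d(1) tsub_carrier by metis
  have sR: "set (map fst xs) \<subseteq> carrier R" and sS: "set (map snd xs) \<subseteq> carrier S"
    using xs(1) by (auto simp: in_lists_conv_set)
  obtain f where f: "R.dual (map fst xs) f" using R.indep_dual[OF sR xs(3)] .
  let ?J = "lspan S (self_alg S) (map snd xs)"
  have J: "ksub S (self_alg S) ?J" using self.lspan_ksub[of "map snd xs"] sS by simp
  have kJ: "ksub k S ?J" by (rule S.ksub_self[OF J])
  have sJ: "set (map snd xs) \<subseteq> ?J" using self.lspan_mem[of "map snd xs"] sS by auto
  have coef: "snd (xs ! i) = lslice (f i) d" if "i < length xs" for i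
    using lslice_nth[OF xs(1) f that] xs(2) by simp
  have fl: "lin k R (f i)" if "i < length xs" for i using f that by (simp add: R.dual_def)
  have xJ: "xs \<in> lists (carrier R \<times> ?J)" using xs(1) sJ by (auto simp: in_lists_conv_set subset_iff)
  \<comment> \<open>Any slice of a product of two tensors with right components in \<open>?J\<close>
    is a combination of products of two elements of \<open>?J\<close>. The statement is for
    arbitrary lists to allow induction on the first factor.\<close>
  have prod: "lslice g (tsum T b us \<otimes>\<^bsub>T\<^esub> tsum T b vs) \<in> W"
    if W: "ksub S (self_alg S) W" "\<And>m z. m \<in> ?J \<Longrightarrow> z \<in> ?J \<Longrightarrow> m \<otimes>\<^bsub>S\<^esub> z \<in> W" and g: "lin k R g"
      and us: "us \<in> lists (carrier R \<times> ?J)" and vs: "vs \<in> lists (carrier R \<times> ?J)" for W g us vs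
    using us
  proof (induction us)
    case Nil
    have "vs \<in> L" using vs ksubD(1)[OF kJ] by (auto simp: in_lists_conv_set)
    then show ?case using ksubD(2)[OF W(1)] lslice_zero[OF g] by simp
  next
    case (Cons x us)
    have kW: "ksub k S W" by (rule S.ksub_self[OF W(1)])
    have L: "us \<in> L" "vs \<in> L" using Cons.hyps vs ksubD(1)[OF kJ] by (auto simp: in_lists_conv_set)
    have x: "fst x \<in> carrier R" "snd x \<in> ?J" "snd x \<in> carrier S" using Cons.hyps ksubD(1)[OF kJ] by auto
    let ?ws = "map (\<lambda>(u, v). (fst x \<otimes>\<^bsub>R\<^esub> u, snd x \<otimes>\<^bsub>S\<^esub> v)) vs"
    have "?ws \<in> lists (carrier R \<times> W)" using vs x W(2) by (auto simp: in_lists_conv_set)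
    then have "lslice g (b (fst x) (snd x) \<otimes>\<^bsub>T\<^esub> tsum T b vs) \<in> W"
      using lslice_mem[OF g kW] tsum_mult[OF L(2) x(1,3)] by simp
    then have "lslice g (b (fst x) (snd x) \<otimes>\<^bsub>T\<^esub> tsum T b vs) \<oplus>\<^bsub>S\<^esub> lslice g (tsum T b us \<otimes>\<^bsub>T\<^esub> tsum T b vs) \<in> W"
      using Cons.IH ksubD(3)[OF kW] by blast
    moreover have "tsum T b (x # us) \<otimes>\<^bsub>T\<^esub> tsum T b vs =
      b (fst x) (snd x) \<otimes>\<^bsub>T\<^esub> tsum T b vs \<oplus>\<^bsub>T\<^esub> tsum T b us \<otimes>\<^bsub>T\<^esub> tsum T b vs"
      using x L by (simp add: T.R.l_distr)
    ultimately show ?case using x L by (simp add: lslice_add[OF g])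
  qed
  have "\<exists>e \<in> ?J. \<forall>x \<in> ?J. e \<otimes>\<^bsub>S\<^esub> x = x"
  proof (rule S.R.idempotent_ideal_unit[OF sS])
    fix y W assume y: "y \<in> set (map snd xs)" and W: "ksub S (self_alg S) W"
      and m: "\<And>m z. m \<in> ?J \<Longrightarrow> z \<in> ?J \<Longrightarrow> m \<otimes>\<^bsub>S\<^esub> z \<in> W"
    then obtain i where i: "i < length xs" "y = snd (xs ! i)" by (auto simp: in_set_conv_nth)
    have "lslice (f i) (d \<otimes>\<^bsub>T\<^esub> d) \<in> W" unfolding xs(2) by (rule prod[OF W m fl[OF i(1)] xJ xJ])
    then show "y \<in> W" using d(2) coef[OF i(1)] i(2) by simp
  qed
  then obtain e where e: "e \<in> ?J" "\<And>x. x \<in> ?J \<Longrightarrow> e \<otimes>\<^bsub>S\<^esub> x = x" by blast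
  have eS: "e \<in> carrier S" using ksubD(1)[OF kJ e(1)] .
  have sl: "lslice g d \<in> ?J" if "lin k R g" for g unfolding xs(2) by (rule lslice_mem[OF that kJ xJ])
  \<comment> \<open>Tensors are separated by their slices, and each slice of \<open>d\<close> lies
    in \<open>?J\<close>, where multiplication by \<open>e\<close> is the identity.\<close>
  have "d \<otimes>\<^bsub>T\<^esub> b \<one>\<^bsub>R\<^esub> e \<ominus>\<^bsub>T\<^esub> d = \<zero>\<^bsub>T\<^esub>"
  proof (rule zero_if_slices_zero)
    show "d \<otimes>\<^bsub>T\<^esub> b \<one>\<^bsub>R\<^esub> e \<ominus>\<^bsub>T\<^esub> d \<in> carrier T" using d eS by simp
    fix g assume g: "lin k R g"
    have "lslice g (d \<otimes>\<^bsub>T\<^esub> b \<one>\<^bsub>R\<^esub> e \<ominus>\<^bsub>T\<^esub> d) = lslice g d \<otimes>\<^bsub>S\<^esub> e \<oplus>\<^bsub>S\<^esub> \<ominus>\<^bsub>S\<^esub> lslice g d"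
      using d(1) eS by (simp add: a_minus_def lslice_add[OF g] lslice_uminus[OF g] lslice_mult[OF g])
    also have "\<dots> = \<zero>\<^bsub>S\<^esub>" using e(2)[OF sl[OF g]] eS lslice_closed[OF g d(1)] by (simp add: S.R.m_comm S.R.r_neg)
    finally show "lslice g (d \<otimes>\<^bsub>T\<^esub> b \<one>\<^bsub>R\<^esub> e \<ominus>\<^bsub>T\<^esub> d) = \<zero>\<^bsub>S\<^esub>" .
  qed
  then have de: "d \<otimes>\<^bsub>T\<^esub> b \<one>\<^bsub>R\<^esub> e = d" using d(1) eS by (simp add: T.R.r_right_minus_eq)
  have "e \<in> W" if W: "ksub S (self_alg S) W" "\<And>f. lin k R f \<Longrightarrow> lslice f d \<in> W" for W
  proof -
    have "snd (xs ! i) \<in> W" if "i < length xs" for i using W(2)[OF fl[OF that]] coef[OF that] by simp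
    then have "set (map snd xs) \<subseteq> W" by (force simp: in_set_conv_nth)
    then show ?thesis using self.lspan_least[OF W(1)] e(1) by blast
  qed
  then show ?thesis using eS de by (auto simp: content_def)
qed

text \<open>The elements of \<open>S\<close> whose image annihilates \<open>y\<close> form an ideal.
  The assumption, contracted on the left, says that this ideal contains all slices of
  \<open>d\<close>, hence also \<open>e\<close>.\<close>

lemma content_annihilate:
  assumes c: "content d e" and d: "d \<in> carrier T" and T': "tensor_product k R S' T' b'"
    and h: "h \<in> ring_hom S S'" "\<And>c. c \<in> carrier k \<Longrightarrow> h (str S c) = str S' c"
    and q: "q \<in> ring_hom T T'" "\<And>r s. r \<in> carrier R \<Longrightarrow> s \<in> carrier S \<Longrightarrow> q (b r s) = b' r (h s)"
    and y: "y \<in> carrier S'" and 0: "q d \<otimes>\<^bsub>T'\<^esub> b' \<one>\<^bsub>R\<^esub> y = \<zero>\<^bsub>T'\<^esub>"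
  shows "h e \<otimes>\<^bsub>S'\<^esub> y = \<zero>\<^bsub>S'\<^esub>"
proof -
  interpret T': tensor_product k R S' T' b' by fact
  let ?W = "{s \<in> carrier S. h s \<otimes>\<^bsub>S'\<^esub> y = \<zero>\<^bsub>S'\<^esub>}"
  note H = ring_hom_closed[OF h(1)] ring_hom_add[OF h(1)] ring_hom_mult[OF h(1)]
  have h0: "h \<zero>\<^bsub>S\<^esub> = \<zero>\<^bsub>S'\<^esub>"
    by (rule additive_zero[OF S.R.abelian_group_axioms T'.S.R.abelian_group_axioms ring_hom_additive[OF h(1)]])
  have "ksub S (self_alg S) ?W"
    using H h0 y by (auto simp: ksub_def smul_def T'.S.R.l_distr T'.S.R.m_assoc)
  moreover have "lslice f d \<in> ?W" if f: "lin k R f" for f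
  proof -
    have "h (lslice f d) \<otimes>\<^bsub>S'\<^esub> y = T'.lslice f (q d \<otimes>\<^bsub>T'\<^esub> b' \<one>\<^bsub>R\<^esub> y)"
      using lslice_id_hom[OF T' h q f d] T'.lslice_mult[OF f ring_hom_closed[OF q(1) d] y] by simp
    then show ?thesis using 0 T'.lslice_zero[OF f] lslice_closed[OF f d] by simp
  qed
  ultimately have "e \<in> ?W" using c by (auto simp: content_def)
  then show ?thesis by simp
qed

end

lemma (in cring) tsum_ldistr:
  assumes "y \<in> carrier R" "\<And>u v. (u, v) \<in> set xs \<Longrightarrow> g u v \<in> carrier R"
  shows "tsum R g xs \<otimes> y = tsum R (\<lambda>u v. g u v \<otimes> y) xs"
proof -
  have "\<And>p. p \<in> set xs \<Longrightarrow> (case p of (u, v) \<Rightarrow> g u v) \<in> carrier R" using assms(2) by auto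
  from lsum_ldistr[OF assms(1) this] show ?thesis by (simp add: tsum_def case_prod_unfold)
qed

text \<open>Next to \<open>y\<close>, \<open>g v\<close> may be replaced by \<open>f v\<close>, so
  the idempotent acts on \<open>y\<close> as \<open>f\<close> of the product of \<open>xs\<close>,
  which is one. Together with \<open>sep_idem_hom\<close> this characterises it as the largest
  idempotent over which \<open>f\<close> and \<open>g\<close> agree.\<close>

lemma sep_idem_absorb:
  fixes R :: "('k, 'a) salg" and Q :: "('q, 'z) ring_scheme"
  assumes R: "cring R" and xs: "sep_idem k R xs" and Q: "cring Q"
    and f: "f \<in> ring_hom R Q" and g: "g \<in> ring_hom R Q"
    and y: "y \<in> carrier Q" "\<And>a. a \<in> carrier R \<Longrightarrow> f a \<otimes>\<^bsub>Q\<^esub> y = g a \<otimes>\<^bsub>Q\<^esub> y"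
  shows "tsum Q (\<lambda>u v. f u \<otimes>\<^bsub>Q\<^esub> g v) xs \<otimes>\<^bsub>Q\<^esub> y = y"
proof -
  interpret R: cring R by fact
  interpret Q: cring Q by fact
  have L: "u \<in> carrier R" "v \<in> carrier R" if "(u, v) \<in> set xs" for u v
    using xs that by (auto simp: sep_idem_def in_lists_conv_set)
  have c: "f a \<in> carrier Q" "g a \<in> carrier Q" if "a \<in> carrier R" for a
    using that ring_hom_closed[OF f] ring_hom_closed[OF g] by auto
  have sw: "f u \<otimes>\<^bsub>Q\<^esub> g v \<otimes>\<^bsub>Q\<^esub> y = f u \<otimes>\<^bsub>Q\<^esub> f v \<otimes>\<^bsub>Q\<^esub> y" if "(u, v) \<in> set xs" for u v
    using L[OF that] c y by (simp add: Q.m_assoc)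
  have fm: "f u \<otimes>\<^bsub>Q\<^esub> f v = f (u \<otimes>\<^bsub>R\<^esub> v)" if "(u, v) \<in> set xs" for u v
    using L[OF that] ring_hom_mult[OF f] by simp
  have "tsum Q (\<lambda>u v. f u \<otimes>\<^bsub>Q\<^esub> g v) xs \<otimes>\<^bsub>Q\<^esub> y = tsum Q (\<lambda>u v. f u \<otimes>\<^bsub>Q\<^esub> g v \<otimes>\<^bsub>Q\<^esub> y) xs"
    using L c y(1) by (intro Q.tsum_ldistr) auto
  also have "\<dots> = tsum Q (\<lambda>u v. f u \<otimes>\<^bsub>Q\<^esub> f v \<otimes>\<^bsub>Q\<^esub> y) xs" using sw by (intro tsum_cong) auto
  also have "\<dots> = tsum Q (\<lambda>u v. f u \<otimes>\<^bsub>Q\<^esub> f v) xs \<otimes>\<^bsub>Q\<^esub> y"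
    using L c y(1) by (intro Q.tsum_ldistr[symmetric]) auto
  also have "tsum Q (\<lambda>u v. f u \<otimes>\<^bsub>Q\<^esub> f v) xs = tsum Q (\<lambda>u v. f (u \<otimes>\<^bsub>R\<^esub> v)) xs" using fm by (intro tsum_cong) auto
  also have "\<dots> = f (tsum R (\<otimes>\<^bsub>R\<^esub>) xs)"
    unfolding tsum_def case_prod_unfold
    by (rule lsum_map_hom[OF R.abelian_group_axioms Q.abelian_group_axioms ring_hom_additive[OF f], symmetric])
      (use L in auto)
  finally show ?thesis using xs ring_hom_one[OF f] y(1) by (simp add: sep_idem_def)
qed

lemma ring_hom_restrict: "f \<in> ring_hom R Q \<Longrightarrow> A \<subseteq> carrier R \<Longrightarrow> f \<in> ring_hom (R\<lparr>carrier := A\<rparr>) Q"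
  by (auto simp: ring_hom_def subset_iff)

text \<open>The separability idempotent of \<open>C \<subseteq> R \<otimes> S\<close> is mapped to \<open>e \<in> R \<otimes> S \<otimes> S\<close> by means of the two
  coprojections \<open>Q1\<close>, \<open>Q2\<close>. The complement \<open>g\<close> of the generator \<open>w\<close> of the coefficient ideal of
  \<open>1 - e\<close> is the largest idempotent of \<open>S \<otimes> S\<close> with \<open>e (1 \<otimes> g) = 1 \<otimes> g\<close>.\<close>

locale descent =
  fixes k :: "('k, 'm) ring_scheme" and R :: "('k, 'a) salg" and S :: "('k, 'b) salg" and T :: "('k, 'c) salg"
    and b :: "'a \<Rightarrow> 'b \<Rightarrow> 'c" and S2 :: "('k, 'd) salg" and b2 and U2 :: "('k, 'f) salg" and c2
    and Q1 Q2 C ps w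
  assumes tp: "tensor_product_field k R S T b" and tp2: "tensor_product_field k S S S2 b2"
    and tpU: "tensor_product_field k R S2 U2 c2"
    and Q1: "Q1 \<in> ring_hom T U2" "\<And>r s. r \<in> carrier R \<Longrightarrow> s \<in> carrier S \<Longrightarrow> Q1 (b r s) = c2 r (b2 s \<one>\<^bsub>S\<^esub>)"
    and Q2: "Q2 \<in> ring_hom T U2" "\<And>r s. r \<in> carrier R \<Longrightarrow> s \<in> carrier S \<Longrightarrow> Q2 (b r s) = c2 r (b2 \<one>\<^bsub>S\<^esub> s)"
    and C: "ksubalg k T C" and ps: "sep_idem k (T\<lparr>carrier := C\<rparr>) ps"
    and w: "tensor_product_field.content k R S2 U2 c2
      (\<one>\<^bsub>U2\<^esub> \<ominus>\<^bsub>U2\<^esub> tsum U2 (\<lambda>u v. Q1 u \<otimes>\<^bsub>U2\<^esub> Q2 v) ps) w"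
begin

sublocale X: tensor_product_field k R S T b by (rule tp)
sublocale S2: tensor_product_field k S S S2 b2 by (rule tp2)
sublocale U: tensor_product_field k R S2 U2 c2 by (rule tpU)

definition "e = tsum U2 (\<lambda>u v. Q1 u \<otimes>\<^bsub>U2\<^esub> Q2 v) ps"
definition "g = \<one>\<^bsub>S2\<^esub> \<ominus>\<^bsub>S2\<^esub> w"

lemma C_carrier: "C \<subseteq> carrier T" using ksubalgD(1)[OF C] by blast

lemma e: "e \<in> carrier U2" "\<And>a. a \<in> C \<Longrightarrow> Q1 a \<otimes>\<^bsub>U2\<^esub> e = Q2 a \<otimes>\<^bsub>U2\<^esub> e" "e \<otimes>\<^bsub>U2\<^esub> e = e"
proof -
  have str: "Q1 (str (T\<lparr>carrier := C\<rparr>) c) = Q2 (str (T\<lparr>carrier := C\<rparr>) c)" if "c \<in> carrier k" for c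
    using that X.R.k.one_closed by (simp add: X.b_str Q1(2) Q2(2))
  note H = sep_idem_hom[OF X.T.ksubalg_algebra_over[OF C] ps U.T.R.is_cring
      ring_hom_restrict[OF Q1(1) C_carrier] ring_hom_restrict[OF Q2(1) C_carrier] str, folded e_def]
  show "e \<in> carrier U2" "e \<otimes>\<^bsub>U2\<^esub> e = e" using H by auto
  show "Q1 a \<otimes>\<^bsub>U2\<^esub> e = Q2 a \<otimes>\<^bsub>U2\<^esub> e" if "a \<in> C" for a using H(2)[of a] that by simp
qed

lemma w_closed: "w \<in> carrier S2" using w by (simp add: U.content_def)

lemma g_closed [simp]: "g \<in> carrier S2" using w_closed by (simp add: g_def)

text \<open>The content \<open>w\<close> acts on \<open>1 - e\<close> as identity, so its complement
  \<open>g\<close> annihilates \<open>1 - e\<close>.\<close>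

lemma e_g: "e \<otimes>\<^bsub>U2\<^esub> c2 \<one>\<^bsub>R\<^esub> g = c2 \<one>\<^bsub>R\<^esub> g"
proof -
  let ?d = "\<one>\<^bsub>U2\<^esub> \<ominus>\<^bsub>U2\<^esub> e"
  have c: "c2 \<one>\<^bsub>R\<^esub> w \<in> carrier U2" "c2 \<one>\<^bsub>R\<^esub> g \<in> carrier U2" using w_closed by simp_all
  have "?d \<otimes>\<^bsub>U2\<^esub> c2 \<one>\<^bsub>R\<^esub> w = ?d" using w by (simp add: U.content_def e_def)
  moreover have "c2 \<one>\<^bsub>R\<^esub> g = \<one>\<^bsub>U2\<^esub> \<ominus>\<^bsub>U2\<^esub> c2 \<one>\<^bsub>R\<^esub> w"
    unfolding g_def a_minus_def
    using w_closed additive_minus[OF S2.T.R.abelian_group_axioms U.T.R.abelian_group_axioms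
      ring_hom_additive[OF U.b_hom_right] w_closed] by (simp add: U.b_add_right)
  moreover have "?d \<otimes>\<^bsub>U2\<^esub> (\<one>\<^bsub>U2\<^esub> \<ominus>\<^bsub>U2\<^esub> c2 \<one>\<^bsub>R\<^esub> w) = ?d \<ominus>\<^bsub>U2\<^esub> ?d \<otimes>\<^bsub>U2\<^esub> c2 \<one>\<^bsub>R\<^esub> w"
    unfolding a_minus_def[of U2 "\<one>\<^bsub>U2\<^esub>" "c2 \<one>\<^bsub>R\<^esub> w"] using e(1) c by (simp add: U.T.R.r_distr U.T.R.r_minus a_minus_def[of U2 ?d])
  ultimately have "?d \<otimes>\<^bsub>U2\<^esub> c2 \<one>\<^bsub>R\<^esub> g = \<zero>\<^bsub>U2\<^esub>" using e(1) by (simp add: U.T.R.r_right_minus_eq)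
  moreover have "?d \<otimes>\<^bsub>U2\<^esub> c2 \<one>\<^bsub>R\<^esub> g = c2 \<one>\<^bsub>R\<^esub> g \<ominus>\<^bsub>U2\<^esub> e \<otimes>\<^bsub>U2\<^esub> c2 \<one>\<^bsub>R\<^esub> g"
    using e(1) c by (simp add: a_minus_def U.T.R.l_distr U.T.R.l_minus)
  ultimately show ?thesis using e(1) c by (simp add: U.T.R.r_right_minus_eq)
qed

text \<open>Maximality of \<open>g\<close>: if \<open>1 \<otimes> y\<close> is fixed by the image of
  \<open>e\<close>, it is annihilated by the image of \<open>1 - e\<close>, hence \<open>y\<close>
  by the image of the content \<open>w\<close>. The claim allows a base change \<open>h\<close>
  because it is used in \<open>S\<close>, in \<open>S \<otimes> S\<close> and in
  \<open>S \<otimes> S \<otimes> S\<close>.\<close>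

lemma absorb:
  assumes T': "tensor_product k R S' T' b'"
    and h: "h \<in> ring_hom S2 S'" "\<And>c. c \<in> carrier k \<Longrightarrow> h (str S2 c) = str S' c"
    and q: "q \<in> ring_hom U2 T'" "\<And>r s. r \<in> carrier R \<Longrightarrow> s \<in> carrier S2 \<Longrightarrow> q (c2 r s) = b' r (h s)"
    and y: "y \<in> carrier S'" and eq: "q e \<otimes>\<^bsub>T'\<^esub> b' \<one>\<^bsub>R\<^esub> y = b' \<one>\<^bsub>R\<^esub> y"
  shows "h g \<otimes>\<^bsub>S'\<^esub> y = y"
proof -
  interpret T': tensor_product k R S' T' b' by fact
  let ?d = "\<one>\<^bsub>U2\<^esub> \<ominus>\<^bsub>U2\<^esub> e"
  note Q = ring_hom_closed[OF q(1)] and H = ring_hom_closed[OF h(1)]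
  have min: "f (\<one>\<^bsub>A\<^esub> \<ominus>\<^bsub>A\<^esub> x) \<otimes>\<^bsub>B\<^esub> z = z \<ominus>\<^bsub>B\<^esub> f x \<otimes>\<^bsub>B\<^esub> z"
    if "cring A" "cring B" and f: "f \<in> ring_hom A B" and x: "x \<in> carrier A" "z \<in> carrier B"
    for f and A :: "('v, 'w) ring_scheme" and B :: "('v2, 'w2) ring_scheme" and x z
  proof -
    interpret A: cring A by fact
    interpret B: cring B by fact
    have m: "f (\<ominus>\<^bsub>A\<^esub> x) = \<ominus>\<^bsub>B\<^esub> f x"
      by (rule additive_minus[OF A.abelian_group_axioms B.abelian_group_axioms ring_hom_additive[OF f] x(1)])
    show ?thesis using x ring_hom_closed[OF f] ring_hom_one[OF f]
      by (simp add: a_minus_def ring_hom_add[OF f] m B.l_distr B.l_minus)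
  qed
  have "q ?d \<otimes>\<^bsub>T'\<^esub> b' \<one>\<^bsub>R\<^esub> y = \<zero>\<^bsub>T'\<^esub>"
    using min[OF U.T.R.is_cring T'.T.R.is_cring q(1) e(1), of "b' \<one>\<^bsub>R\<^esub> y"] y eq
    by (simp add: T'.T.R.r_right_minus_eq)
  then have "h w \<otimes>\<^bsub>S'\<^esub> y = \<zero>\<^bsub>S'\<^esub>"
    using U.content_annihilate[OF w[folded e_def] _ T' h q y] e(1) by simp
  then show ?thesis
    using min[OF S2.T.R.is_cring T'.S.R.is_cring h(1) w_closed y] y by (simp add: g_def a_minus_def)
qed

text \<open>Reflexivity: along the diagonal the two coprojections coincide, so \<open>e\<close>
  becomes the product of the separability idempotent \<open>ps\<close>, which is one, and maximality
  applies with \<open>y = 1\<close>.\<close>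

lemma mult_g:
  assumes mu: "mu \<in> ring_hom S2 S" "\<And>s t. s \<in> carrier S \<Longrightarrow> t \<in> carrier S \<Longrightarrow> mu (b2 s t) = s \<otimes>\<^bsub>S\<^esub> t"
  shows "mu g = \<one>\<^bsub>S\<^esub>"
proof -
  have str: "mu (str S2 c) = str S c" if "c \<in> carrier k" for c using that by (simp add: S2.b_str mu(2))
  obtain q where q: "q \<in> ring_hom U2 T" "\<And>r x. r \<in> carrier R \<Longrightarrow> x \<in> carrier S2 \<Longrightarrow> q (c2 r x) = b r (mu x)"
    using U.id_hom[OF X.tensor_product_axioms mu(1) str] by blast
  have qQ: "q (Q1 t) = t" "q (Q2 t) = t" if "t \<in> carrier T" for t
  proof -
    have i: "(\<lambda>x. x) \<in> ring_hom T T" by (simp add: ring_hom_def)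
    show "q (Q1 t) = t"
      by (rule X.hom_eq[OF X.T.R.is_cring ring_hom_trans[OF Q1(1) q(1), unfolded comp_def] i _ that])
        (simp add: Q1(2) q(2) mu(2))
    show "q (Q2 t) = t"
      by (rule X.hom_eq[OF X.T.R.is_cring ring_hom_trans[OF Q2(1) q(1), unfolded comp_def] i _ that])
        (simp add: Q2(2) q(2) mu(2))
  qed
  have L: "u \<in> carrier T" "v \<in> carrier T" if "(u, v) \<in> set ps" for u v
    using ps C_carrier that by (auto simp: sep_idem_def in_lists_conv_set)
  have "q e = tsum T (\<lambda>u v. q (Q1 u \<otimes>\<^bsub>U2\<^esub> Q2 v)) ps"
    unfolding e_def tsum_def case_prod_unfold
    by (rule lsum_map_hom[OF U.T.R.abelian_group_axioms X.T.R.abelian_group_axioms ring_hom_additive[OF q(1)]])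
      (use L ring_hom_closed[OF Q1(1)] ring_hom_closed[OF Q2(1)] in auto)
  also have "\<dots> = tsum T (\<otimes>\<^bsub>T\<^esub>) ps"
    using L qQ ring_hom_closed[OF Q1(1)] ring_hom_closed[OF Q2(1)] ring_hom_mult[OF q(1)] by (intro tsum_cong) auto
  also have "\<dots> = \<one>\<^bsub>T\<^esub>" using ps by (simp add: sep_idem_def tsum_def)
  finally have "mu g \<otimes>\<^bsub>S\<^esub> \<one>\<^bsub>S\<^esub> = \<one>\<^bsub>S\<^esub>"
    using absorb[OF X.tensor_product_axioms mu(1) str q, of "\<one>\<^bsub>S\<^esub>"] by simp
  then show ?thesis using ring_hom_closed[OF mu(1) g_closed] by simp
qed

text \<open>The equalizer of the two coprojections of \<open>S\<close> over \<open>y\<close>. For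
  \<open>y = g\<close> it is the algebra \<open>B\<close> sought; the version for
  \<open>\<sigma>(g)\<close> is compared with it when stability under \<open>\<sigma>\<close> is
  proved.\<close>

definition eqz :: "'d \<Rightarrow> 'b set" where
  "eqz y = {s \<in> carrier S. b2 s \<one>\<^bsub>S\<^esub> \<otimes>\<^bsub>S2\<^esub> y = b2 \<one>\<^bsub>S\<^esub> s \<otimes>\<^bsub>S2\<^esub> y}"

lemma eqz: assumes y: "y \<in> carrier S2" shows "ksubalg k S (eqz y)"
proof (rule X.S.ksubalgI)
  have c: "b2 s \<one>\<^bsub>S\<^esub> \<in> carrier S2" "b2 \<one>\<^bsub>S\<^esub> s \<in> carrier S2" if "s \<in> carrier S" for s using that by simp_all
  have m: "b2 (s \<otimes>\<^bsub>S\<^esub> t) \<one>\<^bsub>S\<^esub> = b2 s \<one>\<^bsub>S\<^esub> \<otimes>\<^bsub>S2\<^esub> b2 t \<one>\<^bsub>S\<^esub>" "b2 \<one>\<^bsub>S\<^esub> (s \<otimes>\<^bsub>S\<^esub> t) = b2 \<one>\<^bsub>S\<^esub> s \<otimes>\<^bsub>S2\<^esub> b2 \<one>\<^bsub>S\<^esub> t"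
    if "s \<in> carrier S" "t \<in> carrier S" for s t using that by (simp_all add: S2.b_mult)
  show mult: "s \<otimes>\<^bsub>S\<^esub> t \<in> eqz y" if "s \<in> eqz y" "t \<in> eqz y" for s t
  proof -
    have st: "s \<in> carrier S" "t \<in> carrier S" using that by (auto simp: eqz_def)
    have "b2 (s \<otimes>\<^bsub>S\<^esub> t) \<one>\<^bsub>S\<^esub> \<otimes>\<^bsub>S2\<^esub> y = b2 s \<one>\<^bsub>S\<^esub> \<otimes>\<^bsub>S2\<^esub> (b2 t \<one>\<^bsub>S\<^esub> \<otimes>\<^bsub>S2\<^esub> y)"
      unfolding m(1)[OF st] using c st y by (simp add: S2.T.R.m_assoc)
    also have "\<dots> = b2 s \<one>\<^bsub>S\<^esub> \<otimes>\<^bsub>S2\<^esub> (b2 \<one>\<^bsub>S\<^esub> t \<otimes>\<^bsub>S2\<^esub> y)" using that by (simp add: eqz_def)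
    also have "\<dots> = b2 \<one>\<^bsub>S\<^esub> t \<otimes>\<^bsub>S2\<^esub> (b2 s \<one>\<^bsub>S\<^esub> \<otimes>\<^bsub>S2\<^esub> y)" using c[OF st(1)] c[OF st(2)] y by (rule_tac S2.T.R.m_lcomm)
    also have "\<dots> = b2 \<one>\<^bsub>S\<^esub> t \<otimes>\<^bsub>S2\<^esub> (b2 \<one>\<^bsub>S\<^esub> s \<otimes>\<^bsub>S2\<^esub> y)" using that by (simp add: eqz_def)
    also have "\<dots> = b2 \<one>\<^bsub>S\<^esub> s \<otimes>\<^bsub>S2\<^esub> (b2 \<one>\<^bsub>S\<^esub> t \<otimes>\<^bsub>S2\<^esub> y)" using c[OF st(1)] c[OF st(2)] y by (rule_tac S2.T.R.m_lcomm)
    also have "\<dots> = b2 \<one>\<^bsub>S\<^esub> (s \<otimes>\<^bsub>S\<^esub> t) \<otimes>\<^bsub>S2\<^esub> y"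
      unfolding m(2)[OF st] using c st y by (simp add: S2.T.R.m_assoc)
    finally show ?thesis using st by (simp add: eqz_def)
  qed
  show one: "\<one>\<^bsub>S\<^esub> \<in> eqz y" by (simp add: eqz_def)
  show "ksub k S (eqz y)" unfolding ksub_def
  proof (intro conjI ballI)
    show "eqz y \<subseteq> carrier S" by (auto simp: eqz_def)
    show "\<zero>\<^bsub>S\<^esub> \<in> eqz y" by (simp add: eqz_def)
    show "s \<oplus>\<^bsub>S\<^esub> t \<in> eqz y" if "s \<in> eqz y" "t \<in> eqz y" for s t
      using that y by (auto simp: eqz_def S2.b_add_left S2.b_add_right S2.T.R.l_distr)
    show "smul S c s \<in> eqz y" if cs: "c \<in> carrier k" "s \<in> eqz y" for c s
    proof -
      have "str S c \<in> eqz y" using cs(1) by (simp add: eqz_def S2.b_str[symmetric] S2.b_str_right[symmetric])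
      then show ?thesis using mult cs(2) by (simp add: smul_def)
    qed
  qed
qed

lemma Q_g: assumes a: "a \<in> C" shows "Q1 a \<otimes>\<^bsub>U2\<^esub> c2 \<one>\<^bsub>R\<^esub> g = Q2 a \<otimes>\<^bsub>U2\<^esub> c2 \<one>\<^bsub>R\<^esub> g"
proof -
  have aT: "a \<in> carrier T" using a C_carrier by blast
  have c: "Q1 a \<in> carrier U2" "Q2 a \<in> carrier U2" "c2 \<one>\<^bsub>R\<^esub> g \<in> carrier U2"
    using ring_hom_closed[OF Q1(1) aT] ring_hom_closed[OF Q2(1) aT] by simp_all
  have "Q1 a \<otimes>\<^bsub>U2\<^esub> (e \<otimes>\<^bsub>U2\<^esub> c2 \<one>\<^bsub>R\<^esub> g) = Q2 a \<otimes>\<^bsub>U2\<^esub> (e \<otimes>\<^bsub>U2\<^esub> c2 \<one>\<^bsub>R\<^esub> g)"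
    using c e(1) e(2)[OF a] by (simp add: U.T.R.m_assoc[symmetric])
  then show ?thesis by (simp add: e_g)
qed

text \<open>Over \<open>g\<close> the images \<open>Q1 a\<close> and \<open>Q2 a\<close> agree.
  Contracting this identity along \<open>R\<close> gives
  \<open>(s \<otimes> 1) g = (1 \<otimes> s) g\<close> for each slice \<open>s\<close> of
  \<open>a\<close>, which is the defining equation of \<open>eqz g\<close>.\<close>

lemma C_tsub: "C \<subseteq> X.tsub (carrier R) (eqz g)"
proof
  fix a assume a: "a \<in> C"
  have aT: "a \<in> carrier T" using a C_carrier by blast
  show "a \<in> X.tsub (carrier R) (eqz g)"
  proof (rule X.tsub_slices[OF X.R.ksub_carrier ksubalg_ksub[OF eqz[OF g_closed]]])
    show "a \<in> X.tsub (carrier R) (carrier S)" using aT X.tsub_carrier by simp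
    fix f assume f: "lin k R f"
    have "U.lslice f (Q1 a) = b2 (X.lslice f a) \<one>\<^bsub>S\<^esub>"
      by (rule X.lslice_id_hom[OF U.tensor_product_axioms S2.b_hom_left _ Q1 f aT]) (simp add: S2.b_str)
    moreover have "U.lslice f (Q2 a) = b2 \<one>\<^bsub>S\<^esub> (X.lslice f a)"
      by (rule X.lslice_id_hom[OF U.tensor_product_axioms S2.b_hom_right _ Q2 f aT]) (simp add: S2.b_str_right)
    ultimately have "b2 (X.lslice f a) \<one>\<^bsub>S\<^esub> \<otimes>\<^bsub>S2\<^esub> g = b2 \<one>\<^bsub>S\<^esub> (X.lslice f a) \<otimes>\<^bsub>S2\<^esub> g"
      using arg_cong[OF Q_g[OF a], of "U.lslice f"] U.lslice_mult[OF f _ g_closed]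
        ring_hom_closed[OF Q1(1) aT] ring_hom_closed[OF Q2(1) aT] by simp
    then show "X.lslice f a \<in> eqz g" using X.lslice_closed[OF f aT] by (simp add: eqz_def)
  qed
qed

lemma ps_lists: "(u, v) \<in> set ps \<Longrightarrow> u \<in> C" "(u, v) \<in> set ps \<Longrightarrow> v \<in> C"
  using ps by (auto simp: sep_idem_def in_lists_conv_set)

lemma hom_e:
  assumes "cring Q" "q \<in> ring_hom U2 Q"
  shows "q e = tsum Q (\<lambda>u v. q (Q1 u) \<otimes>\<^bsub>Q\<^esub> q (Q2 v)) ps"
proof -
  have c: "Q1 u \<in> carrier U2" "Q2 u \<in> carrier U2" if "u \<in> C" for u
    using that C_carrier ring_hom_closed[OF Q1(1)] ring_hom_closed[OF Q2(1)] by auto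
  interpret Q: cring Q by fact
  have "q e = tsum Q (\<lambda>u v. q (Q1 u \<otimes>\<^bsub>U2\<^esub> Q2 v)) ps"
    unfolding e_def tsum_def case_prod_unfold
    by (rule lsum_map_hom[OF U.T.R.abelian_group_axioms Q.abelian_group_axioms ring_hom_additive[OF assms(2)]])
      (use ps_lists c in auto)
  also have "\<dots> = tsum Q (\<lambda>u v. q (Q1 u) \<otimes>\<^bsub>Q\<^esub> q (Q2 v)) ps"
    using ps_lists c ring_hom_mult[OF assms(2)] by (intro tsum_cong) auto
  finally show ?thesis .
qed

text \<open>Transitivity. Write \<open>g12\<close>, \<open>g13\<close>, \<open>g23\<close> for the
  three images of \<open>g\<close>, and \<open>e13\<close>, \<open>e23\<close> for those of
  \<open>e\<close>. Over \<open>g12\<close> the first two copies of \<open>S\<close> cannot be told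
  apart by \<open>C\<close>, so \<open>e13\<close> and \<open>e23\<close> agree there. Hence
  \<open>g12 g23\<close>, fixed by \<open>e23\<close>, is fixed by \<open>e13\<close> and absorbed
  by \<open>g13\<close>, and likewise \<open>g12 g13\<close> is absorbed by \<open>g23\<close>. Both
  products are equal to \<open>g12 g13 g23\<close>.\<close>

lemma cocycle:
  assumes tp3: "tensor_product k S2 S S3 b3" and tpU3: "tensor_product k R S3 U3 c3"
    and j13: "j13 \<in> ring_hom S2 S3" "\<And>s t. s \<in> carrier S \<Longrightarrow> t \<in> carrier S \<Longrightarrow> j13 (b2 s t) = b3 (b2 s \<one>\<^bsub>S\<^esub>) t"
    and j23: "j23 \<in> ring_hom S2 S3" "\<And>s t. s \<in> carrier S \<Longrightarrow> t \<in> carrier S \<Longrightarrow> j23 (b2 s t) = b3 (b2 \<one>\<^bsub>S\<^esub> s) t"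
  shows "b3 g \<one>\<^bsub>S\<^esub> \<otimes>\<^bsub>S3\<^esub> j13 g = b3 g \<one>\<^bsub>S\<^esub> \<otimes>\<^bsub>S3\<^esub> j23 g"
proof -
  interpret S3: tensor_product k S2 S S3 b3 by fact
  interpret U3: tensor_product k R S3 U3 c3 by fact
  let ?j12 = "\<lambda>x. b3 x \<one>\<^bsub>S\<^esub>" and ?F = "\<lambda>y. c3 \<one>\<^bsub>R\<^esub> y"
  have s12: "?j12 (str S2 c) = str S3 c" if "c \<in> carrier k" for c using that by (simp add: S3.b_str)
  have s13: "j13 (str S2 c) = str S3 c" if "c \<in> carrier k" for c
    using that by (simp add: S2.b_str_right j13(2) S3.b_str_right)
  have s23: "j23 (str S2 c) = str S3 c" if "c \<in> carrier k" for c
    using that by (simp add: S2.b_str_right j23(2) S3.b_str_right)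
  obtain Q12 where Q12: "Q12 \<in> ring_hom U2 U3" "\<And>r x. r \<in> carrier R \<Longrightarrow> x \<in> carrier S2 \<Longrightarrow> Q12 (c2 r x) = c3 r (?j12 x)"
    using U.id_hom[OF tpU3 S3.b_hom_left s12] by blast
  obtain Q13 where Q13: "Q13 \<in> ring_hom U2 U3" "\<And>r x. r \<in> carrier R \<Longrightarrow> x \<in> carrier S2 \<Longrightarrow> Q13 (c2 r x) = c3 r (j13 x)"
    using U.id_hom[OF tpU3 j13(1) s13] by blast
  obtain Q23 where Q23: "Q23 \<in> ring_hom U2 U3" "\<And>r x. r \<in> carrier R \<Longrightarrow> x \<in> carrier S2 \<Longrightarrow> Q23 (c2 r x) = c3 r (j23 x)"
    using U.id_hom[OF tpU3 j23(1) s23] by blast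
  have P: "f (h t) = f' (h' t)"
    if "f \<in> ring_hom U2 U3" "f' \<in> ring_hom U2 U3" "h \<in> ring_hom T U2" "h' \<in> ring_hom T U2"
      "\<And>r s. r \<in> carrier R \<Longrightarrow> s \<in> carrier S \<Longrightarrow> f (h (b r s)) = f' (h' (b r s))" "t \<in> carrier T" for f f' h h' t
    using X.hom_eq[OF U3.T.R.is_cring ring_hom_trans[OF that(3,1)] ring_hom_trans[OF that(4,2)]] that(5,6) by simp
  \<comment> \<open>Of the six composites from \<open>R \<otimes> S\<close> to
    \<open>R \<otimes> S \<otimes> S \<otimes> S\<close> only three are distinct, one for each copy
    of \<open>S\<close>.\<close>
  have P1: "Q13 (Q1 t) = Q12 (Q1 t)" and P2: "Q12 (Q2 t) = Q23 (Q1 t)" and P3: "Q13 (Q2 t) = Q23 (Q2 t)"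
    if "t \<in> carrier T" for t
    by (rule P[OF _ _ _ _ _ that]; simp add: Q12 Q13 Q23 Q1 Q2 j13 j23)+
  have m: "?F (x \<otimes>\<^bsub>S3\<^esub> y) = ?F x \<otimes>\<^bsub>U3\<^esub> ?F y" if "x \<in> carrier S3" "y \<in> carrier S3" for x y
    using that by (simp add: U3.b_mult)
  have E: "?j12 g \<in> carrier S3" "j13 g \<in> carrier S3" "j23 g \<in> carrier S3"
    using ring_hom_closed[OF j13(1)] ring_hom_closed[OF j23(1)] by simp_all
  have F: "?F (?j12 g) \<in> carrier U3" "?F (j13 g) \<in> carrier U3" "?F (j23 g) \<in> carrier U3" using E by simp_all
  have c: "Q1 u \<in> carrier U2" "Q2 u \<in> carrier U2" if "u \<in> C" for u
    using that C_carrier ring_hom_closed[OF Q1(1)] ring_hom_closed[OF Q2(1)] by auto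
  have q: "q x \<in> carrier U3" if "q \<in> {Q12, Q13, Q23}" "x \<in> carrier U2" for q x
    using that ring_hom_closed[OF Q12(1)] ring_hom_closed[OF Q13(1)] ring_hom_closed[OF Q23(1)] by blast
  have F12: "Q12 (c2 \<one>\<^bsub>R\<^esub> g) = ?F (?j12 g)" by (simp add: Q12(2))
  have swap12: "Q13 (Q1 a) \<otimes>\<^bsub>U3\<^esub> ?F (?j12 g) = Q23 (Q1 a) \<otimes>\<^bsub>U3\<^esub> ?F (?j12 g)" if a: "a \<in> C" for a
  proof -
    have aT: "a \<in> carrier T" using a C_carrier by blast
    show ?thesis using arg_cong[OF Q_g[OF a], of Q12] c[OF a]
      by (simp add: ring_hom_mult[OF Q12(1)] F12 P1[OF aT] P2[OF aT])
  qed
  \<comment> \<open>The images of \<open>e\<close> under \<open>Q13\<close> and \<open>Q23\<close>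
    have the same second leg. Their first legs become equal after multiplication with the image of
    \<open>g\<close> under the first embedding.\<close>
  have e12: "Q13 e \<otimes>\<^bsub>U3\<^esub> ?F (?j12 g) = Q23 e \<otimes>\<^bsub>U3\<^esub> ?F (?j12 g)"
  proof -
    have "Q13 e \<otimes>\<^bsub>U3\<^esub> ?F (?j12 g) = tsum U3 (\<lambda>u v. Q13 (Q1 u) \<otimes>\<^bsub>U3\<^esub> Q13 (Q2 v) \<otimes>\<^bsub>U3\<^esub> ?F (?j12 g)) ps"
      unfolding hom_e[OF U3.T.R.is_cring Q13(1)] using F ps_lists c q by (intro U3.T.R.tsum_ldistr) auto
    also have "\<dots> = tsum U3 (\<lambda>u v. Q23 (Q1 u) \<otimes>\<^bsub>U3\<^esub> Q23 (Q2 v) \<otimes>\<^bsub>U3\<^esub> ?F (?j12 g)) ps"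
    proof (rule tsum_cong)
      fix u v assume "(u, v) \<in> set ps"
      then have uv: "u \<in> C" "v \<in> C" using ps_lists by auto
      have v: "Q13 (Q2 v) = Q23 (Q2 v)" using P3 uv C_carrier by blast
      have Qc: "Q13 (Q1 u) \<in> carrier U3" "Q23 (Q1 u) \<in> carrier U3" "Q23 (Q2 v) \<in> carrier U3"
        using q c uv by auto
      have "Q13 (Q1 u) \<otimes>\<^bsub>U3\<^esub> Q13 (Q2 v) \<otimes>\<^bsub>U3\<^esub> ?F (?j12 g) = Q23 (Q2 v) \<otimes>\<^bsub>U3\<^esub> (Q13 (Q1 u) \<otimes>\<^bsub>U3\<^esub> ?F (?j12 g))"
        unfolding v using Qc F by (simp add: U3.T.R.m_ac)
      also have "\<dots> = Q23 (Q1 u) \<otimes>\<^bsub>U3\<^esub> Q23 (Q2 v) \<otimes>\<^bsub>U3\<^esub> ?F (?j12 g)"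
        unfolding swap12[OF uv(1)] using Qc F by (simp add: U3.T.R.m_ac)
      finally show "Q13 (Q1 u) \<otimes>\<^bsub>U3\<^esub> Q13 (Q2 v) \<otimes>\<^bsub>U3\<^esub> ?F (?j12 g) = Q23 (Q1 u) \<otimes>\<^bsub>U3\<^esub> Q23 (Q2 v) \<otimes>\<^bsub>U3\<^esub> ?F (?j12 g)" .
    qed
    also have "\<dots> = Q23 e \<otimes>\<^bsub>U3\<^esub> ?F (?j12 g)"
      unfolding hom_e[OF U3.T.R.is_cring Q23(1)] using F ps_lists c q by (intro U3.T.R.tsum_ldistr[symmetric]) auto
    finally show ?thesis .
  qed
  have e13: "Q13 e \<otimes>\<^bsub>U3\<^esub> ?F (j13 g) = ?F (j13 g)"
    using arg_cong[OF e_g, of Q13] e(1) by (simp add: ring_hom_mult[OF Q13(1)] Q13(2))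
  have e23: "Q23 e \<otimes>\<^bsub>U3\<^esub> ?F (j23 g) = ?F (j23 g)"
    using arg_cong[OF e_g, of Q23] e(1) by (simp add: ring_hom_mult[OF Q23(1)] Q23(2))
  have qe: "Q13 e \<in> carrier U3" "Q23 e \<in> carrier U3" using q e(1) by auto
  have "Q13 e \<otimes>\<^bsub>U3\<^esub> ?F (?j12 g \<otimes>\<^bsub>S3\<^esub> j23 g) = (Q13 e \<otimes>\<^bsub>U3\<^esub> ?F (?j12 g)) \<otimes>\<^bsub>U3\<^esub> ?F (j23 g)"
    using qe F by (simp add: m[OF E(1,3)] U3.T.R.m_assoc)
  also have "\<dots> = ?F (?j12 g) \<otimes>\<^bsub>U3\<^esub> (Q23 e \<otimes>\<^bsub>U3\<^esub> ?F (j23 g))" unfolding e12 using qe F by (simp add: U3.T.R.m_ac)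
  also have "\<dots> = ?F (?j12 g \<otimes>\<^bsub>S3\<^esub> j23 g)" by (simp add: e23 m[OF E(1,3)])
  finally have 1: "j13 g \<otimes>\<^bsub>S3\<^esub> (?j12 g \<otimes>\<^bsub>S3\<^esub> j23 g) = ?j12 g \<otimes>\<^bsub>S3\<^esub> j23 g"
    using absorb[OF tpU3 j13(1) s13 Q13] E by simp
  have "Q23 e \<otimes>\<^bsub>U3\<^esub> ?F (?j12 g \<otimes>\<^bsub>S3\<^esub> j13 g) = (Q23 e \<otimes>\<^bsub>U3\<^esub> ?F (?j12 g)) \<otimes>\<^bsub>U3\<^esub> ?F (j13 g)"
    using qe F by (simp add: m[OF E(1,2)] U3.T.R.m_assoc)
  also have "\<dots> = ?F (?j12 g) \<otimes>\<^bsub>U3\<^esub> (Q13 e \<otimes>\<^bsub>U3\<^esub> ?F (j13 g))" unfolding e12[symmetric] using qe F by (simp add: U3.T.R.m_ac)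
  also have "\<dots> = ?F (?j12 g \<otimes>\<^bsub>S3\<^esub> j13 g)" by (simp add: e13 m[OF E(1,2)])
  finally have 2: "j23 g \<otimes>\<^bsub>S3\<^esub> (?j12 g \<otimes>\<^bsub>S3\<^esub> j13 g) = ?j12 g \<otimes>\<^bsub>S3\<^esub> j13 g"
    using absorb[OF tpU3 j23(1) s23 Q23] E by simp
  have "?j12 g \<otimes>\<^bsub>S3\<^esub> j13 g = j23 g \<otimes>\<^bsub>S3\<^esub> (?j12 g \<otimes>\<^bsub>S3\<^esub> j13 g)" by (rule 2[symmetric])
  also have "\<dots> = j13 g \<otimes>\<^bsub>S3\<^esub> (?j12 g \<otimes>\<^bsub>S3\<^esub> j23 g)" using E by (simp add: S3.T.R.m_ac)
  finally show ?thesis unfolding 1 .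
qed

text \<open>The cocycle identity is used twice. Identifying the third factor with the first gives
  the symmetry of \<open>g\<close>. Contracting the third factor shows that the slices of
  \<open>g\<close> lie in \<open>eqz g\<close>, so \<open>g\<close> lies in
  \<open>eqz g \<otimes> S\<close>; symmetry puts it into \<open>S \<otimes> eqz g\<close> as well,
  and the two subspaces meet in \<open>eqz g \<otimes> eqz g\<close>.\<close>

lemma g_tsub:
  assumes mu: "mu \<in> ring_hom S2 S" "\<And>s t. s \<in> carrier S \<Longrightarrow> t \<in> carrier S \<Longrightarrow> mu (b2 s t) = s \<otimes>\<^bsub>S\<^esub> t"
  shows "g \<in> S2.tsub (eqz g) (eqz g)"
proof -
  let ?b3 = "\<lambda>x s. tensor_class k S2 (str S2) S (str S) [(x, s)]" and ?S3 = "tensor k S2 S"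
  let ?c3 = "\<lambda>x s. tensor_class k R (str R) ?S3 (str ?S3) [(x, s)]" and ?U3 = "tensor k R ?S3"
  have tp3: "tensor_product_field k S2 S ?S3 ?b3"
    by (rule tensor_construction.tensor_field) (unfold_locales)
  interpret V3: tensor_product_field k S2 S ?S3 ?b3 by (rule tp3)
  have tpU3: "tensor_product_field k R ?S3 ?U3 ?c3"
    by (rule tensor_construction.tensor_field) (unfold_locales)
  interpret U3: tensor_product_field k R ?S3 ?U3 ?c3 by (rule tpU3)
  define b3 where "b3 = ?b3"
  define S3 where "S3 = ?S3"
  interpret S3: tensor_product_field k S2 S S3 b3 unfolding b3_def S3_def by (rule tp3)
  note B3 = S3.tensor_product_axioms
  have i1: "(\<lambda>s. b3 (b2 s \<one>\<^bsub>S\<^esub>) \<one>\<^bsub>S\<^esub>) \<in> ring_hom S S3"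
    using ring_hom_trans[OF S2.b_hom_left S3.b_hom_left] by (simp add: comp_def)
  have i2: "(\<lambda>s. b3 (b2 \<one>\<^bsub>S\<^esub> s) \<one>\<^bsub>S\<^esub>) \<in> ring_hom S S3"
    using ring_hom_trans[OF S2.b_hom_right S3.b_hom_left] by (simp add: comp_def)
  have st: "b3 (b2 (str S c) \<one>\<^bsub>S\<^esub>) \<one>\<^bsub>S\<^esub> = b3 \<one>\<^bsub>S2\<^esub> (str S c)" "b3 (b2 \<one>\<^bsub>S\<^esub> (str S c)) \<one>\<^bsub>S\<^esub> = b3 \<one>\<^bsub>S2\<^esub> (str S c)"
    if "c \<in> carrier k" for c
    using that by (simp_all add: S2.b_str[symmetric] S2.b_str_right[symmetric] S3.b_str[symmetric] S3.b_str_right[symmetric])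
  obtain j13 where j13: "j13 \<in> ring_hom S2 S3" "\<And>s t. s \<in> carrier S \<Longrightarrow> t \<in> carrier S \<Longrightarrow> j13 (b2 s t) = b3 (b2 s \<one>\<^bsub>S\<^esub>) t"
    by (rule S2.hom_lift[OF S3.T.R.is_cring i1 S3.b_hom_right]) (simp add: st, simp add: S3.b_split[symmetric])
  obtain j23 where j23: "j23 \<in> ring_hom S2 S3" "\<And>s t. s \<in> carrier S \<Longrightarrow> t \<in> carrier S \<Longrightarrow> j23 (b2 s t) = b3 (b2 \<one>\<^bsub>S\<^esub> s) t"
    by (rule S2.hom_lift[OF S3.T.R.is_cring i2 S3.b_hom_right]) (simp add: st, simp add: S3.b_split[symmetric])
  have coc: "b3 g \<one>\<^bsub>S\<^esub> \<otimes>\<^bsub>S3\<^esub> j13 g = b3 g \<one>\<^bsub>S\<^esub> \<otimes>\<^bsub>S3\<^esub> j23 g"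
    by (rule cocycle[OF B3 _ j13 j23]) (use U3.tensor_product_axioms in \<open>simp_all add: S3_def\<close>)
  have id2: "(\<lambda>x. x) \<in> ring_hom S2 S2" by (simp add: ring_hom_def)
  obtain swp where swp: "swp \<in> ring_hom S2 S2"
    "\<And>s t. s \<in> carrier S \<Longrightarrow> t \<in> carrier S \<Longrightarrow> swp (b2 s t) = b2 \<one>\<^bsub>S\<^esub> s \<otimes>\<^bsub>S2\<^esub> b2 t \<one>\<^bsub>S\<^esub>"
    by (rule S2.hom_lift[OF S2.T.R.is_cring S2.b_hom_right S2.b_hom_left])
      (simp add: S2.b_str[symmetric] S2.b_str_right[symmetric], blast)
  have swp_b: "swp (b2 s t) = b2 t s" if "s \<in> carrier S" "t \<in> carrier S" for s t
    using that by (simp add: swp(2) S2.b_mult)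
  \<comment> \<open>Multiplies the third factor into the first. It sends
    \<open>s \<otimes> 1 \<otimes> t\<close> to \<open>s t \<otimes> 1\<close> and
    \<open>1 \<otimes> s \<otimes> t\<close> to \<open>t \<otimes> s\<close>.\<close>
  obtain th where th: "th \<in> ring_hom S3 S2"
    "\<And>x u. x \<in> carrier S2 \<Longrightarrow> u \<in> carrier S \<Longrightarrow> th (b3 x u) = x \<otimes>\<^bsub>S2\<^esub> b2 u \<one>\<^bsub>S\<^esub>"
    by (rule S3.hom_lift[OF S2.T.R.is_cring id2 S2.b_hom_left]) (simp add: S2.b_str[symmetric], blast)
  have E: "b3 g \<one>\<^bsub>S\<^esub> \<in> carrier S3" "j13 g \<in> carrier S3" "j23 g \<in> carrier S3" "swp g \<in> carrier S2"
    using ring_hom_closed[OF j13(1)] ring_hom_closed[OF j23(1)] ring_hom_closed[OF swp(1)] by simp_all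
  have "th (j13 g) = b2 (mu g) \<one>\<^bsub>S\<^esub>"
    by (rule S2.hom_eq[OF S2.T.R.is_cring ring_hom_trans[OF j13(1) th(1), unfolded comp_def]
        ring_hom_trans[OF mu(1) S2.b_hom_left, unfolded comp_def] _ g_closed])
      (simp add: j13(2) th(2) mu(2) S2.b_mult)
  moreover have "th (j23 g) = swp g"
    by (rule S2.hom_eq[OF S2.T.R.is_cring ring_hom_trans[OF j23(1) th(1), unfolded comp_def] swp(1) _ g_closed])
      (simp add: j23(2) th(2) swp(2))
  \<comment> \<open>In the image of the cocycle identity the factor from \<open>j13\<close> is
    \<open>mu g \<otimes> 1 = 1\<close>, and the factor from \<open>j23\<close> is the exchanged
    \<open>g\<close>. Applying the exchange once more yields equality of \<open>g\<close> and
    \<open>swp g\<close>.\<close>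
  ultimately have gs: "g = g \<otimes>\<^bsub>S2\<^esub> swp g"
    using arg_cong[OF coc, of th] E by (simp add: ring_hom_mult[OF th(1)] th(2) mult_g[OF mu])
  have "swp (swp g) = g"
    by (rule S2.hom_eq[OF S2.T.R.is_cring ring_hom_trans[OF swp(1) swp(1), unfolded comp_def] id2 _ g_closed])
      (simp add: swp_b)
  then have "swp g = swp g \<otimes>\<^bsub>S2\<^esub> g" using arg_cong[OF gs, of swp] E by (simp add: ring_hom_mult[OF swp(1)])
  then have swpg: "swp g = g" using gs E by (simp add: S2.T.R.m_comm)
  interpret W2: tensor_product_field k S S S2 "\<lambda>t s. b2 s t" by (rule S2.swap_field)
  interpret W3: tensor_product k S S2 S3 "\<lambda>t x. b3 x t" by (rule S3.swap)
  have B: "ksub k S (eqz g)" by (rule ksubalg_ksub[OF eqz[OF g_closed]])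
  \<comment> \<open>Contraction of the third factor is linear over the first two, so the factor
    \<open>g\<close> stays in place while \<open>j13 g\<close> and \<open>j23 g\<close> become the
    slice of \<open>g\<close> in the first and in the second position.\<close>
  have "g \<in> W2.tsub (carrier S) (eqz g)"
  proof (rule W2.tsub_slices[OF X.S.ksub_carrier B])
    show "g \<in> W2.tsub (carrier S) (carrier S)" using W2.tsub_carrier by simp
    fix f assume f: "lin k S f"
    have "W3.lslice f (j13 g) = b2 (W2.lslice f g) \<one>\<^bsub>S\<^esub>"
      by (rule W2.lslice_id_hom[OF W3.tensor_product_axioms S2.b_hom_left _ j13(1) _ f g_closed])
        (simp_all add: S2.b_str[symmetric] j13(2))
    moreover have "W3.lslice f (j23 g) = b2 \<one>\<^bsub>S\<^esub> (W2.lslice f g)"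
      by (rule W2.lslice_id_hom[OF W3.tensor_product_axioms S2.b_hom_right _ j23(1) _ f g_closed])
        (simp_all add: S2.b_str_right[symmetric] j23(2))
    moreover have "W3.lslice f (x \<otimes>\<^bsub>S3\<^esub> b3 g \<one>\<^bsub>S\<^esub>) = W3.lslice f x \<otimes>\<^bsub>S2\<^esub> g" if "x \<in> carrier S3" for x
      by (rule W3.lslice_mult[OF f that g_closed])
    ultimately have "b2 (W2.lslice f g) \<one>\<^bsub>S\<^esub> \<otimes>\<^bsub>S2\<^esub> g = b2 \<one>\<^bsub>S\<^esub> (W2.lslice f g) \<otimes>\<^bsub>S2\<^esub> g"
      using arg_cong[OF coc, of "W3.lslice f"] E by (simp add: S3.T.R.m_comm[of "b3 g \<one>\<^bsub>S\<^esub>"])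
    then show "W2.lslice f g \<in> eqz g" using W2.lslice_closed[OF f g_closed] by (simp add: eqz_def)
  qed
  then have l: "g \<in> S2.tsub (eqz g) (carrier S)" by (simp add: S2.tsub_swap)
  then obtain xs where xs: "xs \<in> lists (eqz g \<times> carrier S)" "g = tsum S2 b2 xs" unfolding S2.tsub_def by blast
  have xsL: "xs \<in> S2.L" using xs(1) ksubD(1)[OF B] by (auto simp: in_lists_conv_set)
  have "g = tsum S2 (\<lambda>s t. b2 t s) xs"
    using S2.hom_tsum[OF S2.T.R.is_cring swp(1) xsL swp_b] swpg xs(2) by simp
  also have "\<dots> = tsum S2 b2 (map prod.swap xs)" by (rule tsum_swap[symmetric])
  finally have "g \<in> S2.tsub (carrier S) (eqz g)" using xs(1) swap_lists[of xs "carrier S" "eqz g"] unfolding S2.tsub_def by blast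
  then show ?thesis using S2.tsub_inter[OF B B l] by simp
qed

end

section \<open>Compatibility of the descent with \<sigma>\<close>

locale descent_sigma = descent +
  assumes sR: "sig R \<in> ring_hom R R" and sS: "sig S \<in> ring_hom S S" and sT: "sig T \<in> ring_hom T T"
    and s2: "sig S2 \<in> ring_hom S2 S2" and sU: "sig U2 \<in> ring_hom U2 U2"
    and sTb: "\<And>r s. r \<in> carrier R \<Longrightarrow> s \<in> carrier S \<Longrightarrow> sig T (b r s) = b (sig R r) (sig S s)"
    and s2b: "\<And>s t. s \<in> carrier S \<Longrightarrow> t \<in> carrier S \<Longrightarrow> sig S2 (b2 s t) = b2 (sig S s) (sig S t)"
    and sUc: "\<And>r x. r \<in> carrier R \<Longrightarrow> x \<in> carrier S2 \<Longrightarrow> sig U2 (c2 r x) = c2 (sig R r) (sig S2 x)"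
    and sC: "sig T ` C \<subseteq> C" and spanC: "\<And>W. ksub k T W \<Longrightarrow> W \<subseteq> C \<Longrightarrow> sig T ` C \<subseteq> W \<Longrightarrow> C \<subseteq> W"
begin

lemma sig_Q: "t \<in> carrier T \<Longrightarrow> sig U2 (Q1 t) = Q1 (sig T t)" "t \<in> carrier T \<Longrightarrow> sig U2 (Q2 t) = Q2 (sig T t)"
proof -
  note o = ring_hom_one[OF sS] ring_hom_closed[OF sR] ring_hom_closed[OF sS]
  show "sig U2 (Q1 t) = Q1 (sig T t)" if "t \<in> carrier T"
    by (rule X.hom_eq[OF U.T.R.is_cring ring_hom_trans[OF Q1(1) sU, unfolded comp_def]
        ring_hom_trans[OF sT Q1(1), unfolded comp_def] _ that]) (simp add: Q1(2) sUc s2b sTb o)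
  show "sig U2 (Q2 t) = Q2 (sig T t)" if "t \<in> carrier T"
    by (rule X.hom_eq[OF U.T.R.is_cring ring_hom_trans[OF Q2(1) sU, unfolded comp_def]
        ring_hom_trans[OF sT Q2(1), unfolded comp_def] _ that]) (simp add: Q2(2) sUc s2b sTb o)
qed

text \<open>Two idempotents that absorb each other are equal. Over \<open>\<sigma>(e)\<close> the
  coprojections agree on \<open>\<sigma>(C)\<close>, hence on its span \<open>C\<close>, so
  \<open>e\<close> absorbs \<open>\<sigma>(e)\<close>. Conversely \<open>\<sigma>(e)\<close> is the
  image of \<open>ps\<close> under the coprojections composed with \<open>\<sigma>\<close>, which
  agree over \<open>e\<close> because \<open>\<sigma>(C)\<close> lies in \<open>C\<close>.\<close>

lemma sig_e: "sig U2 e = e"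
proof -
  let ?y = "sig U2 e" and ?C = "T\<lparr>carrier := C\<rparr>"
  have y: "?y \<in> carrier U2" using ring_hom_closed[OF sU e(1)] .
  note q = ring_hom_closed[OF Q1(1)] ring_hom_closed[OF Q2(1)]
  have crC: "cring ?C" using X.T.ksubalg_algebra_over[OF C] by (simp add: algebra_over_def)
  let ?W = "{x \<in> C. Q1 x \<otimes>\<^bsub>U2\<^esub> ?y = Q2 x \<otimes>\<^bsub>U2\<^esub> ?y}"
  have Qstr: "Q1 (str T c) = Q2 (str T c)" if "c \<in> carrier k" for c
    using that by (simp add: X.b_str Q1(2) Q2(2))
  have z: "Q1 \<zero>\<^bsub>T\<^esub> = \<zero>\<^bsub>U2\<^esub>" "Q2 \<zero>\<^bsub>T\<^esub> = \<zero>\<^bsub>U2\<^esub>"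
    using additive_zero[OF X.T.R.abelian_group_axioms U.T.R.abelian_group_axioms] ring_hom_additive Q1(1) Q2(1) by blast+
  have CT: "x \<in> carrier T" if "x \<in> C" for x using that C_carrier by blast
  have "ksub k T ?W" unfolding ksub_def
  proof (intro conjI ballI)
    show "?W \<subseteq> carrier T" using C_carrier by blast
    show "\<zero>\<^bsub>T\<^esub> \<in> ?W" using ksubalgD(2)[OF C] z by simp
    fix u v assume "u \<in> ?W" "v \<in> ?W"
    then show "u \<oplus>\<^bsub>T\<^esub> v \<in> ?W" using y CT q ksubalgD(5)[OF C]
      by (simp add: ring_hom_add[OF Q1(1)] ring_hom_add[OF Q2(1)] U.T.R.l_distr)
  next
    fix c u assume c: "c \<in> carrier k" and u: "u \<in> ?W"
    then have uT: "u \<in> C" "u \<in> carrier T" "str T c \<in> C" "str T c \<in> carrier T" using CT ksubalgD(7)[OF C c] by auto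
    then have "Q1 (str T c \<otimes>\<^bsub>T\<^esub> u) \<otimes>\<^bsub>U2\<^esub> ?y = Q1 (str T c) \<otimes>\<^bsub>U2\<^esub> (Q1 u \<otimes>\<^bsub>U2\<^esub> ?y)"
      using y q by (simp add: ring_hom_mult[OF Q1(1)] U.T.R.m_assoc)
    also have "\<dots> = Q2 (str T c) \<otimes>\<^bsub>U2\<^esub> (Q2 u \<otimes>\<^bsub>U2\<^esub> ?y)" using u Qstr[OF c] by simp
    also have "\<dots> = Q2 (str T c \<otimes>\<^bsub>T\<^esub> u) \<otimes>\<^bsub>U2\<^esub> ?y"
      using uT y q by (simp add: ring_hom_mult[OF Q2(1)] U.T.R.m_assoc)
    finally show "smul T c u \<in> ?W" using uT ksubalgD(6)[OF C] by (simp add: smul_def)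
  qed
  \<comment> \<open>Apply \<open>\<sigma>\<close> to the equation for \<open>a\<close> over
    \<open>e\<close>. The spanning condition then extends the equation over
    \<open>\<sigma>(e)\<close> from \<open>\<sigma>(C)\<close> to all of \<open>C\<close>.\<close>
  moreover have "sig T a \<in> ?W" if a: "a \<in> C" for a
  proof -
    have "sig U2 (Q1 a \<otimes>\<^bsub>U2\<^esub> e) = sig U2 (Q2 a \<otimes>\<^bsub>U2\<^esub> e)" using e(2)[OF a] by simp
    then show ?thesis using sC a CT[OF a] q e(1) by (auto simp: ring_hom_mult[OF sU] sig_Q)
  qed
  ultimately have W: "C \<subseteq> ?W" by (intro spanC) auto
  have ey: "e \<otimes>\<^bsub>U2\<^esub> ?y = ?y" unfolding e_def
    by (rule sep_idem_absorb[OF crC ps U.T.R.is_cring ring_hom_restrict[OF Q1(1) C_carrier]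
        ring_hom_restrict[OF Q2(1) C_carrier] y[unfolded e_def]]) (use W in \<open>auto simp: e_def\<close>)
  have "?y = tsum U2 (\<lambda>u v. sig U2 (Q1 u) \<otimes>\<^bsub>U2\<^esub> sig U2 (Q2 v)) ps" by (rule hom_e[OF U.T.R.is_cring sU])
  also have "\<dots> \<otimes>\<^bsub>U2\<^esub> e = e"
    by (rule sep_idem_absorb[OF crC ps U.T.R.is_cring
        ring_hom_restrict[OF ring_hom_trans[OF Q1(1) sU, unfolded comp_def] C_carrier]
        ring_hom_restrict[OF ring_hom_trans[OF Q2(1) sU, unfolded comp_def] C_carrier] e(1)])
      (use sC e(2) CT in \<open>auto simp: sig_Q image_subset_iff\<close>)
  finally have "?y \<otimes>\<^bsub>U2\<^esub> e = e" .
  then show ?thesis using ey e(1) y by (simp add: U.T.R.m_comm)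
qed

text \<open>Applying \<open>\<sigma>\<close> to \<open>e (1 \<otimes> g) = 1 \<otimes> g\<close> and
  using \<open>\<sigma>(e) = e\<close> shows that \<open>1 \<otimes> \<sigma>(g)\<close> is fixed by
  \<open>e\<close>; maximality of \<open>g\<close> does the rest. This is one inequality between the
  two idempotents; a dimension count later shows that they have the same equalizer.\<close>

lemma g_sig_g: "g \<otimes>\<^bsub>S2\<^esub> sig S2 g = sig S2 g"
proof -
  have c: "sig S2 g \<in> carrier S2" using ring_hom_closed[OF s2 g_closed] .
  have "e \<otimes>\<^bsub>U2\<^esub> c2 \<one>\<^bsub>R\<^esub> (sig S2 g) = c2 \<one>\<^bsub>R\<^esub> (sig S2 g)"
    using arg_cong[OF e_g, of "sig U2"] e(1)
    by (simp add: ring_hom_mult[OF sU] sUc sig_e ring_hom_one[OF sR])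
  then show ?thesis
    using absorb[OF U.tensor_product_axioms, of "\<lambda>x. x" "\<lambda>x. x" "sig S2 g"] c by (simp add: ring_hom_def)
qed

text \<open>Let \<open>B = eqz g\<close> and \<open>Y = eqz (\<sigma>(g))\<close>. From
  \<open>g \<sigma>(g) = \<sigma>(g)\<close> one gets \<open>B \<subseteq> Y\<close>, and
  \<open>\<sigma>\<close> maps \<open>B\<close> into \<open>Y\<close>. The tensor
  \<open>\<sigma>(g)\<close> makes \<open>Y\<close> spanned by the images under
  \<open>\<sigma>\<close> of a basis of \<open>B\<close>. So \<open>Y\<close> is no larger than
  \<open>B\<close>, the two coincide, and both stability and the spanning condition follow.\<close>

lemma eqz_strongly_etale:
  assumes mu: "mu \<in> ring_hom S2 S" "\<And>s t. s \<in> carrier S \<Longrightarrow> t \<in> carrier S \<Longrightarrow> mu (b2 s t) = s \<otimes>\<^bsub>S\<^esub> t"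
  shows "sig S ` eqz g \<subseteq> eqz g" "\<exists>xs. sep_idem k (S\<lparr>carrier := eqz g\<rparr>) xs"
    "ksub k S W \<Longrightarrow> sig S ` eqz g \<subseteq> W \<Longrightarrow> eqz g \<subseteq> W"
proof -
  let ?B = "eqz g" and ?y = "sig S2 g"
  have y: "?y \<in> carrier S2" using ring_hom_closed[OF s2 g_closed] .
  note B = eqz[OF g_closed] and Y = eqz[OF y]
  note kB = ksubalg_ksub[OF B] and kY = ksubalg_ksub[OF Y]
  obtain xs where xs: "xs \<in> lists (?B \<times> ?B)" "g = tsum S2 b2 xs" "indep k S (map fst xs)" "indep k S (map snd xs)"
    using S2.tsub_reduced[OF g_tsub[OF mu] kB kB] by blast
  have xsL: "xs \<in> S2.L" using xs(1) ksubD(1)[OF kB] by (auto simp: in_lists_conv_set)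
  have mus: "mu (tsum S2 b2 zs) = tsum S (\<otimes>\<^bsub>S\<^esub>) zs" if "zs \<in> S2.L" for zs
    by (rule S2.hom_tsum[OF X.S.R.is_cring mu(1) that mu(2)])
  have one: "tsum S (\<otimes>\<^bsub>S\<^esub>) xs = \<one>\<^bsub>S\<^esub>" using mus[OF xsL] mult_g[OF mu] xs(2) by simp
  have "sep_idem k (S\<lparr>carrier := ?B\<rparr>) xs" unfolding sep_idem_def
  proof (intro conjI ballI)
    show "xs \<in> lists (carrier (S\<lparr>carrier := ?B\<rparr>) \<times> carrier (S\<lparr>carrier := ?B\<rparr>))" using xs(1) by simp
    show "tsum (S\<lparr>carrier := ?B\<rparr>) (\<otimes>\<^bsub>S\<lparr>carrier := ?B\<rparr>\<^esub>) xs = \<one>\<^bsub>S\<lparr>carrier := ?B\<rparr>\<^esub>"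
      using one by (simp add: tsum_def)
    fix a assume "a \<in> carrier (S\<lparr>carrier := ?B\<rparr>)"
    then have a: "a \<in> ?B" "a \<in> carrier S" using ksubD(1)[OF kB] by auto
    have l: "map (\<lambda>(u, v). (a \<otimes>\<^bsub>S\<^esub> u, v)) xs \<in> lists (?B \<times> ?B)" "map (\<lambda>(u, v). (u, a \<otimes>\<^bsub>S\<^esub> v)) xs \<in> lists (?B \<times> ?B)"
      using xs(1) ksubalgD(6)[OF B] a(1) by (auto simp: in_lists_conv_set)
    have o: "map (\<lambda>(u, v). (a \<otimes>\<^bsub>S\<^esub> u, \<one>\<^bsub>S\<^esub> \<otimes>\<^bsub>S\<^esub> v)) xs = map (\<lambda>(u, v). (a \<otimes>\<^bsub>S\<^esub> u, v)) xs"
      "map (\<lambda>(u, v). (\<one>\<^bsub>S\<^esub> \<otimes>\<^bsub>S\<^esub> u, a \<otimes>\<^bsub>S\<^esub> v)) xs = map (\<lambda>(u, v). (u, a \<otimes>\<^bsub>S\<^esub> v)) xs"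
      using xsL by (auto simp: in_lists_conv_set)
    have "tsum S2 b2 (map (\<lambda>(u, v). (a \<otimes>\<^bsub>S\<^esub> u, v)) xs) = tsum S2 b2 (map (\<lambda>(u, v). (u, a \<otimes>\<^bsub>S\<^esub> v)) xs)"
      using S2.tsum_mult[OF xsL a(2) X.S.R.one_closed] S2.tsum_mult[OF xsL X.S.R.one_closed a(2)] a(1)
      by (simp add: o eqz_def xs(2)[symmetric])
    \<comment> \<open>The equation defining \<open>eqz g\<close> holds in
      \<open>S \<otimes> S\<close>; since \<open>B \<otimes> B\<close> embeds there, it is a
      consequence of the relations over \<open>B\<close> alone.\<close>
    from S2.tensor_eq_restrict[OF B B l this]
    show "tensor_eq k (S\<lparr>carrier := ?B\<rparr>) (str (S\<lparr>carrier := ?B\<rparr>)) (S\<lparr>carrier := ?B\<rparr>) (str (S\<lparr>carrier := ?B\<rparr>))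
      (map (\<lambda>(u, v). (a \<otimes>\<^bsub>S\<lparr>carrier := ?B\<rparr>\<^esub> u, v)) xs) (map (\<lambda>(u, v). (u, a \<otimes>\<^bsub>S\<lparr>carrier := ?B\<rparr>\<^esub> v)) xs)" by simp
  qed
  then show "\<exists>xs. sep_idem k (S\<lparr>carrier := ?B\<rparr>) xs" by blast
  have sc: "sig S s \<in> carrier S" if "s \<in> carrier S" for s using ring_hom_closed[OF sS that] .
  have bc: "b2 s \<one>\<^bsub>S\<^esub> \<in> carrier S2" "b2 \<one>\<^bsub>S\<^esub> s \<in> carrier S2" if "s \<in> carrier S" for s using that by simp_all
  \<comment> \<open>Multiply the equation over \<open>g\<close> by \<open>\<sigma>(g)\<close>, which
    \<open>g\<close> absorbs.\<close>
  have BY: "?B \<subseteq> eqz ?y"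
  proof
    fix s assume s: "s \<in> ?B"
    then have sS: "s \<in> carrier S" by (simp add: eqz_def)
    have "b2 s \<one>\<^bsub>S\<^esub> \<otimes>\<^bsub>S2\<^esub> (g \<otimes>\<^bsub>S2\<^esub> ?y) = b2 \<one>\<^bsub>S\<^esub> s \<otimes>\<^bsub>S2\<^esub> (g \<otimes>\<^bsub>S2\<^esub> ?y)"
      using s bc[OF sS] y by (simp add: S2.T.R.m_assoc[symmetric] eqz_def)
    then show "s \<in> eqz ?y" using sS by (simp add: eqz_def g_sig_g)
  qed
  have sY: "sig S s \<in> eqz ?y" if "s \<in> ?B" for s
  proof -
    have s: "s \<in> carrier S" "b2 s \<one>\<^bsub>S\<^esub> \<otimes>\<^bsub>S2\<^esub> g = b2 \<one>\<^bsub>S\<^esub> s \<otimes>\<^bsub>S2\<^esub> g" using that by (auto simp: eqz_def)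
    show ?thesis using arg_cong[OF s(2), of "sig S2"] s(1) bc[OF s(1)] sc[OF s(1)]
      by (simp add: eqz_def ring_hom_mult[OF s2] s2b ring_hom_one[OF sS])
  qed
  let ?us = "map fst xs" and ?su = "map (sig S) (map fst xs)" and ?sv = "map (sig S) (map snd xs)"
  have usB: "set ?us \<subseteq> ?B" "set (map snd xs) \<subseteq> ?B" using xs(1) by (auto simp: in_lists_conv_set)
  have usS: "set ?us \<subseteq> carrier S" using usB ksubD(1)[OF kB] by blast
  have suS: "set ?su \<subseteq> carrier S" "set ?sv \<subseteq> carrier S" using sY usB ksubD(1)[OF kY] by auto
  have sub: "set ?su \<subseteq> eqz ?y" "set ?sv \<subseteq> eqz ?y" using sY usB by auto
  note lY = X.S.lspan_least[OF kY sub(1)] X.S.lspan_least[OF kY sub(2)]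
  let ?zs = "map (map_prod (sig S) (sig S)) xs"
  have zs: "?zs \<in> lists (lspan k S ?su \<times> lspan k S ?sv)"
    unfolding in_lists_conv_set
  proof
    fix z assume "z \<in> set ?zs"
    then obtain u v where uv: "(u, v) \<in> set xs" "z = (sig S u, sig S v)" by auto
    then have "sig S u \<in> set ?su" "sig S v \<in> set ?sv" by force+
    then show "z \<in> lspan k S ?su \<times> lspan k S ?sv"
      using X.S.lspan_mem[OF suS(1)] X.S.lspan_mem[OF suS(2)] uv(2) by blast
  qed
  have yz: "?y = tsum S2 b2 ?zs"
    using S2.hom_tsum[OF S2.T.R.is_cring s2 xsL s2b] tsum_map_eq[of xs b2 "sig S" "sig S" "\<lambda>s t. b2 (sig S s) (sig S t)" S2]
    by (simp add: xs(2)[symmetric])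
  \<comment> \<open>A priori \<open>\<sigma>\<close> may destroy independence, and
    \<open>sep_idem_span\<close> asks for independent right components. Hence
    \<open>\<sigma>(g)\<close> is represented anew within the spans of the images of the components
    of \<open>g\<close>.\<close>
  obtain ys where ys: "ys \<in> lists (lspan k S ?su \<times> lspan k S ?sv)" "?y = tsum S2 b2 ys"
    "indep k S (map fst ys)" "indep k S (map snd ys)"
    using S2.tsub_reduced[of ?y, OF _ X.S.lspan_ksub[OF suS(1)] X.S.lspan_ksub[OF suS(2)]] zs yz
    unfolding S2.tsub_def by blast
  have ysY: "ys \<in> lists (eqz ?y \<times> eqz ?y)" using ys(1) lY by (fastforce simp: in_lists_conv_set)
  have ysL: "ys \<in> S2.L" using ysY ksubD(1)[OF kY] by (auto simp: in_lists_conv_set)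
  have "mu ?y = sig S (mu g)"
    by (rule S2.hom_eq[OF X.S.R.is_cring ring_hom_trans[OF s2 mu(1), unfolded comp_def]
        ring_hom_trans[OF mu(1) sS, unfolded comp_def] _ g_closed])
      (simp add: s2b mu(2) sc ring_hom_mult[OF sS])
  then have "tsum S (\<otimes>\<^bsub>S\<^esub>) ys = \<one>\<^bsub>S\<^esub>" using mus[OF ysL] ys(2) mult_g[OF mu] ring_hom_one[OF sS] by simp
  then have "eqz ?y \<subseteq> lspan k S (map fst ys)"
    by (rule sep_idem_span[OF tp2 Y ysY ys(4)]) (simp add: ys(2)[symmetric] eqz_def)
  also have "\<dots> \<subseteq> lspan k S ?su"
    using ys(1) by (intro X.S.lspan_least[OF X.S.lspan_ksub[OF suS(1)]]) (auto simp: in_lists_conv_set)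
  finally have Ysu: "eqz ?y \<subseteq> lspan k S ?su" .
  obtain f where f: "X.S.dual ?us f" using X.S.indep_dual[OF usS xs(3)] .
  \<comment> \<open>The independent list \<open>?us\<close> lies in the span of \<open>?su\<close>,
    which has the same length, so both have the same span. This is where the inclusion of
    \<open>eqz g\<close> in the equalizer of \<open>\<sigma>(g)\<close> becomes an equality.\<close>
  have "lspan k S ?su \<subseteq> lspan k S ?us"
    by (rule X.S.lspan_dual_eq[OF f _ suS(1)]) (use usB(1) BY Ysu in auto)
  also have "\<dots> \<subseteq> ?B" by (rule X.S.lspan_least[OF kB usB(1)])
  finally have YB: "eqz ?y \<subseteq> ?B" using Ysu by blast
  show "sig S ` ?B \<subseteq> ?B" using sY YB by blast
  show "?B \<subseteq> W" if W: "ksub k S W" "sig S ` ?B \<subseteq> W"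
  proof -
    have "lspan k S ?su \<subseteq> W" using W(2) usB(1) by (intro X.S.lspan_least[OF W(1)]) auto
    then show ?thesis using BY Ysu by blast
  qed
qed

end

theorem etale_sub_descent:
  fixes k :: "('k, 'm) sring_scheme" and R :: "('k, 'a) salg" and S :: "('k, 'b) salg" and T :: "('k, 'c) salg"
  assumes k: "sigma_field k" and R: "sigma_alg k R" and S: "sigma_alg k S" and T: "sigma_alg k T"
    and tp: "tensor_product_field k R S T b"
    and sT: "\<And>r s. r \<in> carrier R \<Longrightarrow> s \<in> carrier S \<Longrightarrow> sig T (b r s) = b (sig R r) (sig S s)"
    and C: "etale_sub k T C"
  shows "\<exists>B. etale_sub k S B \<and> C \<subseteq> tensor_product.tsub T b (carrier R) B"
proof -
  define S2 where "S2 = tensor k S S"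
  define b2 where "b2 = (\<lambda>s t. tensor_class k S (str S) S (str S) [(s, t)])"
  define U2 where "U2 = tensor k R S2"
  define c2 where "c2 = (\<lambda>s t. tensor_class k R (str R) S2 (str S2) [(s, t)])"
  note kr = sigma_field_cring(3)[OF k]
  have S2: "sigma_alg k S2" unfolding S2_def by (rule sigma_alg_tensor(1)[OF kr S S])
  have U2: "sigma_alg k U2" unfolding U2_def by (rule sigma_alg_tensor(1)[OF kr R S2])
  have tp2: "tensor_product_field k S S S2 b2" unfolding S2_def b2_def by (rule sigma_tensor[OF k S S])
  have tpU: "tensor_product_field k R S2 U2 c2" unfolding U2_def c2_def by (rule sigma_tensor[OF k R S2])
  have s2: "sig S2 (b2 s t) = b2 (sig S s) (sig S t)" if "s \<in> carrier S" "t \<in> carrier S" for s t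
    unfolding S2_def b2_def by (rule sigma_alg_tensor(2)[OF kr S S that])
  have sU: "sig U2 (c2 r x) = c2 (sig R r) (sig S2 x)" if "r \<in> carrier R" "x \<in> carrier S2" for r x
    unfolding U2_def c2_def by (rule sigma_alg_tensor(2)[OF kr R S2 that])
  interpret X: tensor_product_field k R S T b by (rule tp)
  interpret S2: tensor_product_field k S S S2 b2 by (rule tp2)
  interpret U: tensor_product_field k R S2 U2 c2 by (rule tpU)
  note CD = C[unfolded etale_sub_iff[OF k T]]
  have C': "ksubalg k T C" "sig T ` C \<subseteq> C" using CD by (auto simp: sigma_subalg_iff)
  obtain ps where ps: "sep_idem k (T\<lparr>carrier := C\<rparr>) ps" using CD by blast
  have CT: "C \<subseteq> carrier T" using ksubalgD(1)[OF C'(1)] by blast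
  obtain Q1 where Q1: "Q1 \<in> ring_hom T U2" "\<And>r s. r \<in> carrier R \<Longrightarrow> s \<in> carrier S \<Longrightarrow> Q1 (b r s) = c2 r (b2 s \<one>\<^bsub>S\<^esub>)"
    using X.id_hom[OF U.tensor_product_axioms S2.b_hom_left] S2.b_str by metis
  obtain Q2 where Q2: "Q2 \<in> ring_hom T U2" "\<And>r s. r \<in> carrier R \<Longrightarrow> s \<in> carrier S \<Longrightarrow> Q2 (b r s) = c2 r (b2 \<one>\<^bsub>S\<^esub> s)"
    using X.id_hom[OF U.tensor_product_axioms S2.b_hom_right] S2.b_str_right by metis
  let ?e = "tsum U2 (\<lambda>u v. Q1 u \<otimes>\<^bsub>U2\<^esub> Q2 v) ps"
  have str: "Q1 (str (T\<lparr>carrier := C\<rparr>) c) = Q2 (str (T\<lparr>carrier := C\<rparr>) c)" if "c \<in> carrier k" for c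
    using that by (simp add: X.b_str Q1(2) Q2(2))
  note e = sep_idem_hom[OF X.T.ksubalg_algebra_over[OF C'(1)] ps U.T.R.is_cring
      ring_hom_restrict[OF Q1(1) CT] ring_hom_restrict[OF Q2(1) CT] str]
  let ?d = "\<one>\<^bsub>U2\<^esub> \<ominus>\<^bsub>U2\<^esub> ?e"
  have "?d \<otimes>\<^bsub>U2\<^esub> ?d = ?d"
  proof -
    have "?d \<otimes>\<^bsub>U2\<^esub> ?e = \<zero>\<^bsub>U2\<^esub>" using e(1,3) by (simp add: a_minus_def U.T.R.l_distr U.T.R.l_minus U.T.R.r_neg)
    moreover have "?d \<otimes>\<^bsub>U2\<^esub> ?d = ?d \<ominus>\<^bsub>U2\<^esub> ?d \<otimes>\<^bsub>U2\<^esub> ?e"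
      using e(1) by (subst (2) a_minus_def) (simp add: U.T.R.r_distr U.T.R.r_minus a_minus_def[of U2 ?d])
    ultimately show ?thesis using e(1) by (simp add: a_minus_def[of U2 ?d])
  qed
  then obtain w where w: "U.content ?d w" using U.exists_content[of ?d] e(1) by auto
  interpret descent_sigma k R S T b S2 b2 U2 c2 Q1 Q2 C ps w
    by unfold_locales
      (use tp tp2 tpU Q1 Q2 C' ps w sT s2 sU sigma_algD(1) R S T S2 U2 CD in \<open>auto\<close>)
  have idS: "(\<lambda>s. s) \<in> ring_hom S S" by (simp add: ring_hom_def)
  obtain mu where mu: "mu \<in> ring_hom S2 S" "\<And>s t. s \<in> carrier S \<Longrightarrow> t \<in> carrier S \<Longrightarrow> mu (b2 s t) = s \<otimes>\<^bsub>S\<^esub> t"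
    using S2.hom_lift[OF X.S.R.is_cring idS idS] by blast
  have "etale_sub k S (eqz g)"
    unfolding etale_sub_iff[OF k S] sigma_subalg_iff
    using eqz[OF g_closed] eqz_strongly_etale[OF mu] by blast
  then show ?thesis using C_tsub by blast
qed

lemma (in tensor_product) tsub_mono: "A \<subseteq> A' \<Longrightarrow> B \<subseteq> B' \<Longrightarrow> tsub A B \<subseteq> tsub A' B'"
  unfolding tsub_def by (intro image_mono lists_mono Sigma_mono) auto

section \<open>The strong core of a tensor product\<close>

theorem core_tensor:
  fixes k :: "('k, 'm) sring_scheme" and R :: "('k, 'a) salg" and S :: "('k, 'b) salg" and T :: "('k, 'c) salg"
  assumes k: "sigma_field k" and R: "sigma_alg k R" and S: "sigma_alg k S" and T: "sigma_alg k T"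
    and tp: "tensor_product_field k R S T b"
    and sT: "\<And>r s. r \<in> carrier R \<Longrightarrow> s \<in> carrier S \<Longrightarrow> sig T (b r s) = b (sig R r) (sig S s)"
  shows "carrier (strong_core k T) =
    tensor_product.tsub T b (carrier (strong_core k R)) (carrier (strong_core k S))"
proof -
  interpret X: tensor_product_field k R S T b by (rule tp)
  interpret Y: tensor_product_field k S R T "\<lambda>s r. b r s" by (rule X.swap_field)
  let ?R = "carrier (strong_core k R)" and ?S = "carrier (strong_core k S)" and ?T = "carrier (strong_core k T)"
  note sub = sigma_subalgD(1)[OF sigma_subalg_core[OF k R]] sigma_subalgD(1)[OF sigma_subalg_core[OF k S]]
    sigma_subalgD(1)[OF sigma_subalg_core[OF k T]]
  note ks = ksubalg_ksub[OF sub(1)] ksubalg_ksub[OF sub(2)] ksubalg_ksub[OF sub(3)]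
  have cR: "A \<subseteq> ?R" if "etale_sub k R A" for A using that by (auto simp: core_carrier)
  have cS: "A \<subseteq> ?S" if "etale_sub k S A" for A using that by (auto simp: core_carrier)
  show ?thesis
  proof
    show "?T \<subseteq> X.tsub ?R ?S"
    proof
      fix x assume "x \<in> ?T"
      then obtain C where C: "etale_sub k T C" "x \<in> C" by (auto simp: core_carrier)
      obtain B where B: "etale_sub k S B" "C \<subseteq> X.tsub (carrier R) B"
        using etale_sub_descent[OF k R S T tp sT C(1)] by blast
      obtain A where A: "etale_sub k R A" "C \<subseteq> Y.tsub (carrier S) A"
        using etale_sub_descent[OF k S R T X.swap_field sT C(1)] by blast
      have "x \<in> X.tsub (carrier R) ?S" using B C(2) X.tsub_mono[OF subset_refl cS[OF B(1)]] by blast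
      moreover have "x \<in> X.tsub ?R (carrier S)"
        using A C(2) X.tsub_mono[OF cR[OF A(1)] subset_refl] by (auto simp: X.tsub_swap)
      ultimately show "x \<in> X.tsub ?R ?S" using X.tsub_inter[OF ks(1,2)] by blast
    qed
    show "X.tsub ?R ?S \<subseteq> ?T"
    proof
      fix x assume "x \<in> X.tsub ?R ?S"
      then obtain xs where xs: "xs \<in> lists (?R \<times> ?S)" "x = tsum T b xs" unfolding X.tsub_def by blast
      note o = ring_hom_one[OF sigma_algD(1)[OF R]] ring_hom_one[OF sigma_algD(1)[OF S]]
      have l: "(\<lambda>r. b r \<one>\<^bsub>S\<^esub>) \<in> sigma_alg_hom k R T"
        using X.b_hom_left sT[OF _ X.S.R.one_closed] X.b_str by (auto simp: sigma_alg_hom_def o)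
      have r: "(\<lambda>s. b \<one>\<^bsub>R\<^esub> s) \<in> sigma_alg_hom k S T"
        using X.b_hom_right sT[OF X.R.R.one_closed] X.b_str_right by (auto simp: sigma_alg_hom_def o)
      \<comment> \<open>\<open>u \<otimes> v\<close> is the product of the images of
        \<open>u\<close> and \<open>v\<close> under the two coprojections, which are morphisms of
        difference algebras and so map the cores of \<open>R\<close> and \<open>S\<close> into the
        core of \<open>T\<close>.\<close>
      have "b u v \<in> ?T" if "u \<in> ?R" "v \<in> ?S" for u v
        using ksubalgD(6)[OF sub(3) core_hom[OF k R T l that(1)] core_hom[OF k S T r that(2)]]
          X.b_split[of u v] that ksubD(1)[OF ks(1)] ksubD(1)[OF ks(2)] by simp
      then have "set (map (case_prod b) xs) \<subseteq> ?T" using xs(1) by (auto simp: in_lists_conv_set)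
      then show "x \<in> ?T" unfolding xs(2) tsum_def by (rule ksub_lsum[OF ks(3)])
    qed
  qed
qed

section \<open>The base algebra, tensor products and additive generators inside the universe\<close>

lemma base_alg_simps [simp]:
  "carrier (base_alg k) = carrier k" "monoid.mult (base_alg k) = monoid.mult k" "monoid.one (base_alg k) = monoid.one k"
  "ring.zero (base_alg k) = ring.zero k" "ring.add (base_alg k) = ring.add k" "str (base_alg k) = (\<lambda>c. c)"
  "sig (base_alg k) = sig k"
  by (simp_all add: base_alg_def sring.defs)

lemma sigma_alg_base: "sigma_ring k \<Longrightarrow> sigma_alg k (base_alg k)"
proof -
  assume k: "sigma_ring k"
  then interpret cring k by (simp add: sigma_ring_def)
  have "cring (base_alg k)"
    by (unfold_locales) (auto simp: Units_def a_ac m_ac l_distr r_distr intro: add.l_inv_ex add.r_inv_ex)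
  then show ?thesis using k by (auto simp: sigma_alg_def sigma_ring_def ring_hom_def)
qed

lemma sigma_alg_hom_id: "(\<lambda>x. x) \<in> sigma_alg_hom k R R"
  by (auto simp: sigma_alg_hom_def ring_hom_def)

lemma sigma_alg_hom_comp: "f \<in> sigma_alg_hom k R S \<Longrightarrow> g \<in> sigma_alg_hom k S Q \<Longrightarrow> (\<lambda>x. g (f x)) \<in> sigma_alg_hom k R Q"
  by (auto simp: sigma_alg_hom_def ring_hom_def Pi_iff)

lemma sigma_alg_hom_str: "sigma_alg k R \<Longrightarrow> str R \<in> sigma_alg_hom k (base_alg k) R"
  by (auto simp: sigma_alg_hom_def sigma_alg_def ring_hom_def)

context
  fixes k :: "('u :: infinite) sring" and R S :: "'u ualg"
  assumes k: "sigma_field k" and R: "sigma_alg k R" and S: "sigma_alg k S"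
begin

lemma tensor_ob_field: "tensor_product_field k R S (tensor_ob k R S) (pure_tensor k R S)"
proof -
  interpret T: tensor_product_field k R S "tensor k R S" "\<lambda>r s. tensor_class k R (str R) S (str S) [(r, s)]"
    by (rule sigma_tensor[OF k R S])
  have "tensor_product k R S (tensor_ob k R S) (\<lambda>r s. pure_tensor k R S r s)"
    unfolding tensor_ob_def pure_tensor_def
    by (rule tensor_product_copy[OF T.tensor_product_axioms tensor_emb_inj])
  then show ?thesis
    using sigma_alg_field[OF k R] sigma_alg_field[OF k S] by (simp add: tensor_product_field_def)
qed

lemma sigma_alg_tensor_ob: "sigma_alg k (tensor_ob k R S)"
  unfolding tensor_ob_def
  by (rule sigma_alg_copy[OF sigma_alg_tensor(1)[OF _ R S] _ tensor_emb_inj]) (rule sigma_field_cring(3)[OF k])+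

lemma sig_pure:
  assumes "r \<in> carrier R" "s \<in> carrier S"
  shows "sig (tensor_ob k R S) (pure_tensor k R S r s) = pure_tensor k R S (sig R r) (sig S s)"
proof -
  interpret T: tensor_product_field k R S "tensor k R S" "\<lambda>r s. tensor_class k R (str R) S (str S) [(r, s)]"
    by (rule sigma_tensor[OF k R S])
  show ?thesis unfolding tensor_ob_def pure_tensor_def
    using copy_alg_ops(1)[OF tensor_emb_inj T.b_closed[OF assms]]
      sigma_alg_tensor(2)[OF sigma_field_cring(3)[OF k] R S assms] by simp
qed

interpretation T: tensor_product_field k R S "tensor_ob k R S" "pure_tensor k R S"
  by (rule tensor_ob_field)

lemma pure_hom: "(\<lambda>r. pure_tensor k R S r \<one>\<^bsub>S\<^esub>) \<in> sigma_alg_hom k R (tensor_ob k R S)"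
  "(\<lambda>s. pure_tensor k R S \<one>\<^bsub>R\<^esub> s) \<in> sigma_alg_hom k S (tensor_ob k R S)"
  using T.b_hom_left T.b_hom_right T.b_str T.b_str_right ring_hom_one[OF sigma_algD(1)[OF R]] ring_hom_one[OF sigma_algD(1)[OF S]]
  by (auto simp: sigma_alg_hom_def sig_pure)

text \<open>The tensor product is the coproduct of difference algebras: the induced ring
  homomorphism commutes with \<open>\<sigma>\<close> because both composites agree on pure tensors.
  All structure arrows of the category arise from this property.\<close>

lemma sigma_alg_lift:
  fixes Q :: "'u ualg"
  assumes Q: "sigma_alg k Q" and f: "f \<in> sigma_alg_hom k R Q" and g: "g \<in> sigma_alg_hom k S Q"
  obtains h where "h \<in> sigma_alg_hom k (tensor_ob k R S) Q"
    "\<And>r s. r \<in> carrier R \<Longrightarrow> s \<in> carrier S \<Longrightarrow> h (pure_tensor k R S r s) = f r \<otimes>\<^bsub>Q\<^esub> g s"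
proof -
  note F = sigma_alg_homD[OF f] and G = sigma_alg_homD[OF g]
  interpret Q: cring Q using Q by (simp add: sigma_alg_def sigma_ring_def)
  note c = ring_hom_closed[OF F(1)] ring_hom_closed[OF G(1)] ring_hom_closed[OF sigma_algD(1)[OF R]]
    ring_hom_closed[OF sigma_algD(1)[OF S]]
  obtain h where h: "h \<in> ring_hom (tensor_ob k R S) Q"
    "\<And>r s. r \<in> carrier R \<Longrightarrow> s \<in> carrier S \<Longrightarrow> h (pure_tensor k R S r s) = f r \<otimes>\<^bsub>Q\<^esub> g s"
    by (rule T.hom_lift[OF Q.is_cring F(1) G(1)]) (simp add: F(3) G(3), blast)
  have "h (sig (tensor_ob k R S) x) = sig Q (h x)" if x: "x \<in> carrier (tensor_ob k R S)" for x
    by (rule T.hom_eq[OF Q.is_cring ring_hom_trans[OF sigma_algD(1)[OF sigma_alg_tensor_ob] h(1), unfolded comp_def]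
          ring_hom_trans[OF h(1) sigma_algD(1)[OF Q], unfolded comp_def] _ x])
      (simp add: sig_pure h(2) c F(2) G(2) ring_hom_mult[OF sigma_algD(1)[OF Q]])
  moreover have "h (str (tensor_ob k R S) c) = str Q c" if "c \<in> carrier k" for c
    using that F(3)[OF that] ring_hom_one[OF G(1)] Q.r_one[OF c(1)[OF T.R.str_closed[OF that]]]
    by (simp add: T.b_str h(2))
  ultimately have "h \<in> sigma_alg_hom k (tensor_ob k R S) Q" using h(1) by (simp add: sigma_alg_hom_def)
  then show thesis using h(2) by (rule that)
qed

end

text \<open>Equality of arrows is tested on such sets. The test maps are additive rather than
  multiplicative because freezing one argument of a map on a tensor product leaves only additivity,
  and this is what lets the property pass to iterated tensor products.\<close>

definition gen :: "'u ualg \<Rightarrow> 'u set \<Rightarrow> bool" where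
  "gen R G \<longleftrightarrow> G \<subseteq> carrier R \<and> (\<forall>(Q :: 'u ualg) f g. abelian_group Q \<longrightarrow> additive R Q f \<longrightarrow> additive R Q g \<longrightarrow>
    (\<forall>x \<in> G. f x = g x) \<longrightarrow> (\<forall>x \<in> carrier R. f x = g x))"

lemma gen_carrier: "gen R (carrier R)"
  by (simp add: gen_def)

lemma gen_tensor:
  fixes k :: "('u :: infinite) sring"
  assumes k: "sigma_field k" and R: "sigma_alg k R" and S: "sigma_alg k S" and G: "gen R G" and H: "gen S H"
  shows "gen (tensor_ob k R S) (case_prod (pure_tensor k R S) ` (G \<times> H))"
proof -
  interpret T: tensor_product_field k R S "tensor_ob k R S" "pure_tensor k R S"
    by (rule tensor_ob_field[OF k R S])
  let ?T = "tensor_ob k R S" and ?p = "pure_tensor k R S"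
  have GH: "r \<in> G \<Longrightarrow> r \<in> carrier R" "s \<in> H \<Longrightarrow> s \<in> carrier S" for r s using G H by (auto simp: gen_def)
  show ?thesis unfolding gen_def
  proof (intro conjI allI impI ballI)
    show "case_prod ?p ` (G \<times> H) \<subseteq> carrier ?T" using GH by auto
    fix Q :: "'u ualg" and f g x
    assume Q: "abelian_group Q" and f: "additive ?T Q f" and g: "additive ?T Q g"
      and eq: "\<forall>x \<in> case_prod ?p ` (G \<times> H). f x = g x" and x: "x \<in> carrier ?T"
    have l: "additive R Q (\<lambda>r. h (?p r s))" if "additive ?T Q h" "s \<in> carrier S" for h s
      using that additiveD[OF that(1)] by (auto simp: additive_def T.b_add_left)
    have r: "additive S Q (\<lambda>s. h (?p r s))" if "additive ?T Q h" "r \<in> carrier R" for h r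
      using that additiveD[OF that(1)] by (auto simp: additive_def T.b_add_right)
    have 1: "f (?p r s) = g (?p r s)" if "r \<in> G" "s \<in> carrier S" for r s
      using H Q r[OF f GH(1)[OF that(1)]] r[OF g GH(1)[OF that(1)]] eq that unfolding gen_def by blast
    have 2: "f (?p r s) = g (?p r s)" if "r \<in> carrier R" "s \<in> carrier S" for r s
      using G Q l[OF f that(2)] l[OF g that(2)] 1[OF _ that(2)] that(1) unfolding gen_def by blast
    show "f x = g x" by (rule T.additive_eq[OF Q f g 2 x])
  qed
qed

section \<open>The monoidal category of difference algebras\<close>

text \<open>An arrow stores its source and target, so membership in some hom-set of algebras can be
  a predicate of the arrow alone. Domains then follow by simplification instead of being supplied at
  each use.\<close>

definition arr :: "'u sring \<Rightarrow> 'u arrow \<Rightarrow> bool" where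
  "arr k f \<longleftrightarrow> sigma_alg k (src f) \<and> sigma_alg k (tgt f) \<and> f \<in> alg_arr k (src f) (tgt f)"

lemma alg_arr_iff:
  "f \<in> alg_arr k R S \<longleftrightarrow> src f = R \<and> tgt f = S \<and> act f \<in> sigma_alg_hom k R S \<and> act f \<in> extensional (carrier R)"
  by (cases f) (auto simp: alg_arr_def)

lemma arr_iff: "sigma_alg k R \<Longrightarrow> sigma_alg k S \<Longrightarrow> f \<in> alg_arr k R S \<longleftrightarrow> arr k f \<and> src f = R \<and> tgt f = S"
  by (auto simp: arr_def alg_arr_iff)

lemma arr_hom: "arr k f \<Longrightarrow> src f = R \<Longrightarrow> tgt f = S \<Longrightarrow> act f \<in> sigma_alg_hom k R S"
  by (auto simp: arr_def alg_arr_iff)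

lemma act_closed: "arr k f \<Longrightarrow> tgt f = S \<Longrightarrow> x \<in> carrier (src f) \<Longrightarrow> act f x \<in> carrier S"
  using ring_hom_closed sigma_alg_homD(1) arr_hom by metis

lemma act_mult:
  "arr k f \<Longrightarrow> src f = R \<Longrightarrow> tgt f = S \<Longrightarrow> x \<in> carrier R \<Longrightarrow> y \<in> carrier R \<Longrightarrow>
    act f (x \<otimes>\<^bsub>R\<^esub> y) = act f x \<otimes>\<^bsub>S\<^esub> act f y"
  using ring_hom_mult sigma_alg_homD(1) arr_hom by metis

lemma act_str: "arr k f \<Longrightarrow> src f = R \<Longrightarrow> tgt f = S \<Longrightarrow> c \<in> carrier k \<Longrightarrow> act f (str R c) = str S c"
  using sigma_alg_homD(3) arr_hom by metis

text \<open>Extensionality of the underlying maps reduces equality to the carrier of the source, and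
  \<open>gen\<close> reduces it further to the generators. All coherence laws below are proved by
  this rule on iterated pure tensors.\<close>

lemma arrow_eqI:
  assumes "arr k f" "arr k h" "src h = src f" "tgt h = tgt f" "gen (src f) G"
    and "\<And>x. x \<in> G \<Longrightarrow> act f x = act h x"
  shows "f = h"
proof (rule arrow.expand, intro conjI)
  have H: "act f \<in> sigma_alg_hom k (src f) (tgt f)" "act h \<in> sigma_alg_hom k (src f) (tgt f)"
    using assms(1-4) arr_hom by metis+
  interpret Q: cring "tgt f" using assms(1) by (simp add: arr_def sigma_alg_def sigma_ring_def)
  have "\<forall>x \<in> carrier (src f). act f x = act h x"
    using assms(5,6) ring_hom_additive[OF sigma_alg_homD(1)[OF H(1)]] ring_hom_additive[OF sigma_alg_homD(1)[OF H(2)]]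
      Q.abelian_group_axioms unfolding gen_def by blast
  moreover have "act f \<in> extensional (carrier (src f))" "act h \<in> extensional (carrier (src f))"
    using assms(1-4) by (auto simp: arr_def alg_arr_iff)
  ultimately show "act f = act h" by (intro extensionalityI) auto
qed (use assms in auto)

lemma arrow_of_hom:
  assumes "sigma_alg k R" "sigma_alg k S" "h \<in> sigma_alg_hom k R S"
  shows "Arrow R (restrict h (carrier R)) S \<in> alg_arr k R S"
proof -
  interpret R: cring R using assms(1) by (simp add: sigma_alg_def sigma_ring_def)
  note D = ring_hom_closed[OF sigma_algD(1)[OF assms(1)]]
  have "str R c \<in> carrier R" if "c \<in> carrier k" for c using assms(1) that by (auto simp: sigma_alg_def ring_hom_def)
  then have "restrict h (carrier R) \<in> sigma_alg_hom k R S"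
    using assms(3) D by (auto simp: sigma_alg_hom_def ring_hom_def)
  then show ?thesis by (simp add: alg_arr_iff)
qed

definition ida :: "'u ualg \<Rightarrow> 'u arrow" where
  "ida R = Arrow R (\<lambda>x \<in> carrier R. x) R"

definition cmpa :: "'u arrow \<Rightarrow> 'u arrow \<Rightarrow> 'u arrow" where
  "cmpa h f = Arrow (src f) (compose (carrier (src f)) (act h) (act f)) (tgt h)"

lemma ida_simps [simp]: "src (ida R) = R" "tgt (ida R) = R" "x \<in> carrier R \<Longrightarrow> act (ida R) x = x"
  by (simp_all add: ida_def)

lemma cmpa_simps [simp]: "src (cmpa h f) = src f" "tgt (cmpa h f) = tgt h"
  "x \<in> carrier (src f) \<Longrightarrow> act (cmpa h f) x = act h (act f x)"
  by (simp_all add: cmpa_def compose_def)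

locale sigma_base =
  fixes k :: "('u :: infinite) sring"
  assumes k: "sigma_field k"
begin

abbreviation "alg \<equiv> sigma_alg k"
abbreviation "CC \<equiv> sigma_alg_cat k"
abbreviation "p \<equiv> pure_tensor k"
abbreviation tprod (infixr "\<boxtimes>" 70) where "R \<boxtimes> S \<equiv> tensor_ob k R S"
abbreviation "I \<equiv> base_alg k"
abbreviation "core \<equiv> strong_core k"

lemmas [simp] = sigma_alg_tensor_ob[OF k] sigma_alg_base[OF sigma_field_cring(3)[OF k]] sigma_alg_core[OF k]
lemmas gen_tensor' = gen_tensor[OF k _ _ gen_carrier gen_carrier]

lemma arr_alg [simp]: "arr k f \<Longrightarrow> alg (src f)" "arr k f \<Longrightarrow> alg (tgt f)"
  by (auto simp: arr_def)

lemma pure_closed [simp]: "alg R \<Longrightarrow> alg S \<Longrightarrow> r \<in> carrier R \<Longrightarrow> s \<in> carrier S \<Longrightarrow> p R S r s \<in> carrier (R \<boxtimes> S)"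
  using tensor_product.b_closed[OF tensor_product_field.axioms(1)[OF tensor_ob_field[OF k]]] .

lemma str_closed' [simp]: "alg R \<Longrightarrow> c \<in> carrier k \<Longrightarrow> str R c \<in> carrier R"
  by (auto simp: sigma_alg_def ring_hom_def)

lemma
  assumes "alg R"
  shows alg_mult_closed [simp]: "x \<in> carrier R \<Longrightarrow> y \<in> carrier R \<Longrightarrow> x \<otimes>\<^bsub>R\<^esub> y \<in> carrier R"
    and alg_one_closed [simp]: "\<one>\<^bsub>R\<^esub> \<in> carrier R"
    and alg_one_mult [simp]: "x \<in> carrier R \<Longrightarrow> \<one>\<^bsub>R\<^esub> \<otimes>\<^bsub>R\<^esub> x = x" "x \<in> carrier R \<Longrightarrow> x \<otimes>\<^bsub>R\<^esub> \<one>\<^bsub>R\<^esub> = x"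
proof -
  interpret cring R using assms by (simp add: sigma_alg_def sigma_ring_def)
  show "x \<in> carrier R \<Longrightarrow> y \<in> carrier R \<Longrightarrow> x \<otimes>\<^bsub>R\<^esub> y \<in> carrier R" "\<one>\<^bsub>R\<^esub> \<in> carrier R"
    "x \<in> carrier R \<Longrightarrow> \<one>\<^bsub>R\<^esub> \<otimes>\<^bsub>R\<^esub> x = x" "x \<in> carrier R \<Longrightarrow> x \<otimes>\<^bsub>R\<^esub> \<one>\<^bsub>R\<^esub> = x" by simp_all
qed

lemma pure_mult: "alg R \<Longrightarrow> alg S \<Longrightarrow> r \<in> carrier R \<Longrightarrow> r' \<in> carrier R \<Longrightarrow> s \<in> carrier S \<Longrightarrow> s' \<in> carrier S \<Longrightarrow>
    p R S r s \<otimes>\<^bsub>R \<boxtimes> S\<^esub> p R S r' s' = p R S (r \<otimes>\<^bsub>R\<^esub> r') (s \<otimes>\<^bsub>S\<^esub> s')"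
  using tensor_product.b_mult[OF tensor_product_field.axioms(1)[OF tensor_ob_field[OF k]]] .

lemma arr_ida [simp]: "alg R \<Longrightarrow> arr k (ida R)"
  using arrow_of_hom[OF _ _ sigma_alg_hom_id] by (simp add: arr_def ida_def)

lemma arr_cmpa [simp]:
  assumes "arr k f" "arr k h" "tgt f = src h"
  shows "arr k (cmpa h f)"
proof -
  note c = sigma_alg_hom_comp[OF arr_hom[OF assms(1) HOL.refl assms(3)] arr_hom[OF assms(2) HOL.refl HOL.refl]]
  show ?thesis
    unfolding arr_def arrow.sel cmpa_def compose_def
    using arrow_of_hom[OF arr_alg(1)[OF assms(1)] arr_alg(2)[OF assms(2)] c] arr_alg(1)[OF assms(1)] arr_alg(2)[OF assms(2)]
    by blast
qed

lemmas arrow_eq = arrow_eqI[where k = k]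

text \<open>Existence is the coproduct property, uniqueness holds because pure tensors generate.
  Unique existence is what the descriptions by \<open>THE\<close> in the structure arrows
  require.\<close>

lemma exists_arr:
  assumes "alg R" "alg S" "alg Q" "f \<in> sigma_alg_hom k R Q" "h \<in> sigma_alg_hom k S Q"
  shows "\<exists>!a. a \<in> alg_arr k (R \<boxtimes> S) Q \<and> (\<forall>r \<in> carrier R. \<forall>s \<in> carrier S. act a (p R S r s) = f r \<otimes>\<^bsub>Q\<^esub> h s)"
proof -
  obtain g where g: "g \<in> sigma_alg_hom k (R \<boxtimes> S) Q"
    "\<And>r s. r \<in> carrier R \<Longrightarrow> s \<in> carrier S \<Longrightarrow> g (p R S r s) = f r \<otimes>\<^bsub>Q\<^esub> h s"
    using sigma_alg_lift[OF k assms] by blast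
  show ?thesis
  proof (rule ex1I[of _ "Arrow (R \<boxtimes> S) (restrict g (carrier (R \<boxtimes> S))) Q"])
    show "Arrow (R \<boxtimes> S) (restrict g (carrier (R \<boxtimes> S))) Q \<in> alg_arr k (R \<boxtimes> S) Q \<and>
      (\<forall>r \<in> carrier R. \<forall>s \<in> carrier S. act (Arrow (R \<boxtimes> S) (restrict g (carrier (R \<boxtimes> S))) Q) (p R S r s) = f r \<otimes>\<^bsub>Q\<^esub> h s)"
      using arrow_of_hom[OF _ _ g(1)] g(2) assms by simp
    then have 1: "arr k (Arrow (R \<boxtimes> S) (restrict g (carrier (R \<boxtimes> S))) Q)" using assms by (simp add: arr_iff)
    fix a assume a: "a \<in> alg_arr k (R \<boxtimes> S) Q \<and> (\<forall>r \<in> carrier R. \<forall>s \<in> carrier S. act a (p R S r s) = f r \<otimes>\<^bsub>Q\<^esub> h s)"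
    then have a': "arr k a" "src a = R \<boxtimes> S" "tgt a = Q" using assms by (auto simp: arr_iff)
    show "a = Arrow (R \<boxtimes> S) (restrict g (carrier (R \<boxtimes> S))) Q"
      by (rule arrow_eqI[OF a'(1) 1, where G = "case_prod (p R S) ` (carrier R \<times> carrier S)"])
        (use a a' g(2) assms gen_tensor' in auto)
  qed
qed

lemma pure_hom_comp:
  "alg R \<Longrightarrow> alg S \<Longrightarrow> f \<in> sigma_alg_hom k Q R \<Longrightarrow> (\<lambda>r. p R S (f r) \<one>\<^bsub>S\<^esub>) \<in> sigma_alg_hom k Q (R \<boxtimes> S)"
  "alg R \<Longrightarrow> alg S \<Longrightarrow> f \<in> sigma_alg_hom k Q S \<Longrightarrow> (\<lambda>s. p R S \<one>\<^bsub>R\<^esub> (f s)) \<in> sigma_alg_hom k Q (R \<boxtimes> S)"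
  using sigma_alg_hom_comp[OF _ pure_hom(1)[OF k]] sigma_alg_hom_comp[OF _ pure_hom(2)[OF k]] by blast+

lemma tensor_arr_aux:
  assumes "arr k f" "arr k h"
  shows "tensor_arr k f h \<in> alg_arr k (src f \<boxtimes> src h) (tgt f \<boxtimes> tgt h) \<and>
    (\<forall>r \<in> carrier (src f). \<forall>s \<in> carrier (src h).
      act (tensor_arr k f h) (p (src f) (src h) r s) = p (tgt f) (tgt h) (act f r) (act h s))"
proof -
  have alg: "alg (src f)" "alg (tgt f)" "alg (src h)" "alg (tgt h)" using assms by simp_all
  have m: "p (tgt f) (tgt h) (act f r) \<one>\<^bsub>tgt h\<^esub> \<otimes>\<^bsub>tgt f \<boxtimes> tgt h\<^esub> p (tgt f) (tgt h) \<one>\<^bsub>tgt f\<^esub> (act h s) =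
      p (tgt f) (tgt h) (act f r) (act h s)" if "r \<in> carrier (src f)" "s \<in> carrier (src h)" for r s
    using that alg act_closed[OF assms(1) HOL.refl] act_closed[OF assms(2) HOL.refl] by (simp add: pure_mult)
  have "\<exists>!a. a \<in> alg_arr k (src f \<boxtimes> src h) (tgt f \<boxtimes> tgt h) \<and>
    (\<forall>r \<in> carrier (src f). \<forall>s \<in> carrier (src h). act a (p (src f) (src h) r s) = p (tgt f) (tgt h) (act f r) (act h s))"
    using exists_arr[OF alg(1,3) _ pure_hom_comp(1)[OF alg(2,4) arr_hom[OF assms(1) HOL.refl HOL.refl]]
        pure_hom_comp(2)[OF alg(2,4) arr_hom[OF assms(2) HOL.refl HOL.refl]]] alg by (simp add: m cong: conj_cong)
  from theI'[OF this] show ?thesis unfolding tensor_arr_def .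
qed

lemma tensor_arr [simp]:
  assumes "arr k f" "arr k h"
  shows "arr k (tensor_arr k f h)" "src (tensor_arr k f h) = src f \<boxtimes> src h" "tgt (tensor_arr k f h) = tgt f \<boxtimes> tgt h"
    and "src f = R \<Longrightarrow> src h = S \<Longrightarrow> r \<in> carrier R \<Longrightarrow> s \<in> carrier S \<Longrightarrow>
      act (tensor_arr k f h) (p R S r s) = p (tgt f) (tgt h) (act f r) (act h s)"
  using tensor_arr_aux[OF assms] assms by (auto simp: arr_iff)

lemma lunit_arr_aux:
  assumes R: "alg R"
  shows "lunit_arr k R \<in> alg_arr k (I \<boxtimes> R) R \<and>
    (\<forall>c \<in> carrier k. \<forall>r \<in> carrier R. act (lunit_arr k R) (p I R c r) = str R c \<otimes>\<^bsub>R\<^esub> r)"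
  using theI'[OF exists_arr[OF _ R R sigma_alg_hom_str[OF R] sigma_alg_hom_id]] unfolding lunit_arr_def by simp

lemma lunit_arr [simp]:
  assumes "alg R"
  shows "arr k (lunit_arr k R)" "src (lunit_arr k R) = I \<boxtimes> R" "tgt (lunit_arr k R) = R"
    and "c \<in> carrier k \<Longrightarrow> r \<in> carrier R \<Longrightarrow> act (lunit_arr k R) (p I R c r) = str R c \<otimes>\<^bsub>R\<^esub> r"
  using lunit_arr_aux[OF assms] assms by (auto simp: arr_iff)

lemma runit_arr_aux:
  assumes R: "alg R"
  shows "runit_arr k R \<in> alg_arr k (R \<boxtimes> I) R \<and>
    (\<forall>r \<in> carrier R. \<forall>c \<in> carrier k. act (runit_arr k R) (p R I r c) = r \<otimes>\<^bsub>R\<^esub> str R c)"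
  using theI'[OF exists_arr[OF R _ R sigma_alg_hom_id sigma_alg_hom_str[OF R]]] unfolding runit_arr_def by simp

lemma runit_arr [simp]:
  assumes "alg R"
  shows "arr k (runit_arr k R)" "src (runit_arr k R) = R \<boxtimes> I" "tgt (runit_arr k R) = R"
    and "r \<in> carrier R \<Longrightarrow> c \<in> carrier k \<Longrightarrow> act (runit_arr k R) (p R I r c) = r \<otimes>\<^bsub>R\<^esub> str R c"
  using runit_arr_aux[OF assms] assms by (auto simp: arr_iff)

text \<open>The coproduct property is applied twice, to the three inclusions of \<open>R\<close>,
  \<open>S\<close> and \<open>T\<close> into the target. Uniqueness is tested on pure tensors of
  pure tensors.\<close>

lemma exists_assoc:
  assumes "alg R" "alg S" "alg T"
  shows "\<exists>!h. h \<in> alg_arr k ((R \<boxtimes> S) \<boxtimes> T) (R \<boxtimes> (S \<boxtimes> T)) \<and>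
    (\<forall>r \<in> carrier R. \<forall>s \<in> carrier S. \<forall>t \<in> carrier T.
      act h (p (R \<boxtimes> S) T (p R S r s) t) = p R (S \<boxtimes> T) r (p S T s t))"
proof -
  let ?Q = "R \<boxtimes> (S \<boxtimes> T)"
  have Q: "alg (S \<boxtimes> T)" "alg ?Q" "alg (R \<boxtimes> S)" using assms by simp_all
  have r: "(\<lambda>r. p R (S \<boxtimes> T) r \<one>\<^bsub>S \<boxtimes> T\<^esub>) \<in> sigma_alg_hom k R ?Q"
    by (rule pure_hom_comp(1)[OF assms(1) Q(1) sigma_alg_hom_id])
  have s: "(\<lambda>s. p R (S \<boxtimes> T) \<one>\<^bsub>R\<^esub> (p S T s \<one>\<^bsub>T\<^esub>)) \<in> sigma_alg_hom k S ?Q"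
    by (rule pure_hom_comp(2)[OF assms(1) Q(1) pure_hom_comp(1)[OF assms(2,3) sigma_alg_hom_id]])
  have t: "(\<lambda>t. p R (S \<boxtimes> T) \<one>\<^bsub>R\<^esub> (p S T \<one>\<^bsub>S\<^esub> t)) \<in> sigma_alg_hom k T ?Q"
    by (rule pure_hom_comp(2)[OF assms(1) Q(1) pure_hom_comp(2)[OF assms(2,3) sigma_alg_hom_id]])
  obtain f where f: "f \<in> sigma_alg_hom k (R \<boxtimes> S) ?Q" "\<And>x y. x \<in> carrier R \<Longrightarrow> y \<in> carrier S \<Longrightarrow>
      f (p R S x y) = p R (S \<boxtimes> T) x \<one>\<^bsub>S \<boxtimes> T\<^esub> \<otimes>\<^bsub>?Q\<^esub> p R (S \<boxtimes> T) \<one>\<^bsub>R\<^esub> (p S T y \<one>\<^bsub>T\<^esub>)"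
    using sigma_alg_lift[OF k assms(1,2) Q(2) r s] by blast
  obtain h where h: "h \<in> alg_arr k ((R \<boxtimes> S) \<boxtimes> T) ?Q" "\<And>x y. x \<in> carrier (R \<boxtimes> S) \<Longrightarrow> y \<in> carrier T \<Longrightarrow>
      act h (p (R \<boxtimes> S) T x y) = f x \<otimes>\<^bsub>?Q\<^esub> p R (S \<boxtimes> T) \<one>\<^bsub>R\<^esub> (p S T \<one>\<^bsub>S\<^esub> y)"
    using ex1_implies_ex[OF exists_arr[OF Q(3) assms(3) Q(2) f(1) t]] by blast
  show ?thesis
  proof (rule ex1I[of _ h])
    show 1: "h \<in> alg_arr k ((R \<boxtimes> S) \<boxtimes> T) ?Q \<and> (\<forall>r \<in> carrier R. \<forall>s \<in> carrier S. \<forall>t \<in> carrier T.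
      act h (p (R \<boxtimes> S) T (p R S r s) t) = p R (S \<boxtimes> T) r (p S T s t))"
      using h f(2) assms by (simp add: pure_mult)
    fix a assume a: "a \<in> alg_arr k ((R \<boxtimes> S) \<boxtimes> T) ?Q \<and> (\<forall>r \<in> carrier R. \<forall>s \<in> carrier S. \<forall>t \<in> carrier T.
      act a (p (R \<boxtimes> S) T (p R S r s) t) = p R (S \<boxtimes> T) r (p S T s t))"
    have ah: "arr k a" "src a = (R \<boxtimes> S) \<boxtimes> T" "tgt a = ?Q" "arr k h" "src h = (R \<boxtimes> S) \<boxtimes> T" "tgt h = ?Q"
      using a h(1) assms by (auto simp: arr_iff)
    have g: "gen (src a) (case_prod (p (R \<boxtimes> S) T) ` (case_prod (p R S) ` (carrier R \<times> carrier S) \<times> carrier T))"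
      unfolding ah(2) using assms by (intro gen_tensor[OF k] gen_carrier) auto
    show "a = h" by (rule arrow_eqI[OF ah(1,4) _ _ g]) (use ah a 1 in auto)
  qed
qed

lemma assoc_arr [simp]:
  assumes "alg R" "alg S" "alg T"
  shows "arr k (assoc_arr k R S T)" "src (assoc_arr k R S T) = (R \<boxtimes> S) \<boxtimes> T" "tgt (assoc_arr k R S T) = R \<boxtimes> (S \<boxtimes> T)"
    and "r \<in> carrier R \<Longrightarrow> s \<in> carrier S \<Longrightarrow> t \<in> carrier T \<Longrightarrow>
      act (assoc_arr k R S T) (p (R \<boxtimes> S) T (p R S r s) t) = p R (S \<boxtimes> T) r (p S T s t)"
  using theI'[OF exists_assoc[OF assms]] assms unfolding assoc_arr_def[symmetric] by (simp_all add: arr_iff)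

lemma exists_assoc_inv:
  assumes "alg R" "alg S" "alg T"
  obtains h where "arr k h" "src h = R \<boxtimes> (S \<boxtimes> T)" "tgt h = (R \<boxtimes> S) \<boxtimes> T"
    "\<And>r s t. r \<in> carrier R \<Longrightarrow> s \<in> carrier S \<Longrightarrow> t \<in> carrier T \<Longrightarrow>
      act h (p R (S \<boxtimes> T) r (p S T s t)) = p (R \<boxtimes> S) T (p R S r s) t"
proof -
  let ?Q = "(R \<boxtimes> S) \<boxtimes> T"
  have Q: "alg (R \<boxtimes> S)" "alg ?Q" "alg (S \<boxtimes> T)" using assms by simp_all
  have r: "(\<lambda>r. p (R \<boxtimes> S) T (p R S r \<one>\<^bsub>S\<^esub>) \<one>\<^bsub>T\<^esub>) \<in> sigma_alg_hom k R ?Q"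
    by (rule pure_hom_comp(1)[OF Q(1) assms(3) pure_hom_comp(1)[OF assms(1,2) sigma_alg_hom_id]])
  have s: "(\<lambda>s. p (R \<boxtimes> S) T (p R S \<one>\<^bsub>R\<^esub> s) \<one>\<^bsub>T\<^esub>) \<in> sigma_alg_hom k S ?Q"
    by (rule pure_hom_comp(1)[OF Q(1) assms(3) pure_hom_comp(2)[OF assms(1,2) sigma_alg_hom_id]])
  have t: "(\<lambda>t. p (R \<boxtimes> S) T \<one>\<^bsub>R \<boxtimes> S\<^esub> t) \<in> sigma_alg_hom k T ?Q"
    by (rule pure_hom_comp(2)[OF Q(1) assms(3) sigma_alg_hom_id])
  obtain f where f: "f \<in> sigma_alg_hom k (S \<boxtimes> T) ?Q" "\<And>x y. x \<in> carrier S \<Longrightarrow> y \<in> carrier T \<Longrightarrow>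
      f (p S T x y) = p (R \<boxtimes> S) T (p R S \<one>\<^bsub>R\<^esub> x) \<one>\<^bsub>T\<^esub> \<otimes>\<^bsub>?Q\<^esub> p (R \<boxtimes> S) T \<one>\<^bsub>R \<boxtimes> S\<^esub> y"
    using sigma_alg_lift[OF k assms(2,3) Q(2) s t] by blast
  obtain h where h: "h \<in> alg_arr k (R \<boxtimes> (S \<boxtimes> T)) ?Q" "\<And>x y. x \<in> carrier R \<Longrightarrow> y \<in> carrier (S \<boxtimes> T) \<Longrightarrow>
      act h (p R (S \<boxtimes> T) x y) = p (R \<boxtimes> S) T (p R S x \<one>\<^bsub>S\<^esub>) \<one>\<^bsub>T\<^esub> \<otimes>\<^bsub>?Q\<^esub> f y"
    using ex1_implies_ex[OF exists_arr[OF assms(1) Q(3) Q(2) r f(1)]] by blast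
  show thesis by (rule that[of h]) (use h f(2) assms in \<open>simp_all add: arr_iff pure_mult\<close>)
qed

lemma pure_balanced:
  assumes "alg R" "alg S" "c \<in> carrier k" "r \<in> carrier R" "s \<in> carrier S"
  shows "p R S (str R c \<otimes>\<^bsub>R\<^esub> r) s = p R S r (str S c \<otimes>\<^bsub>S\<^esub> s)"
  using tensor_product.b_smul[OF tensor_product_field.axioms(1)[OF tensor_ob_field[OF k assms(1,2)]] assms(3-5)]
  by (simp add: smul_def)

lemma str_commute: "alg R \<Longrightarrow> c \<in> carrier k \<Longrightarrow> r \<in> carrier R \<Longrightarrow> r \<otimes>\<^bsub>R\<^esub> str R c = str R c \<otimes>\<^bsub>R\<^esub> r"
  using cring.cring_simprules(14)[of R r "str R c"] str_closed' by (simp add: sigma_alg_def sigma_ring_def)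

lemma base_mult_one [simp]: "c \<in> carrier k \<Longrightarrow> c \<otimes>\<^bsub>k\<^esub> \<one>\<^bsub>k\<^esub> = c" "\<one>\<^bsub>k\<^esub> \<in> carrier k"
  "alg R \<Longrightarrow> str R \<one>\<^bsub>k\<^esub> = \<one>\<^bsub>R\<^esub>"
proof -
  interpret cring k using sigma_field_cring(1)[OF k] .
  show "c \<in> carrier k \<Longrightarrow> c \<otimes>\<^bsub>k\<^esub> \<one>\<^bsub>k\<^esub> = c" "\<one>\<^bsub>k\<^esub> \<in> carrier k" by simp_all
  show "alg R \<Longrightarrow> str R \<one>\<^bsub>k\<^esub> = \<one>\<^bsub>R\<^esub>" by (auto simp: sigma_alg_def ring_hom_def)
qed

abbreviation gens where "gens R S G H \<equiv> case_prod (p R S) ` (G \<times> H)"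

lemma cat_simps [simp]:
  "Ob CC = {R. alg R}" "Arr CC = alg_arr k" "idt CC R = ida R" "cmp CC h f = cmpa h f"
  "tob CC = tensor_ob k" "tar CC = tensor_arr k" "unt CC = I" "assoc CC = assoc_arr k"
  "lunit CC = lunit_arr k" "runit CC = runit_arr k"
  by (simp_all add: sigma_alg_cat_def ida_def cmpa_def)

lemma iso_arrI:
  assumes "arr k f" "arr k h" "src h = tgt f" "tgt h = src f" "gen (src f) G" "gen (tgt f) H"
    and "\<And>x. x \<in> G \<Longrightarrow> act h (act f x) = x" "\<And>y. y \<in> H \<Longrightarrow> act f (act h y) = y"
  shows "iso_arr CC (src f) (tgt f) f"
proof -
  have sub: "G \<subseteq> carrier (src f)" "H \<subseteq> carrier (tgt f)" using assms(5,6) by (auto simp: gen_def)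
  have "cmpa h f = ida (src f)"
    by (rule arrow_eq[where G = G]) (use assms sub in \<open>auto simp: subset_iff\<close>)
  moreover have "cmpa f h = ida (tgt f)"
    by (rule arrow_eq[where G = H]) (use assms sub in \<open>auto simp: subset_iff\<close>)
  moreover have "f \<in> alg_arr k (src f) (tgt f)" using assms(1) unfolding arr_def by blast
  moreover have "h \<in> alg_arr k (tgt f) (src f)" using assms(2) unfolding arr_def assms(3,4) by blast
  ultimately show ?thesis unfolding iso_arr_def cat_simps by blast
qed

lemma category: "category CC"
proof
  fix A B D E :: "'u ualg" and f g h
  show "idt CC A \<in> Arr CC A A" if "A \<in> Ob CC" using that by (simp add: arr_iff)
  show "cmp CC g f \<in> Arr CC A D" if "A \<in> Ob CC" "B \<in> Ob CC" "D \<in> Ob CC" "f \<in> Arr CC A B" "g \<in> Arr CC B D"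
    using that by (auto simp: arr_iff)
  show "cmp CC (idt CC B) f = f" "cmp CC f (idt CC A) = f" if "A \<in> Ob CC" "B \<in> Ob CC" "f \<in> Arr CC A B"
  proof -
    have f: "arr k f" "src f = A" "tgt f = B" using that by (auto simp: arr_iff)
    have "cmpa (ida B) f = f"
      by (rule arrow_eq[where G = "carrier A"]) (use f that in \<open>auto simp: gen_carrier act_closed\<close>)
    moreover have "cmpa f (ida A) = f"
      by (rule arrow_eq[where G = "carrier A"]) (use f that in \<open>auto simp: gen_carrier act_closed\<close>)
    ultimately show "cmp CC (idt CC B) f = f" "cmp CC f (idt CC A) = f" by simp_all
  qed
  show "cmp CC (cmp CC h g) f = cmp CC h (cmp CC g f)"
    if "A \<in> Ob CC" "B \<in> Ob CC" "D \<in> Ob CC" "E \<in> Ob CC" "f \<in> Arr CC A B" "g \<in> Arr CC B D" "h \<in> Arr CC D E"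
  proof -
    have f: "arr k f" "src f = A" "tgt f = B" "arr k g" "src g = B" "tgt g = D" "arr k h" "src h = D" "tgt h = E"
      using that by (auto simp: arr_iff)
    have "cmpa (cmpa h g) f = cmpa h (cmpa g f)"
      by (rule arrow_eq[where G = "carrier A"]) (use f in \<open>auto simp: gen_carrier act_closed\<close>)
    then show ?thesis by simp
  qed
qed

text \<open>The inverse is \<open>a \<mapsto> 1 \<otimes> a\<close>. One composite is the identity
  because \<open>1 \<otimes> c a = c \<otimes> a\<close> by balancing.\<close>

lemma lunit_iso: assumes A: "alg A" shows "iso_arr CC (I \<boxtimes> A) A (lunit_arr k A)"
proof -
  let ?h = "Arrow A (restrict (p I A \<one>\<^bsub>I\<^esub>) (carrier A)) (I \<boxtimes> A)"
  have h: "arr k ?h" using arrow_of_hom[OF A _ pure_hom(2)[where R = I, OF k _ A]] A by (simp add: arr_def)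
  have b: "p I A \<one>\<^bsub>k\<^esub> (str A c \<otimes>\<^bsub>A\<^esub> a) = p I A c a" if "c \<in> carrier k" "a \<in> carrier A" for c a
    using pure_balanced[OF _ A that(1), of I "\<one>\<^bsub>k\<^esub>" a] that by simp
  have "iso_arr CC (src (lunit_arr k A)) (tgt (lunit_arr k A)) (lunit_arr k A)"
    by (rule iso_arrI[OF _ h, where G = "gens I A (carrier k) (carrier A)" and H = "carrier A"])
      (use A b gen_tensor'[of I A] in \<open>auto simp: gen_carrier\<close>)
  then show ?thesis using A by simp
qed

lemma runit_iso: assumes A: "alg A" shows "iso_arr CC (A \<boxtimes> I) A (runit_arr k A)"
proof -
  let ?h = "Arrow A (restrict (\<lambda>a. p A I a \<one>\<^bsub>I\<^esub>) (carrier A)) (A \<boxtimes> I)"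
  have h: "arr k ?h" using arrow_of_hom[OF A _ pure_hom(1)[where S = I, OF k A]] A by (simp add: arr_def)
  have b: "p A I (a \<otimes>\<^bsub>A\<^esub> str A c) \<one>\<^bsub>k\<^esub> = p A I a c" if "c \<in> carrier k" "a \<in> carrier A" for c a
    using pure_balanced[OF A _ that(1), of I a "\<one>\<^bsub>k\<^esub>"] that A by (simp add: str_commute)
  have "iso_arr CC (src (runit_arr k A)) (tgt (runit_arr k A)) (runit_arr k A)"
    by (rule iso_arrI[OF _ h, where G = "gens A I (carrier A) (carrier k)" and H = "carrier A"])
      (use A b gen_tensor'[of A I] in \<open>auto simp: gen_carrier\<close>)
  then show ?thesis using A by simp
qed

lemma gen_left: "alg A \<Longrightarrow> alg B \<Longrightarrow> alg D \<Longrightarrow>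
    gen ((A \<boxtimes> B) \<boxtimes> D) (gens (A \<boxtimes> B) D (gens A B (carrier A) (carrier B)) (carrier D))"
  by (intro gen_tensor[OF k] gen_carrier) simp_all

lemma gen_right: "alg A \<Longrightarrow> alg B \<Longrightarrow> alg D \<Longrightarrow>
    gen (A \<boxtimes> (B \<boxtimes> D)) (gens A (B \<boxtimes> D) (carrier A) (gens B D (carrier B) (carrier D)))"
  by (intro gen_tensor[OF k] gen_carrier) simp_all

lemma gen_left4: "alg A \<Longrightarrow> alg B \<Longrightarrow> alg D \<Longrightarrow> alg E \<Longrightarrow>
    gen (((A \<boxtimes> B) \<boxtimes> D) \<boxtimes> E)
      (gens ((A \<boxtimes> B) \<boxtimes> D) E (gens (A \<boxtimes> B) D (gens A B (carrier A) (carrier B)) (carrier D)) (carrier E))"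
  by (intro gen_tensor[OF k] gen_carrier) simp_all

lemma assoc_iso:
  assumes "alg A" "alg B" "alg D"
  shows "iso_arr CC ((A \<boxtimes> B) \<boxtimes> D) (A \<boxtimes> (B \<boxtimes> D)) (assoc_arr k A B D)"
proof -
  obtain h where h: "arr k h" "src h = A \<boxtimes> (B \<boxtimes> D)" "tgt h = (A \<boxtimes> B) \<boxtimes> D"
    "\<And>r s t. r \<in> carrier A \<Longrightarrow> s \<in> carrier B \<Longrightarrow> t \<in> carrier D \<Longrightarrow>
      act h (p A (B \<boxtimes> D) r (p B D s t)) = p (A \<boxtimes> B) D (p A B r s) t"
    using exists_assoc_inv[OF assms] by blast
  have "iso_arr CC (src (assoc_arr k A B D)) (tgt (assoc_arr k A B D)) (assoc_arr k A B D)"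
    by (rule iso_arrI[OF _ h(1), where G = "gens (A \<boxtimes> B) D (gens A B (carrier A) (carrier B)) (carrier D)"
          and H = "gens A (B \<boxtimes> D) (carrier A) (gens B D (carrier B) (carrier D))"])
      (use assms h gen_left gen_right in auto)
  then show ?thesis using assms by simp
qed

text \<open>The equational laws compare arrows with equal source and target, so they are evaluated
  on iterated pure tensors. The triangle is where balancing of scalars enters; naturality of the
  unit arrows uses that arrows respect products and structure maps.\<close>

lemma monoidal_category: "monoidal_category CC"
proof -
  interpret category CC by (rule category)
  show ?thesis
  proof
    show "unt CC \<in> Ob CC" by simp
    fix A B D E A' B' D' A'' B'' :: "'u ualg" and f f' g g' h :: "'u arrow"
    {
      assume "A \<in> Ob CC" "B \<in> Ob CC"
      then have AB: "alg A" "alg B" by simp_all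
      then show "tob CC A B \<in> Ob CC" by simp
      have "tensor_arr k (ida A) (ida B) = ida (A \<boxtimes> B)"
        by (rule arrow_eq[where G = "gens A B (carrier A) (carrier B)"]) (use AB gen_tensor' in auto)
      then show "tar CC (idt CC A) (idt CC B) = idt CC (tob CC A B)" by simp
      have "cmpa (tensor_arr k (ida A) (lunit_arr k B)) (assoc_arr k A I B) = tensor_arr k (runit_arr k A) (ida B)"
        by (rule arrow_eq[where G = "gens (A \<boxtimes> I) B (gens A I (carrier A) (carrier I)) (carrier B)"])
          (use AB gen_left[of A I B] in \<open>auto simp: str_commute pure_balanced\<close>)
      then show "cmp CC (tar CC (idt CC A) (lunit CC B)) (assoc CC A (unt CC) B) = tar CC (runit CC A) (idt CC B)" by simp
    }
    {
      assume "A \<in> Ob CC" "A' \<in> Ob CC" "B \<in> Ob CC" "B' \<in> Ob CC" "f \<in> Arr CC A A'" "g \<in> Arr CC B B'"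
      then show "tar CC f g \<in> Arr CC (tob CC A B) (tob CC A' B')" by (simp add: arr_iff)
    }
    {
      assume "A \<in> Ob CC" "A' \<in> Ob CC" "A'' \<in> Ob CC" "B \<in> Ob CC" "B' \<in> Ob CC" "B'' \<in> Ob CC"
        "f \<in> Arr CC A A'" "f' \<in> Arr CC A' A''" "g \<in> Arr CC B B'" "g' \<in> Arr CC B' B''"
      then have h: "arr k f" "src f = A" "tgt f = A'" "arr k f'" "src f' = A'" "tgt f' = A''"
        "arr k g" "src g = B" "tgt g = B'" "arr k g'" "src g' = B'" "tgt g' = B''" "alg A" "alg B"
        by (auto simp: arr_iff)
      have "tensor_arr k (cmpa f' f) (cmpa g' g) = cmpa (tensor_arr k f' g') (tensor_arr k f g)"
        by (rule arrow_eq[where G = "gens A B (carrier A) (carrier B)"])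
          (use h gen_tensor' in \<open>auto simp: act_closed\<close>)
      then show "tar CC (cmp CC f' f) (cmp CC g' g) = cmp CC (tar CC f' g') (tar CC f g)" by simp
    }
    {
      assume "A \<in> Ob CC" "B \<in> Ob CC" "D \<in> Ob CC"
      then show "iso_arr CC (tob CC (tob CC A B) D) (tob CC A (tob CC B D)) (assoc CC A B D)"
        using assoc_iso by simp
    }
    {
      assume "A \<in> Ob CC" "A' \<in> Ob CC" "B \<in> Ob CC" "B' \<in> Ob CC" "D \<in> Ob CC" "D' \<in> Ob CC"
        "f \<in> Arr CC A A'" "g \<in> Arr CC B B'" "h \<in> Arr CC D D'"
      then have h: "arr k f" "src f = A" "tgt f = A'" "arr k g" "src g = B" "tgt g = B'"
        "arr k h" "src h = D" "tgt h = D'" "alg A" "alg B" "alg D" "alg A'" "alg B'" "alg D'"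
        by (auto simp: arr_iff)
      have "cmpa (assoc_arr k A' B' D') (tensor_arr k (tensor_arr k f g) h) =
          cmpa (tensor_arr k f (tensor_arr k g h)) (assoc_arr k A B D)"
        by (rule arrow_eq[where G = "gens (A \<boxtimes> B) D (gens A B (carrier A) (carrier B)) (carrier D)"])
          (use h gen_left in \<open>auto simp: act_closed\<close>)
      then show "cmp CC (assoc CC A' B' D') (tar CC (tar CC f g) h) = cmp CC (tar CC f (tar CC g h)) (assoc CC A B D)"
        by simp
    }
    {
      assume "A \<in> Ob CC"
      then show "iso_arr CC (tob CC (unt CC) A) A (lunit CC A)" "iso_arr CC (tob CC A (unt CC)) A (runit CC A)"
        using lunit_iso runit_iso by simp_all
    }
    {
      assume "A \<in> Ob CC" "A' \<in> Ob CC" "f \<in> Arr CC A A'"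
      then have h: "arr k f" "src f = A" "tgt f = A'" "alg A" "alg A'" by (auto simp: arr_iff)
      note m = act_mult[OF h(1) HOL.refl HOL.refl] act_str[OF h(1) HOL.refl HOL.refl]
      have "cmpa (lunit_arr k A') (tensor_arr k (ida I) f) = cmpa f (lunit_arr k A)"
        by (rule arrow_eq[where G = "gens I A (carrier I) (carrier A)"])
          (use h gen_tensor'[of I A] in \<open>auto simp: act_closed m\<close>)
      then show "cmp CC (lunit CC A') (tar CC (idt CC (unt CC)) f) = cmp CC f (lunit CC A)" by simp
      have "cmpa (runit_arr k A') (tensor_arr k f (ida I)) = cmpa f (runit_arr k A)"
        by (rule arrow_eq[where G = "gens A I (carrier A) (carrier I)"])
          (use h gen_tensor'[of A I] in \<open>auto simp: act_closed m\<close>)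
      then show "cmp CC (runit CC A') (tar CC f (idt CC (unt CC))) = cmp CC f (runit CC A)" by simp
    }
    {
      assume "A \<in> Ob CC" "B \<in> Ob CC" "D \<in> Ob CC" "E \<in> Ob CC"
      then have h: "alg A" "alg B" "alg D" "alg E" by simp_all
      have "cmpa (assoc_arr k A B (D \<boxtimes> E)) (assoc_arr k (A \<boxtimes> B) D E) =
          cmpa (tensor_arr k (ida A) (assoc_arr k B D E))
            (cmpa (assoc_arr k A (B \<boxtimes> D) E) (tensor_arr k (assoc_arr k A B D) (ida E)))"
        by (rule arrow_eq[where G = "gens ((A \<boxtimes> B) \<boxtimes> D) E
            (gens (A \<boxtimes> B) D (gens A B (carrier A) (carrier B)) (carrier D)) (carrier E)"])
          (use h gen_left4 in auto)
      then show "cmp CC (assoc CC A B (tob CC D E)) (assoc CC (tob CC A B) D E) =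
          cmp CC (tar CC (idt CC A) (assoc CC B D E))
            (cmp CC (assoc CC A (tob CC B D) E) (tar CC (assoc CC A B D) (idt CC E)))" by simp
    }
  qed
qed

end

section \<open>The strong core as a monoidal functor\<close>

lemma core_sel [simp]:
  "monoid.mult (strong_core k R) = monoid.mult R" "monoid.one (strong_core k R) = monoid.one R"
  "ring.zero (strong_core k R) = ring.zero R" "ring.add (strong_core k R) = ring.add R"
  "sig (strong_core k R) = sig R" "str (strong_core k R) = str R"
  by (simp_all add: strong_core_def)

context sigma_base
begin

lemma core_subset: "alg R \<Longrightarrow> x \<in> carrier (core R) \<Longrightarrow> x \<in> carrier R"
  using ksubalgD(1)[OF sigma_subalgD(1)[OF sigma_subalg_core[OF k]]] .

lemma core_incl: "alg R \<Longrightarrow> (\<lambda>x. x) \<in> sigma_alg_hom k (core R) R"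
  using core_subset by (auto simp: sigma_alg_hom_def ring_hom_def)

lemma sigma_alg_hom_core:
  assumes "alg R" "alg S" "f \<in> sigma_alg_hom k R S"
  shows "f \<in> sigma_alg_hom k (core R) (core S)"
  using assms(3) core_subset[OF assms(1)] core_hom[OF k assms] by (auto simp: sigma_alg_hom_def ring_hom_def)

lemma core_arr [simp]:
  assumes f: "arr k f"
  shows "arr k (core_arr k f)"
proof -
  note a = arr_alg[OF f]
  note c = sigma_alg_core[OF k a(1)] sigma_alg_core[OF k a(2)]
  show ?thesis
    unfolding arr_def core_arr_def arrow.sel
    using arrow_of_hom[OF c sigma_alg_hom_core[OF a arr_hom[OF f HOL.refl HOL.refl]]] c by blast
qed

lemma core_arr_simps [simp]:
  "src (core_arr k f) = core (src f)" "tgt (core_arr k f) = core (tgt f)"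
  "x \<in> carrier (core (src f)) \<Longrightarrow> act (core_arr k f) x = act f x"
  by (simp_all add: core_arr_def)

lemma cat_functor: "cat_functor CC CC core (core_arr k)"
proof -
  interpret category CC by (rule category)
  show ?thesis
  proof
    fix A B E :: "'u ualg" and f g
    show "core A \<in> Ob CC" if "A \<in> Ob CC" using that by simp
    show "core_arr k f \<in> Arr CC (core A) (core B)" if "A \<in> Ob CC" "B \<in> Ob CC" "f \<in> Arr CC A B"
      using that by (auto simp: arr_iff)
    show "core_arr k (idt CC A) = idt CC (core A)" if "A \<in> Ob CC"
    proof -
      have "core_arr k (ida A) = ida (core A)"
        by (rule arrow_eq[where G = "carrier (core A)"]) (use that core_subset[of A] in \<open>auto simp: gen_carrier\<close>)
      then show ?thesis by simp
    qed
    show "core_arr k (cmp CC g f) = cmp CC (core_arr k g) (core_arr k f)"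
      if "A \<in> Ob CC" "B \<in> Ob CC" "E \<in> Ob CC" "f \<in> Arr CC A B" "g \<in> Arr CC B E"
    proof -
      have h: "arr k f" "src f = A" "tgt f = B" "arr k g" "src g = B" "tgt g = E" "alg A" "alg B"
        using that by (auto simp: arr_iff)
      have c: "act f x \<in> carrier (core B)" if "x \<in> carrier (core A)" for x
        using core_hom[OF k h(7,8) arr_hom[OF h(1-3)] that] .
      have "core_arr k (cmpa g f) = cmpa (core_arr k g) (core_arr k f)"
        by (rule arrow_eq[where G = "carrier (core A)"]) (use h c core_subset[of A] in \<open>auto simp: gen_carrier\<close>)
      then show ?thesis by simp
    qed
  qed
qed

lemma core_mu_aux:
  assumes A: "alg A" and B: "alg B"
  shows "core_mu k A B \<in> alg_arr k (core A \<boxtimes> core B) (core (A \<boxtimes> B)) \<and>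
    (\<forall>r \<in> carrier (core A). \<forall>s \<in> carrier (core B). act (core_mu k A B) (p (core A) (core B) r s) = p A B r s)"
proof -
  have l: "(\<lambda>r. p A B r \<one>\<^bsub>B\<^esub>) \<in> sigma_alg_hom k (core A) (core (A \<boxtimes> B))"
    using sigma_alg_hom_core[OF A _ pure_hom(1)[OF k A B]] A B by simp
  have r: "(\<lambda>s. p A B \<one>\<^bsub>A\<^esub> s) \<in> sigma_alg_hom k (core B) (core (A \<boxtimes> B))"
    using sigma_alg_hom_core[OF B _ pure_hom(2)[OF k A B]] A B by simp
  have m: "p A B r \<one>\<^bsub>B\<^esub> \<otimes>\<^bsub>A \<boxtimes> B\<^esub> p A B \<one>\<^bsub>A\<^esub> s = p A B r s" if "r \<in> carrier (core A)" "s \<in> carrier (core B)" for r s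
    using core_subset[OF A that(1)] core_subset[OF B that(2)] A B by (simp add: pure_mult)
  have "\<exists>!a. a \<in> alg_arr k (core A \<boxtimes> core B) (core (A \<boxtimes> B)) \<and>
    (\<forall>r \<in> carrier (core A). \<forall>s \<in> carrier (core B). act a (p (core A) (core B) r s) = p A B r s)"
    using exists_arr[OF _ _ _ l r] A B by (simp add: m cong: conj_cong)
  from theI'[OF this] show ?thesis unfolding core_mu_def .
qed

lemma core_mu [simp]:
  assumes "alg A" "alg B"
  shows "arr k (core_mu k A B)" "src (core_mu k A B) = core A \<boxtimes> core B" "tgt (core_mu k A B) = core (A \<boxtimes> B)"
    and "r \<in> carrier (core A) \<Longrightarrow> s \<in> carrier (core B) \<Longrightarrow> act (core_mu k A B) (p (core A) (core B) r s) = p A B r s"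
  using core_mu_aux[OF assms] assms by (auto simp: arr_iff)

lemma pure_core: "alg A \<Longrightarrow> alg B \<Longrightarrow> r \<in> carrier (core A) \<Longrightarrow> s \<in> carrier (core B) \<Longrightarrow> p A B r s \<in> carrier (core (A \<boxtimes> B))"
  using act_closed[of k "core_mu k A B" "core (A \<boxtimes> B)" "p (core A) (core B) r s"] by simp

lemma iso_arr_if_bij:
  assumes f: "arr k f" and bij: "bij_betw (act f) (carrier (src f)) (carrier (tgt f))"
  shows "iso_arr CC (src f) (tgt f) f"
proof -
  let ?g = "inv_into (carrier (src f)) (act f)"
  note F = sigma_alg_homD[OF arr_hom[OF f HOL.refl HOL.refl]]
  have g: "?g y \<in> carrier (src f)" "act f (?g y) = y" if "y \<in> carrier (tgt f)" for y
    using bij_betw_inv_into_right[OF bij that] bij_betwE[OF bij_betw_inv_into[OF bij]] that by auto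
  have gf: "?g (act f x) = x" if "x \<in> carrier (src f)" for x using bij_betw_inv_into_left[OF bij that] .
  have a: "alg (src f)" "alg (tgt f)" using f by simp_all
  interpret S: cring "src f" using a by (simp add: sigma_alg_def sigma_ring_def)
  interpret T: cring "tgt f" using a by (simp add: sigma_alg_def sigma_ring_def)
  have iso: "act f \<in> ring_iso (src f) (tgt f)" using F(1) bij by (simp add: ring_iso_def)
  have "?g \<in> ring_hom (tgt f) (src f)"
    using ring_iso_set_sym[OF S.ring_axioms iso] by (simp add: ring_iso_def)
  moreover have "?g (sig (tgt f) y) = sig (src f) (?g y)" if y: "y \<in> carrier (tgt f)" for y
    using gf[of "sig (src f) (?g y)"] ring_hom_closed[OF sigma_algD(1)[OF a(1)] g(1)[OF y]] F(2)[OF g(1)[OF y]] g(2)[OF y]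
    by simp
  moreover have "?g (str (tgt f) c) = str (src f) c" if "c \<in> carrier k" for c
    using gf[of "str (src f) c"] F(3)[OF that] a that by simp
  ultimately have "?g \<in> sigma_alg_hom k (tgt f) (src f)" by (simp add: sigma_alg_hom_def)
  then have h: "arr k (Arrow (tgt f) (restrict ?g (carrier (tgt f))) (src f))"
    unfolding arr_def arrow.sel using arrow_of_hom[OF a(2,1)] a by blast
  show ?thesis
    by (rule iso_arrI[OF f h _ _ gen_carrier gen_carrier]) (use g gf act_closed[OF f HOL.refl] in auto)
qed

text \<open>Injectivity is the embedding of tensor products of subalgebras over a field
  (\<open>tensor_eq_restrict\<close>), surjectivity is \<open>core_tensor\<close>. A bijective arrow
  has an inverse arrow.\<close>

lemma core_mu_iso:
  assumes A: "alg A" and B: "alg B"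
  shows "iso_arr CC (core A \<boxtimes> core B) (core (A \<boxtimes> B)) (core_mu k A B)"
proof -
  let ?A = "core A" and ?B = "core B"
  interpret T: tensor_product_field k A B "A \<boxtimes> B" "p A B" by (rule tensor_ob_field[OF k A B])
  have AB: "alg ?A" "alg ?B" "alg (A \<boxtimes> B)" using A B by simp_all
  interpret U: tensor_product_field k ?A ?B "?A \<boxtimes> ?B" "p ?A ?B" by (rule tensor_ob_field[OF k AB(1,2)])
  let ?m = "act (core_mu k A B)"
  have hm: "?m \<in> ring_hom (?A \<boxtimes> ?B) (A \<boxtimes> B)"
    using sigma_alg_homD(1)[OF sigma_alg_hom_comp[OF arr_hom[OF core_mu(1-3)] core_incl]] A B by simp
  have m: "?m (tsum (?A \<boxtimes> ?B) (p ?A ?B) xs) = tsum (A \<boxtimes> B) (p A B) xs" if xs: "xs \<in> U.L" for xs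
  proof -
    have "?m (tsum (?A \<boxtimes> ?B) (p ?A ?B) xs) = tsum (A \<boxtimes> B) (\<lambda>r s. ?m (p ?A ?B r s)) xs"
      by (rule U.hom_tsum[OF T.T.R.is_cring hm xs HOL.refl])
    also have "\<dots> = tsum (A \<boxtimes> B) (p A B) xs"
      using xs A B by (intro tsum_cong) (auto simp: in_lists_conv_set)
    finally show ?thesis .
  qed
  note sub = sigma_subalgD(1)[OF sigma_subalg_core[OF k A]] sigma_subalgD(1)[OF sigma_subalg_core[OF k B]]
  have "bij_betw ?m (carrier (?A \<boxtimes> ?B)) (carrier (core (A \<boxtimes> B)))"
  proof (rule bij_betw_imageI)
    show "inj_on ?m (carrier (?A \<boxtimes> ?B))"
    proof (rule inj_onI)
      fix x y assume xy: "x \<in> carrier (?A \<boxtimes> ?B)" "y \<in> carrier (?A \<boxtimes> ?B)" "?m x = ?m y"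
      obtain xs ys where l: "xs \<in> U.L" "x = tsum (?A \<boxtimes> ?B) (p ?A ?B) xs" "ys \<in> U.L" "y = tsum (?A \<boxtimes> ?B) (p ?A ?B) ys"
        using U.b_generate xy(1,2) by meson
      have "tsum (A \<boxtimes> B) (p A B) xs = tsum (A \<boxtimes> B) (p A B) ys" using xy(3) m l by simp
      from T.tensor_eq_restrict[OF sub l(1,3) this]
      have "tensor_eq k ?A (str ?A) ?B (str ?B) xs ys" by (simp add: core_eq[symmetric])
      then show "x = y" using U.tensor_eq_iff[OF l(1,3)] l(2,4) by simp
    qed
    have "carrier (core (A \<boxtimes> B)) = tsum (A \<boxtimes> B) (p A B) ` U.L"
      using core_tensor[OF k A B AB(3) T.tensor_product_field_axioms sig_pure[OF k A B]] by (simp add: T.tsub_def)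
    also have "\<dots> = ?m ` (tsum (?A \<boxtimes> ?B) (p ?A ?B) ` U.L)" using m by (simp add: image_image cong: image_cong)
    also have "tsum (?A \<boxtimes> ?B) (p ?A ?B) ` U.L = carrier (?A \<boxtimes> ?B)"
      using U.tsub_carrier by (simp add: U.tsub_def)
    finally show "?m ` carrier (?A \<boxtimes> ?B) = carrier (core (A \<boxtimes> B))" by simp
  qed
  then show ?thesis using iso_arr_if_bij[OF core_mu(1)[OF A B]] A B by simp
qed

text \<open>The base is strongly etale over itself, so its core is everything. Equality as records,
  and not only an isomorphism, makes the unit comparison an identity arrow.\<close>

lemma core_base: "core I = I"
proof -
  have I: "alg I" by simp
  have "carrier k \<subseteq> carrier (core I)"
    using etale_sub_base[OF k I] by (force simp: core_carrier)
  then have "carrier (core I) = carrier I" using core_subset[OF I] by auto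
  then show ?thesis using core_eq[of k I] by simp
qed

lemma core_eps: "core_eps k = ida I"
  by (simp add: core_eps_def ida_def core_base)

text \<open>On pure tensors the comparison arrows act as inclusions and the core of an arrow acts as
  the arrow itself. Each coherence law thereby becomes a computation with the structure arrows on
  pure tensors of core elements; \<open>pure_core\<close> guarantees that the intermediate values
  stay in the cores.\<close>

lemma monoidal_functor: "monoidal_functor CC CC core (core_arr k) (core_mu k) (core_eps k)"
proof -
  interpret M: monoidal_category CC by (rule monoidal_category)
  interpret F: cat_functor CC CC core "core_arr k" by (rule cat_functor)
  show ?thesis
  proof
    fix A B E A' B' :: "'u ualg" and f g
    show "iso_arr CC (tob CC (core A) (core B)) (core (tob CC A B)) (core_mu k A B)" if "A \<in> Ob CC" "B \<in> Ob CC"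
      using core_mu_iso that by simp
    show "cmp CC (core_mu k A' B') (tar CC (core_arr k f) (core_arr k g)) = cmp CC (core_arr k (tar CC f g)) (core_mu k A B)"
      if "A \<in> Ob CC" "A' \<in> Ob CC" "B \<in> Ob CC" "B' \<in> Ob CC" "f \<in> Arr CC A A'" "g \<in> Arr CC B B'"
    proof -
      have h: "arr k f" "src f = A" "tgt f = A'" "arr k g" "src g = B" "tgt g = B'" "alg A" "alg B" "alg A'" "alg B'"
        using that by (auto simp: arr_iff)
      have c: "act f x \<in> carrier (core A')" if "x \<in> carrier (core A)" for x
        using core_hom[OF k h(7,9) arr_hom[OF h(1-3)] that] .
      have d: "act g x \<in> carrier (core B')" if "x \<in> carrier (core B)" for x
        using core_hom[OF k h(8,10) arr_hom[OF h(4-6)] that] .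
      have "cmpa (core_mu k A' B') (tensor_arr k (core_arr k f) (core_arr k g)) = cmpa (core_arr k (tensor_arr k f g)) (core_mu k A B)"
        by (rule arrow_eq[where G = "gens (core A) (core B) (carrier (core A)) (carrier (core B))"])
          (use h c d gen_tensor'[of "core A" "core B"] pure_core core_subset[of A] core_subset[of B] in auto)
      then show ?thesis by simp
    qed
    show "iso_arr CC (unt CC) (core (unt CC)) (core_eps k)"
      using iso_arrI[of "ida I" "ida I" "carrier I" "carrier I"] gen_carrier[of I] by (simp add: core_eps core_base)
    show "cmp CC (core_arr k (assoc CC A B E)) (cmp CC (core_mu k (tob CC A B) E) (tar CC (core_mu k A B) (idt CC (core E))))
        = cmp CC (core_mu k A (tob CC B E))
            (cmp CC (tar CC (idt CC (core A)) (core_mu k B E)) (assoc CC (core A) (core B) (core E)))"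
      if "A \<in> Ob CC" "B \<in> Ob CC" "E \<in> Ob CC"
    proof -
      have h: "alg A" "alg B" "alg E" using that by simp_all
      have "cmpa (core_arr k (assoc_arr k A B E)) (cmpa (core_mu k (A \<boxtimes> B) E) (tensor_arr k (core_mu k A B) (ida (core E)))) =
          cmpa (core_mu k A (B \<boxtimes> E)) (cmpa (tensor_arr k (ida (core A)) (core_mu k B E)) (assoc_arr k (core A) (core B) (core E)))"
        by (rule arrow_eq[where G = "gens (core A \<boxtimes> core B) (core E)
            (gens (core A) (core B) (carrier (core A)) (carrier (core B))) (carrier (core E))"])
          (use h gen_left[of "core A" "core B" "core E"] pure_core core_subset[of A] core_subset[of B] core_subset[of E] in auto)
      then show ?thesis by simp
    qed
    show "cmp CC (core_arr k (lunit CC A)) (cmp CC (core_mu k (unt CC) A) (tar CC (core_eps k) (idt CC (core A)))) = lunit CC (core A)"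
      if "A \<in> Ob CC"
    proof -
      have h: "alg A" using that by simp
      have "cmpa (core_arr k (lunit_arr k A)) (cmpa (core_mu k I A) (tensor_arr k (ida I) (ida (core A)))) = lunit_arr k (core A)"
        by (rule arrow_eq[where G = "gens I (core A) (carrier I) (carrier (core A))"])
          (use h gen_tensor'[of I "core A"] pure_core[of I A] core_subset[of A] core_mu(4)[of I A] in \<open>auto simp: core_base\<close>)
      then show ?thesis by (simp add: core_eps)
    qed
    show "cmp CC (core_arr k (runit CC A)) (cmp CC (core_mu k A (unt CC)) (tar CC (idt CC (core A)) (core_eps k))) = runit CC (core A)"
      if "A \<in> Ob CC"
    proof -
      have h: "alg A" using that by simp
      have "cmpa (core_arr k (runit_arr k A)) (cmpa (core_mu k A I) (tensor_arr k (ida (core A)) (ida I))) = runit_arr k (core A)"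
        by (rule arrow_eq[where G = "gens (core A) I (carrier (core A)) (carrier I)"])
          (use h gen_tensor'[of "core A" I] pure_core[of A I] core_subset[of A] core_mu(4)[of A I] in \<open>auto simp: core_base\<close>)
      then show ?thesis by (simp add: core_eps)
    qed
  qed
qed

end

theorem corollary1p26:
  fixes k :: "('u :: infinite) sring"
  assumes "sigma_field k"
  shows "monoidal_functor (sigma_alg_cat k) (sigma_alg_cat k) (strong_core k) (core_arr k)
    (core_mu k) (core_eps k)"
  by (rule sigma_base.monoidal_functor) (unfold_locales, rule assms)

end
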